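(* For every $k\ge0$, $E_\flat$ is a norm on the group $D_k(G)$ of $k$-dimensional dipolyhedra (i.e. $E_\flat(D)\ge 0$ with equality only for $D=0$, $E_\flat(-D)=E_\flat(D)$, and $E_\flat(D+D')\le E_\flat(D)+E_\flat(D')$).
   Context: Coefficients: $G$ is an abelian group with a complete translation-invariant metric; $|g|$ denotes the distance from $g$ to the identity $0$. Polyhedra: for $k\ge1$ a $k$-cell $\sigma$ in $\mathbb{R}^3$ is a nonempty bounded oriented subset of an affine $k$-plane that is a finite intersection of open half spaces of that plane; a $0$-cell is a point. $\mathbf{P}_k(\mathbb{Z})$ is the group of formal integer combinations of $k$-cells modulo the relation that two formal sums are identified when all smooth differential $k$-forms have the same integral over both (so $-\sigma$ is $\sigma$ with reversed orientation, and a cell equals the sum of the cells of a subdivision). $\mathbf{P}_k(G)=G\otimes\mathbf{P}_k(\mathbb{Z})$, with the usual boundary $\partial$ ($\partial=0$ on $\mathbf{P}_0$). $M(\sigma)$ is the $k$-dimensional Hausdorff measure of the cell $\sigma$ ($M=1$ for a point). Dipolyhedra: each $k$-cell $\sigma$ determines a $k$-dimensional dipole cell $\delta\sigma$, and each $(k-1)$-cell $\tau$ determines a $k$-dimensional mass cell $\mu\tau$. (They arise as limits in $\mathbb{R}^4$: with $e_4=(0,0,0,1)$, $\mu\tau=\lim_j 2^j(\tau\times 2^{-j}e_4)$, where $\tau\times w$ is the oriented orbit of $\tau$ under translation by $tw$, $0\le t\le1$, and $\delta\sigma=\partial\mu\sigma+\mu\partial\sigma$.) $S_k(G)$ is the group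 of dipole chains $\sum g_i\delta\sigma_i$, and $T_k(G)$ the group of mass chains $\sum g_i\mu\tau_i$ ($T_0(G)=0$); $\delta$ and $\mu$ extend additively to isomorphisms $\delta:\mathbf{P}_k(G)\to S_k(G)$ and $\mu:\mathbf{P}_{k-1}(G)\to T_k(G)$. The group of dipolyhedra is $D_k(G)=S_k(G)\oplus T_k(G)$, with elements written $D=S+T$. The boundary $\partial:D_k(G)\to D_{k-1}(G)$ is given by $\partial\delta\sigma=\delta\partial\sigma$ and $\partial\mu\tau=\delta\tau-\mu\partial\tau$. Energy: if $S=\sum g_i\delta\sigma_i$ with the $\sigma_i$ nonoverlapping, $W(S)=\sum|g_i|M(\sigma_i)$; if $T=\sum g_i\mu\tau_i$ with the $\tau_i$ nonoverlapping, $M(T)=\sum|g_i|M(\tau_i)$. $E(S+T)=W(S)+M(T)$. $E_\flat(D)=\inf\{E(B)+E(C): D=B+\partial C,\ B\in D_k(G),\ C\in D_{k+1}(G)\}$ for $D\in D_k(G)$. *)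

theory Defs
  imports "HOL-Analysis.Analysis" "HOL-Algebra.Free_Abelian_Groups"
begin

section \<open>Oriented polyhedral cells\<close>

(* An oriented k-plane is given by a point and a positively oriented orthonormal frame b of
   its direction space, an oriented k-cell by its point set and such a frame.  Frames that
   induce the same orientation give different pairs but the same integral of every k-form,
   hence the same element of the group of polyhedral chains below. *)

type_synonym cell = "(real^3) set \<times> (real^3) list"

definition orthonormal_frame :: "(real^3) list \<Rightarrow> bool" where
  "orthonormal_frame b \<longleftrightarrow>
     (\<forall>i < length b. \<forall>j < length b. b ! i \<bullet> b ! j = (if i = j then 1 else 0))"

definition plane :: "real^3 \<Rightarrow> (real^3) list \<Rightarrow> (real^3) set" where
  "plane p b = (\<lambda>v. p + v) ` span (set b)"

definition open_half_space_of :: "(real^3) set \<Rightarrow> (real^3) set \<Rightarrow> bool" where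
  "open_half_space_of H U \<longleftrightarrow>
     (\<exists>a c. U = {x \<in> H. a \<bullet> x < c}) \<and> U \<noteq> {} \<and> U \<noteq> H"

(* The dimension is an integer (like aff_dim), so that chain groups of dimension -1 make
   sense; there are no cells of negative dimension.  For k = 0 the only admissible family
   of half spaces is empty, and a cell is a single point. *)
definition cells :: "int \<Rightarrow> cell set" where
  "cells k = {(A, b). int (length b) = k \<and> orthonormal_frame b \<and> A \<noteq> {} \<and> bounded A \<and>
     (\<exists>p \<H>. finite \<H> \<and> (\<forall>U\<in>\<H>. open_half_space_of (plane p b) U) \<and>
            A = plane p b \<inter> \<Inter>\<H>)}"

section \<open>Hausdorff measure\<close>

(* The factor unit_ball_vol s / 2^s is the usual normalisation, for which the measure agrees
   with Lebesgue measure on s-planes.  The empty set needs a separate clause because of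
   0 ^ 0 = 1. *)
definition hausdorff_content :: "nat \<Rightarrow> real \<Rightarrow> (real^3) set \<Rightarrow> ennreal" where
  "hausdorff_content s d A =
     Inf {suminf (\<lambda>n. if U n = {} then 0
                else ennreal (unit_ball_vol (real s) * (diameter (U n) / 2) ^ s)) | U.
            A \<subseteq> (\<Union>n. U n) \<and> (\<forall>n::nat. bounded (U n) \<and> diameter (U n) \<le> d)}"

definition hausdorff_measure :: "nat \<Rightarrow> (real^3) set \<Rightarrow> ennreal" where
  "hausdorff_measure s A = (SUP d\<in>{0<..}. hausdorff_content s d A)"

definition cell_mass :: "cell \<Rightarrow> real" where
  "cell_mass \<sigma> = enn2real (hausdorff_measure (length (snd \<sigma>)) (fst \<sigma>))"

section \<open>Smooth differential forms and their integrals\<close>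

primrec differentiable_times :: "nat \<Rightarrow> (real^3 \<Rightarrow> real) \<Rightarrow> bool" where
  "differentiable_times 0 f \<longleftrightarrow> continuous_on UNIV f"
| "differentiable_times (Suc n) f \<longleftrightarrow> (\<forall>x. f differentiable (at x)) \<and>
     (\<forall>v. differentiable_times n (\<lambda>x. frechet_derivative f (at x) v))"

definition smooth :: "(real^3 \<Rightarrow> real) \<Rightarrow> bool" where
  "smooth f \<longleftrightarrow> (\<forall>n. differentiable_times n f)"

definition alternating_multilinear :: "nat \<Rightarrow> ((real^3) list \<Rightarrow> real) \<Rightarrow> bool" where
  "alternating_multilinear k f \<longleftrightarrow>
     (\<forall>vs. length vs = k \<longrightarrow>
        (\<forall>i<k. linear (\<lambda>v. f (vs[i := v]))) \<and>
        (\<forall>i<k. \<forall>j<k. i \<noteq> j \<and> vs ! i = vs ! j \<longrightarrow> f vs = 0))"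

definition smooth_form :: "nat \<Rightarrow> (real^3 \<Rightarrow> (real^3) list \<Rightarrow> real) \<Rightarrow> bool" where
  "smooth_form k \<omega> \<longleftrightarrow> (\<forall>x. alternating_multilinear k (\<omega> x)) \<and>
     (\<forall>vs. length vs = k \<longrightarrow> smooth (\<lambda>x. \<omega> x vs))"

definition chart :: "real^3 \<Rightarrow> (real^3) list \<Rightarrow> (nat \<Rightarrow> real) \<Rightarrow> real^3" where
  "chart p b t = p + (\<Sum>i<length b. t i *\<^sub>R b ! i)"

(* The form is pulled back along the oriented isometric chart of the plane of the cell.  The
   result does not depend on the base point.  For a 0-cell the product measure over the empty
   index set is a point mass, and the integral is the value of the function at the point. *)
definition cell_integral :: "(real^3 \<Rightarrow> (real^3) list \<Rightarrow> real) \<Rightarrow> cell \<Rightarrow> real" where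
  "cell_integral \<omega> = (\<lambda>(A, b). let \<phi> = chart (SOME p. p \<in> A) b in
     LINT t | PiM {..<length b} (\<lambda>_. lborel). indicat_real A (\<phi> t) * \<omega> (\<phi> t) b)"

definition chain_integral :: "(real^3 \<Rightarrow> (real^3) list \<Rightarrow> real) \<Rightarrow> (cell \<Rightarrow>\<^sub>0 int) \<Rightarrow> real" where
  "chain_integral \<omega> c =
     (\<Sum>\<sigma>\<in>Poly_Mapping.keys c. of_int (Poly_Mapping.lookup c \<sigma>) * cell_integral \<omega> \<sigma>)"

section \<open>Integral polyhedral chains\<close>

type_synonym int_chain = "(cell \<Rightarrow>\<^sub>0 int) set"

definition null_chains :: "int \<Rightarrow> (cell \<Rightarrow>\<^sub>0 int) set" where
  "null_chains k = {c \<in> carrier (free_Abelian_group (cells k)).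
     \<forall>\<omega>. smooth_form (nat k) \<omega> \<longrightarrow> chain_integral \<omega> c = 0}"

definition int_chains :: "int \<Rightarrow> int_chain monoid" where
  "int_chains k = free_Abelian_group (cells k) Mod null_chains k"

definition int_chain_of :: "int \<Rightarrow> (cell \<Rightarrow>\<^sub>0 int) \<Rightarrow> int_chain" where
  "int_chain_of k c = null_chains k #>\<^bsub>free_Abelian_group (cells k)\<^esub> c"

definition outward_normal :: "cell \<Rightarrow> (real^3) set \<Rightarrow> real^3" where
  "outward_normal = (\<lambda>(A, b) F. THE n. n \<in> span (set b) \<and> norm n = 1 \<and>
     (\<forall>x\<in>F. \<forall>y\<in>F. n \<bullet> (x - y) = 0) \<and> (\<forall>x\<in>F. \<forall>y\<in>A. n \<bullet> (y - x) < 0))"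

(* Determinant of the matrix of inner products of two frames; for orthonormal frames of the
   same space it is 1 or -1 according to whether they induce the same orientation. *)
definition frame_det :: "(real^3) list \<Rightarrow> (real^3) list \<Rightarrow> real" where
  "frame_det u v = (\<Sum>p | p permutes {..<length u}.
     of_int (sign p) * (\<Prod>i<length u. u ! i \<bullet> v ! p i))"

definition facet_frame :: "(real^3) set \<Rightarrow> (real^3) list" where
  "facet_frame F = (SOME c. (rel_interior F, c) \<in> cells (aff_dim F))"

(* The boundary orientation of a facet is the one for which the outward normal followed by a
   positively oriented frame of the facet is a positively oriented frame of the cell.  The
   chosen frame of the facet need not be positively oriented; the sign corrects for this. *)
definition cell_boundary :: "cell \<Rightarrow> (cell \<Rightarrow>\<^sub>0 int)" where
  "cell_boundary = (\<lambda>(A, b). \<Sum>F | F facet_of closure A.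
     frag_cmul (if frame_det (outward_normal (A, b) F # facet_frame F) b > 0 then 1 else - 1)
               (frag_of (rel_interior F, facet_frame F)))"

definition int_boundary :: "int \<Rightarrow> int_chain \<Rightarrow> int_chain" where
  "int_boundary k P =
     the_elem ((\<lambda>c. int_chain_of (k - 1) (frag_extend cell_boundary c)) ` P)"

section \<open>Tensor products of abelian groups\<close>

definition tensor_relations ::
    "('a, 'm) monoid_scheme \<Rightarrow> ('b, 'n) monoid_scheme \<Rightarrow> ('a \<times> 'b \<Rightarrow>\<^sub>0 int) set" where
  "tensor_relations G H =
     {frag_of (x \<otimes>\<^bsub>G\<^esub> x', y) - (frag_of (x, y) + frag_of (x', y)) | x x' y.
        x \<in> carrier G \<and> x' \<in> carrier G \<and> y \<in> carrier H} \<union>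
     {frag_of (x, y \<otimes>\<^bsub>H\<^esub> y') - (frag_of (x, y) + frag_of (x, y')) | x y y'.
        x \<in> carrier G \<and> y \<in> carrier H \<and> y' \<in> carrier H}"

definition tensor_kernel ::
    "('a, 'm) monoid_scheme \<Rightarrow> ('b, 'n) monoid_scheme \<Rightarrow> ('a \<times> 'b \<Rightarrow>\<^sub>0 int) set" where
  "tensor_kernel G H =
     generate (free_Abelian_group (carrier G \<times> carrier H)) (tensor_relations G H)"

definition tensor_product ::
    "('a, 'm) monoid_scheme \<Rightarrow> ('b, 'n) monoid_scheme \<Rightarrow> ('a \<times> 'b \<Rightarrow>\<^sub>0 int) set monoid" where
  "tensor_product G H = free_Abelian_group (carrier G \<times> carrier H) Mod tensor_kernel G H"

definition tensor_class ::
    "('a, 'm) monoid_scheme \<Rightarrow> ('b, 'n) monoid_scheme \<Rightarrow> ('a \<times> 'b \<Rightarrow>\<^sub>0 int) \<Rightarrow>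
     ('a \<times> 'b \<Rightarrow>\<^sub>0 int) set" where
  "tensor_class G H z =
     tensor_kernel G H #>\<^bsub>free_Abelian_group (carrier G \<times> carrier H)\<^esub> z"

(* The homomorphism induced on G \<otimes> H \<rightarrow> G \<otimes> K by a homomorphism f from H to K. *)
definition tensor_map ::
    "('a, 'm) monoid_scheme \<Rightarrow> ('c, 'n) monoid_scheme \<Rightarrow> ('b \<Rightarrow> 'c) \<Rightarrow>
     ('a \<times> 'b \<Rightarrow>\<^sub>0 int) set \<Rightarrow> ('a \<times> 'c \<Rightarrow>\<^sub>0 int) set" where
  "tensor_map G K f u =
     the_elem ((\<lambda>z. tensor_class G K (frag_extend (\<lambda>(x, y). frag_of (x, f y)) z)) ` u)"

section \<open>Polyhedral chains with coefficients\<close>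

(* The coefficient group is the additive group of a type.  From here on the chain groups are
   HOL-Algebra groups, written multiplicatively. *)
definition coefficient_group :: "'g::ab_group_add monoid" where
  "coefficient_group = \<lparr>carrier = UNIV, mult = (+), one = 0\<rparr>"

type_synonym 'g chain = "('g \<times> int_chain \<Rightarrow>\<^sub>0 int) set"

definition polyhedral_chains :: "int \<Rightarrow> 'g::ab_group_add chain monoid" where
  "polyhedral_chains k = tensor_product coefficient_group (int_chains k)"

definition weighted_cell :: "int \<Rightarrow> 'g::ab_group_add \<Rightarrow> cell \<Rightarrow> 'g chain" where
  "weighted_cell k g \<sigma> =
     tensor_class coefficient_group (int_chains k) (frag_of (g, int_chain_of k (frag_of \<sigma>)))"

definition chain_boundary :: "int \<Rightarrow> 'g::ab_group_add chain \<Rightarrow> 'g chain" where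
  "chain_boundary k = tensor_map coefficient_group (int_chains (k - 1)) (int_boundary k)"

definition nonoverlapping :: "int \<Rightarrow> cell set \<Rightarrow> bool" where
  "nonoverlapping k F \<longleftrightarrow>
     (\<forall>\<sigma>\<in>F. \<forall>\<tau>\<in>F. \<sigma> \<noteq> \<tau> \<longrightarrow> aff_dim (fst \<sigma> \<inter> fst \<tau>) < k)"

definition chain_mass :: "int \<Rightarrow> 'g::{ab_group_add,metric_space} chain \<Rightarrow> real" where
  "chain_mass k P = (THE m. \<exists>F g. finite F \<and> F \<subseteq> cells k \<and> nonoverlapping k F \<and>
     P = finprod (polyhedral_chains k) (\<lambda>\<sigma>. weighted_cell k (g \<sigma>) \<sigma>) F \<and>
     m = (\<Sum>\<sigma>\<in>F. dist (g \<sigma>) 0 * cell_mass \<sigma>))"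

section \<open>Dipolyhedra\<close>

(* The dipole chains of dimension k are a copy of the polyhedral chains of dimension k, and
   the mass chains of dimension k a copy of the polyhedral chains of dimension k - 1 (which
   is the trivial group for k = 0).  The two maps below are the isomorphisms delta and mu,
   followed by the inclusions into the direct sum. *)

type_synonym 'g dipolyhedron = "'g chain \<times> 'g chain"

definition dipolyhedra :: "int \<Rightarrow> 'g::ab_group_add dipolyhedron monoid" where
  "dipolyhedra k = polyhedral_chains k \<times>\<times> polyhedral_chains (k - 1)"

definition dipole_chain :: "int \<Rightarrow> 'g::ab_group_add chain \<Rightarrow> 'g dipolyhedron" where
  "dipole_chain k P = (P, \<one>\<^bsub>polyhedral_chains (k - 1)\<^esub>)"

definition mass_chain :: "int \<Rightarrow> 'g::ab_group_add chain \<Rightarrow> 'g dipolyhedron" where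
  "mass_chain k Q = (\<one>\<^bsub>polyhedral_chains k\<^esub>, Q)"

definition dipolyhedron_boundary ::
    "int \<Rightarrow> 'g::ab_group_add dipolyhedron \<Rightarrow> 'g dipolyhedron" where
  "dipolyhedron_boundary k = (\<lambda>(P, Q).
     dipole_chain (k - 1) (chain_boundary k P) \<otimes>\<^bsub>dipolyhedra (k - 1)\<^esub>
     (dipole_chain (k - 1) Q \<otimes>\<^bsub>dipolyhedra (k - 1)\<^esub>
      inv\<^bsub>dipolyhedra (k - 1)\<^esub> mass_chain (k - 1) (chain_boundary (k - 1) Q)))"

definition energy :: "int \<Rightarrow> 'g::{ab_group_add,metric_space} dipolyhedron \<Rightarrow> real" where
  "energy k = (\<lambda>(P, Q). chain_mass k P + chain_mass (k - 1) Q)"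

definition flat_energy :: "int \<Rightarrow> 'g::{ab_group_add,metric_space} dipolyhedron \<Rightarrow> real" where
  "flat_energy k D = Inf {energy k B + energy (k + 1) C | B C.
     B \<in> carrier (dipolyhedra k) \<and> C \<in> carrier (dipolyhedra (k + 1)) \<and>
     D = B \<otimes>\<^bsub>dipolyhedra k\<^esub> dipolyhedron_boundary (k + 1) C}"

end

theory Submission
  imports Defs
begin

text \<open>
  A list \<open>q\<close> of \<open>k\<close> covectors and a half space \<open>l \<bullet> z < l \<bullet> x + s\<close> slice a \<open>k\<close>-chain: to almost every
  \<open>x\<close> one assigns the sum of the coefficients of those cells that meet the fibre \<open>q z = q x\<close> inside the
  half space, each with the sign of the determinant of \<open>q\<close> on the oriented plane of the cell.  Formal
  sums of cells with vanishing integrals have slices vanishing almost everywhere, because polynomial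
  bumps localise the integrals, so slices are defined on chains with arbitrary coefficients.

  Three properties give positivity of the flat energy.  A chain that is not zero has a slice that is
  a nonzero constant \<open>a\<close> on a nonempty open set \<open>U\<close>.  The integral of the norm of a slice over a ball is at
  most a constant times the mass of the chain.  And the slice of \<open>\<partial>R\<close> by \<open>q\<close> and \<open>l\<close> is, up to sign, the slice
  of \<open>R\<close> by \<open>l # q\<close>: the fibre of \<open>q\<close> in a cell of one dimension more is a segment, whose two end points
  have opposite signs.  Hence \<open>P = P' + \<partial>R\<close> implies \<open>|a| vol(U) \<le> C (M(P') + M(R))\<close>.  A decomposition
  of \<open>(P, Q)\<close> with boundary part coming from \<open>(R, S)\<close> says that \<open>P = (P' + S) + \<partial>R\<close> and
  \<open>Q = Q' + \<partial>(-S)\<close>, so the energy of the decomposition is bounded below as soon as \<open>P\<close> or \<open>Q\<close> is nonzero.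
\<close>

section \<open>Formal sums with values in an abelian group\<close>

text \<open>Integer chains are defined by integrals of forms, but real-valued integrals do not
  survive tensoring with an arbitrary abelian group. Signed counts of points on fibres are integers,
  and an integer can multiply any group element. The price is that such counts are well defined only
  almost everywhere, and that their vanishing on null chains has to be recovered from the integrals.

  Counts over whole fibres would not suffice: a closed surface meets almost every line with total
  count zero. This is why the fibre is cut by a half space. Its level is tied to \<open>x\<close>
  itself, so for \<open>s = 0\<close> a boundary is counted exactly by the crossings of the level
  through \<open>x\<close>, that is, on the fibres of \<open>l # q\<close>.

  The same slices replace Stokes' theorem: a chain is null as soon as its slices vanish almost
  everywhere, so the boundary maps null chains to null chains and descends to the quotient. They
  also make the coefficients on nonoverlapping cells unique, on which the definite description in
  \<open>chain_mass\<close> depends.\<close>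

definition imul :: "int \<Rightarrow> 'a::ab_group_add \<Rightarrow> 'a" where
  "imul n x = (\<Sum>i<nat n. x) - (\<Sum>i<nat (- n). x)"

lemma imul_0 [simp]: "imul 0 x = 0"
  by (simp add: imul_def)

lemma imul_1 [simp]: "imul 1 x = x"
  by (simp add: imul_def)

lemma imul_Suc: "imul (n + 1) x = imul n x + x"
proof (cases "n \<ge> 0")
  case True
  then have "nat (n + 1) = Suc (nat n)" "nat (- n) = 0" "nat (- (n + 1)) = 0" by auto
  then show ?thesis unfolding imul_def by (simp add: algebra_simps)
next
  case False
  then have "nat (- n) = Suc (nat (- (n + 1)))" "nat n = 0" "nat (n + 1) = 0" by auto
  then show ?thesis unfolding imul_def by (simp add: algebra_simps)
qed

lemma imul_add: "imul (m + n) x = imul m x + imul n x"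
proof (induction n rule: int_induct[where k = 0])
  case (step1 i)
  have "imul (m + (i + 1)) x = imul (m + i) x + x"
    using imul_Suc[of "m + i" x] by (simp add: algebra_simps)
  then show ?case using step1 by (simp add: imul_Suc add.assoc)
next
  case (step2 i)
  have "imul (m + i) x = imul (m + (i - 1)) x + x" "imul i x = imul (i - 1) x + x"
    using imul_Suc[of "m + (i - 1)" x] imul_Suc[of "i - 1" x] by (simp_all add: algebra_simps)
  then show ?case using step2 by (simp add: algebra_simps)
qed simp

lemma imul_minus: "imul (- n) x = - imul n x"
  using imul_add[of n "- n" x] by (simp add: eq_neg_iff_add_eq_0 add.commute)

lemma imul_m1 [simp]: "imul (- 1) x = - x"
  by (simp add: imul_minus)

lemma imul_diff: "imul (m - n) x = imul m x - imul n x"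
  using imul_add[of m "- n" x] by (simp add: imul_minus)

lemma imul_zero_right [simp]: "imul n 0 = 0"
  by (simp add: imul_def)

lemma imul_add_right: "imul n (x + y) = imul n x + imul n y"
  by (simp add: imul_def sum.distrib)

lemma imul_minus_right: "imul n (- x) = - imul n x"
  by (simp add: imul_def sum_negf)

lemma imul_real: "imul n (x::real) = of_int n * x"
  by (cases "n \<ge> 0") (auto simp: imul_def)

lemma imul_int: "imul n (x::int) = n * x"
  by (cases "n \<ge> 0") (auto simp: imul_def)

text \<open>The homomorphism on the free abelian group that extends \<open>w\<close>. It is used
  with three targets: the reals for integrals of forms, the integers for signed counts of points,
  and the coefficient group for slices of chains.\<close>

definition frag_sum :: "('a \<Rightarrow> 'b::ab_group_add) \<Rightarrow> ('a \<Rightarrow>\<^sub>0 int) \<Rightarrow> 'b" where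
  "frag_sum w c = (\<Sum>a\<in>Poly_Mapping.keys c. imul (Poly_Mapping.lookup c a) (w a))"

lemma frag_sum_superset:
  assumes "finite S" "Poly_Mapping.keys c \<subseteq> S"
  shows "frag_sum w c = (\<Sum>a\<in>S. imul (Poly_Mapping.lookup c a) (w a))"
  unfolding frag_sum_def
  by (rule sum.mono_neutral_left) (use assms in \<open>auto simp: in_keys_iff\<close>)

lemma frag_sum_0 [simp]: "frag_sum w 0 = 0"
  by (simp add: frag_sum_def)

lemma frag_sum_of [simp]: "frag_sum w (frag_of a) = w a"
  by (simp add: frag_sum_def)

lemma frag_sum_add: "frag_sum w (c + d) = frag_sum w c + frag_sum w d"
proof -
  let ?S = "Poly_Mapping.keys c \<union> Poly_Mapping.keys d"
  have k: "Poly_Mapping.keys (c + d) \<subseteq> ?S" by (rule keys_add)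
  show ?thesis
    using k by (simp add: frag_sum_superset[of ?S] lookup_add imul_add sum.distrib)
qed

lemma frag_sum_minus: "frag_sum w (- c) = - frag_sum w c"
  using frag_sum_add[of w c "- c"] by (simp add: eq_neg_iff_add_eq_0 add.commute)

lemma frag_sum_diff: "frag_sum w (c - d) = frag_sum w c - frag_sum w d"
  using frag_sum_add[of w c "- d"] by (simp add: frag_sum_minus)

lemma frag_sum_sum: "frag_sum w (\<Sum>i\<in>I. f i) = (\<Sum>i\<in>I. frag_sum w (f i))"
  by (induction I rule: infinite_finite_induct) (simp_all add: frag_sum_add)

lemma frag_sum_cmul: "frag_sum w (frag_cmul n c) = imul n (frag_sum w c)"
proof (induction n rule: int_induct[where k = 0])
  case (step1 i)
  then show ?case by (simp add: frag_cmul_distrib frag_sum_add imul_add)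
next
  case (step2 i)
  then show ?case by (simp add: frag_cmul_diff_distrib frag_sum_diff imul_diff)
qed simp

lemma frag_sum_extend: "frag_sum w (frag_extend f c) = frag_sum (\<lambda>a. frag_sum w (f a)) c"
  by (simp add: frag_extend_def frag_sum_def[of _ c] frag_sum_sum frag_sum_cmul)

lemma frag_sum_cong:
  "(\<And>a. a \<in> Poly_Mapping.keys c \<Longrightarrow> w a = w' a) \<Longrightarrow> frag_sum w c = frag_sum w' c"
  by (simp add: frag_sum_def)

section \<open>Orthonormal frames and determinants\<close>

text \<open>An orthonormal frame in three-space has at most three vectors, so most determinant
  identities below become a finite case analysis on the lengths of the lists involved.\<close>

lemma list_le3_cases:
  assumes "length b \<le> 3"
  obtains "b = []" | x where "b = [x]" | x y where "b = [x, y]" | x y z where "b = [x, y, z]"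
proof (cases b)
  case (Cons x b1)
  then show ?thesis
  proof (cases b1)
    case (Cons y b2)
    with \<open>b = x # b1\<close> show ?thesis
      using assms that by (cases b2) auto
  qed (use that \<open>b = x # b1\<close> in auto)
qed (use that in auto)

lemma frame_det_Nil [simp]: "frame_det [] v = 1"
  by (simp add: frame_det_def sign_id)

lemma frame_det_1 [simp]: "frame_det [a] [x] = a \<bullet> x"
proof -
  have "{..<length [a]} = {0}" by auto
  then show ?thesis by (simp add: frame_det_def sign_id)
qed

lemma frame_det_2 [simp]: "frame_det [a, b] [x, y] = (a \<bullet> x) * (b \<bullet> y) - (a \<bullet> y) * (b \<bullet> x)"
proof -
  have s: "{..<length [a, b]} = {0, 1}" by auto
  have f: "finite {1::nat}" "0 \<notin> {1::nat}" by auto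
  show ?thesis
    unfolding frame_det_def s sum_over_permutations_insert[OF f] permutes_sing
    by (simp add: sign_swap_id sign_id swap_id_eq)
qed

lemma frame_det_3 [simp]: "frame_det [a, b, c] [x, y, z] =
   (a \<bullet> x) * (b \<bullet> y) * (c \<bullet> z) + (a \<bullet> y) * (b \<bullet> z) * (c \<bullet> x) + (a \<bullet> z) * (b \<bullet> x) * (c \<bullet> y)
   - (a \<bullet> x) * (b \<bullet> z) * (c \<bullet> y) - (a \<bullet> y) * (b \<bullet> x) * (c \<bullet> z) - (a \<bullet> z) * (b \<bullet> y) * (c \<bullet> x)"
proof -
  have s: "{..<length [a, b, c]} = {0, 1, 2}" by auto
  have f: "finite {1::nat, 2}" "0 \<notin> {1::nat, 2}" by auto
  have g: "finite {2::nat}" "1 \<notin> {2::nat}" by auto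
  show ?thesis
    unfolding frame_det_def s sum_over_permutations_insert[OF f] sum_over_permutations_insert[OF g]
      permutes_sing
    by (simp add: sign_swap_id permutation_swap_id sign_compose sign_id swap_id_eq algebra_simps)
qed

lemma orthonormal_frame_inner:
  assumes "orthonormal_frame b" "i < length b" "j < length b"
  shows "b ! i \<bullet> b ! j = (if i = j then 1 else 0)"
  using assms by (simp add: orthonormal_frame_def)

lemma orthonormal_frame_distinct: "orthonormal_frame b \<Longrightarrow> distinct b"
  unfolding distinct_conv_nth orthonormal_frame_def
  by (metis zero_neq_one)

lemma orthonormal_frame_norm: "orthonormal_frame b \<Longrightarrow> v \<in> set b \<Longrightarrow> norm v = 1"
  by (metis in_set_conv_nth norm_eq_1 orthonormal_frame_inner)

lemma orthonormal_frame_independent: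
  assumes "orthonormal_frame b"
  shows "independent (set b)"
proof -
  have "pairwise orthogonal (set b)"
    unfolding pairwise_def orthogonal_def
    using assms by (metis in_set_conv_nth orthonormal_frame_inner)
  moreover have "0 \<notin> set b"
    using orthonormal_frame_norm[OF assms] by force
  ultimately show ?thesis by (rule pairwise_orthogonal_independent)
qed

lemma dim_orthonormal_frame: "orthonormal_frame b \<Longrightarrow> dim (span (set b)) = length b"
  by (metis dim_eq_card_independent dim_span distinct_card orthonormal_frame_distinct
      orthonormal_frame_independent)

lemma orthonormal_frame_length: "orthonormal_frame b \<Longrightarrow> length b \<le> 3"
  using dim_orthonormal_frame[of b] dim_subset_UNIV[of "span (set b)"] by simp

lemma orthonormal_frame_expand:
  assumes "orthonormal_frame b" "v \<in> span (set b)"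
  shows "v = (\<Sum>i<length b. (v \<bullet> b ! i) *\<^sub>R b ! i)"
  using assms(2)
proof (induction rule: span_induct_alt)
  case base
  then show ?case by simp
next
  case (step c x y)
  then obtain j where j: "j < length b" "x = b ! j" by (metis in_set_conv_nth)
  have "(\<Sum>i<length b. (x \<bullet> b ! i) *\<^sub>R b ! i) = (\<Sum>i<length b. if i = j then b ! j else 0)"
    by (rule sum.cong) (use j assms(1) in \<open>auto simp: orthonormal_frame_inner\<close>)
  also have "\<dots> = x" using j by simp
  finally have "(\<Sum>i<length b. (x \<bullet> b ! i) *\<^sub>R b ! i) = x" .
  then have "c *\<^sub>R x + y = c *\<^sub>R (\<Sum>i<length b. (x \<bullet> b ! i) *\<^sub>R b ! i) + (\<Sum>i<length b. (y \<bullet> b ! i) *\<^sub>R b ! i)"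
    using step by simp
  also have "\<dots> = (\<Sum>i<length b. ((c *\<^sub>R x + y) \<bullet> b ! i) *\<^sub>R b ! i)"
    by (simp add: inner_add_left scaleR_add_left sum.distrib scaleR_sum_right)
  finally show ?case .
qed

lemma span_expand1: "orthonormal_frame [x] \<Longrightarrow> v \<in> span {x} \<Longrightarrow> v = (v \<bullet> x) *\<^sub>R x"
  using orthonormal_frame_expand[of "[x]" v] by simp

lemma span_expand2:
  "orthonormal_frame [x, y] \<Longrightarrow> v \<in> span {x, y} \<Longrightarrow> v = (v \<bullet> x) *\<^sub>R x + (v \<bullet> y) *\<^sub>R y"
  using orthonormal_frame_expand[of "[x, y]" v] by (simp add: lessThan_Suc add.commute)

lemma span_expand3:
  "orthonormal_frame [x, y, z] \<Longrightarrow> v \<in> span {x, y, z} \<Longrightarrow>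
   v = (v \<bullet> x) *\<^sub>R x + (v \<bullet> y) *\<^sub>R y + (v \<bullet> z) *\<^sub>R z"
  using orthonormal_frame_expand[of "[x, y, z]" v]
  by (simp add: lessThan_Suc numeral_2_eq_2 numeral_3_eq_3 add.commute add.left_commute)

lemma orthonormal_frame_1: "orthonormal_frame [x] \<longleftrightarrow> x \<bullet> x = 1"
  by (simp add: orthonormal_frame_def)

lemma orthonormal_frame_2: "orthonormal_frame [x, y] \<longleftrightarrow> x \<bullet> x = 1 \<and> y \<bullet> y = 1 \<and> x \<bullet> y = 0"
  by (auto simp: orthonormal_frame_def less_Suc_eq inner_commute)

lemma orthonormal_frame_3:
  "orthonormal_frame [x, y, z] \<longleftrightarrow> x \<bullet> x = 1 \<and> y \<bullet> y = 1 \<and> z \<bullet> z = 1 \<and> x \<bullet> y = 0 \<and> x \<bullet> z = 0 \<and> y \<bullet> z = 0"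
  unfolding orthonormal_frame_def
  by (simp add: numeral_3_eq_3 numeral_2_eq_2 All_less_Suc2 inner_commute conj_ac)

text \<open>An alternating form on a k-dimensional space is determined by its value on one frame:
  expand the arguments in \<open>b\<close>, drop the terms with a repeated vector and sort the
  others. It serves twice, for forms evaluated on two frames of the same plane and, with
  \<open>f\<close> itself a determinant, for multiplicativity.\<close>

lemma alternating_frame_det:
  assumes f: "alternating_multilinear (length b) f" and b: "orthonormal_frame b"
    and c: "length c = length b" "set c \<subseteq> span (set b)"
  shows "f c = frame_det c b * f b"
proof (rule list_le3_cases[OF orthonormal_frame_length[OF b]])
  assume "b = []"
  then show ?thesis using c by simp
next
  fix x assume bx: "b = [x]"
  then obtain v where v: "c = [v]" using c bx by (auto simp: length_Suc_conv)
  have l: "linear (\<lambda>v. f [v])"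
    using f bx unfolding alternating_multilinear_def by (auto dest!: spec[of _ "[x]"])
  have "f [v] = f [(v \<bullet> x) *\<^sub>R x]"
    using span_expand1[of x v] b c bx v by simp
  also have "\<dots> = (v \<bullet> x) * f [x]" using linear_scale[OF l] by simp
  finally show ?thesis using v bx by simp
next
  fix x y assume bx: "b = [x, y]"
  then obtain u v where v: "c = [u, v]" using c bx by (auto simp: length_Suc_conv)
  have l1: "linear (\<lambda>v. f [v, s])" for s
    using f bx unfolding alternating_multilinear_def
    by (auto dest!: spec[of _ "[s, s]"] spec[of _ 0])
  have l2: "linear (\<lambda>v. f [s, v])" for s
    using f bx unfolding alternating_multilinear_def
    by (auto dest!: spec[of _ "[s, s]"] spec[of _ "Suc 0"])
  have z: "f [s, s] = 0" for s
    using f bx unfolding alternating_multilinear_def by (force dest!: spec[of _ "[s, s]"])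
  note L = linear_add[OF l1] linear_add[OF l2] linear_scale[OF l1] linear_scale[OF l2]
  \<comment> \<open>Vanishing on repeated arguments gives antisymmetry after expanding
    \<open>f [x + y, x + y]\<close>.\<close>
  have "f [x, y] + f [y, x] = 0"
  proof -
    have "f [x + y, x + y] = f [x, x] + f [y, x] + (f [x, y] + f [y, y])" by (simp only: L)
    then show ?thesis unfolding z by simp
  qed
  then have a: "f [y, x] = - f [x, y]" by linarith
  have "u = (u \<bullet> x) *\<^sub>R x + (u \<bullet> y) *\<^sub>R y" "v = (v \<bullet> x) *\<^sub>R x + (v \<bullet> y) *\<^sub>R y"
    using span_expand2[of x y] b c bx v by auto
  then have "f [u, v] = f [(u \<bullet> x) *\<^sub>R x + (u \<bullet> y) *\<^sub>R y, (v \<bullet> x) *\<^sub>R x + (v \<bullet> y) *\<^sub>R y]" by simp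
  also have "\<dots> = ((u \<bullet> x) * (v \<bullet> y) - (u \<bullet> y) * (v \<bullet> x)) * f [x, y]"
    by (simp add: L z a algebra_simps)
  finally show ?thesis using v bx by simp
next
  fix x y z assume bx: "b = [x, y, z]"
  then obtain u v w where v: "c = [u, v, w]" using c bx by (auto simp: length_Suc_conv)
  have l1: "linear (\<lambda>v. f [v, s, t])" for s t
    using f bx unfolding alternating_multilinear_def
    by (auto dest!: spec[of _ "[s, s, t]"] spec[of _ 0])
  have l2: "linear (\<lambda>v. f [s, v, t])" for s t
    using f bx unfolding alternating_multilinear_def
    by (auto dest!: spec[of _ "[s, s, t]"] spec[of _ "Suc 0"])
  have l3: "linear (\<lambda>v. f [s, t, v])" for s t
    using f bx unfolding alternating_multilinear_def
    by (auto dest!: spec[of _ "[s, t, s]"] spec[of _ "Suc (Suc 0)"])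
  have A: "\<And>vs i j. length vs = 3 \<Longrightarrow> i < 3 \<Longrightarrow> j < 3 \<Longrightarrow> i \<noteq> j \<Longrightarrow> vs ! i = vs ! j \<Longrightarrow> f vs = 0"
    using f bx unfolding alternating_multilinear_def by (auto simp: numeral_3_eq_3)
  have z12: "f [s, s, t] = 0" for s t by (rule A[of _ 0 1]) auto
  have z13: "f [s, t, s] = 0" for s t by (rule A[of _ 0 2]) auto
  have z23: "f [t, s, s] = 0" for s t by (rule A[of _ 1 2]) auto
  note L = linear_add[OF l1] linear_add[OF l2] linear_add[OF l3]
    linear_scale[OF l1] linear_scale[OF l2] linear_scale[OF l3]
  have p1: "f [r, s, t] + f [s, r, t] = 0" for r s t
  proof -
    have "f [r + s, r + s, t] = f [r, r, t] + f [s, r, t] + (f [r, s, t] + f [s, s, t])" by (simp only: L)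
    then show ?thesis unfolding z12 by simp
  qed
  have a1: "f [s, r, t] = - f [r, s, t]" for r s t using p1[of r s t] by linarith
  have p2: "f [t, r, s] + f [t, s, r] = 0" for r s t
  proof -
    have "f [t, r + s, r + s] = f [t, r, r] + f [t, s, r] + (f [t, r, s] + f [t, s, s])" by (simp only: L)
    then show ?thesis unfolding z23 by simp
  qed
  have a2: "f [t, s, r] = - f [t, r, s]" for r s t using p2[of t r s] by linarith
  have perms: "f [x, z, y] = - f [x, y, z]" "f [y, x, z] = - f [x, y, z]" "f [y, z, x] = f [x, y, z]"
     "f [z, x, y] = f [x, y, z]" "f [z, y, x] = - f [x, y, z]"
    using a2[of x z y] a1[of y x z] a2[of y z x] a1[of z x y] a1[of z y x] by simp_all
  have "u = (u \<bullet> x) *\<^sub>R x + (u \<bullet> y) *\<^sub>R y + (u \<bullet> z) *\<^sub>R z" "v = (v \<bullet> x) *\<^sub>R x + (v \<bullet> y) *\<^sub>R y + (v \<bullet> z) *\<^sub>R z"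
     "w = (w \<bullet> x) *\<^sub>R x + (w \<bullet> y) *\<^sub>R y + (w \<bullet> z) *\<^sub>R z"
    using span_expand3[of x y z] b c bx v by auto
  note e = this
  \<comment> \<open>Expand the slots from the last to the first, so that each stage meets only
    vectors of the frame in the slots before it.\<close>
  have w1: "f [x, y, w] = (w \<bullet> z) * f [x, y, z]" "f [y, x, w] = - (w \<bullet> z) * f [x, y, z]"
      "f [x, z, w] = - (w \<bullet> y) * f [x, y, z]" "f [z, x, w] = (w \<bullet> y) * f [x, y, z]"
      "f [y, z, w] = (w \<bullet> x) * f [x, y, z]" "f [z, y, w] = - (w \<bullet> x) * f [x, y, z]"
    by (subst e(3), simp only: L perms z13 z23, simp)+
  have v1: "f [x, v, w] = (v \<bullet> y) * f [x, y, w] + (v \<bullet> z) * f [x, z, w]"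
      "f [y, v, w] = (v \<bullet> x) * f [y, x, w] + (v \<bullet> z) * f [y, z, w]"
      "f [z, v, w] = (v \<bullet> x) * f [z, x, w] + (v \<bullet> y) * f [z, y, w]"
    by (subst e(2), simp only: L z12, simp)+
  have "f [u, v, w] = (u \<bullet> x) * f [x, v, w] + (u \<bullet> y) * f [y, v, w] + (u \<bullet> z) * f [z, v, w]"
    by (subst e(1)) (simp only: L real_scaleR_def)
  also have "\<dots> = frame_det [u, v, w] [x, y, z] * f [x, y, z]"
    unfolding v1 w1 by (simp add: algebra_simps)
  finally show ?thesis using v bx by simp
qed

lemma frame_det_commute:
  assumes "length u = length v" "length u \<le> 3"
  shows "frame_det u v = frame_det v u"
proof -
  have v: "length v \<le> 3" using assms by simp
  show ?thesis
    by (rule list_le3_cases[OF assms(2)]; rule list_le3_cases[OF v]; insert assms)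
      (auto simp: inner_commute algebra_simps)
qed

lemma alternating_multilinear_frame_det:
  assumes "length u \<le> 3"
  shows "alternating_multilinear (length u) (frame_det u)"
  unfolding alternating_multilinear_def
proof (intro allI impI)
  fix vs :: "(real^3) list" assume l: "length vs = length u"
  have l3: "length vs \<le> 3" using l assms by simp
  show "(\<forall>i<length u. linear (\<lambda>v. frame_det u (vs[i := v]))) \<and>
      (\<forall>i<length u. \<forall>j<length u. i \<noteq> j \<and> vs ! i = vs ! j \<longrightarrow> frame_det u vs = 0)"
    by (rule list_le3_cases[OF assms]; rule list_le3_cases[OF l3]; insert l)
      (auto simp: less_Suc_eq numeral_2_eq_2 numeral_3_eq_3 algebra_simps intro!: linearI)
qed

text \<open>\<open>frame_det u\<close> is itself alternating, so its value on \<open>c\<close> is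
  its value on \<open>b\<close> times the determinant of \<open>c\<close> in the frame
  \<open>b\<close>.\<close>

lemma frame_det_mult:
  assumes "orthonormal_frame b" "length u = length b" "length c = length b" "set c \<subseteq> span (set b)"
  shows "frame_det u c = frame_det u b * frame_det b c"
proof -
  have "length u \<le> 3" using assms orthonormal_frame_length by simp
  then have "frame_det u c = frame_det c b * frame_det u b"
    using alternating_frame_det[of b "frame_det u" c] alternating_multilinear_frame_det[of u] assms
    by simp
  then show ?thesis
    using frame_det_commute[of c b] assms orthonormal_frame_length by simp
qed

lemma frame_det_self: "orthonormal_frame b \<Longrightarrow> frame_det b b = 1"
  by (rule list_le3_cases[OF orthonormal_frame_length, of b])
    (auto simp: orthonormal_frame_1 orthonormal_frame_2 orthonormal_frame_3 inner_commute)

text \<open>By multiplicativity and symmetry the square of this determinant is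
  \<open>frame_det b b\<close>, which is 1.\<close>

lemma frame_det_pm1:
  assumes "orthonormal_frame b" "orthonormal_frame c" "span (set b) = span (set c)"
  shows "frame_det b c = 1 \<or> frame_det b c = - 1"
proof -
  have l: "length c = length b" using dim_orthonormal_frame[of b] dim_orthonormal_frame[of c] assms by simp
  have s: "set b \<subseteq> span (set c)" unfolding assms(3)[symmetric] by (rule span_superset)
  have "frame_det b b = frame_det b c * frame_det c b"
    by (rule frame_det_mult[OF assms(2)]) (use l s in auto)
  then have "frame_det b c * frame_det b c = 1"
    unfolding frame_det_commute[OF l orthonormal_frame_length[OF assms(2)]] frame_det_self[OF assms(1)]
    by (rule sym)
  then show ?thesis by (simp add: square_eq_1_iff)
qed

text \<open>Each coordinate of \<open>w\<close> times the determinant is a combination, with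
  cofactors as coefficients, of the three vanishing products. Since some coordinate is not zero, the
  determinant vanishes.\<close>

lemma cramer3:
  fixes w1 w2 w3 p1 p2 p3 q1 q2 q3 r1 r2 r3 :: real
  assumes "w1 * p1 + w2 * p2 + w3 * p3 = 0" "w1 * q1 + w2 * q2 + w3 * q3 = 0"
    "w1 * r1 + w2 * r2 + w3 * r3 = 0" "w1 \<noteq> 0 \<or> w2 \<noteq> 0 \<or> w3 \<noteq> 0"
  shows "p1 * q2 * r3 + p2 * q3 * r1 + p3 * q1 * r2 - p1 * q3 * r2 - p2 * q1 * r3 - p3 * q2 * r1 = 0"
    (is "?D = 0")
proof -
  have "w1 * ?D = (w1 * p1 + w2 * p2 + w3 * p3) * (q2 * r3 - q3 * r2)
      - (w1 * q1 + w2 * q2 + w3 * q3) * (p2 * r3 - p3 * r2)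
      + (w1 * r1 + w2 * r2 + w3 * r3) * (p2 * q3 - p3 * q2)"
    by (simp add: algebra_simps)
  moreover have "w2 * ?D = - (w1 * p1 + w2 * p2 + w3 * p3) * (q1 * r3 - q3 * r1)
      + (w1 * q1 + w2 * q2 + w3 * q3) * (p1 * r3 - p3 * r1)
      - (w1 * r1 + w2 * r2 + w3 * r3) * (p1 * q3 - p3 * q1)"
    by (simp add: algebra_simps)
  moreover have "w3 * ?D = (w1 * p1 + w2 * p2 + w3 * p3) * (q1 * r2 - q2 * r1)
      - (w1 * q1 + w2 * q2 + w3 * q3) * (p1 * r2 - p2 * r1)
      + (w1 * r1 + w2 * r2 + w3 * r3) * (p1 * q2 - p2 * q1)"
    by (simp add: algebra_simps)
  ultimately have "w1 * ?D = 0" "w2 * ?D = 0" "w3 * ?D = 0"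
    unfolding assms by simp_all
  then show ?thesis using assms(4) by (metis mult_eq_0_iff)
qed

lemma frame_det_kernel:
  assumes b: "orthonormal_frame b" and l: "length u = length b"
    and w: "w \<in> span (set b)" "w \<noteq> 0" "\<And>v. v \<in> set u \<Longrightarrow> v \<bullet> w = 0"
  shows "frame_det u b = 0"
proof (rule list_le3_cases[OF orthonormal_frame_length[OF b]])
  assume "b = []"
  then show ?thesis using w by simp
next
  fix x assume bx: "b = [x]"
  then obtain v where v: "u = [v]" using l bx by (auto simp: length_Suc_conv)
  have e: "w = (w \<bullet> x) *\<^sub>R x" using span_expand1[of x w] b bx w by simp
  then have "w \<bullet> x \<noteq> 0" using w(2) by auto
  moreover have "(w \<bullet> x) * (v \<bullet> x) = 0"
    using w(3)[of v] v arg_cong[OF e, of "(\<bullet>) v"] by (simp add: inner_scaleR_right)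
  ultimately show ?thesis using v bx by simp
next
  fix x y assume bx: "b = [x, y]"
  then obtain p q where v: "u = [p, q]" using l bx by (auto simp: length_Suc_conv)
  have e: "w = (w \<bullet> x) *\<^sub>R x + (w \<bullet> y) *\<^sub>R y" using span_expand2[of x y w] b bx w by simp
  then have n: "w \<bullet> x \<noteq> 0 \<or> w \<bullet> y \<noteq> 0" using w(2) by auto
  have 1: "(w \<bullet> x) * (p \<bullet> x) + (w \<bullet> y) * (p \<bullet> y) = 0"
    using w(3)[of p] v arg_cong[OF e, of "(\<bullet>) p"] by (simp add: inner_add_right)
  have 2: "(w \<bullet> x) * (q \<bullet> x) + (w \<bullet> y) * (q \<bullet> y) = 0"
    using w(3)[of q] v arg_cong[OF e, of "(\<bullet>) q"] by (simp add: inner_add_right)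
  have "(w \<bullet> x) * frame_det u b = ((w \<bullet> x) * (p \<bullet> x) + (w \<bullet> y) * (p \<bullet> y)) * (q \<bullet> y)
      - ((w \<bullet> x) * (q \<bullet> x) + (w \<bullet> y) * (q \<bullet> y)) * (p \<bullet> y)"
    "(w \<bullet> y) * frame_det u b = ((w \<bullet> x) * (q \<bullet> x) + (w \<bullet> y) * (q \<bullet> y)) * (p \<bullet> x)
      - ((w \<bullet> x) * (p \<bullet> x) + (w \<bullet> y) * (p \<bullet> y)) * (q \<bullet> x)"
    unfolding v bx frame_det_2 by (simp_all add: algebra_simps)
  then show ?thesis using n unfolding 1 2 by auto
next
  fix x y z assume bx: "b = [x, y, z]"
  then obtain p q r where v: "u = [p, q, r]" using l bx by (auto simp: length_Suc_conv)
  have e: "w = (w \<bullet> x) *\<^sub>R x + (w \<bullet> y) *\<^sub>R y + (w \<bullet> z) *\<^sub>R z" using span_expand3[of x y z w] b bx w by simp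
  then have n: "w \<bullet> x \<noteq> 0 \<or> w \<bullet> y \<noteq> 0 \<or> w \<bullet> z \<noteq> 0" using w(2) by auto
  have *: "(w \<bullet> x) * (p \<bullet> x) + (w \<bullet> y) * (p \<bullet> y) + (w \<bullet> z) * (p \<bullet> z) = 0" if "p \<in> set u" for p
    using w(3)[of p] that arg_cong[OF e, of "(\<bullet>) p"] by (simp add: inner_add_right)
  note 1 = *[of p] and 2 = *[of q] and 3 = *[of r]
  show ?thesis
    unfolding v bx frame_det_3 by (rule cramer3[OF 1 2 3 n]) (use v in auto)
qed

text \<open>The vector is the generalized cross product of \<open>q\<close> within the span of
  \<open>b\<close>. In \<open>slice_boundary\<close> it is the direction of the fibre of
  \<open>q\<close> in the plane of the cell, oriented so that its sign against a covector
  \<open>l\<close> is the sign of \<open>l # q\<close>.\<close>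

lemma frame_det_cofactor:
  assumes b: "orthonormal_frame b" and l: "length b = Suc (length q)"
  shows "\<exists>v\<in>span (set b). \<forall>w. v \<bullet> w = frame_det (w # q) b"
proof (rule list_le3_cases[OF orthonormal_frame_length[OF b]])
  assume "b = []"
  then show ?thesis using l by simp
next
  fix x assume bx: "b = [x]"
  then show ?thesis using l by (intro bexI[of _ x]) (auto simp: span_base inner_commute)
next
  fix x y assume bx: "b = [x, y]"
  then obtain a where v: "q = [a]" using l bx by (cases q) auto
  show ?thesis unfolding v bx
    by (intro bexI[of _ "(a \<bullet> y) *\<^sub>R x - (a \<bullet> x) *\<^sub>R y"])
      (auto simp: span_base span_scale span_diff inner_commute inner_diff_right algebra_simps)
next
  fix x y z assume bx: "b = [x, y, z]"
  then obtain a c where v: "q = [a, c]" using l bx by (cases q; cases "tl q") auto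
  let ?v = "((a \<bullet> y) * (c \<bullet> z) - (a \<bullet> z) * (c \<bullet> y)) *\<^sub>R x
    + ((a \<bullet> z) * (c \<bullet> x) - (a \<bullet> x) * (c \<bullet> z)) *\<^sub>R y + ((a \<bullet> x) * (c \<bullet> y) - (a \<bullet> y) * (c \<bullet> x)) *\<^sub>R z"
  have "?v \<in> span (set b)"
    unfolding bx by (intro span_add span_scale span_base) auto
  moreover have "\<forall>w. ?v \<bullet> w = frame_det (w # q) b"
    unfolding v bx by (simp add: inner_add_left inner_add_right inner_commute algebra_simps)
  ultimately show ?thesis by blast
qed

text \<open>The first row of the matrix is (1, 0, ..., 0), so Laplace expansion leaves the
  minor.\<close>

lemma frame_det_Cons_unit:
  assumes "length q = length c" "length q \<le> 2" "n \<bullet> n = 1" "\<And>v. v \<in> set c \<Longrightarrow> n \<bullet> v = 0"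
  shows "frame_det (n # q) (n # c) = frame_det q c"
proof -
  have q: "length q \<le> 3" and c: "length c \<le> 3" using assms by auto
  show ?thesis
    by (rule list_le3_cases[OF q]; rule list_le3_cases[OF c]; insert assms)
      (auto simp: algebra_simps)
qed

section \<open>Fibres of a list of covectors and the projections along them\<close>

definition qker :: "(real^3) list \<Rightarrow> (real^3) set" where
  "qker q = {y. \<forall>v\<in>set q. v \<bullet> y = 0}"

lemma subspace_qker: "subspace (qker q)"
  by (auto simp: qker_def subspace_def inner_add_right)

lemma dim_qker: "dim (qker q) + dim (set q) = 3"
proof -
  have "dim {y \<in> UNIV. \<forall>x\<in>span (set q). orthogonal x y} + dim (span (set q)) = dim (UNIV :: (real^3) set)"
    by (rule dim_subspace_orthogonal_to_vectors) auto
  moreover have "{y \<in> UNIV. \<forall>x\<in>span (set q). orthogonal x y} = qker q"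
  proof -
    have "set q \<subseteq> {x. x \<bullet> y = 0} \<Longrightarrow> span (set q) \<subseteq> {x. x \<bullet> y = 0}" for y
      by (rule span_minimal) (auto simp: subspace_hyperplane2)
    then show ?thesis by (auto simp: qker_def orthogonal_def span_base)
  qed
  ultimately show ?thesis by simp
qed

lemma span_Int_qker:
  assumes "orthonormal_frame b" "length q = length b" "frame_det q b \<noteq> 0"
  shows "span (set b) \<inter> qker q = {0}"
  using frame_det_kernel[OF assms(1,2)] assms(3) subspace_0[OF subspace_qker] span_zero
  by (fastforce simp: qker_def)

text \<open>Since the span of \<open>b\<close> and the fibre direction \<open>qker q\<close> meet
  only in 0, their dimensions sum to at most 3; with \<open>dim_qker\<close> this forces the
  covectors to be independent.\<close>

lemma frame_det_dim:
  assumes b: "orthonormal_frame b" and l: "length q = length b" and d: "frame_det q b \<noteq> 0"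
  shows "dim (set q) = length b"
proof -
  have "dim {x + y |x y. x \<in> span (set b) \<and> y \<in> qker q} + dim (span (set b) \<inter> qker q)
     = dim (span (set b)) + dim (qker q)"
    by (rule dim_sums_Int) (auto simp: subspace_qker)
  moreover have "dim {x + y |x y. x \<in> span (set b) \<and> y \<in> qker q} \<le> 3"
    using dim_subset_UNIV[of "{x + y |x y. x \<in> span (set b) \<and> y \<in> qker q}"] by simp
  moreover have "dim (set q) \<le> length q"
    by (meson card_length dim_le_card' finite_set le_trans)
  ultimately show ?thesis
    using span_Int_qker[OF b l d] dim_qker[of q] dim_orthonormal_frame[OF b] l by simp
qed

text \<open>The span of \<open>b\<close> and \<open>qker q\<close> are complementary, and
  \<open>Z\<close> is the oblique projection onto the first along the second: it moves a point
  within its fibre of \<open>q\<close> to the plane through the origin.\<close>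

lemma frame_det_projection:
  assumes b: "orthonormal_frame b" and l: "length q = length b" and d: "frame_det q b \<noteq> 0"
  obtains Z where "linear Z" "\<And>x. Z x \<in> span (set b)" "\<And>x v. v \<in> set q \<Longrightarrow> v \<bullet> Z x = v \<bullet> x"
    "\<And>x. x \<in> span (set b) \<Longrightarrow> Z x = x"
proof -
  let ?S = "{x + y |x y. x \<in> span (set b) \<and> y \<in> qker q}"
  have "dim ?S + dim (span (set b) \<inter> qker q) = dim (span (set b)) + dim (qker q)"
    by (rule dim_sums_Int) (auto simp: subspace_qker)
  then have "dim ?S = 3"
    using span_Int_qker[OF b l d] dim_qker[of q] dim_orthonormal_frame[OF b] frame_det_dim[OF b l d] l
    by simp
  then have "span ?S = UNIV" using dim_eq_full[of ?S] by simp
  moreover have "span ?S = ?S"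
    unfolding span_eq_iff by (rule subspace_sums[OF subspace_span subspace_qker])
  ultimately have S: "?S = UNIV" by (rule trans[OF sym, rotated])
  have "\<exists>z. z \<in> span (set b) \<and> x - z \<in> qker q" for x
  proof -
    have "x \<in> ?S" using S by blast
    then obtain z y where "x = z + y" "z \<in> span (set b)" "y \<in> qker q" by blast
    then show ?thesis by (intro exI[of _ z]) auto
  qed
  then obtain Z where Z: "\<And>x. Z x \<in> span (set b)" "\<And>x. x - Z x \<in> qker q" by metis
  have uniq: "Z x = z" if "z \<in> span (set b)" "x - z \<in> qker q" for x z
  proof -
    have "z - Z x = (x - Z x) - (x - z)" by simp
    moreover have "(x - Z x) - (x - z) \<in> qker q" by (intro subspace_diff subspace_qker Z that)
    ultimately have "z - Z x \<in> qker q" by (simp only:)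
    moreover have "z - Z x \<in> span (set b)" by (intro span_diff Z that)
    ultimately have "z - Z x \<in> {0}" unfolding span_Int_qker[OF b l d, symmetric] by simp
    then show ?thesis by simp
  qed
  show thesis
  proof (rule that[of Z])
    show "linear Z"
    proof (rule linearI)
      fix x y
      have "(x - Z x) + (y - Z y) \<in> qker q" by (intro subspace_add subspace_qker Z)
      moreover have "(x - Z x) + (y - Z y) = x + y - (Z x + Z y)" by simp
      ultimately have "x + y - (Z x + Z y) \<in> qker q" by (simp only:)
      then show "Z (x + y) = Z x + Z y" by (rule uniq[rotated]) (intro span_add Z)
    next
      fix r x
      have "r *\<^sub>R (x - Z x) \<in> qker q" by (intro subspace_scale subspace_qker Z)
      then have "r *\<^sub>R x - r *\<^sub>R Z x \<in> qker q" by (simp only: scaleR_diff_right)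
      then show "Z (r *\<^sub>R x) = r *\<^sub>R Z x" by (rule uniq[rotated]) (intro span_scale Z)
    qed
    show "Z x = x" if "x \<in> span (set b)" for x
      by (rule uniq) (use that subspace_0[OF subspace_qker] in auto)
    show "v \<bullet> Z x = v \<bullet> x" if "v \<in> set q" for v x
      using Z(2)[of x] that by (simp add: qker_def inner_diff_right)
  qed (rule Z)
qed

section \<open>Integration over planes through Lebesgue measure of the ambient space\<close>

abbreviation pi_lborel :: "nat set \<Rightarrow> (nat \<Rightarrow> real) measure" where
  "pi_lborel I \<equiv> Pi\<^sub>M I (\<lambda>_. lborel)"

lemma measurable_chart:
  assumes "{..<length b} \<subseteq> I"
  shows "chart p b \<in> borel_measurable (pi_lborel I)"
proof -
  have "(\<lambda>t. t i) \<in> borel_measurable (pi_lborel I)" if "i < length b" for i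
  proof -
    have "(\<lambda>t. t i) \<in> measurable (pi_lborel I) lborel"
      by (rule measurable_component_singleton) (use assms that in auto)
    then show ?thesis by simp
  qed
  then have "(\<lambda>t. p + (\<Sum>i<length b. t i *\<^sub>R b ! i)) \<in> borel_measurable (pi_lborel I)"
    by (intro borel_measurable_add borel_measurable_const borel_measurable_sum borel_measurable_scaleR)
      auto
  then show ?thesis by (simp add: chart_def[abs_def])
qed

lemma product_sigma_finite_lborel: "product_sigma_finite (\<lambda>_::nat. lborel :: real measure)"
  by (simp add: product_sigma_finite_def sigma_finite_lborel)

definition std_frame :: "(real^3) list" where
  "std_frame = [axis 1 1, axis 2 1, axis 3 1]"

lemma chart_std: "chart 0 std_frame t = vector [t 0, t 1, t 2]"
  by (simp add: chart_def std_frame_def lessThan_Suc numeral_3_eq_3 vec_eq_iff forall_3 axis_def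
      numeral_2_eq_2)

text \<open>Uniqueness of Lebesgue measure reduces the claim to boxes, which the chart pulls back to
  products of intervals.\<close>

lemma distr_chart_std: "distr (pi_lborel {..<3}) borel (chart 0 std_frame) = lborel"
proof (rule sym, rule lborel_eqI)
  interpret product_sigma_finite "\<lambda>_::nat. lborel :: real measure"
    by (rule product_sigma_finite_lborel)
  fix l u :: "real^3" assume lu: "\<And>b. b \<in> Basis \<Longrightarrow> l \<bullet> b \<le> u \<bullet> b"
  let ?L = "\<lambda>i::nat. if i = 0 then l$1 else if i = 1 then l$2 else l$3"
  let ?U = "\<lambda>i::nat. if i = 0 then u$1 else if i = 1 then u$2 else u$3"
  have s3: "{..<3::nat} = {0, 1, 2}" by auto
  have *: "l $ i \<le> u $ i" for i using lu[of "axis i 1"] by (auto simp: inner_axis Basis_vec_def)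
  have m: "chart 0 std_frame \<in> borel_measurable (pi_lborel {..<3})"
    by (rule measurable_chart) (simp add: std_frame_def)
  have "emeasure (distr (pi_lborel {..<3}) borel (chart 0 std_frame)) (box l u)
      = emeasure (pi_lborel {..<3}) (chart 0 std_frame -` box l u \<inter> space (pi_lborel {..<3}))"
    by (rule emeasure_distr[OF m]) simp
  also have "chart 0 std_frame -` box l u \<inter> space (pi_lborel {..<3}) = Pi\<^sub>E {..<3} (\<lambda>i. {?L i<..<?U i})"
    unfolding chart_std space_PiM s3
    by (auto simp: mem_box_cart forall_3 vector_3 PiE_def Pi_def)
  also have "emeasure (pi_lborel {..<3}) \<dots> = (\<Prod>i<3. emeasure lborel {?L i<..<?U i})"
    by (rule emeasure_PiM) auto
  also have "\<dots> = ennreal (\<Prod>b\<in>Basis. (u - l) \<bullet> b)"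
  proof -
    have "(\<Prod>b\<in>Basis. (u - l) \<bullet> b) = (\<Prod>i\<in>UNIV. (u - l) $ i)"
      unfolding Basis_vec_def
      by (rule prod.reindex_cong[of "\<lambda>i::3. axis i (1::real)"])
        (auto simp: inj_on_def axis_eq_axis inner_axis)
    also have "\<dots> = (\<Prod>i<3. ?U i - ?L i)" unfolding s3 UNIV_3 by simp
    finally have p: "(\<Prod>b\<in>Basis. (u - l) \<bullet> b) = (\<Prod>i<3. ?U i - ?L i)" .
    have "(\<Prod>i<3. emeasure lborel {?L i<..<?U i}) = (\<Prod>i<3. ennreal (?U i - ?L i))"
      by (intro prod.cong) (simp_all add: *)
    also have "\<dots> = ennreal (\<Prod>i<3. ?U i - ?L i)" by (rule prod_ennreal) (simp add: *)
    finally show ?thesis unfolding p .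
  qed
  finally show "emeasure (distr (pi_lborel {..<3}) borel (chart 0 std_frame)) (box l u)
     = ennreal (\<Prod>b\<in>Basis. (u - l) \<bullet> b)" .
qed simp

lemma distr_orthogonal:
  fixes f :: "real^3 \<Rightarrow> real^3"
  assumes f: "orthogonal_transformation f"
  shows "distr lborel borel f = lborel"
proof (rule sym, rule lborel_eqI)
  fix l u :: "real^3" assume lu: "\<And>b. b \<in> Basis \<Longrightarrow> l \<bullet> b \<le> u \<bullet> b"
  have m: "f \<in> borel_measurable borel"
    using f by (intro borel_measurable_continuous_onI linear_continuous_on)
      (simp add: orthogonal_transformation_linear linear_conv_bounded_linear[symmetric])
  have bij: "bij f" using f by (rule orthogonal_transformation_bij)
  have g: "orthogonal_transformation (inv_into UNIV f)" using f by (rule orthogonal_transformation_inv)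
  have "f -` box l u = inv_into UNIV f ` box l u"
    using bij by (simp add: bij_vimage_eq_inv_image)
  moreover have "measure lebesgue (inv_into UNIV f ` box l u) = measure lebesgue (box l u)"
    by (rule measure_orthogonal_image[OF g]) simp
  moreover have "inv_into UNIV f ` box l u \<in> lmeasurable"
    by (rule measurable_orthogonal_image[OF g]) simp
  ultimately have "emeasure lebesgue (f -` box l u) = emeasure lebesgue (box l u)"
    by (simp add: emeasure_eq_measure2)
  moreover have "f -` box l u \<in> sets borel"
    using measurable_sets[OF m, of "box l u"] by simp
  ultimately have "emeasure lborel (f -` box l u) = emeasure lborel (box l u)"
    by simp
  then show "emeasure (distr lborel borel f) (box l u) = ennreal (\<Prod>b\<in>Basis. (u - l) \<bullet> b)"
    using m lu by (simp add: emeasure_distr)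
qed simp

text \<open>The chart is the standard chart followed by an orthogonal map and a translation, and all
  three preserve the measure.\<close>

lemma distr_chart:
  assumes e: "orthonormal_frame e" "length e = 3"
  shows "distr (pi_lborel {..<3}) borel (chart p e) = lborel"
proof -
  let ?f = "\<lambda>v::real^3. \<Sum>i<3. (v \<bullet> std_frame ! i) *\<^sub>R e ! i"
  have s3: "{..<3::nat} = {0, 1, 2}" by auto
  have lin: "linear ?f"
    by (intro linearI) (simp_all add: inner_add_left scaleR_add_left sum.distrib scaleR_sum_right)
  have ee: "e ! i \<bullet> e ! j = (if i = j then 1 else 0)" if "i < 3" "j < 3" for i j
    using orthonormal_frame_inner[OF e(1)] e(2) that by simp
  have "?f v \<bullet> ?f w = v \<bullet> w" for v w
  proof -
    have "?f v \<bullet> ?f w = (\<Sum>i<3. (v \<bullet> std_frame ! i) * (w \<bullet> std_frame ! i))"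
    proof -
      have "?f v \<bullet> ?f w = (\<Sum>i<3. \<Sum>j<3. (v \<bullet> std_frame ! i) * ((w \<bullet> std_frame ! j) * (e ! i \<bullet> e ! j)))"
        unfolding inner_sum_left unfolding inner_sum_right
        by (intro sum.cong refl) (simp add: mult.left_commute)
      also have "\<dots> = (\<Sum>i<3. \<Sum>j<3. if j = i then (v \<bullet> std_frame ! i) * (w \<bullet> std_frame ! i) else 0)"
        by (intro sum.cong refl) (auto simp: ee)
      finally show ?thesis by simp
    qed
    also have "\<dots> = v \<bullet> w"
      unfolding s3 inner_vec_def sum_3 by (simp add: std_frame_def axis_def)
    finally show ?thesis .
  qed
  then have "orthogonal_transformation ?f"
    unfolding orthogonal_transformation_def using lin by blast
  then have d: "distr lborel borel ?f = lborel" by (rule distr_orthogonal)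
  have m: "?f \<in> borel_measurable borel" by measurable
  have ms: "chart 0 std_frame \<in> borel_measurable (pi_lborel {..<3})"
    by (rule measurable_chart) (simp add: std_frame_def)
  have "chart 0 std_frame t \<bullet> std_frame ! i = t i" if "i < 3" for t i
  proof -
    from that consider "i = 0" | "i = 1" | "i = 2" by linarith
    then show ?thesis unfolding chart_std by cases (simp_all add: std_frame_def inner_axis)
  qed
  then have "?f (chart 0 std_frame t) = chart 0 e t" for t
    by (simp add: chart_def[of _ e] e(2))
  then have "chart p e = (\<lambda>x. p + x) \<circ> (?f \<circ> chart 0 std_frame)"
    by (auto simp: chart_def fun_eq_iff)
  then have "distr (pi_lborel {..<3}) borel (chart p e) = distr (distr (distr (pi_lborel {..<3}) borel (chart 0 std_frame)) borel ?f) borel ((+) p)"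
    using m ms by (simp add: distr_distr comp_assoc)
  also have "\<dots> = lborel"
    unfolding distr_chart_std d lborel_distr_plus ..
  finally show ?thesis .
qed

lemma orthonormal_frame_extend1:
  assumes "orthonormal_frame b" "length b < 3"
  obtains v where "orthonormal_frame (b @ [v])"
proof -
  have "dim (set b) = length b" using dim_orthonormal_frame[OF assms(1)] by simp
  have "\<not> qker b \<subseteq> {0}"
  proof
    assume "qker b \<subseteq> {0}"
    then have "dim (qker b) = 0" by (simp only: dim_eq_0)
    then show False using dim_qker[of b] assms(2) \<open>dim (set b) = length b\<close> by linarith
  qed
  then obtain w where w: "w \<in> qker b" "w \<noteq> 0" by blast
  let ?v = "w /\<^sub>R norm w"
  have v: "?v \<bullet> ?v = 1" using w(2) by (simp add: power2_norm_eq_inner[symmetric] power2_eq_square)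
  have o: "x \<bullet> ?v = 0" if "x \<in> set b" for x using w that by (simp add: qker_def)
  show thesis
  proof (rule that[of ?v])
    show "orthonormal_frame (b @ [?v])"
      unfolding orthonormal_frame_def
    proof (intro allI impI)
      fix i j assume "i < length (b @ [?v])" "j < length (b @ [?v])"
      then show "(b @ [?v]) ! i \<bullet> (b @ [?v]) ! j = (if i = j then 1 else 0)"
        using orthonormal_frame_inner[OF assms(1), of i j] v o[of "b ! i"] o[of "b ! j"]
        by (auto simp: nth_append less_Suc_eq inner_commute)
    qed
  qed
qed

lemma orthonormal_frame_extend:
  assumes "orthonormal_frame b"
  obtains c where "orthonormal_frame (b @ c)" "length (b @ c) = 3"
proof -
  have "\<exists>c. orthonormal_frame (b @ c) \<and> length (b @ c) = 3"
    using assms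
  proof (induction "3 - length b" arbitrary: b)
    case 0
    then show ?case using orthonormal_frame_length[of b] by (intro exI[of _ "[]"]) auto
  next
    case (Suc n)
    then obtain v where v: "orthonormal_frame (b @ [v])"
      using orthonormal_frame_extend1[of b] by (metis zero_less_Suc zero_less_diff)
    have "n = 3 - length (b @ [v])" using Suc.hyps(2) by simp
    from Suc.hyps(1)[OF this v]
    obtain c where "orthonormal_frame ((b @ [v]) @ c)" "length ((b @ [v]) @ c) = 3" by blast
    then show ?case by (intro exI[of _ "v # c"]) auto
  qed
  then show thesis using that by blast
qed

section \<open>Orthogonal projection onto planes\<close>

definition proj :: "real^3 \<Rightarrow> (real^3) list \<Rightarrow> real^3 \<Rightarrow> real^3" where
  "proj p b x = p + (\<Sum>i<length b. ((x - p) \<bullet> b ! i) *\<^sub>R b ! i)"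

lemma measurable_proj [measurable]: "proj p b \<in> borel_measurable borel"
  unfolding proj_def by measurable

lemma proj_in_plane: "proj p b x \<in> plane p b"
  unfolding proj_def plane_def by (intro imageI span_sum span_scale span_base) auto

lemma chart_in_plane: "chart p b t \<in> plane p b"
  unfolding chart_def plane_def by (intro imageI span_sum span_scale span_base) auto

lemma proj_inner:
  assumes "orthonormal_frame b" "v \<in> set b"
  shows "v \<bullet> proj p b x = v \<bullet> x"
proof -
  obtain j where j: "j < length b" "v = b ! j" using assms by (metis in_set_conv_nth)
  have "(\<Sum>i<length b. ((x - p) \<bullet> b ! i) * (v \<bullet> b ! i)) = (\<Sum>i<length b. if i = j then (x - p) \<bullet> v else 0)"
    by (rule sum.cong) (use j in \<open>auto simp: orthonormal_frame_inner[OF assms(1)]\<close>)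
  also have "\<dots> = (x - p) \<bullet> v" using j by simp
  finally have "v \<bullet> proj p b x = v \<bullet> p + (x - p) \<bullet> v"
    by (simp add: proj_def inner_add_right inner_sum_right)
  then show ?thesis by (simp add: inner_diff_right inner_commute[of _ v])
qed

lemma proj_unique:
  assumes b: "orthonormal_frame b" and z: "z \<in> plane p b" "\<And>v. v \<in> set b \<Longrightarrow> v \<bullet> z = v \<bullet> x"
  shows "proj p b x = z"
proof -
  obtain u where u: "z = p + u" "u \<in> span (set b)" using z(1) by (auto simp: plane_def)
  have "u = (\<Sum>i<length b. (u \<bullet> b ! i) *\<^sub>R b ! i)" by (rule orthonormal_frame_expand[OF b u(2)])
  also have "\<dots> = (\<Sum>i<length b. ((x - p) \<bullet> b ! i) *\<^sub>R b ! i)"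
  proof (rule sum.cong)
    fix i assume "i \<in> {..<length b}"
    then have "b ! i \<bullet> (p + u) = b ! i \<bullet> x" using z(2)[of "b ! i"] u(1) by simp
    then have "u \<bullet> b ! i = (x - p) \<bullet> b ! i"
      by (simp add: inner_diff_right inner_add_right inner_commute[of _ "b ! i"])
    then show "(u \<bullet> b ! i) *\<^sub>R b ! i = ((x - p) \<bullet> b ! i) *\<^sub>R b ! i" by simp
  qed simp
  finally show ?thesis by (simp add: proj_def u(1))
qed

text \<open>The volume of the unit ball in the 3 - k normal coordinates of a k-plane, numbered so
  that they continue the coordinates of the chart. For k = 3 the index set is empty and the value is
  1.\<close>

definition fibre_volume :: "nat \<Rightarrow> real" where
  "fibre_volume k = measure (pi_lborel {k..<3}) {y \<in> space (pi_lborel {k..<3}). (\<Sum>j\<in>{k..<3}. (y j)\<^sup>2) < 1}"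

lemma fibre_volume_pos: "fibre_volume k > 0"
proof -
  interpret product_sigma_finite "\<lambda>_::nat. lborel :: real measure"
    by (rule product_sigma_finite_lborel)
  let ?S = "{y \<in> space (pi_lborel {k..<3}). (\<Sum>j\<in>{k..<3}. (y j)\<^sup>2) < 1}"
  have S: "?S \<in> sets (pi_lborel {k..<3})" by measurable
  have "Pi\<^sub>E {k..<3} (\<lambda>_. {-1/2<..<1/2::real}) \<subseteq> ?S"
  proof
    fix y assume y: "y \<in> Pi\<^sub>E {k..<3} (\<lambda>_. {-1/2<..<1/2::real})"
    \<comment> \<open>At most three squares of size at most 1/4 stay below 1, so a cube of side 1
      fits into the ball.\<close>
    have "(\<Sum>j\<in>{k..<3}. (y j)\<^sup>2) \<le> (\<Sum>j\<in>{k..<3}. 1/4)"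
    proof (rule sum_mono)
      fix j assume "j \<in> {k..<3}"
      then have "\<bar>y j\<bar> \<le> 1/2" using y by (auto simp: PiE_def Pi_def abs_le_iff less_imp_le)
      then have "\<bar>y j\<bar>\<^sup>2 \<le> (1/2)\<^sup>2" by (intro power_mono) auto
      then show "(y j)\<^sup>2 \<le> 1/4" by (simp add: power2_eq_square)
    qed
    also have "\<dots> < 1" by simp
    finally show "y \<in> ?S" using y by (auto simp: space_PiM PiE_def)
  qed
  then have "emeasure (pi_lborel {k..<3}) (Pi\<^sub>E {k..<3} (\<lambda>_. {-1/2<..<1/2::real})) \<le> emeasure (pi_lborel {k..<3}) ?S"
    by (rule emeasure_mono[OF _ S])
  then have 1: "1 \<le> emeasure (pi_lborel {k..<3}) ?S" by (simp add: emeasure_PiM)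
  \<comment> \<open>The outer cube gives finiteness, without which the real-valued
    \<open>measure\<close> would be 0 by convention.\<close>
  have "?S \<subseteq> Pi\<^sub>E {k..<3} (\<lambda>_. {-1<..<1::real})"
  proof
    fix y assume y: "y \<in> ?S"
    have "-1 < y j \<and> y j < 1" if "j \<in> {k..<3}" for j
    proof -
      have "(y j)\<^sup>2 \<le> (\<Sum>j\<in>{k..<3}. (y j)\<^sup>2)" by (rule member_le_sum) (use that in auto)
      then have "(y j)\<^sup>2 < 1" using y by auto
      then show ?thesis by (simp add: abs_square_less_1 abs_less_iff)
    qed
    then show "y \<in> Pi\<^sub>E {k..<3} (\<lambda>_. {-1<..<1::real})"
      using y by (auto simp: space_PiM PiE_def)
  qed
  then have "emeasure (pi_lborel {k..<3}) ?S \<le> emeasure (pi_lborel {k..<3}) (Pi\<^sub>E {k..<3} (\<lambda>_. {-1<..<1::real}))"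
    by (rule emeasure_mono) (auto intro!: sets_PiM_I_finite)
  also have "\<dots> = (\<Prod>i\<in>{k..<3}. 2)" by (simp add: emeasure_PiM)
  also have "\<dots> < \<infinity>" by (simp add: power_less_top_ennreal)
  finally have "emeasure (pi_lborel {k..<3}) ?S \<noteq> \<infinity>" by simp
  then have "emeasure (pi_lborel {k..<3}) ?S = ennreal (fibre_volume k)"
    by (simp add: fibre_volume_def emeasure_eq_ennreal_measure)
  with 1 show ?thesis by (metis ennreal_1 ennreal_le_iff2 ennreal_neg not_less not_one_le_zero zero_less_one less_le_trans linorder_le_less_linear)
qed

text \<open>The part of the space over a plane at distance less than 1: an integral over the plane of a
  form becomes a Lebesgue integral over \<open>\<real>\<^sup>3\<close>, so that planes of different dimensions and
  frames of the same plane are treated alike.\<close>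

definition slab :: "real^3 \<Rightarrow> (real^3) list \<Rightarrow> (real^3) set" where
  "slab p b = {x. norm (x - proj p b x) < 1}"

lemma slab_measurable [measurable]: "slab p b \<in> sets borel"
  unfolding slab_def by measurable

lemma slab_integrable:
  assumes h: "h \<in> borel_measurable borel" and C: "\<And>z. \<bar>h z\<bar> \<le> C" and R: "\<And>z. norm z > R \<Longrightarrow> h z = (0::real)"
  shows "integrable lborel (\<lambda>x. indicat_real (slab p b) x * h (proj p b x))"
proof (rule Bochner_Integration.integrable_bound)
  have "bounded (ball 0 (R + 1) :: (real^3) set)" by simp
  then show "integrable lborel (\<lambda>x. C * indicat_real (ball 0 (R + 1) :: (real^3) set) x)"
    using emeasure_bounded_finite[of "ball 0 (R + 1) :: (real^3) set"]
    by (intro integrable_mult_right integrable_real_indicator) auto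
  show "(\<lambda>x. indicat_real (slab p b) x * h (proj p b x)) \<in> borel_measurable lborel"
    using h by measurable
  have "norm (indicat_real (slab p b) x * h (proj p b x)) \<le> norm (C * indicat_real (ball 0 (R + 1)) x)" for x
  proof (cases "x \<in> slab p b \<and> h (proj p b x) \<noteq> 0")
    case True
    then have "norm (proj p b x) \<le> R" using R not_less by blast
    moreover have "norm (x - proj p b x) < 1" using True by (simp add: slab_def)
    ultimately have "norm x < R + 1"
      using norm_triangle_ineq[of "x - proj p b x" "proj p b x"] by simp
    then show ?thesis using True C[of "proj p b x"] by (simp add: indicator_def)
  qed (auto simp: indicator_def)
  then show "AE x in lborel. norm (indicat_real (slab p b) x * h (proj p b x)) \<le> norm (C * indicat_real (ball 0 (R + 1)) x)"
    by simp
qed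

text \<open>Fubini in orthonormal coordinates that begin with those of the plane: on the slab the
  integrand depends only on the plane coordinates, and the normal coordinates contribute the
  constant \<open>fibre_volume\<close>.\<close>

lemma chart_integral_slab:
  assumes b: "orthonormal_frame b"
    and h: "h \<in> borel_measurable borel" and C: "\<And>z. \<bar>h z\<bar> \<le> C" and R: "\<And>z. norm z > R \<Longrightarrow> h z = (0::real)"
  shows "fibre_volume (length b) * (LINT t | pi_lborel {..<length b}. h (chart p b t))
     = (LINT x | lborel. indicat_real (slab p b) x * h (proj p b x))"
proof -
  interpret product_sigma_finite "\<lambda>_::nat. lborel :: real measure"
    by (rule product_sigma_finite_lborel)
  let ?k = "length b"
  let ?I = "{..<?k}" and ?J = "{?k..<3}"
  let ?f = "\<lambda>x. indicat_real (slab p b) x * h (proj p b x)"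
  obtain c where e: "orthonormal_frame (b @ c)" "length (b @ c) = 3"
    using orthonormal_frame_extend[OF b] by blast
  let ?e = "b @ c"
  have IJ: "?I \<union> ?J = {..<3}" using e(2) by auto
  have mc: "chart p ?e \<in> borel_measurable (pi_lborel {..<3})"
    by (rule measurable_chart) (use e(2) in auto)
  have f: "integrable lborel ?f" by (rule slab_integrable[OF h C R])
  have mf: "?f \<in> borel_measurable borel" using h by measurable
  have "(LINT x | lborel. ?f x) = (LINT t | pi_lborel {..<3}. ?f (chart p ?e t))"
    by (subst distr_chart[OF e, of p, symmetric]) (rule integral_distr[OF mc mf])
  also have "\<dots> = (LINT x | pi_lborel ?I. LINT y | pi_lborel ?J. ?f (chart p ?e (merge ?I ?J (x, y))))"
    unfolding IJ[symmetric]
  proof (rule product_integral_fold)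
    have "integrable (distr (pi_lborel {..<3}) borel (chart p ?e)) ?f"
      unfolding distr_chart[OF e] by (rule f)
    then show "integrable (pi_lborel (?I \<union> ?J)) (\<lambda>t. ?f (chart p ?e t))"
      unfolding IJ by (subst (asm) integrable_distr_eq[OF mc mf])
  qed auto
  also have "\<dots> = (LINT x | pi_lborel ?I. fibre_volume ?k * h (chart p b x))"
  proof (rule Bochner_Integration.integral_cong)
    fix x
    have ch: "chart p ?e (merge ?I ?J (x, y)) = chart p b x + (\<Sum>j\<in>?J. y j *\<^sub>R ?e ! j)" for y
    proof -
      have "(\<Sum>i<3. merge ?I ?J (x, y) i *\<^sub>R ?e ! i) = (\<Sum>i\<in>?I. merge ?I ?J (x, y) i *\<^sub>R ?e ! i) + (\<Sum>i\<in>?J. merge ?I ?J (x, y) i *\<^sub>R ?e ! i)"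
        unfolding IJ[symmetric] by (rule sum.union_disjoint) auto
      also have "\<dots> = (\<Sum>i<?k. x i *\<^sub>R b ! i) + (\<Sum>j\<in>?J. y j *\<^sub>R ?e ! j)"
        by (intro arg_cong2[where f = "(+)"] sum.cong) (auto simp: merge_def nth_append)
      finally show ?thesis unfolding chart_def e(2) by simp
    qed
    have ee: "?e ! i \<bullet> ?e ! j = (if i = j then 1 else 0)" if "i < 3" "j < 3" for i j
      using orthonormal_frame_inner[OF e(1), of i j] e(2) that by simp
    have pr: "proj p b (chart p b x + (\<Sum>j\<in>?J. y j *\<^sub>R ?e ! j)) = chart p b x" for y
    proof (rule proj_unique[OF b])
      show "chart p b x \<in> plane p b" by (rule chart_in_plane)
      fix v assume "v \<in> set b"
      then obtain i where i: "i < ?k" "v = b ! i" by (metis in_set_conv_nth)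
      have "v \<bullet> ?e ! j = 0" if "j \<in> ?J" for j
        using ee[of i j] i e(2) that by (simp add: nth_append)
      then show "v \<bullet> chart p b x = v \<bullet> (chart p b x + (\<Sum>j\<in>?J. y j *\<^sub>R ?e ! j))"
        by (simp add: inner_add_right inner_sum_right)
    qed
    have nn: "(norm (\<Sum>j\<in>?J. y j *\<^sub>R ?e ! j))\<^sup>2 = (\<Sum>j\<in>?J. (y j)\<^sup>2)" for y :: "nat \<Rightarrow> real"
    proof -
      have "(norm (\<Sum>j\<in>?J. y j *\<^sub>R ?e ! j))\<^sup>2 = (\<Sum>i\<in>?J. \<Sum>j\<in>?J. y i * (y j * (?e ! i \<bullet> ?e ! j)))"
        unfolding power2_norm_eq_inner inner_sum_left unfolding inner_sum_right
        by (intro sum.cong refl) (simp add: mult.left_commute)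
      also have "\<dots> = (\<Sum>i\<in>?J. \<Sum>j\<in>?J. if j = i then y i * y i else 0)"
        by (intro sum.cong) (auto simp: ee)
      finally show ?thesis by (simp add: power2_eq_square)
    qed
    have "chart p b x + (\<Sum>j\<in>?J. y j *\<^sub>R ?e ! j) \<in> slab p b \<longleftrightarrow> (\<Sum>j\<in>?J. (y j)\<^sup>2) < 1" for y
      unfolding slab_def mem_Collect_eq pr nn[symmetric] by (simp add: abs_square_less_1)
    then have "?f (chart p ?e (merge ?I ?J (x, y))) = h (chart p b x) * indicat_real {y. (\<Sum>j\<in>?J. (y j)\<^sup>2) < 1} y" for y
      unfolding ch pr by (simp add: indicator_def)
    then have "(LINT y | pi_lborel ?J. ?f (chart p ?e (merge ?I ?J (x, y)))) = h (chart p b x) * (LINT y | pi_lborel ?J. indicat_real {y. (\<Sum>j\<in>?J. (y j)\<^sup>2) < 1} y)"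
      by simp
    also have "(LINT y | pi_lborel ?J. indicat_real {y. (\<Sum>j\<in>?J. (y j)\<^sup>2) < 1} y) = fibre_volume ?k"
    proof -
      have "(LINT y | pi_lborel ?J. indicat_real {y. (\<Sum>j\<in>?J. (y j)\<^sup>2) < 1} y)
        = (LINT y | pi_lborel ?J. indicat_real {y \<in> space (pi_lborel ?J). (\<Sum>j\<in>?J. (y j)\<^sup>2) < 1} y)"
        by (rule Bochner_Integration.integral_cong) (auto simp: indicator_def)
      also have "\<dots> = fibre_volume ?k"
        unfolding fibre_volume_def by (simp add: Int_absorb2)
      finally show ?thesis .
    qed
    finally show "(LINT y | pi_lborel ?J. ?f (chart p ?e (merge ?I ?J (x, y)))) = fibre_volume ?k * h (chart p b x)"
      by simp
  qed simp
  also have "\<dots> = fibre_volume ?k * (LINT x | pi_lborel ?I. h (chart p b x))" by simp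
  finally show ?thesis by simp
qed

section \<open>Thin sets\<close>

text \<open>Subsets of finitely many planes of lower dimension.  Up to such sets cells are open, closed and
  can be subdivided, and almost every fibre of a linear map avoids them.\<close>

definition thin :: "int \<Rightarrow> (real^3) set \<Rightarrow> bool" where
  "thin k E \<longleftrightarrow> (\<exists>\<A>. finite \<A> \<and> E \<subseteq> \<Union>\<A> \<and> (\<forall>H\<in>\<A>. affine H \<and> aff_dim H < k))"

lemma thin_subset: "thin k E \<Longrightarrow> D \<subseteq> E \<Longrightarrow> thin k D"
  unfolding thin_def by (meson order_trans)

lemma thin_Un: "thin k D \<Longrightarrow> thin k E \<Longrightarrow> thin k (D \<union> E)"
  unfolding thin_def
proof safe
  fix A B assume *: "finite A" "D \<subseteq> \<Union> A" "\<forall>H\<in>A. affine H \<and> aff_dim H < k"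
    "finite B" "E \<subseteq> \<Union> B" "\<forall>H\<in>B. affine H \<and> aff_dim H < k"
  then show "\<exists>\<A>. finite \<A> \<and> D \<union> E \<subseteq> \<Union> \<A> \<and> (\<forall>H\<in>\<A>. affine H \<and> aff_dim H < k)"
    by (intro exI[of _ "A \<union> B"]) (auto simp: Un_subset_iff)
qed

lemma thin_empty: "thin k {}"
  unfolding thin_def by (intro exI[of _ "{}"]) auto

lemma thin_UN: "finite I \<Longrightarrow> (\<And>i. i \<in> I \<Longrightarrow> thin k (E i)) \<Longrightarrow> thin k (\<Union>i\<in>I. E i)"
  by (induction I rule: finite_induct) (auto intro: thin_empty thin_Un)

lemma thin_affine: "affine H \<Longrightarrow> aff_dim H < k \<Longrightarrow> thin k H"
  unfolding thin_def by (intro exI[of _ "{H}"]) auto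

lemma thin_aff_dim: "aff_dim H < k \<Longrightarrow> thin k H"
  by (rule thin_subset[OF thin_affine[of "affine hull H"]]) (auto simp: hull_subset)

definition qeq :: "(real^3) list \<Rightarrow> real^3 \<Rightarrow> real^3 \<Rightarrow> bool" where
  "qeq q z x \<longleftrightarrow> (\<forall>v\<in>set q. v \<bullet> z = v \<bullet> x)"

lemma qeq_qker: "qeq q z x \<longleftrightarrow> x - z \<in> qker q"
  by (auto simp: qeq_def qker_def inner_diff_right)

text \<open>The points whose fibre meets an affine \<open>H\<close> lie in a translate of a sum of
  subspaces whose dimensions add up to less than \<open>dim (set q) + (3 - dim (set q))\<close>,
  hence in a negligible set.\<close>

lemma AE_avoid_thin:
  assumes "thin (int (dim (set q))) E"
  shows "AE x in lborel. \<forall>z\<in>E. \<not> qeq q z x"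
proof -
  obtain A where A: "finite A" "E \<subseteq> \<Union> A" "\<And>H. H \<in> A \<Longrightarrow> affine H \<and> aff_dim H < int (dim (set q))"
    using assms unfolding thin_def by blast
  have "AE x in lborel. \<forall>z\<in>H. \<not> qeq q z x" if "H \<in> A" for H
  proof (cases "H = {}")
    case False
    then obtain h where h: "h \<in> H" by blast
    have aH: "affine H" "aff_dim H < int (dim (set q))" using A(3)[OF that] by auto
    define L where "L = (\<lambda>x. - h + x) ` H"
    have sL: "subspace L"
      unfolding L_def using affine_diffs_subspace[OF aH(1) h] .
    have "aff_dim H = int (dim L)"
      unfolding L_def using aff_dim_eq_dim[of h H] hull_inc[of h H affine] h by simp
    then have "dim L + dim (qker q) < 3" using aH(2) dim_qker[of q] by linarith
    moreover have "dim {x + y |x y. x \<in> L \<and> y \<in> qker q} + dim (L \<inter> qker q) = dim L + dim (qker q)"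
      by (rule dim_sums_Int) (auto simp: sL subspace_qker)
    ultimately have "negligible {x + y |x y. x \<in> L \<and> y \<in> qker q}"
      by (intro negligible_lowdim) simp
    then have "negligible ((+) h ` {x + y |x y. x \<in> L \<and> y \<in> qker q})"
      by (rule negligible_translation)
    moreover have "{x. \<exists>z\<in>H. qeq q z x} \<subseteq> (+) h ` {x + y |x y. x \<in> L \<and> y \<in> qker q}"
    proof
      fix x assume "x \<in> {x. \<exists>z\<in>H. qeq q z x}"
      then obtain z where z: "z \<in> H" "qeq q z x" by blast
      have "x = h + ((- h + z) + (x - z))" by simp
      moreover have "- h + z \<in> L" "x - z \<in> qker q" using z by (auto simp: L_def qeq_qker)
      ultimately show "x \<in> (+) h ` {x + y |x y. x \<in> L \<and> y \<in> qker q}" by blast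
    qed
    ultimately have "negligible {x. \<exists>z\<in>H. qeq q z x}" by (rule negligible_subset)
    then have "AE x in lebesgue. x \<notin> {x. \<exists>z\<in>H. qeq q z x}"
      unfolding negligible_iff_null_sets by (rule AE_not_in)
    then show ?thesis unfolding AE_completion_iff by simp
  qed simp
  then have "AE x in lborel. \<forall>H\<in>A. \<forall>z\<in>H. \<not> qeq q z x"
    using A(1) by (simp add: AE_finite_all)
  then show ?thesis by eventually_elim (use A(2) in blast)
qed

text \<open>The fibres of the covectors \<open>b\<close> are the normal spaces of the plane, so the
  projection of \<open>x\<close> lies on the fibre through \<open>x\<close>.\<close>

lemma proj_AE_avoid:
  assumes b: "orthonormal_frame b" and E: "thin (int (length b)) E"
  shows "AE x in lborel. proj p b x \<notin> E"
proof -
  have "dim (set b) = length b" using dim_orthonormal_frame[OF b] by simp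
  then have "AE x in lborel. \<forall>z\<in>E. \<not> qeq b z x" using AE_avoid_thin[of b E] E by simp
  then show ?thesis
    by eventually_elim (auto simp: qeq_def proj_inner[OF b])
qed

section \<open>Geometry of cells\<close>

lemma plane_alt: "plane p b = {x. x - p \<in> span (set b)}"
  unfolding plane_def by (auto simp: image_iff) (metis add.commute diff_add_cancel)

lemma affine_plane [simp]: "affine (plane p b)"
  unfolding plane_def by (simp add: affine_translation[symmetric] subspace_imp_affine)

lemma closed_plane [simp]: "closed (plane p b)"
  by (rule affine_closed) simp

lemma aff_dim_plane: "orthonormal_frame b \<Longrightarrow> aff_dim (plane p b) = int (length b)"
  unfolding plane_def
  by (simp add: aff_dim_translation_eq aff_dim_subspace dim_orthonormal_frame[simplified])

lemma plane_base: "p \<in> plane p b"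
  by (simp add: plane_alt span_zero)

lemma plane_eq: "x \<in> plane p b \<Longrightarrow> plane x b = plane p b"
  unfolding plane_alt
proof (intro Collect_cong)
  fix y assume x: "x \<in> {x. x - p \<in> span (set b)}"
  show "y - x \<in> span (set b) \<longleftrightarrow> y - p \<in> span (set b)"
  proof
    assume "y - x \<in> span (set b)"
    then have "(y - x) + (x - p) \<in> span (set b)" by (rule span_add) (use x in simp)
    then show "y - p \<in> span (set b)" by simp
  next
    assume "y - p \<in> span (set b)"
    then have "(y - p) - (x - p) \<in> span (set b)" by (rule span_diff) (use x in simp)
    then show "y - x \<in> span (set b)" by simp
  qed
qed

lemma plane_eq_imp_span: "plane p b = plane p c \<Longrightarrow> span (set b) = span (set c)"
  unfolding plane_def by (metis inj_image_eq_iff inj_on_add)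

lemma cellsD:
  assumes "\<sigma> \<in> cells k"
  shows "int (length (snd \<sigma>)) = k" "orthonormal_frame (snd \<sigma>)" "fst \<sigma> \<noteq> {}" "bounded (fst \<sigma>)"
proof -
  obtain A b where s: "\<sigma> = (A, b)" by (cases \<sigma>)
  then have "int (length b) = k \<and> orthonormal_frame b \<and> A \<noteq> {} \<and> bounded A"
    using assms unfolding cells_def by blast
  then show "int (length (snd \<sigma>)) = k" "orthonormal_frame (snd \<sigma>)" "fst \<sigma> \<noteq> {}" "bounded (fst \<sigma>)"
    using s by simp_all
qed

text \<open>Trades the family of half spaces for finitely many strict inequalities and moves the
  base point into the cell, where the plane no longer depends on the point chosen.\<close>

lemma cell_presentation:
  assumes "(A, b) \<in> cells k"
  obtains p L where "finite L" "A = {x \<in> plane p b. \<forall>(a, c)\<in>L. a \<bullet> x < c}" "p \<in> A"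
    "\<And>x. x \<in> A \<Longrightarrow> plane x b = plane p b"
    "\<And>a c. (a, c) \<in> L \<Longrightarrow> \<exists>x\<in>plane p b. \<not> a \<bullet> x < c"
proof -
  obtain p0 H where H: "finite H" "\<forall>U\<in>H. open_half_space_of (plane p0 b) U" "A = plane p0 b \<inter> \<Inter>H"
    using assms unfolding cells_def by blast
  have "\<forall>U\<in>H. \<exists>ac. (\<forall>x. x \<in> U \<longleftrightarrow> x \<in> plane p0 b \<and> fst ac \<bullet> x < snd ac) \<and> (\<exists>x\<in>plane p0 b. x \<notin> U)"
  proof
    fix U assume "U \<in> H"
    with H(2) have "open_half_space_of (plane p0 b) U" by (rule bspec)
    then obtain a c where "U = {x \<in> plane p0 b. a \<bullet> x < c}" "U \<noteq> plane p0 b"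
      unfolding open_half_space_of_def by blast
    then show "\<exists>ac. (\<forall>x. x \<in> U \<longleftrightarrow> x \<in> plane p0 b \<and> fst ac \<bullet> x < snd ac) \<and> (\<exists>x\<in>plane p0 b. x \<notin> U)"
      by (intro exI[of _ "(a, c)"]) auto
  qed
  from bchoice[OF this] obtain f where
    f: "\<And>U x. U \<in> H \<Longrightarrow> x \<in> U \<longleftrightarrow> x \<in> plane p0 b \<and> fst (f U) \<bullet> x < snd (f U)"
      "\<And>U. U \<in> H \<Longrightarrow> \<exists>x\<in>plane p0 b. x \<notin> U" by blast
  obtain p where p: "p \<in> A" using cellsD(3)[OF assms] by auto
  then have "p \<in> plane p0 b" using H(3) by blast
  then have pl: "plane p b = plane p0 b" by (rule plane_eq)
  define L where "L = f ` H"
  have c1: "A = {x \<in> plane p b. \<forall>(a, c)\<in>L. a \<bullet> x < c}"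
  proof (intro Set.set_eqI)
    fix x
    have "x \<in> A \<longleftrightarrow> x \<in> plane p0 b \<and> (\<forall>U\<in>H. x \<in> U)" using H(3) by blast
    also have "\<dots> \<longleftrightarrow> x \<in> plane p0 b \<and> (\<forall>U\<in>H. fst (f U) \<bullet> x < snd (f U))" using f(1) by blast
    also have "\<dots> \<longleftrightarrow> x \<in> {x \<in> plane p b. \<forall>(a, c)\<in>L. a \<bullet> x < c}"
      unfolding L_def pl by (simp add: split_beta)
    finally show "x \<in> A \<longleftrightarrow> x \<in> {x \<in> plane p b. \<forall>(a, c)\<in>L. a \<bullet> x < c}" .
  qed
  have c2: "\<exists>x\<in>plane p b. \<not> a \<bullet> x < c" if "(a, c) \<in> L" for a c
  proof -
    obtain U where U: "U \<in> H" "f U = (a, c)"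
      using \<open>(a, c) \<in> L\<close> unfolding L_def by (metis imageE)
    obtain x where "x \<in> plane p0 b" "x \<notin> U" using f(2)[OF U(1)] by blast
    then have "\<not> fst (f U) \<bullet> x < snd (f U)" using f(1)[OF U(1), of x] by blast
    then have "\<not> a \<bullet> x < c" unfolding U(2) by simp
    with \<open>x \<in> plane p0 b\<close> show ?thesis unfolding pl by blast
  qed
  have c3: "plane x b = plane p b" if "x \<in> A" for x
    using that H(3) plane_eq[of x p0 b] pl by blast
  have "finite L" unfolding L_def using H(1) by (rule finite_imageI)
  then show thesis using c1 p c3 c2 by (rule that)
qed

lemma cellI:
  assumes "int (length b) = k" "orthonormal_frame b" "A \<noteq> {}" "bounded A" "finite L"
    "A = {x \<in> plane p b. \<forall>(a, c)\<in>L. a \<bullet> x < c}"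
  shows "(A, b) \<in> cells k"
proof -
  \<comment> \<open>An inequality that holds on the whole plane gives no proper half space and is
    dropped. For a single point this removes all of them.\<close>
  define H where "H = (\<lambda>(a, c). {x \<in> plane p b. a \<bullet> x < c}) ` L - {plane p b}"
  have "\<forall>U\<in>H. open_half_space_of (plane p b) U"
  proof
    fix U assume "U \<in> H"
    then obtain a c where "(a, c) \<in> L" "U = {x \<in> plane p b. a \<bullet> x < c}" "U \<noteq> plane p b"
      unfolding H_def by auto
    moreover have "U \<noteq> {}" using \<open>A \<noteq> {}\<close> calculation assms(6) by blast
    ultimately show "open_half_space_of (plane p b) U"
      unfolding open_half_space_of_def by blast
  qed
  moreover have "A = plane p b \<inter> \<Inter>H"
  proof
    show "A \<subseteq> plane p b \<inter> \<Inter>H" unfolding assms(6) H_def by auto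
    show "plane p b \<inter> \<Inter>H \<subseteq> A"
    proof
      fix x assume x: "x \<in> plane p b \<inter> \<Inter>H"
      have "a \<bullet> x < c" if "(a, c) \<in> L" for a c
      proof (cases "{x \<in> plane p b. a \<bullet> x < c} = plane p b")
        case True
        then show ?thesis using x by blast
      next
        case False
        then have "{x \<in> plane p b. a \<bullet> x < c} \<in> H" using that unfolding H_def by auto
        then show ?thesis using x by blast
      qed
      then show "x \<in> A" unfolding assms(6) using x by auto
    qed
  qed
  moreover have "finite H" using assms(5) by (simp add: H_def)
  ultimately show ?thesis using assms unfolding cells_def by blast
qed

lemma cell_presentation_fst:
  assumes "\<sigma> \<in> cells k"
  obtains p L where "finite L" "fst \<sigma> = {x \<in> plane p (snd \<sigma>). \<forall>(a, c)\<in>L. a \<bullet> x < c}" "p \<in> fst \<sigma>"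
    "\<And>x. x \<in> fst \<sigma> \<Longrightarrow> plane x (snd \<sigma>) = plane p (snd \<sigma>)"
proof -
  obtain A b where s: "\<sigma> = (A, b)" by (cases \<sigma>)
  with assms have "(A, b) \<in> cells k" by simp
  then obtain p L where "finite L" "A = {x \<in> plane p b. \<forall>(a, c)\<in>L. a \<bullet> x < c}" "p \<in> A"
    "\<And>x. x \<in> A \<Longrightarrow> plane x b = plane p b"
    by (rule cell_presentation) (rule that)
  note * = this
  show thesis
  proof (rule that[of L p])
    show "finite L" by (rule *(1))
    show "fst \<sigma> = {x \<in> plane p (snd \<sigma>). \<forall>(a, c)\<in>L. a \<bullet> x < c}"
      unfolding s fst_conv snd_conv by (rule *(2))
    show "p \<in> fst \<sigma>" unfolding s fst_conv by (rule *(3))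
    show "plane x (snd \<sigma>) = plane p (snd \<sigma>)" if "x \<in> fst \<sigma>" for x
      using *(4)[of x] that unfolding s fst_conv snd_conv by blast
  qed
qed

lemma cell_subset_plane:
  assumes "(A, b) \<in> cells k" "x \<in> A"
  shows "A \<subseteq> plane x b"
proof -
  obtain p L where pL: "A = {x \<in> plane p b. \<forall>(a, c)\<in>L. a \<bullet> x < c}"
    "\<And>x. x \<in> A \<Longrightarrow> plane x b = plane p b"
    by (rule cell_presentation[OF assms(1)]) (rule that)
  show ?thesis unfolding pL(2)[OF assms(2)] by (subst pL(1)) blast
qed

lemma convex_presentation: "convex {x \<in> plane p b. \<forall>(a, c)\<in>L. a \<bullet> x < c}"
proof -
  have "{x \<in> plane p b. \<forall>(a, c)\<in>L. a \<bullet> x < c} = plane p b \<inter> (\<Inter>(a, c)\<in>L. {x. a \<bullet> x < c})" by auto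
  also have "convex \<dots>"
    by (intro convex_Int convex_INT) (auto simp: affine_imp_convex convex_halfspace_lt)
  finally show ?thesis .
qed

lemma open_presentation: "finite L \<Longrightarrow> open (\<Inter>(a, c)\<in>L. {x. (a :: real^3) \<bullet> x < c})"
  by (rule open_INT) (auto simp: open_halfspace_lt)

lemma cell_convex:
  assumes "\<sigma> \<in> cells k"
  shows "convex (fst \<sigma>)"
proof -
  obtain p L where "fst \<sigma> = {x \<in> plane p (snd \<sigma>). \<forall>(a, c)\<in>L. a \<bullet> x < c}"
    by (rule cell_presentation_fst[OF assms]) (rule that)
  then show ?thesis by (simp only: convex_presentation)
qed

lemma cell_openin:
  assumes "(A, b) \<in> cells k" "x \<in> A"
  shows "openin (top_of_set (plane x b)) A"
proof -
  obtain p L where pL: "finite L" "A = {x \<in> plane p b. \<forall>(a, c)\<in>L. a \<bullet> x < c}" "p \<in> A"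
    "\<And>x. x \<in> A \<Longrightarrow> plane x b = plane p b"
    by (rule cell_presentation[OF assms(1)]) (rule that)
  have "A = plane x b \<inter> (\<Inter>(a, c)\<in>L. {x. a \<bullet> x < c})"
    unfolding pL(4)[OF assms(2)] by (subst pL(2)) auto
  then show ?thesis using open_presentation[OF pL(1)] by (metis openin_open)
qed

lemma cell_affine_hull:
  assumes "(A, b) \<in> cells k" "x \<in> A"
  shows "affine hull A = plane x b"
proof -
  obtain T where T: "open T" "A = plane x b \<inter> T"
    using cell_openin[OF assms] by (auto simp: openin_open)
  have "affine hull (plane x b \<inter> T) = affine hull (plane x b)"
    by (rule affine_hull_convex_Int_open) (use T assms(2) in \<open>auto simp: affine_imp_convex\<close>)
  then show ?thesis using T(2) by (simp add: hull_same)
qed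

lemma cell_aff_dim: "\<sigma> \<in> cells k \<Longrightarrow> aff_dim (fst \<sigma>) = k"
  using cell_affine_hull[of "fst \<sigma>" "snd \<sigma>" k] aff_dim_plane[of "snd \<sigma>"] cellsD[of \<sigma> k]
  by (metis aff_dim_affine_hull all_not_in_conv prod.collapse)

lemma cell_rel_interior: "\<sigma> \<in> cells k \<Longrightarrow> rel_interior (fst \<sigma>) = fst \<sigma>"
  using cell_affine_hull[of "fst \<sigma>" "snd \<sigma>" k] cell_openin[of "fst \<sigma>" "snd \<sigma>" k] cellsD(3)[of \<sigma> k]
  by (metis all_not_in_conv prod.collapse rel_interior_openin)

text \<open>The segment from a point satisfying the weak inequalities to a point of \<open>A\<close>
  lies in \<open>A\<close>, except possibly for its first end point.\<close>

lemma cell_closure: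
  assumes A: "A = {x \<in> plane p b. \<forall>(a, c)\<in>L. a \<bullet> x < c}" and "finite L" "A \<noteq> {}"
  shows "closure A = {x \<in> plane p b. \<forall>(a, c)\<in>L. a \<bullet> x \<le> c}"
proof
  have "{x \<in> plane p b. \<forall>(a, c)\<in>L. a \<bullet> x \<le> c} = plane p b \<inter> (\<Inter>(a, c)\<in>L. {x. a \<bullet> x \<le> c})" by auto
  also have "closed \<dots>"
    by (intro closed_Int closed_INT closed_plane) (auto simp: closed_halfspace_le)
  finally show "closure A \<subseteq> {x \<in> plane p b. \<forall>(a, c)\<in>L. a \<bullet> x \<le> c}"
    by (intro closure_minimal) (auto simp: A less_imp_le)
  show "{x \<in> plane p b. \<forall>(a, c)\<in>L. a \<bullet> x \<le> c} \<subseteq> closure A"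
  proof
    fix x assume x: "x \<in> {x \<in> plane p b. \<forall>(a, c)\<in>L. a \<bullet> x \<le> c}"
    obtain y where y: "y \<in> A" using assms by blast
    have s: "(1 - t) *\<^sub>R x + t *\<^sub>R y \<in> A" if "0 < t" "t \<le> 1" for t
    proof -
      have "(1 - t) *\<^sub>R x + t *\<^sub>R y \<in> plane p b"
        using x y that affine_imp_convex[OF affine_plane, of p b] by (auto simp: A intro!: convexD)
      moreover have "a \<bullet> ((1 - t) *\<^sub>R x + t *\<^sub>R y) < c" if "(a, c) \<in> L" for a c
      proof -
        have "a \<bullet> x \<le> c" "a \<bullet> y < c" using x y \<open>(a, c) \<in> L\<close> by (auto simp: A)
        then have "(1 - t) * (a \<bullet> x) \<le> (1 - t) * c" "t * (a \<bullet> y) < t * c"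
          using \<open>0 < t\<close> \<open>t \<le> 1\<close> by (auto intro: mult_left_mono)
        then show ?thesis by (simp add: inner_add_right algebra_simps)
      qed
      ultimately show ?thesis by (auto simp: A)
    qed
    have "(\<lambda>n. (1 - 1 / real (Suc n)) *\<^sub>R x + (1 / real (Suc n)) *\<^sub>R y) \<longlonglongrightarrow> (1 - 0) *\<^sub>R x + 0 *\<^sub>R y"
      using LIMSEQ_inverse_real_of_nat by (intro tendsto_intros) (simp_all add: inverse_eq_divide)
    then have "(\<lambda>n. (1 - 1 / real (Suc n)) *\<^sub>R x + (1 / real (Suc n)) *\<^sub>R y) \<longlonglongrightarrow> x" by simp
    moreover have "(1 - 1 / real (Suc n)) *\<^sub>R x + (1 / real (Suc n)) *\<^sub>R y \<in> A" for n
      by (rule s) auto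
    ultimately show "x \<in> closure A"
      unfolding closure_sequential
      by (intro exI[of _ "\<lambda>n. (1 - 1 / real (Suc n)) *\<^sub>R x + (1 / real (Suc n)) *\<^sub>R y"] conjI allI)
  qed
qed

text \<open>A frontier point turns one of the inequalities into an equation, and that hyperplane
  does not contain the plane of the cell because \<open>p\<close> satisfies the inequality
  strictly.\<close>

lemma cell_frontier_thin:
  assumes "\<sigma> \<in> cells k"
  shows "thin k (closure (fst \<sigma>) - fst \<sigma>)"
proof -
  obtain A b where s: "\<sigma> = (A, b)" by (cases \<sigma>)
  with assms have "(A, b) \<in> cells k" by simp
  then obtain p L where pL: "finite L" "A = {x \<in> plane p b. \<forall>(a, c)\<in>L. a \<bullet> x < c}" "p \<in> A"
    by (rule cell_presentation)
  have d: "aff_dim (plane p b) = k" using cellsD[OF assms] aff_dim_plane s by auto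
  have "closure A - A \<subseteq> (\<Union>(a, c)\<in>L. plane p b \<inter> {x. a \<bullet> x = c})"
  proof
    fix x assume x: "x \<in> closure A - A"
    then have "x \<in> plane p b" "\<forall>(a, c)\<in>L. a \<bullet> x \<le> c"
      using cell_closure[OF pL(2,1)] pL(3) by auto
    moreover obtain a c where "(a, c) \<in> L" "\<not> a \<bullet> x < c" using x calculation(1) pL(2) by auto
    ultimately show "x \<in> (\<Union>(a, c)\<in>L. plane p b \<inter> {x. a \<bullet> x = c})" by force
  qed
  moreover have "thin k (\<Union>(a, c)\<in>L. plane p b \<inter> {x. a \<bullet> x = c})"
  proof (rule thin_UN[OF pL(1)], clarify)
    fix a c assume L: "(a, c) \<in> L"
    then have "a \<bullet> p < c" using pL(2,3) by auto
    then have "\<not> plane p b \<subseteq> {x. a \<bullet> x = c}" using plane_base[of p b] by auto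
    then have "aff_dim (plane p b \<inter> {x. a \<bullet> x = c}) < k"
      using aff_dim_affine_Int_hyperplane[OF affine_plane, of p b a c] d aff_dim_geq[of "plane p b"]
        aff_dim_plane cellsD(2)[OF assms] s by (auto split: if_splits)
    then show "thin k (plane p b \<inter> {x. a \<bullet> x = c})" by (rule thin_aff_dim)
  qed
  ultimately show ?thesis using thin_subset s by simp
qed

lemma cell_borel: "\<sigma> \<in> cells k \<Longrightarrow> fst \<sigma> \<in> sets borel"
proof -
  assume a: "\<sigma> \<in> cells k"
  obtain p L where pL: "finite L" "fst \<sigma> = {x \<in> plane p (snd \<sigma>). \<forall>(a, c)\<in>L. a \<bullet> x < c}"
    by (rule cell_presentation_fst[OF a]) (rule that)
  have "fst \<sigma> = plane p (snd \<sigma>) \<inter> (\<Inter>(a, c)\<in>L. {x. a \<bullet> x < c})" unfolding pL(2) by auto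
  also have "\<dots> \<in> sets borel" using open_presentation[OF pL(1)] by (auto intro: borel_closed borel_open)
  finally show ?thesis .
qed

lemma planes_Int_thin:
  assumes "orthonormal_frame b" "orthonormal_frame c" "length b = length c" "plane p b \<noteq> plane r c"
  shows "thin (int (length b)) (plane p b \<inter> plane r c)"
proof (rule thin_affine)
  show a: "affine (plane p b \<inter> plane r c)" by (intro affine_Int) auto
  have d: "aff_dim (plane p b) = int (length b)" "aff_dim (plane r c) = int (length b)"
    using aff_dim_plane assms by auto
  show "aff_dim (plane p b \<inter> plane r c) < int (length b)"
  proof (rule ccontr)
    assume "\<not> aff_dim (plane p b \<inter> plane r c) < int (length b)"
    moreover have "aff_dim (plane p b \<inter> plane r c) \<le> int (length b)"
      using d aff_dim_subset[of "plane p b \<inter> plane r c" "plane p b"] by simp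
    ultimately have e: "aff_dim (plane p b \<inter> plane r c) = int (length b)" by simp
    then have ne: "plane p b \<inter> plane r c \<noteq> {}" by auto
    have "plane p b \<inter> plane r c = plane p b" "plane p b \<inter> plane r c = plane r c"
      by (rule affine_dim_equal; use a ne e d in auto)+
    then show False using assms(4) by simp
  qed
qed

section \<open>Refinement by hyperplane arrangements\<close>

text \<open>The sectors of a finite family of hyperplanes, including the degenerate ones inside the hyperplanes,
  partition the space; a family of cells is refined by the sectors that are open in their planes.\<close>

definition sector :: "((real^3) \<times> real) set \<Rightarrow> real^3 \<Rightarrow> (real^3) set" where
  "sector L x = {y. \<forall>(a, c)\<in>L. sgn (a \<bullet> y - c) = sgn (a \<bullet> x - c)}"

lemma sector_refl: "x \<in> sector L x"
  by (auto simp: sector_def)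

lemma sector_eq: "y \<in> sector L x \<Longrightarrow> sector L y = sector L x"
  by (fastforce simp: sector_def)

lemma sector_disjoint: "sector L x = sector L y \<or> sector L x \<inter> sector L y = {}"
  using sector_eq by blast

lemma finite_sectors:
  assumes "finite L"
  shows "finite (range (sector L))"
proof -
  have "range (sector L) \<subseteq> (\<lambda>f. {y. \<forall>(a, c)\<in>L. sgn (a \<bullet> y - c) = f (a, c)}) ` (PiE L (\<lambda>_. {-1, 0, 1}))"
  proof
    fix S assume "S \<in> range (sector L)"
    then obtain x where x: "S = sector L x" by blast
    let ?f = "restrict (\<lambda>(a, c). sgn (a \<bullet> x - c)) L"
    have "sgn r \<in> {-1, 0, 1}" for r :: real by (simp add: sgn_if)
    then have "?f \<in> PiE L (\<lambda>_. {-1, 0, 1})" by (simp add: PiE_iff split_beta)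
    moreover have "S = {y. \<forall>(a, c)\<in>L. sgn (a \<bullet> y - c) = ?f (a, c)}" unfolding x sector_def by auto
    ultimately show "S \<in> (\<lambda>f. {y. \<forall>(a, c)\<in>L. sgn (a \<bullet> y - c) = f (a, c)}) ` (PiE L (\<lambda>_. {-1, 0, 1}))"
      by blast
  qed
  then show ?thesis by (rule finite_subset) (use assms in \<open>auto intro: finite_PiE\<close>)
qed

lemma plane_equations:
  obtains L where "finite L" "plane p b = {x. \<forall>(a, c)\<in>L. a \<bullet> x = c}"
proof -
  obtain F where F: "finite F" "affine hull (plane p b) = \<Inter>F" "\<And>h. h \<in> F \<Longrightarrow> \<exists>a c. a \<noteq> 0 \<and> h = {x. a \<bullet> x = c}"
    using affine_hull_finite_intersection_hyperplanes[of "plane p b"] by metis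
  then obtain f g where fg: "\<And>h. h \<in> F \<Longrightarrow> h = {x. f h \<bullet> x = g h}" by metis
  show thesis
  proof (rule that[of "(\<lambda>h. (f h, g h)) ` F"])
    have "plane p b = \<Inter>F" using F(2) by (simp add: hull_same)
    then show "plane p b = {x. \<forall>(a, c)\<in>(\<lambda>h. (f h, g h)) ` F. a \<bullet> x = c}" using fg by fastforce
  qed (use F in auto)
qed

text \<open>The arrangement takes up the equations of the plane of each cell along with its
  inequalities. Both are preserved by equality of signs, so a sector that starts in the cell cannot
  leave it, not even in the normal direction.\<close>

lemma exists_arrangement:
  assumes "finite \<F>" "\<F> \<subseteq> cells k"
  obtains L where "finite L" "\<And>\<sigma> x. \<sigma> \<in> \<F> \<Longrightarrow> x \<in> fst \<sigma> \<Longrightarrow> sector L x \<subseteq> fst \<sigma>"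
proof -
  have "\<exists>L. finite L \<and> (\<forall>x\<in>fst \<sigma>. sector L x \<subseteq> fst \<sigma>)" if "\<sigma> \<in> \<F>" for \<sigma>
  proof -
    have "\<sigma> \<in> cells k" using that assms by blast
    then obtain p L where pL: "finite L" "fst \<sigma> = {x \<in> plane p (snd \<sigma>). \<forall>(a, c)\<in>L. a \<bullet> x < c}"
      by (rule cell_presentation_fst)
    obtain M where M: "finite M" "plane p (snd \<sigma>) = {x. \<forall>(a, c)\<in>M. a \<bullet> x = c}"
      by (rule plane_equations)
    have "sector (L \<union> M) x \<subseteq> fst \<sigma>" if "x \<in> fst \<sigma>" for x
    proof
      fix y assume y: "y \<in> sector (L \<union> M) x"
      have "a \<bullet> y < c" if "(a, c) \<in> L" for a c
      proof -
        have "a \<bullet> x < c" using \<open>x \<in> fst \<sigma>\<close> that pL(2) by auto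
        moreover have "sgn (a \<bullet> y - c) = sgn (a \<bullet> x - c)" using y that by (auto simp: sector_def)
        ultimately show ?thesis by (auto simp: sgn_if split: if_splits)
      qed
      moreover have "a \<bullet> y = c" if "(a, c) \<in> M" for a c
      proof -
        have "a \<bullet> x = c" using \<open>x \<in> fst \<sigma>\<close> that pL(2) M(2) by auto
        moreover have "sgn (a \<bullet> y - c) = sgn (a \<bullet> x - c)" using y that by (auto simp: sector_def)
        ultimately show ?thesis by (auto simp: sgn_if split: if_splits)
      qed
      ultimately show "y \<in> fst \<sigma>" unfolding pL(2) M(2) by auto
    qed
    then show ?thesis using pL(1) M(1) by (intro exI[of _ "L \<union> M"]) auto
  qed
  then obtain f where f: "\<And>\<sigma>. \<sigma> \<in> \<F> \<Longrightarrow> finite (f \<sigma>) \<and> (\<forall>x\<in>fst \<sigma>. sector (f \<sigma>) x \<subseteq> fst \<sigma>)" by metis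
  show thesis
  proof (rule that[of "\<Union>(f ` \<F>)"])
    fix \<sigma> x assume s: "\<sigma> \<in> \<F>" "x \<in> fst \<sigma>"
    have "sector (\<Union>(f ` \<F>)) x \<subseteq> sector (f \<sigma>) x" using s by (auto simp: sector_def)
    then show "sector (\<Union>(f ` \<F>)) x \<subseteq> fst \<sigma>" using f[OF s(1)] s(2) by blast
  qed (use f assms in auto)
qed

text \<open>A sector of full dimension spans the plane of the cell. Hence every equation among its
  sign conditions already holds on the plane, and only strict conditions remain.\<close>

lemma sector_cell:
  assumes s: "(A, b) \<in> cells k" and L: "finite L" and x: "x \<in> A" and sub: "sector L x \<subseteq> A"
    and d: "aff_dim (sector L x) = k"
  shows "(sector L x, b) \<in> cells k"
proof -
  obtain p M where pM: "finite M" "A = {x \<in> plane p b. \<forall>(a, c)\<in>M. a \<bullet> x < c}"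
    by (rule cell_presentation[OF s]) (rule that)
  have hull: "affine hull (sector L x) = plane p b"
  proof (rule affine_dim_equal)
    show "affine hull (sector L x) \<subseteq> plane p b"
      by (rule hull_minimal) (use sub pM(2) in auto)
    show "affine hull (sector L x) \<noteq> {}" using sector_refl[of x L] by (metis affine_hull_eq_empty empty_iff)
    show "aff_dim (affine hull (sector L x)) = aff_dim (plane p b)"
      using d cellsD[OF s] aff_dim_plane by auto
  qed auto
  \<comment> \<open>The conditions that are strict at \<open>x\<close>, with those of positive sign
    negated to bring them into the form \<open>a \<bullet> y < c\<close>.\<close>
  define N where "N = {(a, c) \<in> L. a \<bullet> x < c} \<union> (\<lambda>(a, c). (- a, - c)) ` {(a, c) \<in> L. a \<bullet> x > c}"
  have fN: "finite N" unfolding N_def using L by (intro finite_UnI finite_imageI finite_subset[OF _ L]) auto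
  show ?thesis
  proof (rule cellI)
    show "sector L x = {y \<in> plane p b. \<forall>(a, c)\<in>M \<union> N. a \<bullet> y < c}"
    proof (intro Set.set_eqI iffI)
      fix y assume y: "y \<in> sector L x"
      have sg: "\<And>a c. (a, c) \<in> L \<Longrightarrow> sgn (a \<bullet> y - c) = sgn (a \<bullet> x - c)" using y by (auto simp: sector_def)
      have "a \<bullet> y < c" if "(a, c) \<in> N" for a c
        using that unfolding N_def
      proof
        assume "(a, c) \<in> {(a, c) \<in> L. a \<bullet> x < c}"
        then show ?thesis using sg[of a c] by (auto simp: sgn_if split: if_splits)
      next
        assume "(a, c) \<in> (\<lambda>(a, c). (- a, - c)) ` {(a, c) \<in> L. a \<bullet> x > c}"
        then obtain a' c' where "a = - a'" "c = - c'" "(a', c') \<in> L" "a' \<bullet> x > c'" by auto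
        then show ?thesis using sg[of a' c'] by (auto simp: sgn_if split: if_splits)
      qed
      then show "y \<in> {y \<in> plane p b. \<forall>(a, c)\<in>M \<union> N. a \<bullet> y < c}" using sub y pM(2) by blast
    next
      fix y assume y: "y \<in> {y \<in> plane p b. \<forall>(a, c)\<in>M \<union> N. a \<bullet> y < c}"
      have "sgn (a \<bullet> y - c) = sgn (a \<bullet> x - c)" if ac: "(a, c) \<in> L" for a c
      proof (cases "a \<bullet> x < c \<or> a \<bullet> x > c")
        case True
        then consider "a \<bullet> x < c" | "a \<bullet> x > c" by blast
        then show ?thesis
        proof cases
          case 1
          then have "(a, c) \<in> N" using ac by (auto simp: N_def)
          then have "a \<bullet> y < c" using y by blast
          then show ?thesis using 1 by (auto simp: sgn_if)
        next
          case 2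
          then have "(- a, - c) \<in> N" using ac by (force simp: N_def)
          then have "(- a) \<bullet> y < - c" using y by blast
          then show ?thesis using 2 by (auto simp: sgn_if)
        qed
      next
        case False
        \<comment> \<open>A condition with sign 0 passes from the sector to its affine hull, which
          contains \<open>y\<close>.\<close>
        then have "sector L x \<subseteq> {z. a \<bullet> z = c}"
          using ac by (auto simp: sector_def sgn_if split: if_splits)
        then have "affine hull (sector L x) \<subseteq> {z. a \<bullet> z = c}"
          by (rule hull_minimal) (rule affine_hyperplane)
        then have "a \<bullet> y = c" using y hull by blast
        then show ?thesis using False by auto
      qed
      then show "y \<in> sector L x" by (auto simp: sector_def)
    qed
    show "bounded (sector L x)" using sub cellsD[OF s] by (auto intro: bounded_subset)
  qed (use cellsD[OF s] sector_refl[of x L] fN pM(1) in auto)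
qed

lemma exists_refinement:
  assumes "finite \<F>" "\<F> \<subseteq> cells k"
  obtains \<S> where "finite \<S>" "disjoint \<S>"
    "\<And>S. S \<in> \<S> \<Longrightarrow> \<exists>\<sigma>\<in>\<F>. S \<subseteq> fst \<sigma>"
    "\<And>S \<sigma>. S \<in> \<S> \<Longrightarrow> \<sigma> \<in> \<F> \<Longrightarrow> S \<subseteq> fst \<sigma> \<or> S \<inter> fst \<sigma> = {}"
    "\<And>S \<sigma>. S \<in> \<S> \<Longrightarrow> \<sigma> \<in> \<F> \<Longrightarrow> S \<subseteq> fst \<sigma> \<Longrightarrow> (S, snd \<sigma>) \<in> cells k"
    "\<And>\<sigma>. \<sigma> \<in> \<F> \<Longrightarrow> thin k (fst \<sigma> - \<Union>{S \<in> \<S>. S \<subseteq> fst \<sigma>})"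
proof -
  obtain L where L: "finite L" "\<And>\<sigma> x. \<sigma> \<in> \<F> \<Longrightarrow> x \<in> fst \<sigma> \<Longrightarrow> sector L x \<subseteq> fst \<sigma>"
    using exists_arrangement[OF assms] by metis
  \<comment> \<open>Sectors of lower dimension are discarded; they make up the thin remainder of
    each cell.\<close>
  define \<S> where "\<S> = {sector L x |x \<sigma>. \<sigma> \<in> \<F> \<and> x \<in> fst \<sigma> \<and> aff_dim (sector L x) = k}"
  have sub: "\<S> \<subseteq> range (sector L)" by (auto simp: \<S>_def)
  show thesis
  proof (rule that[of \<S>])
    show "finite \<S>" using sub finite_sectors[OF L(1)] by (rule finite_subset)
    show "disjoint \<S>"
      unfolding disjoint_def
    proof (intro ballI impI)
      fix S T assume "S \<in> \<S>" "T \<in> \<S>" "S \<noteq> T"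
      then obtain x y where "S = sector L x" "T = sector L y" using sub by blast
      then show "S \<inter> T = {}" using sector_disjoint[of L x y] \<open>S \<noteq> T\<close> by blast
    qed
    fix S assume "S \<in> \<S>"
    then obtain x \<sigma>0 where x: "S = sector L x" "\<sigma>0 \<in> \<F>" "x \<in> fst \<sigma>0" "aff_dim S = k"
      by (auto simp: \<S>_def)
    then show "\<exists>\<sigma>\<in>\<F>. S \<subseteq> fst \<sigma>" using L(2) by blast
    fix \<sigma> assume s: "\<sigma> \<in> \<F>"
    show "S \<subseteq> fst \<sigma> \<or> S \<inter> fst \<sigma> = {}"
    proof (rule disjCI)
      assume "S \<inter> fst \<sigma> \<noteq> {}"
      then obtain y where "y \<in> S" "y \<in> fst \<sigma>" by blast
      then show "S \<subseteq> fst \<sigma>" using sector_eq[of y L x] L(2)[OF s, of y] x(1) by simp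
    qed
    show "(S, snd \<sigma>) \<in> cells k" if "S \<subseteq> fst \<sigma>"
      using sector_cell[of "fst \<sigma>" "snd \<sigma>" k L x] that s assms(2) L(1) x sector_refl[of x L] by auto
  next
    fix \<sigma> assume s: "\<sigma> \<in> \<F>"
    have "fst \<sigma> - \<Union>{S \<in> \<S>. S \<subseteq> fst \<sigma>} \<subseteq> (\<Union>S\<in>{S \<in> range (sector L). aff_dim S < k}. S)"
    proof
      fix x assume x: "x \<in> fst \<sigma> - \<Union>{S \<in> \<S>. S \<subseteq> fst \<sigma>}"
      then have sx: "sector L x \<subseteq> fst \<sigma>" using L(2)[OF s] by blast
      have "aff_dim (sector L x) \<le> k"
        using aff_dim_subset[OF sx] cell_aff_dim[of \<sigma> k] s assms(2) by auto
      moreover have "aff_dim (sector L x) \<noteq> k"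
        using x sx s sector_refl[of x L] unfolding \<S>_def by blast
      ultimately show "x \<in> (\<Union>S\<in>{S \<in> range (sector L). aff_dim S < k}. S)"
        by (intro UN_I[of "sector L x"]) (auto simp: sector_refl)
    qed
    moreover have "thin k (\<Union>S\<in>{S \<in> range (sector L). aff_dim S < k}. S)"
      by (rule thin_UN) (use finite_sectors[OF L(1)] in \<open>auto intro: thin_aff_dim\<close>)
    ultimately show "thin k (fst \<sigma> - \<Union>{S \<in> \<S>. S \<subseteq> fst \<sigma>})" by (rule thin_subset[rotated])
  qed
qed

section \<open>Integrals of forms over cells\<close>

lemma qker_span: "qker q = {y. \<forall>x\<in>span (set q). x \<bullet> y = 0}"
proof -
  have "set q \<subseteq> {x. x \<bullet> y = 0} \<Longrightarrow> span (set q) \<subseteq> {x. x \<bullet> y = 0}" for y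
    by (rule span_minimal) (auto simp: subspace_hyperplane2)
  then show ?thesis by (auto simp: qker_def span_base)
qed

lemma proj_cong:
  assumes "orthonormal_frame b" "orthonormal_frame c" "plane p b = plane r c"
  shows "proj p b = proj r c"
proof
  fix x
  have "r \<in> plane p b" using plane_base[of r c] assms(3) by simp
  then have "plane r b = plane r c" using plane_eq[of r p b] assms(3) by simp
  then have "span (set b) = span (set c)" by (rule plane_eq_imp_span)
  then have k: "qker b = qker c" unfolding qker_span by simp
  have "x - proj r c x \<in> qker c"
    by (simp add: qker_def inner_diff_right proj_inner[OF assms(2)])
  then have "v \<bullet> proj r c x = v \<bullet> x" if "v \<in> set b" for v
    unfolding k[symmetric] using that by (simp add: qker_def inner_diff_right)
  moreover have "proj r c x \<in> plane p b" unfolding assms(3) by (rule proj_in_plane)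
  ultimately show "proj p b x = proj r c x" by (intro proj_unique[OF assms(1)]) auto
qed

lemma slab_cong:
  "orthonormal_frame b \<Longrightarrow> orthonormal_frame c \<Longrightarrow> plane p b = plane r c \<Longrightarrow> slab p b = slab r c"
  unfolding slab_def using proj_cong[of b c p r] by simp

lemma smooth_continuous: "smooth f \<Longrightarrow> continuous_on UNIV f"
  unfolding smooth_def by (metis differentiable_times.simps(1))

lemma cell_integrand:
  assumes s: "(A, b) \<in> cells k" and g: "continuous_on UNIV g"
  obtains C R where "(\<lambda>z. indicat_real A z * g z) \<in> borel_measurable borel"
    "\<And>z. \<bar>indicat_real A z * g z\<bar> \<le> C" "\<And>z. norm z > R \<Longrightarrow> indicat_real A z * g z = 0"
proof -
  have A: "A \<in> sets borel" "bounded A" using cell_borel[OF s] cellsD[OF s] by auto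
  obtain R where R: "\<And>z. z \<in> A \<Longrightarrow> norm z \<le> R" using A(2) unfolding bounded_iff by blast
  have "compact (g ` closure A)"
    using A(2) continuous_on_subset[OF g] by (intro compact_continuous_image) auto
  then have "bounded (g ` closure A)" by (rule compact_imp_bounded)
  then obtain C where C: "\<And>y. y \<in> g ` closure A \<Longrightarrow> norm y \<le> C"
    unfolding bounded_iff by blast
  show thesis
  proof (rule that[of "max C 0" R])
    show "(\<lambda>z. indicat_real A z * g z) \<in> borel_measurable borel"
      using A(1) borel_measurable_continuous_onI[OF g] by measurable
    show "\<bar>indicat_real A z * g z\<bar> \<le> max C 0" for z
      using C[of "g z"] closure_subset[of A] by (auto simp: indicator_def)
    show "norm z > R \<Longrightarrow> indicat_real A z * g z = 0" for z
      using R[of z] by (auto simp: indicator_def)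
  qed
qed

lemma cell_slab_integrable:
  assumes s: "(A, b) \<in> cells k" and g: "continuous_on UNIV g"
  shows "integrable lborel (\<lambda>x. indicat_real (slab p b) x * (indicat_real A (proj p b x) * g (proj p b x)))"
proof -
  obtain C R where "(\<lambda>z. indicat_real A z * g z) \<in> borel_measurable borel"
    "\<And>z. \<bar>indicat_real A z * g z\<bar> \<le> C" "\<And>z. norm z > R \<Longrightarrow> indicat_real A z * g z = 0"
    by (rule cell_integrand[OF s g]) (rule that)
  then show ?thesis by (rule slab_integrable)
qed

text \<open>The slab and the projection depend only on the plane, so the arbitrary base point inside
  \<open>cell_integral\<close> can be replaced by any point of the cell.\<close>

lemma cell_integral_slab:
  assumes s: "(A, b) \<in> cells k" and g: "continuous_on UNIV (\<lambda>x. \<omega> x b)" and p: "p \<in> A"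
  shows "fibre_volume (length b) * cell_integral \<omega> (A, b) =
    (LINT x | lborel. indicat_real (slab p b) x * (indicat_real A (proj p b x) * \<omega> (proj p b x) b))"
proof -
  let ?r = "SOME p. p \<in> A"
  have b: "orthonormal_frame b" using cellsD[OF s] by simp
  have r: "?r \<in> A" using p by (rule someI)
  have pl: "plane p b = plane ?r b"
    using cell_affine_hull[OF s p] cell_affine_hull[OF s r] by simp
  obtain C R where "(\<lambda>z. indicat_real A z * \<omega> z b) \<in> borel_measurable borel"
    "\<And>z. \<bar>indicat_real A z * \<omega> z b\<bar> \<le> C" "\<And>z. norm z > R \<Longrightarrow> indicat_real A z * \<omega> z b = 0"
    by (rule cell_integrand[OF s g]) (rule that)
  from chart_integral_slab[OF b this, where p = ?r]
  show ?thesis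
    unfolding cell_integral_def proj_cong[OF b b pl] slab_cong[OF b b pl] by (simp add: Let_def)
qed

text \<open>On frames of one plane a form scales by their relative determinant, while slab and
  projection stay the same.\<close>

lemma cell_integral_frame:
  assumes s: "(A, b) \<in> cells k" "(A, c) \<in> cells k" and w: "smooth_form (nat k) \<omega>"
  shows "cell_integral \<omega> (A, c) = frame_det c b * cell_integral \<omega> (A, b)"
proof -
  have b: "orthonormal_frame b" "orthonormal_frame c" "length c = length b" "length b = nat k"
    using cellsD[OF s(1)] cellsD[OF s(2)] by auto
  obtain p where p: "p \<in> A" using cellsD(3)[OF s(1)] by auto
  have pl: "plane p b = plane p c"
    using cell_affine_hull[OF s(1) p] cell_affine_hull[OF s(2) p] by simp
  have sp: "span (set b) = span (set c)" using plane_eq_imp_span[OF pl] .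
  have g: "continuous_on UNIV (\<lambda>x. \<omega> x b)" "continuous_on UNIV (\<lambda>x. \<omega> x c)"
    using w b unfolding smooth_form_def by (auto intro: smooth_continuous)
  have f: "\<omega> x c = frame_det c b * \<omega> x b" for x
  proof (rule alternating_frame_det)
    show "alternating_multilinear (length b) (\<omega> x)" using w b unfolding smooth_form_def by auto
    show "set c \<subseteq> span (set b)" unfolding sp by (rule span_superset)
  qed (use b in auto)
  have "fibre_volume (length c) * cell_integral \<omega> (A, c) =
    (LINT x | lborel. indicat_real (slab p c) x * (indicat_real A (proj p c x) * \<omega> (proj p c x) c))"
    by (rule cell_integral_slab[where \<omega> = \<omega>, OF s(2) g(2) p])
  also have "\<dots> = (LINT x | lborel. frame_det c b * (indicat_real (slab p b) x * (indicat_real A (proj p b x) * \<omega> (proj p b x) b)))"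
    unfolding proj_cong[OF b(1,2) pl] slab_cong[OF b(1,2) pl] f by (simp add: mult_ac)
  also have "\<dots> = frame_det c b * (fibre_volume (length b) * cell_integral \<omega> (A, b))"
    unfolding cell_integral_slab[where \<omega> = \<omega>, OF s(1) g(1) p] by (rule integral_mult_right_zero)
  finally show ?thesis using fibre_volume_pos[of "length b"] b(3) by simp
qed

text \<open>The projection of almost every \<open>x\<close> misses the thin remainder, and off it
  the indicator of \<open>A\<close> is the sum of those of the pieces.\<close>

lemma cell_integral_partition:
  assumes s: "(A, b) \<in> cells k" and w: "smooth_form (nat k) \<omega>"
    and S: "finite \<S>" "disjoint \<S>" "\<And>S. S \<in> \<S> \<Longrightarrow> S \<subseteq> A \<and> (S, b) \<in> cells k" "thin k (A - \<Union>\<S>)"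
  shows "cell_integral \<omega> (A, b) = (\<Sum>S\<in>\<S>. cell_integral \<omega> (S, b))"
proof -
  have b: "orthonormal_frame b" "length b = nat k" "int (length b) = k" using cellsD[OF s] by auto
  have g: "continuous_on UNIV (\<lambda>x. \<omega> x b)"
    using w b unfolding smooth_form_def by (auto intro: smooth_continuous)
  obtain p where p: "p \<in> A" using cellsD(3)[OF s] by auto
  let ?f = "\<lambda>S x. indicat_real (slab p b) x * (indicat_real S (proj p b x) * \<omega> (proj p b x) b)"
  have 1: "fibre_volume (length b) * cell_integral \<omega> (S, b) = (LINT x | lborel. ?f S x)" if "S \<in> \<S>" for S
  proof -
    have SA: "S \<subseteq> A" "(S, b) \<in> cells k" using S(3)[OF that] by auto
    then obtain r where r: "r \<in> S" using cellsD(3) by fastforce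
    then have "r \<in> A" using SA by blast
    have pl: "plane p b = plane r b"
      using cell_affine_hull[OF s p] cell_affine_hull[OF s \<open>r \<in> A\<close>] by simp
    show ?thesis
      unfolding proj_cong[OF b(1) b(1) pl] slab_cong[OF b(1) b(1) pl]
      by (rule cell_integral_slab[where \<omega> = \<omega>, OF SA(2) g r])
  qed
  have ind: "indicat_real A z = (\<Sum>S\<in>\<S>. indicat_real S z)" if nz: "z \<notin> A - \<Union>\<S>" for z
  proof (cases "z \<in> A")
    case True
    then obtain S where S': "S \<in> \<S>" "z \<in> S" using nz by blast
    have "indicat_real T z = (if T = S then 1 else 0)" if "T \<in> \<S>" for T
      using S' that S(2) unfolding disjoint_def by (auto simp: indicator_def)
    then have "(\<Sum>T\<in>\<S>. indicat_real T z) = (\<Sum>T\<in>\<S>. if T = S then 1 else 0)" by (intro sum.cong) auto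
    then show ?thesis using True S' S(1) by simp
  next
    case False
    then have "(\<Sum>T\<in>\<S>. indicat_real T z) = 0" using S(3) by (intro sum.neutral) (auto simp: indicator_def)
    then show ?thesis using False by simp
  qed
  have "AE x in lborel. proj p b x \<notin> A - \<Union>\<S>"
    by (rule proj_AE_avoid[OF b(1)]) (use S(4) b(3) in simp)
  then have ae: "AE x in lborel. ?f A x = (\<Sum>S\<in>\<S>. ?f S x)"
    by eventually_elim (simp add: ind sum_distrib_left sum_distrib_right)
  have int: "integrable lborel (?f S)" if "S \<in> \<S>" for S
    using cell_slab_integrable[of S b k, OF _ g] S(3)[OF that] by blast
  have "fibre_volume (length b) * cell_integral \<omega> (A, b) = (LINT x | lborel. ?f A x)"
    by (rule cell_integral_slab[where \<omega> = \<omega>, OF s g p])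
  also have "\<dots> = (LINT x | lborel. (\<Sum>S\<in>\<S>. ?f S x))"
    by (rule integral_cong_AE)
      (use ae cell_slab_integrable[OF s g, of p] int in \<open>auto intro!: borel_measurable_sum borel_measurable_integrable\<close>)
  also have "\<dots> = (\<Sum>S\<in>\<S>. LINT x | lborel. ?f S x)"
    by (rule Bochner_Integration.integral_sum) (rule int)
  also have "\<dots> = (\<Sum>S\<in>\<S>. fibre_volume (length b) * cell_integral \<omega> (S, b))" using 1 by simp
  finally have "fibre_volume (length b) * cell_integral \<omega> (A, b) = fibre_volume (length b) * (\<Sum>S\<in>\<S>. cell_integral \<omega> (S, b))"
    by (simp add: sum_distrib_left)
  then show ?thesis using fibre_volume_pos[of "length b"] by simp
qed

lemma chain_integral_frag_sum: "chain_integral \<omega> c = frag_sum (cell_integral \<omega>) c"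
  by (simp add: chain_integral_def frag_sum_def imul_real)

section \<open>Null chains\<close>

lemma null_chains_iff:
  "c \<in> null_chains k \<longleftrightarrow> Poly_Mapping.keys c \<subseteq> cells k \<and>
     (\<forall>\<omega>. smooth_form (nat k) \<omega> \<longrightarrow> frag_sum (cell_integral \<omega>) c = 0)"
  by (auto simp: null_chains_def chain_integral_frag_sum carrier_free_Abelian_group_iff)

lemma null_chains_0: "0 \<in> null_chains k"
  by (simp add: null_chains_iff)

lemma null_chains_add: "c \<in> null_chains k \<Longrightarrow> d \<in> null_chains k \<Longrightarrow> c + d \<in> null_chains k"
  using keys_add[of c d] by (auto simp: null_chains_iff frag_sum_add)

lemma null_chains_minus: "c \<in> null_chains k \<Longrightarrow> - c \<in> null_chains k"
  by (auto simp: null_chains_iff frag_sum_minus)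

lemma null_chains_cmul: "c \<in> null_chains k \<Longrightarrow> frag_cmul n c \<in> null_chains k"
  using keys_cmul[of n c] by (auto simp: null_chains_iff frag_sum_cmul)

lemma null_chains_sum: "(\<And>i. i \<in> I \<Longrightarrow> f i \<in> null_chains k) \<Longrightarrow> (\<Sum>i\<in>I. f i) \<in> null_chains k"
  by (induction I rule: infinite_finite_induct) (auto intro: null_chains_0 null_chains_add)

text \<open>Signs are integers because only integers act on an arbitrary coefficient group. For two
  frames of the same space the sign equals the determinant; for a list of covectors it can also be
  0.\<close>

definition frame_sign :: "(real^3) list \<Rightarrow> (real^3) list \<Rightarrow> int" where
  "frame_sign u b = (if frame_det u b > 0 then 1 else if frame_det u b < 0 then - 1 else 0)"

lemma frame_sign_pm1:
  assumes "orthonormal_frame b" "orthonormal_frame c" "span (set b) = span (set c)"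
  shows "frame_sign b c = 1 \<or> frame_sign b c = - 1" "of_int (frame_sign b c) = frame_det b c"
  using frame_det_pm1[OF assms] by (auto simp: frame_sign_def)

lemma cells_same_span:
  assumes "(A, b) \<in> cells k" "(A, c) \<in> cells k"
  shows "span (set b) = span (set c)"
proof -
  obtain p where p: "p \<in> A" using cellsD(3)[OF assms(1)] by auto
  have "plane p b = plane p c"
    using cell_affine_hull[OF assms(1) p] cell_affine_hull[OF assms(2) p] by simp
  then show ?thesis by (rule plane_eq_imp_span)
qed

lemma keys_diff_subset: "Poly_Mapping.keys c \<subseteq> S \<Longrightarrow> Poly_Mapping.keys d \<subseteq> S \<Longrightarrow> Poly_Mapping.keys (c - d) \<subseteq> S"
  using keys_diff[of c d] by blast

lemma keys_sum_subset: "(\<And>i. i \<in> I \<Longrightarrow> Poly_Mapping.keys (f i) \<subseteq> S) \<Longrightarrow> Poly_Mapping.keys (\<Sum>i\<in>I. f i) \<subseteq> S"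
proof (induction I rule: infinite_finite_induct)
  case (insert i I)
  then show ?case using keys_add[of "f i" "\<Sum>i\<in>I. f i"] by fastforce
qed auto

lemma keys_cmul_subset: "Poly_Mapping.keys c \<subseteq> S \<Longrightarrow> Poly_Mapping.keys (frag_cmul n c) \<subseteq> S"
  using keys_cmul[of n c] by blast

lemma null_frame:
  assumes "(A, b) \<in> cells k" "(A, c) \<in> cells k"
  shows "frag_of (A, c) - frag_cmul (frame_sign c b) (frag_of (A, b)) \<in> null_chains k"
  unfolding null_chains_iff
proof (intro conjI allI impI)
  show "Poly_Mapping.keys (frag_of (A, c) - frag_cmul (frame_sign c b) (frag_of (A, b))) \<subseteq> cells k"
    by (intro keys_diff_subset keys_cmul_subset) (use assms in auto)
  fix \<omega> :: "real^3 \<Rightarrow> (real^3) list \<Rightarrow> real" assume w: "smooth_form (nat k) \<omega>"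
  have "of_int (frame_sign c b) = frame_det c b"
    by (rule frame_sign_pm1(2)) (use cellsD[OF assms(1)] cellsD[OF assms(2)] cells_same_span[OF assms] in auto)
  then show "frag_sum (cell_integral \<omega>) (frag_of (A, c) - frag_cmul (frame_sign c b) (frag_of (A, b))) = 0"
    using cell_integral_frame[OF assms w] by (simp add: frag_sum_diff frag_sum_cmul imul_real)
qed

lemma null_partition:
  assumes s: "(A, b) \<in> cells k"
    and S: "finite \<S>" "disjoint \<S>" "\<And>S. S \<in> \<S> \<Longrightarrow> S \<subseteq> A \<and> (S, b) \<in> cells k" "thin k (A - \<Union>\<S>)"
  shows "frag_of (A, b) - (\<Sum>S\<in>\<S>. frag_of (S, b)) \<in> null_chains k"
  unfolding null_chains_iff
proof (intro conjI allI impI)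
  show "Poly_Mapping.keys (frag_of (A, b) - (\<Sum>S\<in>\<S>. frag_of (S, b))) \<subseteq> cells k"
    by (intro keys_diff_subset keys_sum_subset) (use s S(3) in auto)
  fix \<omega> :: "real^3 \<Rightarrow> (real^3) list \<Rightarrow> real" assume w: "smooth_form (nat k) \<omega>"
  show "frag_sum (cell_integral \<omega>) (frag_of (A, b) - (\<Sum>S\<in>\<S>. frag_of (S, b))) = 0"
    using cell_integral_partition[OF s w S] by (simp add: frag_sum_diff frag_sum_sum)
qed

section \<open>Polynomial test forms\<close>

text \<open>Polynomials are closed under directional derivatives; this feeds the induction that
  proves them smooth.\<close>

lemma real_polynomial_function_derivative:
  fixes f :: "real^3 \<Rightarrow> real"
  assumes "real_polynomial_function f"
  shows "\<exists>f'. (\<forall>x. (f has_derivative f' x) (at x)) \<and> (\<forall>v. real_polynomial_function (\<lambda>x. f' x v))"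
  using assms
proof induction
  case (linear f)
  then show ?case by (intro exI[of _ "\<lambda>x. f"]) (auto intro: bounded_linear_imp_has_derivative)
next
  case (const c)
  then show ?case by (intro exI[of _ "\<lambda>x v. 0"]) auto
next
  case (add f g)
  then obtain f' g' where "\<forall>x. (f has_derivative f' x) (at x)" "\<forall>v. real_polynomial_function (\<lambda>x. f' x v)"
    "\<forall>x. (g has_derivative g' x) (at x)" "\<forall>v. real_polynomial_function (\<lambda>x. g' x v)" by blast
  then show ?case by (intro exI[of _ "\<lambda>x v. f' x v + g' x v"]) (auto intro: has_derivative_add)
next
  case (mult f g)
  then obtain f' g' where "\<forall>x. (f has_derivative f' x) (at x)" "\<forall>v. real_polynomial_function (\<lambda>x. f' x v)"
    "\<forall>x. (g has_derivative g' x) (at x)" "\<forall>v. real_polynomial_function (\<lambda>x. g' x v)" by blast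
  with mult.hyps show ?case
    by (intro exI[of _ "\<lambda>x v. f x * g' x v + f' x v * g x"] conjI allI has_derivative_mult
        real_polynomial_function.intros(3,4)) auto
qed

lemma real_polynomial_function_smooth:
  fixes f :: "real^3 \<Rightarrow> real"
  assumes "real_polynomial_function f"
  shows "smooth f"
proof -
  have "differentiable_times n f" for n
    using assms
  proof (induction n arbitrary: f)
    case 0
    obtain f' where "\<forall>x. (f has_derivative f' x) (at x)"
      using real_polynomial_function_derivative[OF 0] by blast
    then show ?case
      by (simp add: continuous_on_eq_continuous_at) (meson has_derivative_continuous)
  next
    case (Suc n)
    obtain f' where f: "\<And>x. (f has_derivative f' x) (at x)" "\<And>v. real_polynomial_function (\<lambda>x. f' x v)"
      using real_polynomial_function_derivative[OF Suc.prems] by blast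
    have "frechet_derivative f (at x) = f' x" for x
      using frechet_derivative_at[OF f(1)] by simp
    moreover have "f differentiable at x" for x using f(1) unfolding differentiable_def by blast
    ultimately show ?case using Suc.IH[OF f(2)] by simp
  qed
  then show ?thesis by (simp add: smooth_def)
qed

text \<open>On the ball of radius \<open>R\<close> about \<open>z\<close> the powers lie between 0 and 1 and concentrate at \<open>z\<close>.
  Since cells are bounded, these polynomials replace test functions with compact support.\<close>

definition bump :: "real^3 \<Rightarrow> real \<Rightarrow> nat \<Rightarrow> real^3 \<Rightarrow> real" where
  "bump z R N x = (1 - (norm (x - z))\<^sup>2 / R\<^sup>2) ^ N"

lemma real_polynomial_function_bump: "real_polynomial_function (bump z R N)"
proof -
  have l: "real_polynomial_function (\<lambda>x. x \<bullet> b - z \<bullet> b)" for b :: "real^3"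
    by (intro real_polynomial_function_diff real_polynomial_function.intros(2) real_polynomial_function.intros(1)
        bounded_linear_inner_left)
  have e: "(norm (x - z))\<^sup>2 = (\<Sum>b\<in>Basis. (x \<bullet> b - z \<bullet> b) * (x \<bullet> b - z \<bullet> b))" for x
    unfolding power2_norm_eq_inner by (subst euclidean_inner) (simp add: inner_diff_left)
  show ?thesis
    unfolding bump_def[abs_def] e
    by (intro real_polynomial_function_power real_polynomial_function_diff real_polynomial_function.intros(2)
        real_polynomial_function_divide real_polynomial_function_sum real_polynomial_function.intros(4) l) simp_all
qed

lemma smooth_form_bump:
  assumes "length u \<le> 3"
  shows "smooth_form (length u) (\<lambda>x vs. bump z R N x * frame_det u vs)"
  unfolding smooth_form_def
proof (intro conjI allI impI)
  fix vs :: "(real^3) list"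
  show "smooth (\<lambda>x. bump z R N x * frame_det u vs)"
    by (intro real_polynomial_function_smooth real_polynomial_function.intros(4) real_polynomial_function_bump
        real_polynomial_function.intros(2))
next
  fix x
  show "alternating_multilinear (length u) (\<lambda>vs. bump z R N x * frame_det u vs)"
    using alternating_multilinear_frame_det[OF assms] unfolding alternating_multilinear_def
    by (auto intro!: linear_compose_scale_right[where f = "\<lambda>v. frame_det u (_[_ := v])", unfolded real_scaleR_def])
qed

text \<open>Otherwise the powers of \<open>t' / t\<close> would grow beyond
  \<open>C / W\<close>.\<close>

lemma power_dominated:
  fixes W C t t' :: real
  assumes "\<And>N. W * t' ^ N \<le> C * t ^ N" "0 < t" "t < t'"
  shows "W \<le> 0"
proof (rule ccontr)
  assume W: "\<not> W \<le> 0"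
  obtain N where N: "C / W < (t' / t) ^ N" using real_arch_pow[of "t' / t" "C / W"] assms by auto
  then have "C / W * t ^ N < t' ^ N" using assms by (simp add: power_divide field_simps)
  then have "C * t ^ N < W * t' ^ N" using W by (simp add: field_simps)
  then show False using assms(1)[of N] by simp
qed

text \<open>The points of the slab that project to within \<open>d / 2\<close> of \<open>z\<close>
  form an open set of positive measure, on which the base of the power is at least its value at
  distance \<open>d / 2\<close>. So the integral decays no faster than a power whose base exceeds
  the one at distance \<open>d\<close>.\<close>

lemma bump_mass_bounds:
  assumes b: "orthonormal_frame b" and d: "0 < d" "d < R"
  obtains m where "m > 0"
    "\<And>N. m * (1 - (d / 2)\<^sup>2 / R\<^sup>2) ^ N \<le>
      (LINT x | lborel. indicat_real (slab z b) x * (indicat_real (ball z d) (proj z b x) * bump z R N (proj z b x)))"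
    "\<And>N. integrable lborel (\<lambda>x. indicat_real (slab z b) x * (indicat_real (ball z d) (proj z b x) * bump z R N (proj z b x)))"
proof -
  let ?P = "proj z b"
  let ?U = "{x. norm (x - ?P x) < 1} \<inter> {x. dist z (?P x) < d / 2}"
  have cP: "continuous_on UNIV ?P" unfolding proj_def by (intro continuous_intros)
  have oU: "open ?U"
    by (intro open_Int open_Collect_less continuous_intros cP)
  have "?P z = z" by (simp add: proj_def)
  then have zU: "z \<in> ?U" using d by simp
  have mU: "?U \<in> sets lborel" using oU by simp
  have "bounded ?U"
    unfolding bounded_iff
  proof (intro exI ballI)
    fix x assume "x \<in> ?U"
    then have "norm (x - ?P x) < 1" "dist z (?P x) < d / 2" by auto
    moreover have "norm x \<le> norm (x - ?P x) + norm (?P x - z) + norm z"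
      using norm_triangle_ineq[of "x - ?P x" "?P x"] norm_triangle_ineq[of "?P x - z" z] by simp
    ultimately show "norm x \<le> 1 + d / 2 + norm z" by (simp add: dist_norm norm_minus_commute)
  qed
  then have fin: "emeasure lborel ?U < \<infinity>" by (rule emeasure_bounded_finite)
  have "emeasure lborel ?U \<noteq> 0"
  proof
    assume "emeasure lborel ?U = 0"
    then have "?U \<in> null_sets lborel" using mU by (rule null_setsI)
    then have "negligible ?U" unfolding negligible_iff_null_sets by (rule null_sets_completionI)
    then show False using open_not_negligible[OF oU] zU by blast
  qed
  then have mpos: "measure lborel ?U > 0" using fin by (simp add: measure_def enn2real_positive_iff zero_less_iff_neq_zero)
  have bound: "\<bar>indicat_real (ball z d) y * bump z R N y\<bar> \<le> 1" for y N
  proof (cases "y \<in> ball z d")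
    case True
    then have "norm (y - z) \<le> R" using d by (simp add: dist_norm norm_minus_commute)
    then have "(norm (y - z))\<^sup>2 \<le> R\<^sup>2" by (intro power_mono) auto
    then have "0 \<le> 1 - (norm (y - z))\<^sup>2 / R\<^sup>2" "1 - (norm (y - z))\<^sup>2 / R\<^sup>2 \<le> 1"
      using d by (auto simp: divide_simps)
    then show ?thesis by (auto simp: bump_def indicator_def power_le_one)
  qed simp
  have mb: "(\<lambda>y. indicat_real (ball z d) y * bump z R N y) \<in> borel_measurable borel" for N
    unfolding bump_def using d
    by (intro borel_measurable_times borel_measurable_indicator borel_measurable_continuous_onI continuous_intros) auto
  have int: "integrable lborel (\<lambda>x. indicat_real (slab z b) x * (indicat_real (ball z d) (?P x) * bump z R N (?P x)))" for N
  proof (rule slab_integrable[OF mb bound])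
    fix y :: "real^3" assume "norm y > norm z + d"
    then have "y \<notin> ball z d" using norm_triangle_ineq2[of y z] by (auto simp: dist_norm norm_minus_commute)
    then show "indicat_real (ball z d) y * bump z R N y = 0" by simp
  qed
  show thesis
  proof (rule that[OF mpos _ int])
    fix N
    let ?t = "1 - (d / 2)\<^sup>2 / R\<^sup>2"
    have "measure lborel ?U * ?t ^ N = (LINT x | lborel. ?t ^ N * indicat_real ?U x)"
      using fin mU by (simp add: mult.commute)
    also have "\<dots> \<le> (LINT x | lborel. indicat_real (slab z b) x * (indicat_real (ball z d) (?P x) * bump z R N (?P x)))"
    proof (rule integral_mono)
      show "integrable lborel (\<lambda>x. ?t ^ N * indicat_real ?U x)"
        using fin mU by (intro integrable_mult_right integrable_real_indicator) auto
      fix x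
      show "?t ^ N * indicat_real ?U x \<le> indicat_real (slab z b) x * (indicat_real (ball z d) (?P x) * bump z R N (?P x))"
      proof (cases "x \<in> ?U")
        case True
        then have n: "norm (?P x - z) < d / 2" "x \<in> slab z b" by (auto simp: slab_def dist_norm norm_minus_commute)
        then have "?P x \<in> ball z d" using d by (simp add: dist_norm norm_minus_commute)
        moreover have "?t ^ N \<le> bump z R N (?P x)"
          unfolding bump_def
        proof (rule power_mono)
          have "(norm (?P x - z))\<^sup>2 \<le> (d / 2)\<^sup>2" using n by (intro power_mono) auto
          then show "?t \<le> 1 - (norm (?P x - z))\<^sup>2 / R\<^sup>2" by (simp add: divide_right_mono)
          have "(d / 2)\<^sup>2 \<le> R\<^sup>2" using d by (intro power_mono) auto
          then show "0 \<le> ?t" using d by (simp add: divide_simps)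
        qed
        ultimately show ?thesis using True n by simp
      next
        case False
        moreover have "0 \<le> indicat_real (slab z b) x * (indicat_real (ball z d) (?P x) * bump z R N (?P x))"
        proof (cases "?P x \<in> ball z d")
          case True
          then have "norm (?P x - z) \<le> R" using d by (simp add: dist_norm norm_minus_commute)
          then have "(norm (?P x - z))\<^sup>2 \<le> R\<^sup>2" by (intro power_mono) auto
          then have "0 \<le> 1 - (norm (?P x - z))\<^sup>2 / R\<^sup>2" using d by (auto simp: divide_simps)
          then show ?thesis by (simp add: bump_def)
        qed simp
        ultimately show ?thesis by simp
      qed
    qed (rule int)
    finally show "measure lborel ?U * ?t ^ N \<le>
      (LINT x | lborel. indicat_real (slab z b) x * (indicat_real (ball z d) (?P x) * bump z R N (?P x)))" .
  qed
qed

section \<open>Null chains have vanishing densities and slices\<close>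

lemma frame_sign_mult:
  assumes "orthonormal_frame b" "orthonormal_frame c" "span (set b) = span (set c)" "length u = length b"
  shows "frame_sign u c = frame_sign u b * frame_sign b c"
proof -
  have l: "length c = length b"
    using dim_orthonormal_frame[OF assms(1)] dim_orthonormal_frame[OF assms(2)] assms(3) by simp
  have "set c \<subseteq> span (set b)" unfolding assms(3) by (rule span_superset)
  then have "frame_det u c = frame_det u b * frame_det b c"
    by (intro frame_det_mult) (use assms l in auto)
  then show ?thesis using frame_det_pm1[OF assms(1-3)] by (auto simp: frame_sign_def)
qed

lemma cell_ball:
  assumes s: "(A, b) \<in> cells k" and z: "z \<in> A"
  obtains d where "d > 0" "\<And>y. y \<in> plane z b \<Longrightarrow> dist z y < d \<Longrightarrow> y \<in> A"
proof -
  obtain T where T: "open T" "A = plane z b \<inter> T"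
    using cell_openin[OF assms] by (auto simp: openin_open)
  then obtain d where "d > 0" "ball z d \<subseteq> T" using z open_contains_ball by blast
  with T that show thesis by (auto simp: subset_iff)
qed

text \<open>The part of \<open>A\<close> where \<open>P\<close> holds is far from \<open>z\<close>
  and contributes at most a power of the value at distance \<open>d\<close>; the part where
  \<open>P\<close> fails is kept. Cells through \<open>z\<close> use this with the part near
  \<open>z\<close> kept, all other cells with nothing kept.\<close>

lemma bump_density_estimate:
  assumes s: "(A, b) \<in> cells k" and N: "\<And>y. y \<in> A \<Longrightarrow> norm (y - z) \<le> R" and d: "0 < d" "d < R"
    and far: "\<And>y. y \<in> A \<Longrightarrow> P y \<Longrightarrow> d \<le> norm (y - z)"
    and P: "\<And>y. \<not> P y \<Longrightarrow> y \<in> A" "\<And>y. \<not> P y \<Longrightarrow> norm (y - z) \<le> R"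
      "integrable lborel (\<lambda>x. indicat_real (slab p b) x * (indicat_real {y. \<not> P y} (proj p b x) * bump z R n (proj p b x)))"
  shows "\<bar>(LINT x | lborel. indicat_real (slab p b) x * (indicat_real A (proj p b x) * bump z R n (proj p b x)))
      - (LINT x | lborel. indicat_real (slab p b) x * (indicat_real {y. \<not> P y} (proj p b x) * bump z R n (proj p b x)))\<bar>
    \<le> (LINT x | lborel. indicat_real (slab p b) x * (indicat_real A (proj p b x) * 1)) * (1 - d\<^sup>2 / R\<^sup>2) ^ n"
proof -
  let ?f = "\<lambda>x. indicat_real (slab p b) x * (indicat_real A (proj p b x) * bump z R n (proj p b x))"
  let ?g = "\<lambda>x. indicat_real (slab p b) x * (indicat_real {y. \<not> P y} (proj p b x) * bump z R n (proj p b x))"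
  let ?h = "\<lambda>x. indicat_real (slab p b) x * (indicat_real A (proj p b x) * 1)"
  have cb: "continuous_on UNIV (bump z R n)"
    unfolding bump_def[abs_def] using d by (intro continuous_intros) auto
  have f: "integrable lborel ?f" by (rule cell_slab_integrable[OF s cb])
  have h: "integrable lborel ?h" by (rule cell_slab_integrable[OF s]) (rule continuous_on_const)
  have pt: "\<bar>?f x - ?g x\<bar> \<le> ?h x * (1 - d\<^sup>2 / R\<^sup>2) ^ n" for x
  proof -
    let ?y = "proj p b x"
    have t: "0 \<le> (1 - d\<^sup>2 / R\<^sup>2) ^ n"
    proof -
      have "d\<^sup>2 \<le> R\<^sup>2" using d by (intro power_mono) auto
      then have "0 \<le> 1 - d\<^sup>2 / R\<^sup>2" using d by (simp add: divide_simps)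
      then show ?thesis by simp
    qed
    show ?thesis
    proof (cases "x \<in> slab p b \<and> ?y \<in> A \<and> P ?y")
      case True
      then have "d \<le> norm (?y - z)" "norm (?y - z) \<le> R" using far N by auto
      then have "d\<^sup>2 \<le> (norm (?y - z))\<^sup>2" "(norm (?y - z))\<^sup>2 \<le> R\<^sup>2" using d by (auto intro: power_mono)
      then have "0 \<le> 1 - (norm (?y - z))\<^sup>2 / R\<^sup>2" "1 - (norm (?y - z))\<^sup>2 / R\<^sup>2 \<le> 1 - d\<^sup>2 / R\<^sup>2"
        using d by (auto simp: divide_simps)
      then have "0 \<le> bump z R n ?y" "bump z R n ?y \<le> (1 - d\<^sup>2 / R\<^sup>2) ^ n"
        unfolding bump_def by (auto intro: power_mono)
      then show ?thesis using True by simp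
    next
      case False
      then have e: "?f x = ?g x" using P(1)[of ?y] by (auto simp: indicator_def)
      have "0 \<le> ?h x" by simp
      then have "0 \<le> ?h x * (1 - d\<^sup>2 / R\<^sup>2) ^ n" using t by (rule mult_nonneg_nonneg)
      then show ?thesis unfolding e by simp
    qed
  qed
  have "\<bar>(LINT x | lborel. ?f x) - (LINT x | lborel. ?g x)\<bar> = \<bar>LINT x | lborel. ?f x - ?g x\<bar>"
    by (subst Bochner_Integration.integral_diff[OF f P(3)]) simp
  also have "\<dots> \<le> (LINT x | lborel. \<bar>?f x - ?g x\<bar>)"
    by (rule integral_abs_bound)
  also have "\<dots> \<le> (LINT x | lborel. ?h x * (1 - d\<^sup>2 / R\<^sup>2) ^ n)"
  proof (rule integral_mono)
    show "integrable lborel (\<lambda>x. \<bar>?f x - ?g x\<bar>)"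
      by (intro integrable_abs Bochner_Integration.integrable_diff f P(3))
    show "integrable lborel (\<lambda>x. ?h x * (1 - d\<^sup>2 / R\<^sup>2) ^ n)"
      by (intro integrable_mult_left h)
  qed (rule pt)
  also have "\<dots> = (LINT x | lborel. ?h x) * (1 - d\<^sup>2 / R\<^sup>2) ^ n"
    by (rule integral_mult_left_zero)
  finally show ?thesis .
qed

text \<open>Test the chain with the bump at \<open>z\<close> times the determinant form of a frame
  \<open>b\<close>. As the power grows, cells through \<open>z\<close> contribute their signed
  multiplicity times a common integral, which decays more slowly than all other contributions; the
  multiplicity must therefore vanish.\<close>

lemma null_density:
  assumes c: "c \<in> null_chains k"
  obtains E where "thin k E"
    "\<And>z u. z \<notin> E \<Longrightarrow> length u = nat k \<Longrightarrow>
      (\<Sum>\<sigma>\<in>{\<sigma>\<in>Poly_Mapping.keys c. z \<in> fst \<sigma>}. Poly_Mapping.lookup c \<sigma> * frame_sign u (snd \<sigma>)) = 0"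
proof -
  define F where "F = Poly_Mapping.keys c"
  have F: "finite F" "F \<subseteq> cells k" using c by (auto simp: F_def null_chains_iff)
  define pt where "pt = (\<lambda>\<sigma>::cell. SOME p. p \<in> fst \<sigma>)"
  have pt: "pt \<sigma> \<in> fst \<sigma>" if "\<sigma> \<in> F" for \<sigma>
  proof -
    have "fst \<sigma> \<noteq> {}" by (rule cellsD(3)[of \<sigma> k]) (use that F(2) in blast)
    then show ?thesis unfolding pt_def by (simp add: some_in_eq)
  qed
  define pl where "pl = (\<lambda>\<sigma>. plane (pt \<sigma>) (snd \<sigma>))"
  have pl: "plane z (snd \<sigma>) = pl \<sigma>" if "\<sigma> \<in> F" "z \<in> fst \<sigma>" for \<sigma> z
  proof -
    have c: "(fst \<sigma>, snd \<sigma>) \<in> cells k" using that F(2) by auto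
    show ?thesis
      unfolding pl_def
      by (rule trans[OF sym[OF cell_affine_hull[OF c that(2)]] cell_affine_hull[OF c pt[OF that(1)]]])
  qed
  \<comment> \<open>Off this set \<open>z\<close> is on the frontier of no cell, and all cells
    through \<open>z\<close> lie in one plane.\<close>
  define E where "E = (\<Union>\<sigma>\<in>F. closure (fst \<sigma>) - fst \<sigma>) \<union> (\<Union>\<sigma>\<in>F. \<Union>\<tau>\<in>{\<tau>\<in>F. pl \<sigma> \<noteq> pl \<tau>}. pl \<sigma> \<inter> pl \<tau>)"
  have "thin k E"
    unfolding E_def
  proof (intro thin_Un thin_UN F(1))
    fix \<sigma> assume s: "\<sigma> \<in> F"
    show "thin k (closure (fst \<sigma>) - fst \<sigma>)" using cell_frontier_thin s F(2) by blast
    show "finite {\<tau> \<in> F. pl \<sigma> \<noteq> pl \<tau>}" using F(1) by simp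
    fix \<tau> assume "\<tau> \<in> {\<tau> \<in> F. pl \<sigma> \<noteq> pl \<tau>}"
    then have t: "\<tau> \<in> F" "pl \<sigma> \<noteq> pl \<tau>" by auto
    have *: "orthonormal_frame (snd \<sigma>)" "orthonormal_frame (snd \<tau>)" "int (length (snd \<sigma>)) = k" "int (length (snd \<tau>)) = k"
      using cellsD(1,2)[of \<sigma> k] cellsD(1,2)[of \<tau> k] s t(1) F(2) by (simp_all add: subset_eq)
    then have "thin (int (length (snd \<sigma>))) (pl \<sigma> \<inter> pl \<tau>)"
      using t unfolding pl_def by (intro planes_Int_thin) auto
    then show "thin k (pl \<sigma> \<inter> pl \<tau>)" using * by simp
  qed
  moreover have "(\<Sum>\<sigma>\<in>{\<sigma>\<in>Poly_Mapping.keys c. z \<in> fst \<sigma>}. Poly_Mapping.lookup c \<sigma> * frame_sign u (snd \<sigma>)) = 0"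
    if zE: "z \<notin> E" and u: "length u = nat k" for z u
  proof (cases "\<exists>\<sigma>\<in>F. z \<in> fst \<sigma>")
    case False
    then have "{\<sigma>\<in>Poly_Mapping.keys c. z \<in> fst \<sigma>} = {}" by (auto simp: F_def)
    then show ?thesis by (simp only: sum.empty)
  next
    case True
    then obtain \<sigma>0 where s0: "\<sigma>0 \<in> F" "z \<in> fst \<sigma>0" by blast
    define b where "b = snd \<sigma>0"
    have b: "orthonormal_frame b" "int (length b) = k" using cellsD(1,2)[of \<sigma>0 k] s0 F(2) by (simp_all add: b_def subset_eq)
    have lb: "length b = nat k" "length b \<le> 3" using b orthonormal_frame_length by auto
    define F0 where "F0 = {\<sigma>\<in>F. z \<in> fst \<sigma>}"
    have F0: "finite F0" "F0 \<subseteq> F" using F(1) by (auto simp: F0_def)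
    have cop: "plane z (snd \<sigma>) = plane z b" if "\<sigma> \<in> F0" for \<sigma>
    proof -
      have s: "\<sigma> \<in> F" "z \<in> fst \<sigma>" using that by (auto simp: F0_def)
      have "z \<in> pl \<sigma> \<inter> pl \<sigma>0" using pl[OF s] pl[OF s0] plane_base by blast
      then have "pl \<sigma> = pl \<sigma>0" using zE s s0 unfolding E_def by blast
      then show ?thesis using pl[OF s] pl[OF s0] by (simp add: b_def)
    qed
    have fr: "orthonormal_frame (snd \<sigma>)" "int (length (snd \<sigma>)) = k" if "\<sigma> \<in> F" for \<sigma>
      using cellsD(1,2)[of \<sigma> k] that F(2) by (simp_all add: subset_eq)
    have "\<exists>d>0. (\<sigma> \<in> F0 \<longrightarrow> (\<forall>y\<in>plane z b. dist z y < d \<longrightarrow> y \<in> fst \<sigma>)) \<and>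
        (\<sigma> \<notin> F0 \<longrightarrow> (\<forall>y\<in>fst \<sigma>. d \<le> dist z y))" if s: "\<sigma> \<in> F" for \<sigma>
    proof (cases "\<sigma> \<in> F0")
      case True
      then have "(fst \<sigma>, snd \<sigma>) \<in> cells k" "z \<in> fst \<sigma>" using F(2) s by (auto simp: F0_def)
      then obtain d where "d > 0" "\<And>y. y \<in> plane z (snd \<sigma>) \<Longrightarrow> dist z y < d \<Longrightarrow> y \<in> fst \<sigma>"
        by (rule cell_ball) (rule that)
      then show ?thesis using cop[OF True] True by auto
    next
      case False
      then have "z \<notin> closure (fst \<sigma>)" using zE s unfolding E_def F0_def by blast
      then obtain d where "d > 0" "\<And>y. y \<in> closure (fst \<sigma>) \<Longrightarrow> d \<le> dist z y"
        by (metis closed_closure separate_point_closed)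
      then show ?thesis using closure_subset[of "fst \<sigma>"] False by blast
    qed
    then have "\<forall>\<sigma>\<in>F. \<exists>d. d > 0 \<and> (\<sigma> \<in> F0 \<longrightarrow> (\<forall>y\<in>plane z b. dist z y < d \<longrightarrow> y \<in> fst \<sigma>)) \<and>
        (\<sigma> \<notin> F0 \<longrightarrow> (\<forall>y\<in>fst \<sigma>. d \<le> dist z y))" by blast
    from bchoice[OF this] obtain df where df0: "\<And>\<sigma>. \<sigma> \<in> F \<Longrightarrow> df \<sigma> > 0 \<and> (\<sigma> \<in> F0 \<longrightarrow> (\<forall>y\<in>plane z b. dist z y < df \<sigma> \<longrightarrow> y \<in> fst \<sigma>)) \<and>
        (\<sigma> \<notin> F0 \<longrightarrow> (\<forall>y\<in>fst \<sigma>. df \<sigma> \<le> dist z y))" by blast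
    have df: "\<And>\<sigma>. \<sigma> \<in> F \<Longrightarrow> df \<sigma> > 0"
      "\<And>\<sigma> y. \<sigma> \<in> F0 \<Longrightarrow> y \<in> plane z b \<Longrightarrow> dist z y < df \<sigma> \<Longrightarrow> y \<in> fst \<sigma>"
      "\<And>\<sigma> y. \<sigma> \<in> F \<Longrightarrow> \<sigma> \<notin> F0 \<Longrightarrow> y \<in> fst \<sigma> \<Longrightarrow> df \<sigma> \<le> dist z y"
      subgoal using df0 by blast
      subgoal using df0 F0(2) by blast
      subgoal using df0 by blast
      done
    \<comment> \<open>One radius for all cells: those through \<open>z\<close> fill the disc of
      radius \<open>d\<close> in their plane, the others keep at least this distance.\<close>
    define d where "d = Min (df ` F)"
    have Fne: "F \<noteq> {}" using s0 by blast
    have d: "d > 0" "\<And>\<sigma>. \<sigma> \<in> F \<Longrightarrow> d \<le> df \<sigma>" using F(1) Fne df(1) by (auto simp: d_def)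
    have "bounded (fst \<sigma>)" if "\<sigma> \<in> F" for \<sigma>
      by (rule cellsD(4)[of _ k]) (use F(2) that in blast)
    then have "bounded (\<Union>\<sigma>\<in>F. fst \<sigma>)" by (intro bounded_UN F(1) ballI)
    then have "\<exists>R0. \<forall>y\<in>(\<Union>\<sigma>\<in>F. fst \<sigma>). dist z y \<le> R0"
      unfolding bounded_any_center[of _ z] .
    then obtain R0 where R0: "\<And>y. y \<in> (\<Union>\<sigma>\<in>F. fst \<sigma>) \<Longrightarrow> dist z y \<le> R0" by blast
    \<comment> \<open>Larger than \<open>d\<close>, and large enough that every cell lies within
      distance \<open>R\<close> of \<open>z\<close>, where the bump is between 0 and 1.\<close>
    define R where "R = max R0 0 + d + 1"
    have R: "d < R" "\<And>\<sigma> y. \<sigma> \<in> F \<Longrightarrow> y \<in> fst \<sigma> \<Longrightarrow> norm (y - z) \<le> R"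
      using R0 d(1) by (force simp: R_def dist_norm norm_minus_commute)+
    obtain m where m: "m > 0"
      "\<And>n. m * (1 - (d / 2)\<^sup>2 / R\<^sup>2) ^ n \<le>
        (LINT x | lborel. indicat_real (slab z b) x * (indicat_real (ball z d) (proj z b x) * bump z R n (proj z b x)))"
      "\<And>n. integrable lborel (\<lambda>x. indicat_real (slab z b) x * (indicat_real (ball z d) (proj z b x) * bump z R n (proj z b x)))"
      by (rule bump_mass_bounds[where z = z, OF b(1) d(1) R(1)]) (rule that)
    define I where "I n = (LINT x | lborel. indicat_real (slab z b) x * (indicat_real (ball z d) (proj z b x) * bump z R n (proj z b x)))" for n
    define J where "J \<sigma> n = (LINT x | lborel. indicat_real (slab (pt \<sigma>) (snd \<sigma>)) x * (indicat_real (fst \<sigma>) (proj (pt \<sigma>) (snd \<sigma>) x) * bump z R n (proj (pt \<sigma>) (snd \<sigma>) x)))" for \<sigma> n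
    define M where "M \<sigma> = (LINT x | lborel. indicat_real (slab (pt \<sigma>) (snd \<sigma>)) x * (indicat_real (fst \<sigma>) (proj (pt \<sigma>) (snd \<sigma>) x) * 1))" for \<sigma>
    let ?t = "1 - d\<^sup>2 / R\<^sup>2" and ?t' = "1 - (d / 2)\<^sup>2 / R\<^sup>2"
    have t: "0 < ?t" "?t < ?t'"
    proof -
      have "d\<^sup>2 < R\<^sup>2" using d(1) R(1) by (intro power_strict_mono) auto
      then show "0 < ?t" using d(1) R(1) by (simp add: divide_simps)
      have "(d / 2)\<^sup>2 < d\<^sup>2" using d(1) by (intro power_strict_mono) auto
      then show "?t < ?t'" using d(1) R(1) by (simp add: divide_strict_right_mono)
    qed
    have J0: "\<bar>J \<sigma> n - I n\<bar> \<le> M \<sigma> * ?t ^ n" if s: "\<sigma> \<in> F0" for \<sigma> n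
    proof -
      have sF: "\<sigma> \<in> F" "z \<in> fst \<sigma>" using s by (auto simp: F0_def)
      have e: "plane (pt \<sigma>) (snd \<sigma>) = plane z b" using cop[OF s] pl[OF sF] by (simp add: pl_def)
      have pe: "proj (pt \<sigma>) (snd \<sigma>) = proj z b" "slab (pt \<sigma>) (snd \<sigma>) = slab z b"
        using proj_cong[OF fr(1)[OF sF(1)] b(1) e] slab_cong[OF fr(1)[OF sF(1)] b(1) e] by auto
      let ?P = "\<lambda>y. \<not> (y \<in> ball z d \<and> y \<in> fst \<sigma>)"
      have ind: "indicat_real (ball z d) (proj z b x) = indicat_real {y. \<not> ?P y} (proj z b x)" for x
        using df(2)[OF s proj_in_plane[of z b x]] d(2)[OF sF(1)] by (auto simp: indicator_def)
      have "\<bar>(LINT x | lborel. indicat_real (slab (pt \<sigma>) (snd \<sigma>)) x * (indicat_real (fst \<sigma>) (proj (pt \<sigma>) (snd \<sigma>) x) * bump z R n (proj (pt \<sigma>) (snd \<sigma>) x)))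
        - (LINT x | lborel. indicat_real (slab (pt \<sigma>) (snd \<sigma>)) x * (indicat_real {y. \<not> ?P y} (proj (pt \<sigma>) (snd \<sigma>) x) * bump z R n (proj (pt \<sigma>) (snd \<sigma>) x)))\<bar>
        \<le> (LINT x | lborel. indicat_real (slab (pt \<sigma>) (snd \<sigma>)) x * (indicat_real (fst \<sigma>) (proj (pt \<sigma>) (snd \<sigma>) x) * 1)) * ?t ^ n"
      proof (rule bump_density_estimate[of _ _ k])
        show "(fst \<sigma>, snd \<sigma>) \<in> cells k" using sF F(2) by auto
        show "norm (y - z) \<le> R" if "y \<in> fst \<sigma>" for y using R(2)[OF sF(1) that] .
        show "d \<le> norm (y - z)" if "y \<in> fst \<sigma>" "?P y" for y
          using that by (auto simp: dist_norm norm_minus_commute)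
        show "\<not> ?P y \<Longrightarrow> norm (y - z) \<le> R" for y using R(2)[OF sF(1)] by blast
        show "integrable lborel (\<lambda>x. indicat_real (slab (pt \<sigma>) (snd \<sigma>)) x * (indicat_real {y. \<not> ?P y} (proj (pt \<sigma>) (snd \<sigma>) x) * bump z R n (proj (pt \<sigma>) (snd \<sigma>) x)))"
          using m(3)[of n] unfolding ind pe .
      qed (use d R in auto)
      then show ?thesis unfolding J_def I_def M_def ind pe .
    qed
    have J1: "\<bar>J \<sigma> n\<bar> \<le> M \<sigma> * ?t ^ n" if s: "\<sigma> \<in> F - F0" for \<sigma> n
    proof -
      have sF: "\<sigma> \<in> F" "\<sigma> \<notin> F0" using s by auto
      have "\<bar>(LINT x | lborel. indicat_real (slab (pt \<sigma>) (snd \<sigma>)) x * (indicat_real (fst \<sigma>) (proj (pt \<sigma>) (snd \<sigma>) x) * bump z R n (proj (pt \<sigma>) (snd \<sigma>) x)))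
        - (LINT x | lborel. indicat_real (slab (pt \<sigma>) (snd \<sigma>)) x * (indicat_real {y. \<not> True} (proj (pt \<sigma>) (snd \<sigma>) x) * bump z R n (proj (pt \<sigma>) (snd \<sigma>) x)))\<bar>
        \<le> (LINT x | lborel. indicat_real (slab (pt \<sigma>) (snd \<sigma>)) x * (indicat_real (fst \<sigma>) (proj (pt \<sigma>) (snd \<sigma>) x) * 1)) * ?t ^ n"
      proof (rule bump_density_estimate[of _ _ k])
        show "(fst \<sigma>, snd \<sigma>) \<in> cells k" using sF F(2) by auto
        show "norm (y - z) \<le> R" if "y \<in> fst \<sigma>" for y using R(2)[OF sF(1) that] .
        show "d \<le> norm (y - z)" if "y \<in> fst \<sigma>" True for y
          using df(3)[OF sF that(1)] d(2)[OF sF(1)] by (simp add: dist_norm norm_minus_commute)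
      qed (use d R in auto)
      then show ?thesis unfolding J_def M_def by simp
    qed
    let ?w = "\<lambda>\<sigma>. of_int (Poly_Mapping.lookup c \<sigma>) * frame_det b (snd \<sigma>)"
    \<comment> \<open>The signed multiplicity at \<open>z\<close>, followed by the constant that
      bounds all error terms.\<close>
    define W where "W = (\<Sum>\<sigma>\<in>F0. ?w \<sigma>)"
    define C where "C = (\<Sum>\<sigma>\<in>F. \<bar>?w \<sigma>\<bar> * M \<sigma>)"
    have zero: "(\<Sum>\<sigma>\<in>F. ?w \<sigma> * J \<sigma> n) = 0" for n
    proof -
      let ?\<omega> = "\<lambda>x vs. bump z R n x * frame_det b vs"
      have w: "smooth_form (nat k) ?\<omega>" unfolding lb(1)[symmetric] by (rule smooth_form_bump[OF lb(2)])
      have cb: "continuous_on UNIV (\<lambda>x. bump z R n x * frame_det b v)" for v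
        unfolding bump_def[abs_def] using d R by (intro continuous_intros) auto
      have J: "fibre_volume (length b) * cell_integral ?\<omega> \<sigma> = frame_det b (snd \<sigma>) * J \<sigma> n" if "\<sigma> \<in> F" for \<sigma>
      proof -
        have "(fst \<sigma>, snd \<sigma>) \<in> cells k" using that F(2) by auto
        from cell_integral_slab[where \<omega> = ?\<omega>, OF this cb pt[OF that]]
        have "fibre_volume (length (snd \<sigma>)) * cell_integral ?\<omega> \<sigma> = (LINT x | lborel. indicat_real (slab (pt \<sigma>) (snd \<sigma>)) x * (indicat_real (fst \<sigma>) (proj (pt \<sigma>) (snd \<sigma>) x) * (bump z R n (proj (pt \<sigma>) (snd \<sigma>) x) * frame_det b (snd \<sigma>))))"
          by simp
        also have "\<dots> = (LINT x | lborel. frame_det b (snd \<sigma>) * (indicat_real (slab (pt \<sigma>) (snd \<sigma>)) x * (indicat_real (fst \<sigma>) (proj (pt \<sigma>) (snd \<sigma>) x) * bump z R n (proj (pt \<sigma>) (snd \<sigma>) x))))"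
          by (simp add: mult_ac)
        also have "\<dots> = frame_det b (snd \<sigma>) * J \<sigma> n" unfolding J_def by (rule integral_mult_right_zero)
        moreover have "length (snd \<sigma>) = length b" using fr(2)[OF that] b(2) by simp
        ultimately show ?thesis by simp
      qed
      have "0 = fibre_volume (length b) * frag_sum (cell_integral ?\<omega>) c"
        using c w unfolding null_chains_iff by simp
      also have "\<dots> = (\<Sum>\<sigma>\<in>F. of_int (Poly_Mapping.lookup c \<sigma>) * (fibre_volume (length b) * cell_integral ?\<omega> \<sigma>))"
        unfolding frag_sum_def F_def[symmetric] by (simp add: imul_real sum_distrib_left mult_ac)
      also have "\<dots> = (\<Sum>\<sigma>\<in>F. of_int (Poly_Mapping.lookup c \<sigma>) * (frame_det b (snd \<sigma>) * J \<sigma> n))"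
        by (intro sum.cong) (simp_all only: J)
      finally show ?thesis by (simp add: mult.assoc)
    qed
    \<comment> \<open>Replace the integral over each cell through \<open>z\<close> by the common
      integral \<open>I n\<close>; the differences and the cells off \<open>z\<close> are of the
      order \<open>?t ^ n\<close>.\<close>
    have key: "\<bar>W\<bar> * I n \<le> C * ?t ^ n" for n
    proof -
      have "(\<Sum>\<sigma>\<in>F. ?w \<sigma> * J \<sigma> n) = (\<Sum>\<sigma>\<in>F0. ?w \<sigma> * J \<sigma> n) + (\<Sum>\<sigma>\<in>F - F0. ?w \<sigma> * J \<sigma> n)"
        using sum.subset_diff[OF F0(2) F(1)] by (simp add: add.commute)
      moreover have "W * I n = (\<Sum>\<sigma>\<in>F0. ?w \<sigma> * J \<sigma> n) - (\<Sum>\<sigma>\<in>F0. ?w \<sigma> * (J \<sigma> n - I n))"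
        unfolding W_def sum_distrib_right sum_subtractf[symmetric] right_diff_distrib by simp
      ultimately have "W * I n = - ((\<Sum>\<sigma>\<in>F - F0. ?w \<sigma> * J \<sigma> n) + (\<Sum>\<sigma>\<in>F0. ?w \<sigma> * (J \<sigma> n - I n)))"
        using zero[of n] by linarith
      then have "\<bar>W * I n\<bar> \<le> \<bar>\<Sum>\<sigma>\<in>F - F0. ?w \<sigma> * J \<sigma> n\<bar> + \<bar>\<Sum>\<sigma>\<in>F0. ?w \<sigma> * (J \<sigma> n - I n)\<bar>"
        unfolding abs_minus_cancel by (simp only: abs_minus_cancel abs_triangle_ineq)
      also have "\<dots> \<le> (\<Sum>\<sigma>\<in>F - F0. \<bar>?w \<sigma> * J \<sigma> n\<bar>) + (\<Sum>\<sigma>\<in>F0. \<bar>?w \<sigma> * (J \<sigma> n - I n)\<bar>)"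
        by (intro add_mono sum_abs)
      also have "\<dots> \<le> (\<Sum>\<sigma>\<in>F - F0. \<bar>?w \<sigma>\<bar> * (M \<sigma> * ?t ^ n)) + (\<Sum>\<sigma>\<in>F0. \<bar>?w \<sigma>\<bar> * (M \<sigma> * ?t ^ n))"
        unfolding abs_mult[of "?w _" "J _ _"] abs_mult[of "?w _" "J _ _ - I _"]
        by (intro add_mono sum_mono mult_left_mono J0 J1) auto
      also have "\<dots> = (\<Sum>\<sigma>\<in>F. \<bar>?w \<sigma>\<bar> * (M \<sigma> * ?t ^ n))"
        by (rule sum.subset_diff[OF F0(2) F(1), symmetric])
      also have "\<dots> = C * ?t ^ n" unfolding C_def sum_distrib_right by (simp only: mult.assoc)
      finally have "\<bar>W * I n\<bar> \<le> C * ?t ^ n" .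
      moreover have "\<bar>W\<bar> * I n \<le> \<bar>W * I n\<bar>" unfolding abs_mult by (intro mult_left_mono) auto
      ultimately show ?thesis by linarith
    qed
    have "\<bar>W\<bar> * m \<le> 0"
    proof (rule power_dominated[OF _ t])
      fix n
      have "\<bar>W\<bar> * m * ?t' ^ n \<le> \<bar>W\<bar> * I n"
        unfolding mult.assoc I_def by (intro mult_left_mono m(2)) auto
      then show "\<bar>W\<bar> * m * ?t' ^ n \<le> C * ?t ^ n" using key[of n] by linarith
    qed
    then have W0: "W = 0" using m(1) by (simp add: mult_le_0_iff)
    have sp: "span (set b) = span (set (snd \<sigma>))" if "\<sigma> \<in> F0" for \<sigma>
      using plane_eq_imp_span[OF cop[OF that]] by simp
    have "W = of_int (\<Sum>\<sigma>\<in>F0. Poly_Mapping.lookup c \<sigma> * frame_sign b (snd \<sigma>))"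
      unfolding W_def of_int_sum of_int_mult
    proof (rule sum.cong)
      fix \<sigma> assume s: "\<sigma> \<in> F0"
      then have "\<sigma> \<in> F" using F0(2) by blast
      show "?w \<sigma> = of_int (Poly_Mapping.lookup c \<sigma>) * of_int (frame_sign b (snd \<sigma>))"
        unfolding frame_sign_pm1(2)[OF b(1) fr(1)[OF \<open>\<sigma> \<in> F\<close>] sp[OF s]] ..
    qed simp
    then have i0: "(\<Sum>\<sigma>\<in>F0. Poly_Mapping.lookup c \<sigma> * frame_sign b (snd \<sigma>)) = 0" using W0 by linarith
    \<comment> \<open>Passing from \<open>b\<close> to another list \<open>u\<close> multiplies all
      terms by the same sign, because the cells through \<open>z\<close> have a common direction
      space.\<close>
    have "(\<Sum>\<sigma>\<in>F0. Poly_Mapping.lookup c \<sigma> * frame_sign u (snd \<sigma>)) = (\<Sum>\<sigma>\<in>F0. frame_sign u b * (Poly_Mapping.lookup c \<sigma> * frame_sign b (snd \<sigma>)))"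
    proof (rule sum.cong)
      fix \<sigma> assume s: "\<sigma> \<in> F0"
      then have "\<sigma> \<in> F" using F0(2) by blast
      have "frame_sign u (snd \<sigma>) = frame_sign u b * frame_sign b (snd \<sigma>)"
        by (rule frame_sign_mult[OF b(1) fr(1)[OF \<open>\<sigma> \<in> F\<close>] sp[OF s]]) (use u lb in simp)
      then show "Poly_Mapping.lookup c \<sigma> * frame_sign u (snd \<sigma>) = frame_sign u b * (Poly_Mapping.lookup c \<sigma> * frame_sign b (snd \<sigma>))"
        by simp
    qed simp
    also have "\<dots> = 0" unfolding sum_distrib_left[symmetric] i0 by simp
    finally show ?thesis unfolding F0_def F_def .
  qed
  ultimately show thesis by (rule that)
qed

text \<open>Whenever the sign is not zero the fibre of \<open>q\<close> through \<open>x\<close> meets the plane of the cell in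
  exactly one point.  The choice \<open>l = 0\<close>, \<open>s = 1\<close> gives the slice without a half space.\<close>

definition cut :: "(real^3) list \<Rightarrow> real^3 \<Rightarrow> real \<Rightarrow> cell \<Rightarrow> real^3 \<Rightarrow> int" where
  "cut q l s \<sigma> x = (if \<exists>z\<in>fst \<sigma>. qeq q z x \<and> l \<bullet> z < l \<bullet> x + s then frame_sign q (snd \<sigma>) else 0)"

lemma cell_qeq_unique:
  assumes s: "(A, b) \<in> cells k" and q: "length q = nat k" "frame_sign q b \<noteq> 0"
    and z: "z \<in> A" "y \<in> A" "qeq q z x" "qeq q y x"
  shows "y = z"
proof -
  have b: "orthonormal_frame b" "length q = length b" using cellsD[OF s] q by auto
  have "frame_det q b \<noteq> 0" using q(2) by (auto simp: frame_sign_def)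
  then have k: "span (set b) \<inter> qker q = {0}" by (rule span_Int_qker[OF b])
  have "y - z \<in> span (set b)" using cell_subset_plane[OF s z(1)] z(2) by (auto simp: plane_alt)
  moreover have "y - z \<in> qker q" using z(3,4) by (auto simp: qeq_def qker_def inner_diff_right)
  ultimately have "y - z \<in> span (set b) \<inter> qker q" by (rule IntI)
  then show ?thesis unfolding k by simp
qed

text \<open>On a generic fibre, collect the cells by the point where they meet it. At each such
  point the signed multiplicities cancel by \<open>null_density\<close>, and the half space keeps
  either all of them or none.\<close>

lemma null_slice:
  assumes c: "c \<in> null_chains k" and q: "length q = nat k"
  shows "AE x in lborel. frag_sum (\<lambda>\<sigma>. cut q l s \<sigma> x) c = 0"
proof (cases "\<forall>\<sigma>\<in>Poly_Mapping.keys c. frame_sign q (snd \<sigma>) = 0")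
  case True
  then have "frag_sum (\<lambda>\<sigma>. cut q l s \<sigma> x) c = 0" for x
    unfolding frag_sum_def by (intro sum.neutral) (auto simp: cut_def)
  then show ?thesis by simp
next
  case False
  have F: "finite (Poly_Mapping.keys c)" "Poly_Mapping.keys c \<subseteq> cells k"
    using c by (auto simp: null_chains_iff)
  obtain \<sigma>0 where s0: "\<sigma>0 \<in> Poly_Mapping.keys c" "frame_sign q (snd \<sigma>0) \<noteq> 0" using False by blast
  have b0: "orthonormal_frame (snd \<sigma>0)" "int (length (snd \<sigma>0)) = k" using cellsD(1,2)[of \<sigma>0 k] s0 F(2) by (simp_all add: subset_eq)
  \<comment> \<open>A nonzero sign makes the covectors independent, which is what lets almost every
    fibre avoid the thin set.\<close>
  have "frame_det q (snd \<sigma>0) \<noteq> 0" using s0(2) by (auto simp: frame_sign_def)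
  then have "dim (set q) = length (snd \<sigma>0)"
    by (intro frame_det_dim b0(1)) (use q b0(2) in auto)
  then have dq: "int (dim (set q)) = k" using b0(2) by simp
  obtain E where E: "thin k E" "\<And>z u. z \<notin> E \<Longrightarrow> length u = nat k \<Longrightarrow>
      (\<Sum>\<sigma>\<in>{\<sigma>\<in>Poly_Mapping.keys c. z \<in> fst \<sigma>}. Poly_Mapping.lookup c \<sigma> * frame_sign u (snd \<sigma>)) = 0"
    by (rule null_density[OF c]) (rule that)
  have "AE x in lborel. \<forall>z\<in>E. \<not> qeq q z x" by (rule AE_avoid_thin) (use E(1) dq in simp)
  then show ?thesis
  proof eventually_elim
    fix x assume x: "\<forall>z\<in>E. \<not> qeq q z x"
    define F' where "F' = {\<sigma>\<in>Poly_Mapping.keys c. frame_sign q (snd \<sigma>) \<noteq> 0 \<and> (\<exists>z\<in>fst \<sigma>. qeq q z x)}"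
    define zf where "zf \<sigma> = (SOME z. z \<in> fst \<sigma> \<and> qeq q z x)" for \<sigma> :: cell
    have zf: "zf \<sigma> \<in> fst \<sigma> \<and> qeq q (zf \<sigma>) x" if "\<sigma> \<in> F'" for \<sigma>
      unfolding zf_def by (rule someI_ex) (use that in \<open>auto simp: F'_def\<close>)
    have un: "z = zf \<sigma>" if "\<sigma> \<in> F'" "z \<in> fst \<sigma>" "qeq q z x" for \<sigma> z
    proof (rule cell_qeq_unique[of "fst \<sigma>" "snd \<sigma>" k q])
      show "(fst \<sigma>, snd \<sigma>) \<in> cells k" "frame_sign q (snd \<sigma>) \<noteq> 0" using that(1) F(2) by (auto simp: F'_def)
    qed (use zf that q in auto)
    let ?g = "\<lambda>z. if l \<bullet> z < l \<bullet> x + s then 1 else (0::int)"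
    have cF: "cut q l s \<sigma> x = ?g (zf \<sigma>) * frame_sign q (snd \<sigma>)" if "\<sigma> \<in> F'" for \<sigma>
      using zf[OF that] un[OF that] unfolding cut_def by auto
    have fF: "finite F'" using F(1) by (simp add: F'_def)
    have "frag_sum (\<lambda>\<sigma>. cut q l s \<sigma> x) c = (\<Sum>\<sigma>\<in>F'. Poly_Mapping.lookup c \<sigma> * cut q l s \<sigma> x)"
      unfolding frag_sum_def imul_int
      by (rule sum.mono_neutral_right) (use F(1) in \<open>auto simp: F'_def cut_def\<close>)
    also have "\<dots> = (\<Sum>z\<in>zf ` F'. \<Sum>\<sigma>\<in>{\<sigma>. \<sigma> \<in> F' \<and> zf \<sigma> = z}. Poly_Mapping.lookup c \<sigma> * cut q l s \<sigma> x)"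
      by (rule sum.image_gen[OF fF])
    also have "\<dots> = (\<Sum>z\<in>zf ` F'. 0)"
    proof (rule sum.cong)
      fix z assume "z \<in> zf ` F'"
      then obtain \<sigma>1 where "\<sigma>1 \<in> F'" "z = zf \<sigma>1" by blast
      then have qz: "qeq q z x" using zf by blast
      then have zE: "z \<notin> E" using x by blast
      have "(\<Sum>\<sigma>\<in>{\<sigma>. \<sigma> \<in> F' \<and> zf \<sigma> = z}. Poly_Mapping.lookup c \<sigma> * cut q l s \<sigma> x)
        = (\<Sum>\<sigma>\<in>{\<sigma>. \<sigma> \<in> F' \<and> zf \<sigma> = z}. ?g z * (Poly_Mapping.lookup c \<sigma> * frame_sign q (snd \<sigma>)))"
        by (rule sum.cong) (auto simp: cF)
      also have "\<dots> = ?g z * (\<Sum>\<sigma>\<in>{\<sigma>. \<sigma> \<in> F' \<and> zf \<sigma> = z}. Poly_Mapping.lookup c \<sigma> * frame_sign q (snd \<sigma>))"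
        by (rule sum_distrib_left[symmetric])
      also have "(\<Sum>\<sigma>\<in>{\<sigma>. \<sigma> \<in> F' \<and> zf \<sigma> = z}. Poly_Mapping.lookup c \<sigma> * frame_sign q (snd \<sigma>))
        = (\<Sum>\<sigma>\<in>{\<sigma>\<in>Poly_Mapping.keys c. z \<in> fst \<sigma>}. Poly_Mapping.lookup c \<sigma> * frame_sign q (snd \<sigma>))"
      proof (rule sum.mono_neutral_left)
        show "{\<sigma>. \<sigma> \<in> F' \<and> zf \<sigma> = z} \<subseteq> {\<sigma>\<in>Poly_Mapping.keys c. z \<in> fst \<sigma>}"
          using zf by (auto simp: F'_def)
        show "\<forall>\<sigma>\<in>{\<sigma>\<in>Poly_Mapping.keys c. z \<in> fst \<sigma>} - {\<sigma>. \<sigma> \<in> F' \<and> zf \<sigma> = z}. Poly_Mapping.lookup c \<sigma> * frame_sign q (snd \<sigma>) = 0"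
        proof
          fix \<sigma> assume s: "\<sigma> \<in> {\<sigma>\<in>Poly_Mapping.keys c. z \<in> fst \<sigma>} - {\<sigma>. \<sigma> \<in> F' \<and> zf \<sigma> = z}"
          then have "\<sigma> \<notin> F'" using un[of \<sigma> z] qz by auto
          then have "frame_sign q (snd \<sigma>) = 0" using s qz unfolding F'_def by auto
          then show "Poly_Mapping.lookup c \<sigma> * frame_sign q (snd \<sigma>) = 0" by simp
        qed
      qed (use F(1) in simp)
      also have "\<dots> = 0" by (rule E(2)[OF zE q])
      finally show "(\<Sum>\<sigma>\<in>{\<sigma>. \<sigma> \<in> F' \<and> zf \<sigma> = z}. Poly_Mapping.lookup c \<sigma> * cut q l s \<sigma> x) = 0" by simp
    qed simp
    finally show "frag_sum (\<lambda>\<sigma>. cut q l s \<sigma> x) c = 0" by simp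
  qed
qed

section \<open>Slices detect nonoverlapping chains\<close>

lemma AE_ex_open:
  assumes "AE x in lborel. P (x :: real^3)" "open U" "U \<noteq> {}"
  obtains x where "x \<in> U" "P x"
proof -
  have "\<exists>x\<in>U. P x"
  proof (rule ccontr)
    assume "\<not> (\<exists>x\<in>U. P x)"
    then have "AE x in lborel. x \<notin> U" using assms(1) by (auto elim!: AE_mp)
    then have "AE x in lebesgue. x \<notin> U" by (simp add: AE_completion_iff)
    then have "U \<in> null_sets lebesgue"
      using assms(2) by (subst AE_iff_null_sets) auto
    then have "negligible U" by (simp add: negligible_iff_null_sets)
    then show False using open_not_negligible[OF assms(2,3)] by simp
  qed
  then show thesis using that by blast
qed

text \<open>Finitely many hyperplanes do not fill the space.\<close>

lemma exists_separating_functional: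
  assumes "finite W" "0 \<notin> W"
  obtains l :: "real^3" where "\<And>w. w \<in> W \<Longrightarrow> l \<bullet> w \<noteq> 0"
proof -
  have "negligible (\<Union>w\<in>W. {l. w \<bullet> l = 0})"
    using assms by (intro negligible_Union) (auto intro!: negligible_hyperplane)
  then have "(\<Union>w\<in>W. {l. w \<bullet> l = 0}) \<noteq> UNIV" using non_negligible_UNIV by metis
  then obtain l where "l \<notin> (\<Union>w\<in>W. {l. w \<bullet> l = 0})" by blast
  then show thesis using that[of l] by (auto simp: inner_commute)
qed

text \<open>\<open>Z x\<close> is the point where the fibre through \<open>x\<close> meets the plane
  of the cell: the oblique projection of \<open>frame_det_projection\<close>, translated to a base
  point.\<close>

lemma cell_slice_map:
  assumes s: "(A, b) \<in> cells k" and q: "length q = nat k" "frame_sign q b \<noteq> 0"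
  obtains Z where "continuous_on UNIV Z" "\<And>x z. z \<in> A \<and> qeq q z x \<longleftrightarrow> z \<in> A \<and> z = Z x"
    "\<And>x. qeq q (Z x) x" "\<And>x y. x \<in> A \<Longrightarrow> Z y \<in> plane x b"
proof -
  have b: "orthonormal_frame b" "length q = length b" using cellsD[OF s] q by auto
  have d: "frame_det q b \<noteq> 0" using q(2) by (auto simp: frame_sign_def)
  obtain p where p: "p \<in> A" using cellsD(3)[OF s] by auto
  obtain L where L: "linear L" "\<And>x. L x \<in> span (set b)" "\<And>x v. v \<in> set q \<Longrightarrow> v \<bullet> L x = v \<bullet> x"
    by (rule frame_det_projection[OF b d]) (rule that)
  let ?Z = "\<lambda>x. p + L (x - p)"
  have qZ: "qeq q (?Z x) x" for x by (simp add: qeq_def inner_add_right L(3) inner_diff_right)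
  have k: "span (set b) \<inter> qker q = {0}" by (rule span_Int_qker[OF b d])
  have "z = ?Z x" if "z \<in> A" "qeq q z x" for x z
  proof -
    have "z - p \<in> span (set b)" using cell_subset_plane[OF s p] that(1) unfolding plane_alt by blast
    then have "(z - p) - L (x - p) \<in> span (set b)" using L(2) by (rule span_diff)
    then have "z - ?Z x \<in> span (set b)" by (simp add: algebra_simps)
    moreover have "z - ?Z x \<in> qker q"
      unfolding qker_def inner_diff_right using that(2) qZ[of x] by (simp add: qeq_def inner_diff_right)
    ultimately have "z - ?Z x \<in> span (set b) \<inter> qker q" by (rule IntI)
    then show ?thesis unfolding k by simp
  qed
  moreover have "continuous_on UNIV ?Z"
  proof -
    have "bounded_linear L" using L(1) by (simp add: linear_conv_bounded_linear)
    then have "continuous_on UNIV L" by (rule linear_continuous_on)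
    then have "continuous_on UNIV (\<lambda>x. L (x - p))"
      by (rule continuous_on_compose2) (auto intro!: continuous_intros)
    then show ?thesis by (intro continuous_on_add continuous_on_const)
  qed
  moreover have "?Z y \<in> plane x b" if "x \<in> A" for x y
  proof -
    have "plane x b = plane p b" using cell_affine_hull[OF s that] cell_affine_hull[OF s p] by simp
    then show ?thesis using L(2) by (simp add: plane_alt)
  qed
  ultimately show thesis using that[of ?Z] qZ by blast
qed

text \<open>The point where the fibre meets the plane depends continuously on \<open>x\<close>, so
  the slice can jump only when this point crosses the frontier of the cell or the bounding plane of
  the half space. The last two assumptions exclude both at \<open>x\<close>.\<close>

lemma cut_locally_constant:
  assumes s: "(A, b) \<in> cells k" and q: "length q = nat k"
    and fr: "\<And>z. z \<in> closure A - A \<Longrightarrow> \<not> qeq q z x"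
    and l: "\<And>z. z \<in> A \<Longrightarrow> qeq q z x \<Longrightarrow> l \<bullet> z \<noteq> l \<bullet> x + s"
  shows "\<forall>\<^sub>F y in nhds x. cut q l s (A, b) y = cut q l s (A, b) x"
proof (cases "frame_sign q b = 0")
  case True
  then show ?thesis by (simp add: cut_def)
next
  case False
  obtain Z where Z: "continuous_on UNIV Z" "\<And>x z. z \<in> A \<and> qeq q z x \<longleftrightarrow> z \<in> A \<and> z = Z x"
    "\<And>x. qeq q (Z x) x" "\<And>x y. x \<in> A \<Longrightarrow> Z y \<in> plane x b"
    by (rule cell_slice_map[OF s q False]) (rule that)
  have cut: "cut q l s (A, b) y = (if Z y \<in> A \<and> l \<bullet> Z y < l \<bullet> y + s then frame_sign q b else 0)" for y
  proof -
    have "(\<exists>z\<in>A. qeq q z y \<and> l \<bullet> z < l \<bullet> y + s) \<longleftrightarrow> Z y \<in> A \<and> l \<bullet> Z y < l \<bullet> y + s"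
    proof
      assume "\<exists>z\<in>A. qeq q z y \<and> l \<bullet> z < l \<bullet> y + s"
      then obtain z where "z \<in> A" "qeq q z y" "l \<bullet> z < l \<bullet> y + s" by blast
      then show "Z y \<in> A \<and> l \<bullet> Z y < l \<bullet> y + s" using Z(2)[of z y] by simp
    next
      assume "Z y \<in> A \<and> l \<bullet> Z y < l \<bullet> y + s"
      then show "\<exists>z\<in>A. qeq q z y \<and> l \<bullet> z < l \<bullet> y + s" using Z(3)[of y] by (intro bexI[of _ "Z y"]) auto
    qed
    then show ?thesis by (simp add: cut_def)
  qed
  have tZ: "(Z \<longlongrightarrow> Z x) (nhds x)"
    using Z(1) by (simp add: continuous_on_eq_continuous_at isCont_def tendsto_at_iff_tendsto_nhds)
  show ?thesis
  proof (cases "Z x \<in> A")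
    case True
    obtain T where T: "open T" "A = plane (Z x) b \<inter> T"
      using cell_openin[OF s True] by (auto simp: openin_open)
    have ev: "\<forall>\<^sub>F y in nhds x. Z y \<in> T"
      by (rule topological_tendstoD[OF tZ T(1)]) (use T(2) True in blast)
    have inA: "Z y \<in> A \<longleftrightarrow> Z y \<in> T" for y using T(2) Z(4)[OF True] by blast
    have "l \<bullet> Z x \<noteq> l \<bullet> x + s" using l[OF True Z(3)] .
    then consider "l \<bullet> Z x < l \<bullet> x + s" | "l \<bullet> Z x > l \<bullet> x + s" by linarith
    then show ?thesis
    proof cases
      case 1
      have "\<forall>\<^sub>F y in nhds x. l \<bullet> Z y - (l \<bullet> y + s) < 0"
        by (rule order_tendstoD(2)[of _ "l \<bullet> Z x - (l \<bullet> x + s)"])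
          (use 1 in \<open>auto intro!: tendsto_intros tZ filterlim_ident\<close>)
      with ev show ?thesis by eventually_elim (use 1 True inA in \<open>auto simp: cut\<close>)
    next
      case 2
      have "\<forall>\<^sub>F y in nhds x. l \<bullet> Z y - (l \<bullet> y + s) > 0"
        by (rule order_tendstoD(1)[of _ "l \<bullet> Z x - (l \<bullet> x + s)"])
          (use 2 in \<open>auto intro!: tendsto_intros tZ filterlim_ident\<close>)
      then show ?thesis by eventually_elim (use 2 in \<open>auto simp: cut\<close>)
    qed
  next
    case False
    then have "Z x \<notin> closure A" using fr Z(3) by blast
    then have "\<forall>\<^sub>F y in nhds x. Z y \<in> - closure A"
      by (intro topological_tendstoD[OF tZ]) auto
    then show ?thesis
      by eventually_elim (use False closure_subset[of A] in \<open>auto simp: cut\<close>)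
  qed
qed

lemma frame_sign_self: "orthonormal_frame b \<Longrightarrow> frame_sign b b = 1"
  by (simp add: frame_sign_def frame_det_self)

text \<open>A generic \<open>l\<close> separates the points of \<open>Z\<close>. If the fibre has
  positive dimension, \<open>x\<close> can be slid along it to a level just above the lowest point,
  and the offset is 0. If the fibre is a single point, which takes three covectors,
  \<open>l = 0\<close> and \<open>s = 1\<close> keep that point.\<close>

lemma isolate_point:
  assumes Z: "finite Z" "z0 \<in> Z" "\<And>z. z \<in> Z \<Longrightarrow> qeq q z z0" and q: "length q \<le> 3"
  obtains l s x zs where "zs \<in> Z" "qeq q x zs" "l \<bullet> zs < l \<bullet> x + s"
    "\<And>z. z \<in> Z \<Longrightarrow> z \<noteq> zs \<Longrightarrow> l \<bullet> x + s < l \<bullet> z" "length q \<le> 2 \<Longrightarrow> s = 0"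
proof (cases "qker q = {0}")
  case True
  have zz: "z = z0" if "z \<in> Z" for z
    using Z(3)[OF that] True by (simp add: qeq_qker)
  have len: "\<not> length q \<le> 2"
  proof
    assume "length q \<le> 2"
    moreover have "dim (set q) \<le> length q"
      by (meson card_length dim_le_card' finite_set le_trans)
    ultimately show False using dim_qker[of q] True by simp
  qed
  show thesis
  proof (rule that[of z0 z0 0 1])
    show "0 \<bullet> z0 + 1 < 0 \<bullet> z" if "z \<in> Z" "z \<noteq> z0" for z using zz that by blast
  qed (use Z(2) len in \<open>auto simp: qeq_def\<close>)
next
  case False
  then obtain n where n: "n \<in> qker q" "n \<noteq> 0" using subspace_0[OF subspace_qker] by blast
  \<comment> \<open>The differences make \<open>l\<close> injective on \<open>Z\<close>; the fibre
    direction \<open>n\<close> makes \<open>l\<close> vary along the fibre.\<close>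
  let ?W = "insert n ((\<lambda>(z, y). z - y) ` (Z \<times> Z) - {0})"
  obtain l where l: "\<And>w. w \<in> ?W \<Longrightarrow> l \<bullet> w \<noteq> 0"
    by (rule exists_separating_functional[of ?W]) (use Z(1) n(2) in auto)
  have ln: "l \<bullet> n \<noteq> 0" using l by blast
  have inj: "l \<bullet> z \<noteq> l \<bullet> y" if "z \<in> Z" "y \<in> Z" "z \<noteq> y" for z y
  proof -
    have "z - y \<in> ?W" using that by force
    from l[OF this] show ?thesis by (simp add: inner_diff_right)
  qed
  have "\<exists>zs\<in>Z. \<forall>z\<in>Z. l \<bullet> zs \<le> l \<bullet> z"
    using Z(1,2) ex_is_arg_min_if_finite[of Z "\<lambda>z. l \<bullet> z"] by (auto simp: is_arg_min_linorder)
  then obtain zs where zs: "zs \<in> Z" "\<And>z. z \<in> Z \<Longrightarrow> l \<bullet> zs \<le> l \<bullet> z" by blast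
  \<comment> \<open>At most half of every gap above the lowest point; the 1 keeps the set nonempty
    when there is only one point.\<close>
  define e where "e = Min (insert 1 ((\<lambda>z. (l \<bullet> z - l \<bullet> zs) / 2) ` (Z - {zs})))"
  have gap: "l \<bullet> zs < l \<bullet> z" if "z \<in> Z - {zs}" for z
    using zs(2)[of z] inj[of z zs] that zs(1) by force
  have e: "e > 0" unfolding e_def using Z(1) gap by (subst Min_gr_iff) auto
  have e2: "e \<le> (l \<bullet> z - l \<bullet> zs) / 2" if "z \<in> Z - {zs}" for z
    unfolding e_def using that Z(1) by (intro Min_le) auto
  \<comment> \<open>Moving by this multiple of \<open>n\<close> raises the value of \<open>l\<close>
    by exactly \<open>e\<close>.\<close>
  let ?x = "zs + (e / (l \<bullet> n)) *\<^sub>R n"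
  have lx: "l \<bullet> ?x = l \<bullet> zs + e" using ln by (simp add: inner_add_right)
  show thesis
  proof (rule that[of zs ?x l 0])
    show "qeq q ?x zs" using n(1) by (auto simp: qeq_def qker_def inner_add_right)
    show "l \<bullet> zs < l \<bullet> ?x + 0" using lx e by simp
    show "l \<bullet> ?x + 0 < l \<bullet> z" if "z \<in> Z" "z \<noteq> zs" for z
    proof -
      have "z \<in> Z - {zs}" using that by simp
      then show ?thesis using e2[of z] gap[of z] lx by (simp add: field_simps)
    qed
  qed (use zs in auto)
qed

lemma imul_frame_sign_eq_0_iff: "imul (frame_sign u b) g = 0 \<longleftrightarrow> frame_sign u b = 0 \<or> g = 0"
  by (auto simp: frame_sign_def)

text \<open>Let \<open>q\<close> be the frame of one of the cells.  A generic fibre of \<open>q\<close> meets finitely many cells, in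
  points on which a generic \<open>l\<close> is injective, and a half space isolates the lowest point.  For \<open>k = 3\<close> the
  fibre is a single point and nothing has to be isolated; this is why \<open>s = 0\<close> is possible exactly
  in the dimensions in which boundaries occur.\<close>

lemma exists_nonzero_slice:
  fixes g :: "cell \<Rightarrow> 'g::ab_group_add"
  assumes F: "finite F" "F \<subseteq> cells k" "nonoverlapping k F" "F \<noteq> {}" and g: "\<And>\<sigma>. \<sigma> \<in> F \<Longrightarrow> g \<sigma> \<noteq> 0"
  obtains q l s a U where "length q = nat k" "k \<le> 2 \<Longrightarrow> s = 0" "a \<noteq> 0" "open U" "U \<noteq> {}"
    "\<And>x. x \<in> U \<Longrightarrow> (\<Sum>\<sigma>\<in>F. imul (cut q l s \<sigma> x) (g \<sigma>)) = a"
proof -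
  obtain \<sigma>0 where s0: "\<sigma>0 \<in> F" using F(4) by blast
  then have c0: "(fst \<sigma>0, snd \<sigma>0) \<in> cells k" using F(2) by auto
  define q where "q = snd \<sigma>0"
  have q: "orthonormal_frame q" "int (length q) = k" "length q = nat k" "length q \<le> 3"
    using cellsD[OF c0] orthonormal_frame_length by (auto simp: q_def)
  \<comment> \<open>A fibre that avoids this set meets no frontier, and none of its points lies in
    two cells.\<close>
  define E where "E = (\<Union>\<sigma>\<in>F. closure (fst \<sigma>) - fst \<sigma>) \<union> (\<Union>\<sigma>\<in>F. \<Union>\<tau>\<in>F - {\<sigma>}. fst \<sigma> \<inter> fst \<tau>)"
  have "thin k E"
    unfolding E_def
  proof (intro thin_Un thin_UN F(1))
    fix \<sigma> assume s: "\<sigma> \<in> F"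
    show "thin k (closure (fst \<sigma>) - fst \<sigma>)" using cell_frontier_thin s F(2) by blast
    show "finite (F - {\<sigma>})" using F(1) by simp
    fix \<tau> assume "\<tau> \<in> F - {\<sigma>}"
    then have t: "\<tau> \<in> F" "\<sigma> \<noteq> \<tau>" by auto
    have "aff_dim (fst \<sigma> \<inter> fst \<tau>) < k"
      using F(3)[unfolded nonoverlapping_def, rule_format, OF s t] .
    then show "thin k (fst \<sigma> \<inter> fst \<tau>)" by (rule thin_aff_dim)
  qed
  moreover have "int (dim (set q)) = k" using dim_orthonormal_frame[OF q(1)] q(2) by simp
  ultimately have ae: "AE x in lborel. \<forall>z\<in>E. \<not> qeq q z x" by (intro AE_avoid_thin) simp
  obtain p where p: "p \<in> fst \<sigma>0" using cellsD(3)[OF c0] by auto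
  obtain T where T: "open T" "fst \<sigma>0 = plane p q \<inter> T"
    using cell_openin[OF c0 p] by (auto simp: openin_open q_def)
  \<comment> \<open>An open set of points whose fibres hit the first cell, so that a generic fibre
    with at least one hit can be chosen.\<close>
  let ?V = "{x. proj p q x \<in> T}"
  have "continuous_on UNIV (proj p q)" unfolding proj_def by (intro continuous_intros)
  then have "open ?V" using open_vimage[OF T(1)] by (simp add: vimage_def)
  moreover have "p \<in> ?V" using p T(2) by (simp add: proj_def)
  ultimately obtain x1 where x1: "proj p q x1 \<in> T" "\<forall>z\<in>E. \<not> qeq q z x1"
    using AE_ex_open[OF ae, of ?V] by blast
  let ?z0 = "proj p q x1"
  have z0: "?z0 \<in> fst \<sigma>0" using T(2) x1(1) proj_in_plane by blast
  have qz0: "qeq q ?z0 x1" unfolding qeq_def using proj_inner[OF q(1)] by blast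
  define Z where "Z = {z. \<exists>\<sigma>\<in>F. frame_sign q (snd \<sigma>) \<noteq> 0 \<and> z \<in> fst \<sigma> \<and> qeq q z x1}"
  have f1: "finite Z"
  proof -
    have "Z \<subseteq> (\<lambda>\<sigma>. SOME z. z \<in> fst \<sigma> \<and> qeq q z x1) ` F"
    proof
      fix z assume "z \<in> Z"
      then obtain \<sigma> where s: "\<sigma> \<in> F" "frame_sign q (snd \<sigma>) \<noteq> 0" "z \<in> fst \<sigma>" "qeq q z x1" by (auto simp: Z_def)
      have "(fst \<sigma>, snd \<sigma>) \<in> cells k" using s(1) F(2) by auto
      note un = cell_qeq_unique[OF this q(3) s(2)]
      have "(SOME z. z \<in> fst \<sigma> \<and> qeq q z x1) \<in> fst \<sigma> \<and> qeq q (SOME z. z \<in> fst \<sigma> \<and> qeq q z x1) x1"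
        by (rule someI[of "\<lambda>z. z \<in> fst \<sigma> \<and> qeq q z x1" z]) (use s in auto)
      then have "z = (SOME z. z \<in> fst \<sigma> \<and> qeq q z x1)" using un[of "SOME z. z \<in> fst \<sigma> \<and> qeq q z x1" z x1] s by blast
      then show "z \<in> (\<lambda>\<sigma>. SOME z. z \<in> fst \<sigma> \<and> qeq q z x1) ` F" using s(1) by blast
    qed
    then show ?thesis using F(1) by (rule finite_surj[rotated])
  qed
  have f2: "?z0 \<in> Z"
    unfolding Z_def using s0 z0 qz0 frame_sign_self[OF q(1)]
    by (intro CollectI bexI[of _ \<sigma>0]) (simp_all add: q_def[symmetric])
  have f3: "qeq q z ?z0" if "z \<in> Z" for z using that qz0 by (auto simp: Z_def qeq_def)
  obtain l s x zs where x: "zs \<in> Z" "qeq q x zs" "l \<bullet> zs < l \<bullet> x + s"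
    "\<And>z. z \<in> Z \<Longrightarrow> z \<noteq> zs \<Longrightarrow> l \<bullet> x + s < l \<bullet> z" "length q \<le> 2 \<Longrightarrow> s = 0"
    by (rule isolate_point[OF f1 f2 _ q(4)], erule f3) (rule that)
  \<comment> \<open>\<open>x\<close> may differ from \<open>x1\<close> but lies on the same fibre,
    so the genericity of \<open>x1\<close> carries over.\<close>
  have xx1: "qeq q z x \<longleftrightarrow> qeq q z x1" for z using x(1,2) by (auto simp: Z_def qeq_def)
  have xE: "\<not> qeq q z x" if "z \<in> E" for z using x1(2) that xx1 by blast
  obtain \<sigma>s where ss: "\<sigma>s \<in> F" "frame_sign q (snd \<sigma>s) \<noteq> 0" "zs \<in> fst \<sigma>s" "qeq q zs x1"
    using x(1) by (auto simp: Z_def)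
  have cs: "cut q l s \<sigma> x = (if \<sigma> = \<sigma>s then frame_sign q (snd \<sigma>s) else 0)" if s: "\<sigma> \<in> F" for \<sigma>
  proof (cases "\<sigma> = \<sigma>s")
    case True
    then show ?thesis using ss x(3) xx1 by (auto simp: cut_def)
  next
    case False
    have "frame_sign q (snd \<sigma>) = 0" if z: "z \<in> fst \<sigma>" "qeq q z x" "l \<bullet> z < l \<bullet> x + s" for z
    proof (rule ccontr)
      assume "frame_sign q (snd \<sigma>) \<noteq> 0"
      then have "z \<in> Z" using s z xx1 by (auto simp: Z_def)
      then have "z = zs" using x(4)[of z] z(3) by force
      then have "zs \<in> E" using False s ss(1,3) z(1) unfolding E_def by blast
      then show False using xE ss(4) xx1 by blast
    qed
    then show ?thesis using False by (auto simp: cut_def)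
  qed
  have "\<forall>\<^sub>F y in nhds x. cut q l s \<sigma> y = cut q l s \<sigma> x" if s: "\<sigma> \<in> F" for \<sigma>
  proof (cases "frame_sign q (snd \<sigma>) = 0")
    case True
    then show ?thesis by (simp add: cut_def)
  next
    case False
    have "(fst \<sigma>, snd \<sigma>) \<in> cells k" using s F(2) by auto
    then have "\<forall>\<^sub>F y in nhds x. cut q l s (fst \<sigma>, snd \<sigma>) y = cut q l s (fst \<sigma>, snd \<sigma>) x"
    proof (rule cut_locally_constant[OF _ q(3)])
      show "\<not> qeq q z x" if "z \<in> closure (fst \<sigma>) - fst \<sigma>" for z
        by (rule xE) (use that s in \<open>auto simp: E_def\<close>)
      show "l \<bullet> z \<noteq> l \<bullet> x + s" if "z \<in> fst \<sigma>" "qeq q z x" for z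
      proof -
        have "z \<in> Z" using that s False xx1 by (auto simp: Z_def)
        then show ?thesis using x(3) x(4)[of z] by (cases "z = zs") auto
      qed
    qed
    then show ?thesis by simp
  qed
  then have "\<forall>\<^sub>F y in nhds x. \<forall>\<sigma>\<in>F. cut q l s \<sigma> y = cut q l s \<sigma> x"
    using F(1) by (simp add: eventually_ball_finite_distrib)
  then obtain U where U: "open U" "x \<in> U" "\<And>y. y \<in> U \<Longrightarrow> \<forall>\<sigma>\<in>F. cut q l s \<sigma> y = cut q l s \<sigma> x"
    unfolding eventually_nhds by blast
  show thesis
  proof (rule that[of q s "imul (frame_sign q (snd \<sigma>s)) (g \<sigma>s)" U l])
    show "imul (frame_sign q (snd \<sigma>s)) (g \<sigma>s) \<noteq> 0" using g[OF ss(1)] ss(2) by (simp add: imul_frame_sign_eq_0_iff)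
    fix y assume y: "y \<in> U"
    have "(\<Sum>\<sigma>\<in>F. imul (cut q l s \<sigma> y) (g \<sigma>)) = (\<Sum>\<sigma>\<in>F. if \<sigma> = \<sigma>s then imul (frame_sign q (snd \<sigma>s)) (g \<sigma>s) else 0)"
      by (rule sum.cong) (use U(3)[OF y] cs in auto)
    then show "(\<Sum>\<sigma>\<in>F. imul (cut q l s \<sigma> y) (g \<sigma>)) = imul (frame_sign q (snd \<sigma>s)) (g \<sigma>s)"
      using ss(1) F(1) by simp
  qed (use q x(5) U in auto)
qed

section \<open>Facets of a cell\<close>

lemma exists_frame_affine:
  assumes "affine H" "p \<in> H"
  obtains c where "orthonormal_frame c" "plane p c = H"
proof -
  let ?L = "(\<lambda>x. - p + x) ` H"
  have "subspace ?L" using affine_diffs_subspace[OF assms] .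
  then obtain B where B: "B \<subseteq> ?L" "pairwise orthogonal B" "\<And>x. x \<in> B \<Longrightarrow> norm x = 1"
    "independent B" "card B = dim ?L" "span B = ?L"
    by (rule orthonormal_basis_subspace) (rule that)
  have "finite B" using B(4) by (rule independent_imp_finite)
  then obtain c where c: "set c = B" "distinct c" using finite_distinct_list by blast
  have "orthonormal_frame c"
    unfolding orthonormal_frame_def
  proof (intro allI impI)
    fix i j assume ij: "i < length c" "j < length c"
    show "c ! i \<bullet> c ! j = (if i = j then 1 else 0)"
    proof (cases "i = j")
      case True
      then show ?thesis using B(3)[of "c ! i"] nth_mem[OF ij(1)] c(1) by (simp add: norm_eq_1)
    next
      case False
      then have "c ! i \<noteq> c ! j" using c(2) ij by (simp add: nth_eq_iff_index_eq)
      then show ?thesis using B(2) ij c(1) False unfolding pairwise_def orthogonal_def by auto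
    qed
  qed
  moreover have "plane p c = H" unfolding plane_def c(1) B(6) by (auto simp: image_iff)
  ultimately show thesis by (rule that)
qed

text \<open>In an irredundant description of a polyhedron the relative interior is given by the same
  inequalities made strict.\<close>

lemma polyhedron_rel_interior_cell:
  assumes P: "polyhedron P" "bounded P" "P \<noteq> {}"
  shows "\<exists>c. (rel_interior P, c) \<in> cells (aff_dim P)"
proof -
  obtain F where F: "finite F" "P = affine hull P \<inter> \<Inter>F" "\<And>h. h \<in> F \<Longrightarrow> \<exists>a b. a \<noteq> 0 \<and> h = {x. a \<bullet> x \<le> b}"
    "\<And>F'. F' \<subset> F \<Longrightarrow> P \<subset> affine hull P \<inter> \<Inter>F'"
    using P(1) unfolding polyhedron_Int_affine_minimal by meson
  have "\<forall>h\<in>F. \<exists>ab. fst ab \<noteq> 0 \<and> h = {x. fst ab \<bullet> x \<le> snd ab}" using F(3) by fastforce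
  from bchoice[OF this] obtain ab where ab: "\<And>h. h \<in> F \<Longrightarrow> fst (ab h) \<noteq> 0 \<and> h = {x. fst (ab h) \<bullet> x \<le> snd (ab h)}"
    by blast
  have ri: "rel_interior P = {x \<in> P. \<forall>h\<in>F. fst (ab h) \<bullet> x < snd (ab h)}"
    by (rule rel_interior_polyhedron_explicit[where a = "\<lambda>h. fst (ab h)" and b = "\<lambda>h. snd (ab h)", OF F(1,2) ab F(4)])
  obtain p where p: "p \<in> affine hull P" using P(3) hull_subset[of P affine] by blast
  obtain c where c: "orthonormal_frame c" "plane p c = affine hull P"
    by (rule exists_frame_affine[OF affine_affine_hull p]) (rule that)
  have "(rel_interior P, c) \<in> cells (aff_dim P)"
  proof (rule cellI[where p = p and L = "ab ` F"])
    show "int (length c) = aff_dim P"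
      using aff_dim_plane[OF c(1), of p] unfolding c(2) by simp
    show "rel_interior P \<noteq> {}" using P by (simp add: rel_interior_eq_empty polyhedron_imp_convex)
    show "bounded (rel_interior P)" using P(2) rel_interior_subset bounded_subset by blast
    show "rel_interior P = {x \<in> plane p c. \<forall>(a, d)\<in>ab ` F. a \<bullet> x < d}"
    proof (rule Set.set_eqI)
      fix x
      have "x \<in> P" if "x \<in> affine hull P" "\<forall>h\<in>F. fst (ab h) \<bullet> x < snd (ab h)"
      proof -
        have "x \<in> h" if "h \<in> F" for h
        proof -
          have "fst (ab h) \<bullet> x \<le> snd (ab h)" using \<open>\<forall>h\<in>F. fst (ab h) \<bullet> x < snd (ab h)\<close> that by force
          then have "x \<in> {x. fst (ab h) \<bullet> x \<le> snd (ab h)}" by simp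
          then show ?thesis using ab[OF that] by blast
        qed
        then have "x \<in> affine hull P \<inter> \<Inter>F" using that(1) by blast
        then show ?thesis using F(2) by blast
      qed
      moreover have "x \<in> affine hull P" if "x \<in> P" using that hull_subset[of P affine] by blast
      ultimately show "x \<in> rel_interior P \<longleftrightarrow> x \<in> {x \<in> plane p c. \<forall>(a, d)\<in>ab ` F. a \<bullet> x < d}"
        unfolding ri c(2) by (auto simp: split_beta)
    qed
  qed (use c F(1) in auto)
  then show ?thesis by blast
qed

lemma cell_closure_polytope: "\<sigma> \<in> cells k \<Longrightarrow> polytope (closure (fst \<sigma>))"
proof -
  assume s: "\<sigma> \<in> cells k"
  obtain p L where pL: "finite L" "fst \<sigma> = {x \<in> plane p (snd \<sigma>). \<forall>(a, c)\<in>L. a \<bullet> x < c}"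
    by (rule cell_presentation_fst[OF s]) (rule that)
  have "closure (fst \<sigma>) = {x \<in> plane p (snd \<sigma>). \<forall>(a, c)\<in>L. a \<bullet> x \<le> c}"
    by (rule cell_closure[OF pL(2,1)]) (use cellsD[OF s] in blast)
  also have "\<dots> = plane p (snd \<sigma>) \<inter> \<Inter>((\<lambda>(a, c). {x. a \<bullet> x \<le> c}) ` L)" by auto
  also have "polyhedron \<dots>"
  proof (rule polyhedron_Int)
    show "polyhedron (plane p (snd \<sigma>))" by (rule affine_imp_polyhedron) simp
    show "polyhedron (\<Inter>((\<lambda>(a, c). {x. a \<bullet> x \<le> c}) ` L))"
      by (rule polyhedron_Inter) (use pL(1) in \<open>auto simp: polyhedron_halfspace_le\<close>)
  qed
  finally show ?thesis
    using cellsD(4)[OF s] by (simp add: polytope_eq_bounded_polyhedron bounded_closure)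
qed

text \<open>This is what makes the choice in \<open>facet_frame\<close> succeed.\<close>

lemma facet_cell:
  assumes s: "\<sigma> \<in> cells k" and F: "F facet_of closure (fst \<sigma>)"
  shows "(rel_interior F, facet_frame F) \<in> cells (k - 1)"
proof -
  have P: "polytope (closure (fst \<sigma>))" by (rule cell_closure_polytope[OF s])
  have pF: "polytope F" using F P by (simp add: facet_of_imp_face_of face_of_polytope_polytope)
  have d: "aff_dim F = k - 1" using F cell_aff_dim[OF s] by (simp add: facet_of_def closure_aff_dim)
  have "\<exists>c. (rel_interior F, c) \<in> cells (aff_dim F)"
    by (rule polyhedron_rel_interior_cell)
      (use pF F in \<open>auto simp: polytope_imp_polyhedron polytope_imp_bounded facet_of_def\<close>)
  then have "(rel_interior F, facet_frame F) \<in> cells (aff_dim F)"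
    unfolding facet_frame_def by (rule someI_ex)
  then show ?thesis unfolding d .
qed

lemma finite_facets: "\<sigma> \<in> cells k \<Longrightarrow> finite {F. F facet_of closure (fst \<sigma>)}"
  using cell_closure_polytope by (intro finite_polyhedron_facets polytope_imp_polyhedron)

lemma orthonormal_frame_Cons:
  assumes "orthonormal_frame c" "n \<bullet> n = 1" "\<And>v. v \<in> set c \<Longrightarrow> n \<bullet> v = 0"
  shows "orthonormal_frame (n # c)"
  unfolding orthonormal_frame_def
proof (intro allI impI)
  have o: "n \<bullet> c ! i = 0" "c ! i \<bullet> n = 0" if "i < length c" for i
    using assms(3)[OF nth_mem[OF that]] inner_commute[of n "c ! i"] by simp_all
  fix i j assume "i < length (n # c)" "j < length (n # c)"
  then show "(n # c) ! i \<bullet> (n # c) ! j = (if i = j then 1 else 0)"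
    using assms(2) orthonormal_frame_inner[OF assms(1)]
    by (cases i; cases j) (simp_all add: o)
qed

lemma cell_rel_interior_closure: "\<sigma> \<in> cells k \<Longrightarrow> rel_interior (closure (fst \<sigma>)) = fst \<sigma>"
  using convex_rel_interior_closure[OF cell_convex] cell_rel_interior by metis

lemma facet_normal_exists:
  assumes s: "(A, b) \<in> cells k" and F: "F facet_of closure A"
  shows "\<exists>n\<in>span (set b). norm n = 1 \<and> (\<forall>x\<in>F. \<forall>y\<in>F. n \<bullet> (x - y) = 0) \<and> (\<forall>x\<in>F. \<forall>y\<in>A. n \<bullet> (y - x) < 0)"
proof -
  have b: "orthonormal_frame b" using cellsD[OF s] by simp
  have cl: "closure A \<subseteq> plane p b" if "p \<in> A" for p
    by (rule closure_minimal) (use cell_subset_plane[OF s that] in auto)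
  obtain p where p: "p \<in> A" using cellsD(3)[OF s] by auto
  have "polyhedron (closure A)" using cell_closure_polytope[OF s] by (simp add: polytope_imp_polyhedron)
  then obtain a c where ac: "a \<noteq> 0" "closure A \<subseteq> {x. a \<bullet> x \<le> c}" "F = closure A \<inter> {x. a \<bullet> x = c}"
    using facet_of_polyhedron[OF _ F] by metis
  \<comment> \<open>The part of the supporting functional along the plane. It has the same values on
    differences of points of the closure and can be scaled to norm 1.\<close>
  define a' where "a' = (\<Sum>i<length b. (a \<bullet> b ! i) *\<^sub>R b ! i)"
  have a's: "a' \<in> span (set b)" unfolding a'_def by (intro span_sum span_scale span_base) auto
  have a': "a' \<bullet> u = a \<bullet> u" if "u \<in> span (set b)" for u
  proof -
    have "a \<bullet> u = a \<bullet> (\<Sum>i<length b. (u \<bullet> b ! i) *\<^sub>R b ! i)" using orthonormal_frame_expand[OF b that] by simp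
    also have "\<dots> = (\<Sum>i<length b. (u \<bullet> b ! i) * (a \<bullet> b ! i))" by (simp add: inner_sum_right)
    also have "\<dots> = a' \<bullet> u" unfolding a'_def by (simp add: inner_sum_left inner_commute[of u] mult.commute)
    finally show ?thesis by simp
  qed
  have dif: "x - y \<in> span (set b)" if "x \<in> closure A" "y \<in> closure A" for x y
  proof -
    have "(x - p) - (y - p) \<in> span (set b)"
      by (rule span_diff) (use cl[OF p] that in \<open>auto simp: plane_alt\<close>)
    then show ?thesis by simp
  qed
  have FA: "F \<subseteq> closure A" using F by (rule facet_of_imp_subset)
  \<comment> \<open>Equality would put \<open>y\<close> into a proper face, but it lies in the
    relative interior of the closure.\<close>
  have lt: "a \<bullet> y < c" if y: "y \<in> A" for y
  proof (rule ccontr)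
    assume "\<not> a \<bullet> y < c"
    moreover have yc: "y \<in> closure A" using y closure_subset by blast
    ultimately have "y \<in> F" using ac(2,3) by force
    moreover have "y \<in> rel_interior (closure A)" using cell_rel_interior_closure[OF s] y by simp
    moreover have "F face_of closure A" using F by (rule facet_of_imp_face_of)
    moreover have "F \<noteq> closure A" using F by (auto simp: facet_of_def)
    ultimately show False using face_of_disjoint_rel_interior by blast
  qed
  obtain z where z: "z \<in> F" using F by (auto simp: facet_of_def)
  have az: "a \<bullet> z = c" using z ac(3) by blast
  have zA: "z \<in> closure A" "p \<in> closure A" using z FA p closure_subset by blast+
  have "a' \<bullet> (p - z) < 0" using a'[OF dif[OF zA(2,1)]] lt[OF p] az by (simp add: inner_diff_right)
  then have n0: "a' \<noteq> 0" by auto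
  show ?thesis
  proof (intro bexI[of _ "a' /\<^sub>R norm a'"] conjI ballI)
    show "a' /\<^sub>R norm a' \<in> span (set b)" using a's by (rule span_scale)
    show "norm (a' /\<^sub>R norm a') = 1" using n0 by simp
    show "(a' /\<^sub>R norm a') \<bullet> (x - y) = 0" if "x \<in> F" "y \<in> F" for x y
    proof -
      have "x \<in> closure A" "y \<in> closure A" "a \<bullet> x = c" "a \<bullet> y = c" using that FA ac(3) by auto
      then have "a' \<bullet> (x - y) = 0" using a'[OF dif, of x y] by (simp add: inner_diff_right)
      then show ?thesis by simp
    qed
    show "(a' /\<^sub>R norm a') \<bullet> (y - x) < 0" if "x \<in> F" "y \<in> A" for x y
    proof -
      have "x \<in> closure A" "a \<bullet> x = c" using that FA ac(3) by auto
      moreover have "y \<in> closure A" using that closure_subset by blast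
      ultimately have "a' \<bullet> (y - x) < 0" using a'[OF dif, of y x] lt[OF that(2)] by (simp add: inner_diff_right)
      then show ?thesis using n0 by (simp add: mult_less_0_iff field_simps)
    qed
  qed
qed

text \<open>Justifies the definite description in \<open>outward_normal\<close>. Every candidate is
  orthogonal to the frame of the facet, so within the direction space of the cell two candidates are
  parallel; as both point away from the cell, they agree.\<close>

lemma facet_structure:
  assumes s: "(A, b) \<in> cells k" and F: "F facet_of closure A"
  defines "n \<equiv> outward_normal (A, b) F" and "c \<equiv> facet_frame F"
  shows "n \<in> span (set b)" "n \<bullet> n = 1" "\<And>x y. x \<in> F \<Longrightarrow> y \<in> A \<Longrightarrow> n \<bullet> (y - x) < 0"
    "\<And>v. v \<in> set c \<Longrightarrow> n \<bullet> v = 0" "orthonormal_frame (n # c)" "span (set (n # c)) = span (set b)"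
    "length b = Suc (length c)"
proof -
  let ?N = "\<lambda>n. n \<in> span (set b) \<and> norm n = 1 \<and> (\<forall>x\<in>F. \<forall>y\<in>F. n \<bullet> (x - y) = 0) \<and> (\<forall>x\<in>F. \<forall>y\<in>A. n \<bullet> (y - x) < 0)"
  have cc: "(rel_interior F, c) \<in> cells (k - 1)" unfolding c_def using facet_cell[OF s] F by simp
  have b: "orthonormal_frame b" "int (length b) = k" using cellsD[OF s] by auto
  have c: "orthonormal_frame c" "int (length c) = k - 1" using cellsD[OF cc] by auto
  show l: "length b = Suc (length c)" using b c by linarith
  obtain z where z: "z \<in> rel_interior F" using cellsD(3)[OF cc] by auto
  then have zF: "z \<in> F" using rel_interior_subset by blast
  obtain d where d: "d > 0" "\<And>y. y \<in> plane z c \<Longrightarrow> dist z y < d \<Longrightarrow> y \<in> rel_interior F"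
    by (rule cell_ball[OF cc z]) (rule that)
  \<comment> \<open>The facet contains a small step along each vector of its frame, so orthogonality
    to the facet becomes orthogonality to the frame.\<close>
  have zc: "z + (d / 2) *\<^sub>R v \<in> F" if "v \<in> set c" for v
  proof -
    have "norm v = 1" by (rule orthonormal_frame_norm[OF c(1) that])
    then have "z + (d / 2) *\<^sub>R v \<in> rel_interior F"
      by (intro d(2)) (use d(1) that in \<open>auto simp: plane_alt dist_norm span_scale span_base\<close>)
    then show ?thesis using rel_interior_subset by blast
  qed
  have N: "m \<bullet> m = 1" "\<And>v. v \<in> set c \<Longrightarrow> m \<bullet> v = 0" "orthonormal_frame (m # c)" "span (set (m # c)) = span (set b)"
    if m: "?N m" for m
  proof -
    show m1: "m \<bullet> m = 1" using m by (simp add: norm_eq_1)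
    show m2: "m \<bullet> v = 0" if "v \<in> set c" for v
    proof -
      have "m \<bullet> ((z + (d / 2) *\<^sub>R v) - z) = 0" using m zc[OF that] zF by blast
      then show ?thesis using d(1) by simp
    qed
    show m3: "orthonormal_frame (m # c)" by (rule orthonormal_frame_Cons[OF c(1) m1 m2])
    have "set c \<subseteq> span (set b)"
    proof
      fix v assume v: "v \<in> set c"
      obtain p where p: "p \<in> A" using cellsD(3)[OF s] by auto
      have "closure A \<subseteq> plane p b"
        by (rule closure_minimal) (use cell_subset_plane[OF s p] in auto)
      then have "F \<subseteq> plane p b" using F facet_of_imp_subset by blast
      then have "(z + (d / 2) *\<^sub>R v) - p \<in> span (set b)" "z - p \<in> span (set b)"
        using zc[OF v] zF by (auto simp: plane_alt)
      then have "((z + (d / 2) *\<^sub>R v) - p) - (z - p) \<in> span (set b)" by (rule span_diff)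
      then have "(d / 2) *\<^sub>R v \<in> span (set b)" by simp
      from span_scale[OF this, of "2 / d"] show "v \<in> span (set b)" using d(1) by simp
    qed
    then have "span (set (m # c)) \<subseteq> span (set b)" using m by (intro span_minimal) auto
    moreover have "dim (span (set b)) \<le> dim (span (set (m # c)))"
      unfolding dim_orthonormal_frame[OF b(1)] dim_orthonormal_frame[OF m3] using l by simp
    ultimately show "span (set (m # c)) = span (set b)"
      by (intro subspace_dim_equal subspace_span)
  qed
  have "\<exists>!m. ?N m"
  proof (rule ex_ex1I)
    show "\<exists>m. ?N m" using facet_normal_exists[OF s F] by blast
    fix m m' assume m: "?N m" "?N m'"
    have "m' \<in> span (set (m # c))" using N(4)[OF m(1)] m(2) by blast
    then have "m' = (\<Sum>i<length (m # c). (m' \<bullet> (m # c) ! i) *\<^sub>R (m # c) ! i)"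
      by (rule orthonormal_frame_expand[OF N(3)[OF m(1)]])
    also have "\<dots> = (m' \<bullet> m) *\<^sub>R m + (\<Sum>i<length c. (m' \<bullet> c ! i) *\<^sub>R c ! i)"
      by (simp add: sum.lessThan_Suc_shift del: sum.lessThan_Suc)
    also have "(\<Sum>i<length c. (m' \<bullet> c ! i) *\<^sub>R c ! i) = 0"
      by (intro sum.neutral) (simp add: N(2)[OF m(2)])
    finally have e: "m' = (m' \<bullet> m) *\<^sub>R m" by simp
    obtain y where y: "y \<in> A" using cellsD(3)[OF s] by auto
    have "m \<bullet> (y - z) < 0" "m' \<bullet> (y - z) < 0" using m y zF by blast+
    moreover have "m' \<bullet> (y - z) = (m' \<bullet> m) * (m \<bullet> (y - z))"
      by (subst e) simp
    ultimately have "m' \<bullet> m > 0" by (metis mult_neg_neg mult_nonpos_nonpos not_less order_less_imp_le)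
    moreover have "\<bar>m' \<bullet> m\<bar> = 1"
    proof -
      have "norm m' = \<bar>m' \<bullet> m\<bar> * norm m" using arg_cong[OF e, of norm] by simp
      then show ?thesis using m by simp
    qed
    ultimately have "m' \<bullet> m = 1" by simp
    then show "m = m'" using e by simp
  qed
  then have "?N n" unfolding n_def outward_normal_def prod.case by (rule theI')
  then show "n \<in> span (set b)" "\<And>x y. x \<in> F \<Longrightarrow> y \<in> A \<Longrightarrow> n \<bullet> (y - x) < 0" by blast+
  show "n \<bullet> n = 1" "\<And>v. v \<in> set c \<Longrightarrow> n \<bullet> v = 0" "orthonormal_frame (n # c)" "span (set (n # c)) = span (set b)"
    using N[OF \<open>?N n\<close>] by blast+
qed

lemma cell_boundary_eq:
  "cell_boundary (A, b) = (\<Sum>F | F facet_of closure A.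
     frag_cmul (if frame_det (outward_normal (A, b) F # facet_frame F) b > 0 then 1 else - 1)
               (frag_of (rel_interior F, facet_frame F)))"
  by (simp add: cell_boundary_def)

lemma keys_cell_boundary:
  assumes s: "\<sigma> \<in> cells k"
  shows "Poly_Mapping.keys (cell_boundary \<sigma>) \<subseteq> cells (k - 1)"
proof -
  obtain A b where A: "\<sigma> = (A, b)" by (cases \<sigma>)
  show ?thesis
    unfolding A cell_boundary_eq
  proof (intro keys_sum_subset keys_cmul_subset)
    fix F assume "F \<in> {F. F facet_of closure A}"
    then have "(rel_interior F, facet_frame F) \<in> cells (k - 1)" using facet_cell[OF s, of F] A by simp
    then show "Poly_Mapping.keys (frag_of (rel_interior F, facet_frame F)) \<subseteq> cells (k - 1)" by simp
  qed
qed

section \<open>Slices of the boundary\<close>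

definition sgni :: "real \<Rightarrow> int" where
  "sgni r = (if r > 0 then 1 else if r < 0 then - 1 else 0)"

lemma frame_sign_sgni: "frame_sign u b = sgni (frame_det u b)"
  by (simp add: frame_sign_def sgni_def)

text \<open>The orientation of the chosen facet frame enters both factors and cancels: write the
  determinant of \<open>q\<close> on the facet as one of \<open>outward_normal (A, b) F # q\<close>
  and compare with \<open>b\<close>. What remains says whether the fibre direction \<open>v\<close>
  leaves or enters the cell through the facet.\<close>

lemma facet_sign:
  assumes s: "(A, b) \<in> cells k" and F: "F facet_of closure A" and q: "length b = Suc (length q)"
    and v: "\<And>w. v \<bullet> w = frame_det (w # q) b"
  shows "(if frame_det (outward_normal (A, b) F # facet_frame F) b > 0 then 1 else - 1) * frame_sign q (facet_frame F)
    = sgni (v \<bullet> outward_normal (A, b) F)"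
proof -
  let ?n = "outward_normal (A, b) F" and ?c = "facet_frame F"
  note fs = facet_structure[OF s F]
  have b: "orthonormal_frame b" using cellsD[OF s] by simp
  have l: "length q = length ?c" "length q \<le> 2" using q fs(7) orthonormal_frame_length[OF b] by auto
  have sub: "set (?n # ?c) \<subseteq> span (set b)" using span_superset[of "set (?n # ?c)"] unfolding fs(6) .
  have "frame_det q ?c = frame_det (?n # q) (?n # ?c)"
    by (rule frame_det_Cons_unit[symmetric]) (use l fs in auto)
  also have "\<dots> = frame_det (?n # q) b * frame_det b (?n # ?c)"
    by (rule frame_det_mult[OF b]) (use q fs(7) sub in auto)
  also have "frame_det b (?n # ?c) = frame_det (?n # ?c) b"
    by (rule frame_det_commute) (use fs(7) orthonormal_frame_length[OF b] in auto)
  finally have e: "frame_det q ?c = (v \<bullet> ?n) * frame_det (?n # ?c) b" unfolding v[of ?n] .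
  have "frame_det (?n # ?c) b = 1 \<or> frame_det (?n # ?c) b = - 1"
    by (rule frame_det_pm1[OF fs(5) b fs(6)])
  then show ?thesis unfolding frame_sign_def e sgni_def by auto
qed

lemma frame_det_repeat:
  assumes "length b = Suc (length q)" "length b \<le> 3" "w \<in> set q"
  shows "frame_det (w # q) b = 0"
proof -
  have q: "length q \<le> 3" using assms by simp
  show ?thesis
    by (rule list_le3_cases[OF assms(2)]; rule list_le3_cases[OF q]; insert assms)
      (auto simp: algebra_simps)
qed

text \<open>If \<open>u\<close> had a component orthogonal to \<open>v\<close>, that component would
  be annihilated by all of \<open>v # q\<close>, so the determinant \<open>v \<bullet> v\<close>
  would vanish.\<close>

lemma cofactor_kernel:
  assumes b: "orthonormal_frame b" "length b = Suc (length q)"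
    and v: "v \<in> span (set b)" "\<And>w. v \<bullet> w = frame_det (w # q) b" "v \<noteq> 0"
    and u: "u \<in> span (set b)" "u \<in> qker q"
  obtains t where "u = t *\<^sub>R v"
proof -
  let ?t = "(u \<bullet> v) / (v \<bullet> v)"
  have vv: "v \<bullet> v \<noteq> 0" using v(3) by simp
  have vq: "w \<bullet> v = 0" if "w \<in> set q" for w
    using v(2)[of w] frame_det_repeat[OF b(2) orthonormal_frame_length[OF b(1)] that] by (simp add: inner_commute)
  have "u - ?t *\<^sub>R v = 0"
  proof (rule ccontr)
    assume n: "u - ?t *\<^sub>R v \<noteq> 0"
    have "frame_det (v # q) b = 0"
    proof (rule frame_det_kernel[OF b(1) _ _ n])
      show "u - ?t *\<^sub>R v \<in> span (set b)" by (intro span_diff span_scale u v)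
      fix w assume "w \<in> set (v # q)"
      then show "w \<bullet> (u - ?t *\<^sub>R v) = 0"
        using vq[of w] u(2) vv by (auto simp: inner_diff_right qker_def inner_commute)
    qed (use b in simp)
    then show False using v(2)[of v] vv by simp
  qed
  then show thesis using that[of ?t] by simp
qed

text \<open>The fibre in the closed cell is a compact segment in direction \<open>v\<close>. Its
  ends maximize and minimize \<open>v\<close>, genericity puts them into relative interiors of
  facets, and convexity makes them the only points where the line leaves and enters. The case
  distinction on \<open>l\<close> says when the segment crosses the level of
  \<open>x\<close>.\<close>

lemma line_through_cell:
  assumes s: "(A, b) \<in> cells k" and q: "length b = Suc (length q)"
    and v: "v \<in> span (set b)" "\<And>w. v \<bullet> w = frame_det (w # q) b" "v \<noteq> 0"
    and E: "\<And>F z. F facet_of closure A \<Longrightarrow> z \<in> F - rel_interior F \<Longrightarrow> \<not> qeq q z x"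
    and y: "y \<in> A" "qeq q y x"
  obtains F1 F2 z1 z2 where
    "F1 facet_of closure A" "F2 facet_of closure A" "z1 \<in> rel_interior F1" "z2 \<in> rel_interior F2"
    "qeq q z1 x" "qeq q z2 x" "v \<bullet> outward_normal (A, b) F1 > 0" "v \<bullet> outward_normal (A, b) F2 < 0"
    "\<And>F z. F facet_of closure A \<Longrightarrow> z \<in> rel_interior F \<Longrightarrow> qeq q z x \<Longrightarrow> v \<bullet> outward_normal (A, b) F > 0 \<Longrightarrow> z = z1 \<and> F = F1"
    "\<And>F z. F facet_of closure A \<Longrightarrow> z \<in> rel_interior F \<Longrightarrow> qeq q z x \<Longrightarrow> v \<bullet> outward_normal (A, b) F < 0 \<Longrightarrow> z = z2 \<and> F = F2"
    "\<And>l. (\<exists>z\<in>A. qeq q z x \<and> l \<bullet> z = l \<bullet> x) \<longleftrightarrow>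
       (if l \<bullet> v > 0 then l \<bullet> z2 < l \<bullet> x \<and> l \<bullet> x < l \<bullet> z1
        else if l \<bullet> v < 0 then l \<bullet> z1 < l \<bullet> x \<and> l \<bullet> x < l \<bullet> z2 else l \<bullet> x = l \<bullet> y)"
    "\<And>l. l \<bullet> v = 0 \<Longrightarrow> l \<bullet> z1 = l \<bullet> z2" "\<And>l. l \<bullet> v > 0 \<Longrightarrow> l \<bullet> z2 < l \<bullet> z1"
    "\<And>l. l \<bullet> v < 0 \<Longrightarrow> l \<bullet> z1 < l \<bullet> z2"
proof -
  have b: "orthonormal_frame b" using cellsD[OF s] by simp
  have vv: "v \<bullet> v > 0" using v(3) by simp
  have vq: "w \<bullet> v = 0" if "w \<in> set q" for w
    using v(2)[of w] frame_det_repeat[OF q orthonormal_frame_length[OF b] that] by (simp add: inner_commute)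
  have cl: "closure A \<subseteq> plane y b"
    by (rule closure_minimal) (use cell_subset_plane[OF s y(1)] in auto)
  have Acl: "A \<subseteq> closure A" by (rule closure_subset)
  define N where "N = {z \<in> closure A. qeq q z x}"
  have yN: "y \<in> N" using y Acl by (auto simp: N_def)
  have line: "\<exists>t. z = y + t *\<^sub>R v" if "z \<in> N" for z
  proof -
    have "z - y \<in> span (set b)" using that cl by (auto simp: N_def plane_alt)
    moreover have "z - y \<in> qker q" using that y(2) by (auto simp: N_def qeq_def qker_def inner_diff_right)
    ultimately obtain t where "z - y = t *\<^sub>R v" by (rule cofactor_kernel[OF b q v]) (rule that)
    then show ?thesis by (intro exI[of _ t]) (simp add: algebra_simps)
  qed
  have qv: "qeq q (y + t *\<^sub>R v) x" for t using y(2) vq by (simp add: qeq_def inner_add_right)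
  have "closed N"
  proof -
    have "N = closure A \<inter> (\<Inter>w\<in>set q. {z. w \<bullet> z = w \<bullet> x})" by (auto simp: N_def qeq_def)
    also have "closed \<dots>" by (intro closed_Int closed_INT) (auto simp: closed_hyperplane)
    finally show ?thesis .
  qed
  moreover have "bounded N" using cellsD(4)[OF s] by (auto simp: N_def intro: bounded_subset)
  ultimately have cN: "compact N" by (simp add: compact_eq_bounded_closed)
  have cont: "continuous_on N ((\<bullet>) v)" by (intro continuous_intros)
  have Nne: "N \<noteq> {}" using yN by blast
  obtain z1 where z1: "z1 \<in> N" "\<And>z. z \<in> N \<Longrightarrow> v \<bullet> z \<le> v \<bullet> z1"
    using continuous_attains_sup[OF cN Nne cont] by auto
  obtain z2 where z2: "z2 \<in> N" "\<And>z. z \<in> N \<Longrightarrow> v \<bullet> z2 \<le> v \<bullet> z"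
    using continuous_attains_inf[OF cN Nne cont] by auto
  have move: "\<exists>e>0. \<forall>t. \<bar>t\<bar> < e \<longrightarrow> z + t *\<^sub>R v \<in> A" if z: "z \<in> A" for z
  proof -
    obtain d where d: "d > 0" "\<And>w. w \<in> plane z b \<Longrightarrow> dist z w < d \<Longrightarrow> w \<in> A"
      by (rule cell_ball[OF s z]) (rule that)
    have "z + t *\<^sub>R v \<in> A" if "\<bar>t\<bar> < d / norm v" for t
    proof (rule d(2))
      show "z + t *\<^sub>R v \<in> plane z b" using v(1) by (simp add: plane_alt span_scale)
      show "dist z (z + t *\<^sub>R v) < d" using that v(3) by (simp add: dist_norm field_simps)
    qed
    then show ?thesis using d(1) v(3) by (intro exI[of _ "d / norm v"]) auto
  qed
  \<comment> \<open>From a point of the open cell one can move both ways along the line, so neither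
    extremum is attained in \<open>A\<close>.\<close>
  have inA: "\<exists>z\<in>N. v \<bullet> z > v \<bullet> w" "\<exists>z\<in>N. v \<bullet> z < v \<bullet> w" if w: "w \<in> A" "qeq q w x" for w
  proof -
    obtain e where e: "e > 0" "\<And>t. \<bar>t\<bar> < e \<Longrightarrow> w + t *\<^sub>R v \<in> A" using move[OF w(1)] by blast
    have m: "w + t *\<^sub>R v \<in> N" if "\<bar>t\<bar> < e" for t
    proof -
      have "qeq q (w + t *\<^sub>R v) x" using w(2) vq by (simp add: qeq_def inner_add_right)
      then show ?thesis using e(2)[OF that] Acl by (auto simp: N_def)
    qed
    have 1: "w + (e / 2) *\<^sub>R v \<in> N" "w + (- (e / 2)) *\<^sub>R v \<in> N" by (rule m; use e(1) in simp)+
    show "\<exists>z\<in>N. v \<bullet> z > v \<bullet> w"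
      by (rule bexI[OF _ 1(1)]) (use e(1) vv in \<open>simp add: inner_add_right\<close>)
    show "\<exists>z\<in>N. v \<bullet> z < v \<bullet> w"
      by (rule bexI[OF _ 1(2)]) (use e(1) vv in \<open>simp add: inner_diff_right\<close>)
  qed
  have facet: "\<exists>F. F facet_of closure A \<and> z \<in> rel_interior F" if z: "z \<in> N" "z \<notin> A" for z
  proof -
    have "z \<in> closure A - rel_interior (closure A)"
      using z cell_rel_interior_closure[OF s] by (auto simp: N_def)
    also have "\<dots> = \<Union> {F. F facet_of closure A}"
      using cell_closure_polytope[OF s] by (intro rel_boundary_of_polyhedron polytope_imp_polyhedron) simp
    finally obtain F where F: "F facet_of closure A" "z \<in> F" by blast
    then have "z \<in> rel_interior F" using E[OF F(1), of z] z by (auto simp: N_def)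
    then show ?thesis using F by blast
  qed
  have z1A: "z1 \<notin> A" using inA(1)[of z1] z1 by (force simp: N_def)
  have z2A: "z2 \<notin> A" using inA(2)[of z2] z2 by (force simp: N_def)
  obtain F1 where F1: "F1 facet_of closure A" "z1 \<in> rel_interior F1" using facet[OF z1(1) z1A] by blast
  obtain F2 where F2: "F2 facet_of closure A" "z2 \<in> rel_interior F2" using facet[OF z2(1) z2A] by blast
  obtain t1 where t1: "z1 = y + t1 *\<^sub>R v" using line[OF z1(1)] by blast
  obtain t2 where t2: "z2 = y + t2 *\<^sub>R v" using line[OF z2(1)] by blast
  have "v \<bullet> y < v \<bullet> z1" using inA(1)[OF y] z1(2) by force
  then have t1p: "t1 > 0" unfolding t1 using vv by (simp add: inner_add_right zero_less_mult_iff)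
  have "v \<bullet> z2 < v \<bullet> y" using inA(2)[OF y] z2(2) by force
  then have t2n: "t2 < 0" unfolding t2 using vv by (simp add: inner_add_right mult_less_0_iff)
  have p1: "v \<bullet> outward_normal (A, b) F1 > 0"
  proof -
    have "outward_normal (A, b) F1 \<bullet> (y - z1) < 0"
      by (rule facet_structure(3)[OF s F1(1) _ y(1)]) (use F1(2) rel_interior_subset in blast)
    then have "t1 * (outward_normal (A, b) F1 \<bullet> v) > 0" unfolding t1 by simp
    then show ?thesis using t1p by (simp add: zero_less_mult_iff inner_commute)
  qed
  have p2: "v \<bullet> outward_normal (A, b) F2 < 0"
  proof -
    have "outward_normal (A, b) F2 \<bullet> (y - z2) < 0"
      by (rule facet_structure(3)[OF s F2(1) _ y(1)]) (use F2(2) rel_interior_subset in blast)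
    then have "t2 * (outward_normal (A, b) F2 \<bullet> v) > 0" unfolding t2 by simp
    then show ?thesis using t2n by (simp add: zero_less_mult_iff inner_commute)
  qed
  have FN: "z \<in> N \<and> z \<in> F" if "F facet_of closure A" "z \<in> rel_interior F" "qeq q z x" for F z
    using that rel_interior_subset[of F] facet_of_imp_subset[of F] by (auto simp: N_def)
  have facet_le: "outward_normal (A, b) F \<bullet> (w - z) \<le> 0" if F: "F facet_of closure A" "z \<in> F" "w \<in> closure A" for F z w
  proof -
    let ?n = "outward_normal (A, b) F"
    have "closure A \<subseteq> {w. ?n \<bullet> w \<le> ?n \<bullet> z}"
    proof (rule closure_minimal)
      show "A \<subseteq> {w. ?n \<bullet> w \<le> ?n \<bullet> z}"
        using facet_structure(3)[OF s F(1,2)] by (force simp: inner_diff_right)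
    qed (rule closed_halfspace_le)
    then show ?thesis using F(3) by (auto simp: inner_diff_right)
  qed
  have same: "F = G" if "F facet_of closure A" "G facet_of closure A" "z \<in> rel_interior F" "z \<in> rel_interior G" for F G z
    using face_of_eq[of F "closure A" G] that by (auto simp: facet_of_imp_face_of)
  have eqz: "z = w" if zw: "z \<in> N" "w \<in> N" "v \<bullet> z = v \<bullet> w" for z w
  proof -
    obtain t where "z = y + t *\<^sub>R v" using line[OF zw(1)] by blast
    moreover obtain u where "w = y + u *\<^sub>R v" using line[OF zw(2)] by blast
    ultimately show ?thesis using zw(3) vv by (simp add: inner_add_right)
  qed
  \<comment> \<open>The closed cell lies behind the facet \<open>F\<close>. A line that leaves
    through \<open>F\<close> cannot continue in the cell as far as a later \<open>z1\<close>, so the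
    two points coincide.\<close>
  have u1: "z = z1 \<and> F = F1" if F: "F facet_of closure A" "z \<in> rel_interior F" "qeq q z x" "v \<bullet> outward_normal (A, b) F > 0" for F z
  proof -
    have zN: "z \<in> N" "z \<in> F" using FN[OF F(1-3)] by auto
    obtain t where t: "z = y + t *\<^sub>R v" using line[OF zN(1)] by blast
    have "outward_normal (A, b) F \<bullet> (z1 - z) \<le> 0"
      by (rule facet_le[OF F(1) zN(2)]) (use z1(1) in \<open>simp add: N_def\<close>)
    moreover have "z1 - z = (t1 - t) *\<^sub>R v" unfolding t1 t by (simp add: scaleR_diff_left)
    ultimately have "(t1 - t) * (v \<bullet> outward_normal (A, b) F) \<le> 0" by (simp add: inner_commute)
    then have "t1 \<le> t" using F(4) by (simp add: mult_le_0_iff)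
    moreover have "v \<bullet> z \<le> v \<bullet> z1" by (rule z1(2)[OF zN(1)])
    ultimately have "v \<bullet> z = v \<bullet> z1" unfolding t t1 using vv by (simp add: inner_add_right)
    then have "z = z1" by (rule eqz[OF zN(1) z1(1)])
    then show ?thesis using same[OF F(1) F1(1)] F(2) F1(2) by blast
  qed
  have u2: "z = z2 \<and> F = F2" if F: "F facet_of closure A" "z \<in> rel_interior F" "qeq q z x" "v \<bullet> outward_normal (A, b) F < 0" for F z
  proof -
    have zN: "z \<in> N" "z \<in> F" using FN[OF F(1-3)] by auto
    obtain t where t: "z = y + t *\<^sub>R v" using line[OF zN(1)] by blast
    have "outward_normal (A, b) F \<bullet> (z2 - z) \<le> 0"
      by (rule facet_le[OF F(1) zN(2)]) (use z2(1) in \<open>simp add: N_def\<close>)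
    moreover have "z2 - z = (t2 - t) *\<^sub>R v" unfolding t2 t by (simp add: scaleR_diff_left)
    ultimately have "(t2 - t) * (v \<bullet> outward_normal (A, b) F) \<le> 0" by (simp add: inner_commute)
    then have "t \<le> t2" using F(4) by (simp add: mult_le_0_iff)
    moreover have "v \<bullet> z2 \<le> v \<bullet> z" by (rule z2(2)[OF zN(1)])
    ultimately have "v \<bullet> z = v \<bullet> z2" unfolding t t2 using vv by (simp add: inner_add_right)
    then have "z = z2" by (rule eqz[OF zN(1) z2(1)])
    then show ?thesis using same[OF F(1) F2(1)] F(2) F2(2) by blast
  qed
  \<comment> \<open>The points between the ends arise by shrinking an end point towards
    \<open>y\<close>, which lies in the relative interior.\<close>
  have seg: "y + t *\<^sub>R v \<in> A \<longleftrightarrow> t2 < t \<and> t < t1" for t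
  proof
    assume a: "y + t *\<^sub>R v \<in> A"
    have "v \<bullet> (y + t *\<^sub>R v) < v \<bullet> z1" "v \<bullet> z2 < v \<bullet> (y + t *\<^sub>R v)"
      using inA[OF a qv] z1(2) z2(2) by force+
    then show "t2 < t \<and> t < t1" unfolding t1 t2 using vv by (simp add: inner_add_right)
  next
    assume t: "t2 < t \<and> t < t1"
    have ri: "y \<in> rel_interior (closure A)" using y(1) cell_rel_interior_closure[OF s] by simp
    have cv: "convex (closure A)" using cell_convex[OF s] by simp
    have sh: "z - e *\<^sub>R (z - y) \<in> A" if "z \<in> N" "0 < e" "e \<le> 1" for z e
    proof -
      have "z - e *\<^sub>R (z - y) \<in> rel_interior (closure A)"
        by (rule rel_interior_closure_convex_shrink[OF cv ri]) (use that in \<open>auto simp: N_def\<close>)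
      then show ?thesis using cell_rel_interior_closure[OF s] by simp
    qed
    show "y + t *\<^sub>R v \<in> A"
    proof (cases "t \<ge> 0")
      case True
      have "z1 - (1 - t / t1) *\<^sub>R (z1 - y) \<in> A"
        by (rule sh[OF z1(1)]) (use t t1p True in auto)
      moreover have "z1 - (1 - t / t1) *\<^sub>R (z1 - y) = y + t *\<^sub>R v"
        unfolding t1 using t1p by (simp add: algebra_simps)
      ultimately show ?thesis by simp
    next
      case False
      have "z2 - (1 - t / t2) *\<^sub>R (z2 - y) \<in> A"
        by (rule sh[OF z2(1)]) (use t t2n False in \<open>auto simp: field_simps\<close>)
      moreover have "z2 - (1 - t / t2) *\<^sub>R (z2 - y) = y + t *\<^sub>R v"
        unfolding t2 using t2n by (simp add: algebra_simps)
      ultimately show ?thesis by simp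
    qed
  qed
  have hit: "(\<exists>z\<in>A. qeq q z x \<and> l \<bullet> z = l \<bullet> x) \<longleftrightarrow>
       (if l \<bullet> v > 0 then l \<bullet> z2 < l \<bullet> x \<and> l \<bullet> x < l \<bullet> z1
        else if l \<bullet> v < 0 then l \<bullet> z1 < l \<bullet> x \<and> l \<bullet> x < l \<bullet> z2 else l \<bullet> x = l \<bullet> y)" (is "?L \<longleftrightarrow> ?R") for l
  proof -
    have "?L \<longleftrightarrow> (\<exists>t. t2 < t \<and> t < t1 \<and> l \<bullet> y + t * (l \<bullet> v) = l \<bullet> x)"
    proof
      assume ?L
      then obtain z where z: "z \<in> A" "qeq q z x" "l \<bullet> z = l \<bullet> x" by blast
      then have "z \<in> N" using Acl by (auto simp: N_def)
      then obtain t where "z = y + t *\<^sub>R v" using line by blast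
      then show "\<exists>t. t2 < t \<and> t < t1 \<and> l \<bullet> y + t * (l \<bullet> v) = l \<bullet> x"
        using z seg[of t] by (intro exI[of _ t]) (auto simp: inner_add_right)
    next
      assume "\<exists>t. t2 < t \<and> t < t1 \<and> l \<bullet> y + t * (l \<bullet> v) = l \<bullet> x"
      then obtain t where "t2 < t \<and> t < t1" "l \<bullet> y + t * (l \<bullet> v) = l \<bullet> x" by blast
      then show ?L using seg[of t] qv[of t] by (intro bexI[of _ "y + t *\<^sub>R v"]) (auto simp: inner_add_right)
    qed
    also have "\<dots> \<longleftrightarrow> ?R"
    proof (cases "l \<bullet> v = 0")
      case True
      then show ?thesis using t1p t2n by (auto intro!: exI[of _ 0])
    next
      case False
      then have "(\<exists>t. t2 < t \<and> t < t1 \<and> l \<bullet> y + t * (l \<bullet> v) = l \<bullet> x) \<longleftrightarrow> t2 < (l \<bullet> x - l \<bullet> y) / (l \<bullet> v) \<and> (l \<bullet> x - l \<bullet> y) / (l \<bullet> v) < t1"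
      proof -
        have "l \<bullet> y + t * (l \<bullet> v) = l \<bullet> x \<longleftrightarrow> t = (l \<bullet> x - l \<bullet> y) / (l \<bullet> v)" for t
          using False by (auto simp: field_simps)
        then show ?thesis by simp
      qed
      also have "\<dots> \<longleftrightarrow> ?R"
        unfolding t1 t2 using False by (auto simp: inner_add_right field_simps)
      finally show ?thesis .
    qed
    finally show ?thesis .
  qed
  have lz: "l \<bullet> z1 = l \<bullet> z2" if "l \<bullet> v = 0" for l
    unfolding t1 t2 using that by (simp add: inner_add_right)
  have t12: "t2 < t1" using t1p t2n by linarith
  have lp: "l \<bullet> z2 < l \<bullet> z1" if "l \<bullet> v > 0" for l
    unfolding t1 t2 using that t12 by (simp add: inner_add_right)
  have ln: "l \<bullet> z1 < l \<bullet> z2" if "l \<bullet> v < 0" for l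
    unfolding t1 t2 using that t12 by (simp add: inner_add_right)
  show thesis
    by (rule that[OF F1(1) F2(1) F1(2) F2(2) _ _ p1 p2 u1 u2 hit lz lp ln])
      (use z1(1) z2(1) in \<open>auto simp: N_def\<close>)
qed

text \<open>Split the inward direction \<open>u\<close> into a part \<open>w\<close> tangential to
  the facet and a positive multiple of \<open>y - z\<close> with \<open>y\<close> in the cell. A
  small step along \<open>w\<close> stays in the facet, and shrinking towards \<open>y\<close> then
  enters the cell.\<close>

lemma enter_cell:
  assumes s: "(A, b) \<in> cells k" and F: "F facet_of closure A" and z: "z \<in> rel_interior F"
    and u: "u \<in> span (set b)" "outward_normal (A, b) F \<bullet> u < 0"
  shows "\<exists>t. z + t *\<^sub>R u \<in> A"
proof -
  let ?n = "outward_normal (A, b) F" and ?c = "facet_frame F"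
  note fs = facet_structure[OF s F]
  have cc: "(rel_interior F, ?c) \<in> cells (k - 1)" using facet_cell[OF s] F by simp
  obtain y where y: "y \<in> A" using cellsD(3)[OF s] by auto
  have zF: "z \<in> F" using z rel_interior_subset by blast
  have ny: "?n \<bullet> (y - z) < 0" by (rule fs(3)[OF zF y])
  \<comment> \<open>The multiple for which the remainder is orthogonal to the normal.\<close>
  define a where "a = (?n \<bullet> u) / (?n \<bullet> (y - z))"
  have a: "a > 0" unfolding a_def using u(2) ny by (simp add: divide_neg_neg)
  define w where "w = u - a *\<^sub>R (y - z)"
  have nw: "?n \<bullet> w = 0" unfolding w_def a_def using ny by (simp add: inner_diff_right)
  have cl: "closure A \<subseteq> plane y b"
    by (rule closure_minimal) (use cell_subset_plane[OF s y] in auto)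
  have zc: "z \<in> closure A" using zF F facet_of_imp_subset by blast
  then have "z - y \<in> span (set b)" using cl by (auto simp: plane_alt)
  then have "- (z - y) \<in> span (set b)" by (rule span_neg)
  then have yz: "y - z \<in> span (set b)" by simp
  have "w \<in> span (set b)" unfolding w_def by (rule span_diff[OF u(1) span_scale[OF yz]])
  then have "w \<in> span (set (?n # ?c))" using fs(6) by simp
  then have "w = (\<Sum>i<length (?n # ?c). (w \<bullet> (?n # ?c) ! i) *\<^sub>R (?n # ?c) ! i)"
    by (rule orthonormal_frame_expand[OF fs(5)])
  also have "\<dots> = (\<Sum>i<length ?c. (w \<bullet> ?c ! i) *\<^sub>R ?c ! i)"
    using nw by (simp add: sum.lessThan_Suc_shift inner_commute[of w ?n] del: sum.lessThan_Suc)
  finally have wc: "w = (\<Sum>i<length ?c. (w \<bullet> ?c ! i) *\<^sub>R ?c ! i)" .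
  have "(\<Sum>i<length ?c. (w \<bullet> ?c ! i) *\<^sub>R ?c ! i) \<in> span (set ?c)"
    by (intro span_sum span_scale span_base) auto
  then have ws: "w \<in> span (set ?c)" using wc by simp
  obtain d where d: "d > 0" "\<And>y. y \<in> plane z ?c \<Longrightarrow> dist z y < d \<Longrightarrow> y \<in> rel_interior F"
    by (rule cell_ball[OF cc z]) (rule that)
  define r where "r = d / (2 * (norm w + 1))"
  have r: "r > 0" "r * norm w < d"
  proof -
    have n: "norm w + 1 > 0" using norm_ge_zero[of w] by linarith
    then show "r > 0" using d(1) by (simp add: r_def)
    then have "r * norm w \<le> r * (norm w + 1)" by simp
    also have "r * (norm w + 1) = d / 2"
    proof -
      have c: "d / (2 * N) * N = d / 2" if "N \<noteq> 0" for N :: real using that by simp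
      show ?thesis unfolding r_def by (rule c) (use n in simp)
    qed
    finally show "r * norm w < d" using d(1) by linarith
  qed
  have "z + r *\<^sub>R w \<in> rel_interior F"
    by (rule d(2)) (use ws r in \<open>auto simp: plane_alt span_scale dist_norm\<close>)
  then have zr: "z + r *\<^sub>R w \<in> closure A"
    using rel_interior_subset[of F] facet_of_imp_subset[OF F] by blast
  \<comment> \<open>Chosen so that the steps along \<open>w\<close> and \<open>y - z\<close>
    recombine to a multiple of \<open>u\<close>, that is,
    \<open>e = (1 - e) * r * a\<close>.\<close>
  define e where "e = r * a / (1 + r * a)"
  have ra: "r * a > 0" using r(1) a by simp
  have e: "0 < e" "e \<le> 1" unfolding e_def using ra by (simp_all add: field_simps)
  have "(z + r *\<^sub>R w) - e *\<^sub>R ((z + r *\<^sub>R w) - y) \<in> rel_interior A"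
    by (rule rel_interior_closure_convex_shrink[OF _ _ zr e])
      (use cell_convex[OF s] cell_rel_interior[OF s] y in auto)
  then have inA: "(z + r *\<^sub>R w) - e *\<^sub>R ((z + r *\<^sub>R w) - y) \<in> A"
    using cell_rel_interior[OF s] by simp
  have e1: "1 - e = 1 / (1 + r * a)" unfolding e_def using ra by (simp add: field_simps)
  have e2: "e = (1 - e) * r * a" unfolding e1 by (simp add: e_def)
  have "(z + r *\<^sub>R w) - e *\<^sub>R ((z + r *\<^sub>R w) - y) = z + ((1 - e) * r) *\<^sub>R w + e *\<^sub>R (y - z)"
    by (simp add: algebra_simps)
  also have "e *\<^sub>R (y - z) = ((1 - e) * r * a) *\<^sub>R (y - z)" using e2 by simp
  also have "z + ((1 - e) * r) *\<^sub>R w + ((1 - e) * r * a) *\<^sub>R (y - z) = z + ((1 - e) * r) *\<^sub>R u"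
    unfolding w_def by (simp add: algebra_simps)
  finally show ?thesis using inA by metis
qed

text \<open>The fibre of \<open>q\<close> in the cell is an open segment with end points on two facets.  Exactly one of
  the end points lies below the level of \<open>x\<close> under \<open>l\<close> if the segment crosses that level; otherwise both or
  none do, and their signs cancel.\<close>

lemma slice_boundary:
  assumes s: "(A, b) \<in> cells k" and q: "length b = Suc (length q)"
  shows "AE x in lborel. frag_sum (\<lambda>\<tau>. cut q l 0 \<tau> x) (cell_boundary (A, b)) = - cut (l # q) 0 1 (A, b) x"
proof -
  have b: "orthonormal_frame b" "int (length b) = k" using cellsD[OF s] by auto
  obtain v where v: "v \<in> span (set b)" "\<And>w. v \<bullet> w = frame_det (w # q) b"
    using frame_det_cofactor[OF b(1) q] by blast
  let ?FF = "{F. F facet_of closure A}"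
  have fin: "finite ?FF" using finite_facets[OF s] by simp
  let ?n = "outward_normal (A, b)"
  let ?hit = "\<lambda>F x. \<exists>z\<in>rel_interior F. qeq q z x \<and> l \<bullet> z < l \<bullet> x"
  \<comment> \<open>By \<open>facet_sign\<close> a facet that is hit counts with the sign of
    \<open>v\<close> against its outward normal, whichever frame was chosen for it.\<close>
  have lhs: "frag_sum (\<lambda>\<tau>. cut q l 0 \<tau> x) (cell_boundary (A, b)) = (\<Sum>F\<in>?FF. if ?hit F x then sgni (v \<bullet> ?n F) else 0)" for x
  proof -
    have "frag_sum (\<lambda>\<tau>. cut q l 0 \<tau> x) (cell_boundary (A, b)) = (\<Sum>F\<in>?FF.
      (if frame_det (?n F # facet_frame F) b > 0 then 1 else - 1) * cut q l 0 (rel_interior F, facet_frame F) x)"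
      unfolding cell_boundary_eq frag_sum_sum frag_sum_cmul frag_sum_of imul_int ..
    also have "\<dots> = (\<Sum>F\<in>?FF. if ?hit F x then sgni (v \<bullet> ?n F) else 0)"
    proof (rule sum.cong)
      fix F assume "F \<in> ?FF"
      then have F: "F facet_of closure A" by simp
      show "(if frame_det (?n F # facet_frame F) b > 0 then 1 else - 1) * cut q l 0 (rel_interior F, facet_frame F) x
         = (if ?hit F x then sgni (v \<bullet> ?n F) else 0)"
      proof -
        have "cut q l 0 (rel_interior F, facet_frame F) x = (if ?hit F x then frame_sign q (facet_frame F) else 0)"
          by (simp only: cut_def fst_conv snd_conv add_0_right)
        then show ?thesis
          using facet_sign[OF s F q v(2)]
          by (cases "?hit F x") (simp_all only: if_True if_False mult_zero_right)
      qed
    qed simp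
    finally show ?thesis .
  qed
  have rhs: "cut (l # q) 0 1 (A, b) x = (if \<exists>z\<in>A. qeq q z x \<and> l \<bullet> z = l \<bullet> x then sgni (l \<bullet> v) else 0)" for x
    unfolding cut_def frame_sign_sgni snd_conv v(2)[of l, symmetric] by (auto simp: qeq_def inner_commute)
  show ?thesis
  proof (cases "v = 0")
    case True
    \<comment> \<open>Here \<open>q\<close> is degenerate on the direction space of the cell and
      both sides vanish.\<close>
    then have sg: "sgni (v \<bullet> ?n F) = 0" "sgni (l \<bullet> v) = 0" for F by (simp_all add: sgni_def)
    show ?thesis
      unfolding lhs rhs by (intro AE_I2) (simp only: sg if_cancel sum.neutral_const minus_zero)
  next
    case False
    then have "v \<bullet> v \<noteq> 0" by simp
    then have "frame_det (v # q) b \<noteq> 0" unfolding v(2)[of v] .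
    then have "dim (set (v # q)) = length b" by (intro frame_det_dim[OF b(1)]) (use q in auto)
    then have "dim (set q) \<ge> length q" using q by (simp add: dim_insert split: if_splits)
    moreover have "dim (set q) \<le> length q"
      by (meson card_length dim_le_card' finite_set le_trans)
    ultimately have dq: "int (dim (set q)) = k - 1" using q b(2) by simp
    have "thin (k - 1) (\<Union>F\<in>?FF. F - rel_interior F)"
    proof (rule thin_UN[OF fin])
      fix F assume "F \<in> ?FF"
      then have F: "F facet_of closure A" by simp
      have cc: "(rel_interior F, facet_frame F) \<in> cells (k - 1)" using facet_cell[OF s] F by simp
      have "convex F" using F by (auto simp: facet_of_def intro: face_of_imp_convex)
      then have "F \<subseteq> closure (rel_interior F)" using closure_subset[of F] by (simp add: convex_closure_rel_interior)
      then have "F - rel_interior F \<subseteq> closure (rel_interior F) - rel_interior F" by blast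
      then show "thin (k - 1) (F - rel_interior F)"
        using cell_frontier_thin[OF cc] by (auto intro: thin_subset)
    qed
    then have ae1: "AE x in lborel. \<forall>z\<in>(\<Union>F\<in>?FF. F - rel_interior F). \<not> qeq q z x"
      by (intro AE_avoid_thin) (use dq in simp)
    \<comment> \<open>For \<open>l \<bullet> v = 0\<close> the ends of the segment are at the same
      level and cancel; otherwise \<open>l # q\<close> is nondegenerate on the cell and has generic
      fibres.\<close>
    have ae2: "AE x in lborel. l \<bullet> v \<noteq> 0 \<longrightarrow> (\<forall>z\<in>closure A - A. \<not> qeq (l # q) z x)"
    proof (cases "l \<bullet> v = 0")
      case False
      then have "frame_det (l # q) b \<noteq> 0" using v(2)[of l] by (simp add: inner_commute)
      then have "dim (set (l # q)) = length b" by (intro frame_det_dim[OF b(1)]) (use q in auto)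
      then have "AE x in lborel. \<forall>z\<in>closure A - A. \<not> qeq (l # q) z x"
        by (intro AE_avoid_thin) (use cell_frontier_thin[OF s] b(2) in simp)
      then show ?thesis by eventually_elim simp
    qed simp
    from ae1 ae2 show ?thesis
    proof eventually_elim
      fix x assume x1: "\<forall>z\<in>(\<Union>F\<in>?FF. F - rel_interior F). \<not> qeq q z x"
        and x2: "l \<bullet> v \<noteq> 0 \<longrightarrow> (\<forall>z\<in>closure A - A. \<not> qeq (l # q) z x)"
      have E: "\<not> qeq q z x" if "F facet_of closure A" "z \<in> F - rel_interior F" for F z
        using x1 that by blast
      have vq: "w \<bullet> v = 0" if "w \<in> set q" for w
        using v(2)[of w] frame_det_repeat[OF q orthonormal_frame_length[OF b(1)] that] by (simp add: inner_commute)
      show "frag_sum (\<lambda>\<tau>. cut q l 0 \<tau> x) (cell_boundary (A, b)) = - cut (l # q) 0 1 (A, b) x"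
      proof (cases "\<exists>y\<in>A. qeq q y x")
        case False
        \<comment> \<open>From a facet hit transversally the line would enter the cell, which this
          fibre misses.\<close>
        have "sgni (v \<bullet> ?n F) = 0" if F: "F facet_of closure A" and h: "?hit F x" for F
        proof (rule ccontr)
          assume n: "sgni (v \<bullet> ?n F) \<noteq> 0"
          obtain z where z: "z \<in> rel_interior F" "qeq q z x" using h by blast
          define u where "u = (if v \<bullet> ?n F < 0 then v else - v)"
          have "u \<in> span (set b)" "?n F \<bullet> u < 0" using v(1) n
            by (auto simp: u_def sgni_def span_neg inner_commute split: if_splits)
          then obtain t where t: "z + t *\<^sub>R u \<in> A" using enter_cell[OF s F z(1)] by blast
          moreover have "qeq q (z + t *\<^sub>R u) x" using z(2) vq by (auto simp: qeq_def u_def inner_add_right)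
          ultimately show False using False by blast
        qed
        then have "(\<Sum>F\<in>?FF. if ?hit F x then sgni (v \<bullet> ?n F) else 0) = 0" by (intro sum.neutral) auto
        moreover have "\<not> (\<exists>z\<in>A. qeq q z x \<and> l \<bullet> z = l \<bullet> x)" using False by blast
        ultimately show ?thesis unfolding lhs rhs by (simp only: if_False minus_zero)
      next
        case True
        then obtain y where y: "y \<in> A" "qeq q y x" by blast
        obtain F1 F2 z1 z2 where F: "F1 facet_of closure A" "F2 facet_of closure A"
          "z1 \<in> rel_interior F1" "z2 \<in> rel_interior F2"
          "qeq q z1 x" "qeq q z2 x" "v \<bullet> ?n F1 > 0" "v \<bullet> ?n F2 < 0"
          and u1: "\<And>F z. F facet_of closure A \<Longrightarrow> z \<in> rel_interior F \<Longrightarrow> qeq q z x \<Longrightarrow> v \<bullet> ?n F > 0 \<Longrightarrow> z = z1 \<and> F = F1"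
          and u2: "\<And>F z. F facet_of closure A \<Longrightarrow> z \<in> rel_interior F \<Longrightarrow> qeq q z x \<Longrightarrow> v \<bullet> ?n F < 0 \<Longrightarrow> z = z2 \<and> F = F2"
          and hit: "\<And>l. (\<exists>z\<in>A. qeq q z x \<and> l \<bullet> z = l \<bullet> x) \<longleftrightarrow>
             (if l \<bullet> v > 0 then l \<bullet> z2 < l \<bullet> x \<and> l \<bullet> x < l \<bullet> z1
              else if l \<bullet> v < 0 then l \<bullet> z1 < l \<bullet> x \<and> l \<bullet> x < l \<bullet> z2 else l \<bullet> x = l \<bullet> y)"
          and lz: "\<And>l. l \<bullet> v = 0 \<Longrightarrow> l \<bullet> z1 = l \<bullet> z2"
          and lp: "\<And>l. l \<bullet> v > 0 \<Longrightarrow> l \<bullet> z2 < l \<bullet> z1" and ln: "\<And>l. l \<bullet> v < 0 \<Longrightarrow> l \<bullet> z1 < l \<bullet> z2"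
          by (rule line_through_cell[OF s q v False _ y], erule (1) E) (rule that)
        \<comment> \<open>The end \<open>z1\<close> counts with sign 1 and \<open>z2\<close> with
          sign - 1; facets parallel to \<open>v\<close> count 0.\<close>
        have trm: "(if ?hit F x then sgni (v \<bullet> ?n F) else 0) =
          (if F = F1 then (if l \<bullet> z1 < l \<bullet> x then 1 else 0) else 0) + (if F = F2 then (if l \<bullet> z2 < l \<bullet> x then - 1 else 0) else 0)"
          if G: "F facet_of closure A" for F
        proof -
          have n12: "F1 \<noteq> F2" using F(7,8) by auto
          consider "v \<bullet> ?n F > 0" | "v \<bullet> ?n F < 0" | "v \<bullet> ?n F = 0" by linarith
          then show ?thesis
          proof cases
            case 1
            then have "F \<noteq> F2" using F(8) by auto
            moreover have "?hit F x \<longleftrightarrow> F = F1 \<and> l \<bullet> z1 < l \<bullet> x"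
              using u1[OF G _ _ 1] F(3,5) by blast
            moreover have "sgni (v \<bullet> ?n F) = 1" using 1 by (simp add: sgni_def)
            ultimately show ?thesis by auto
          next
            case 2
            then have "F \<noteq> F1" using F(7) by auto
            moreover have "?hit F x \<longleftrightarrow> F = F2 \<and> l \<bullet> z2 < l \<bullet> x"
              using u2[OF G _ _ 2] F(4,6) by blast
            moreover have "sgni (v \<bullet> ?n F) = - 1" using 2 by (simp add: sgni_def)
            ultimately show ?thesis by auto
          next
            case 3
            then have "F \<noteq> F1" "F \<noteq> F2" using F(7,8) by auto
            then show ?thesis using 3 by (simp add: sgni_def)
          qed
        qed
        have "(\<Sum>F\<in>?FF. if ?hit F x then sgni (v \<bullet> ?n F) else 0)
          = (\<Sum>F\<in>?FF. (if F = F1 then (if l \<bullet> z1 < l \<bullet> x then 1 else 0) else 0) + (if F = F2 then (if l \<bullet> z2 < l \<bullet> x then - 1 else 0) else 0))"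
          by (rule sum.cong) (simp_all add: trm)
        also have "\<dots> = (if l \<bullet> z1 < l \<bullet> x then 1 else 0) + (if l \<bullet> z2 < l \<bullet> x then - 1 else 0)"
          using fin F(1,2) by (simp add: sum.distrib)
        finally have L: "(\<Sum>F\<in>?FF. if ?hit F x then sgni (v \<bullet> ?n F) else 0)
          = (if l \<bullet> z1 < l \<bullet> x then 1 else 0) + (if l \<bullet> z2 < l \<bullet> x then - 1 else (0::int))" .
        \<comment> \<open>An end at the level of \<open>x\<close> would be a frontier point on the
          fibre of \<open>l # q\<close>, which genericity excludes.\<close>
        have bd: "l \<bullet> z1 \<noteq> l \<bullet> x" "l \<bullet> z2 \<noteq> l \<bullet> x" if lv: "l \<bullet> v \<noteq> 0"
        proof -
          have "z \<in> closure A - A" if "G facet_of closure A" "z \<in> rel_interior G" for G z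
          proof -
            have "z \<in> G" using that rel_interior_subset by blast
            then have "z \<in> closure A" using that facet_of_imp_subset by blast
            moreover have "z \<notin> A" using facet_structure(3)[OF s that(1) \<open>z \<in> G\<close>, of z] by auto
            ultimately show ?thesis by blast
          qed
          then have "\<not> qeq (l # q) z1 x" "\<not> qeq (l # q) z2 x" using x2 lv F(1-4) by blast+
          then show "l \<bullet> z1 \<noteq> l \<bullet> x" "l \<bullet> z2 \<noteq> l \<bullet> x" using F(5,6) by (auto simp: qeq_def)
        qed
        consider "l \<bullet> v > 0" | "l \<bullet> v < 0" | "l \<bullet> v = 0" by linarith
        then show ?thesis
        proof cases
          case 1
          have le: "l \<bullet> z2 < l \<bullet> z1" by (rule lp[OF 1])
          then show ?thesis unfolding lhs rhs L hit using 1 bd by (auto simp: sgni_def)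
        next
          case 2
          have le: "l \<bullet> z1 < l \<bullet> z2" by (rule ln[OF 2])
          then show ?thesis unfolding lhs rhs L hit using 2 bd by (auto simp: sgni_def)
        next
          case 3
          then show ?thesis unfolding lhs rhs L using lz[OF 3] by (auto simp: sgni_def)
        qed
      qed
    qed
  qed
qed

section \<open>Hausdorff measure of cells\<close>

definition hweight :: "nat \<Rightarrow> (real^3) set \<Rightarrow> ennreal" where
  "hweight s U = (if U = {} then 0 else ennreal (unit_ball_vol (real s) * (diameter U / 2) ^ s))"

definition hcover :: "real \<Rightarrow> (real^3) set \<Rightarrow> (nat \<Rightarrow> (real^3) set) \<Rightarrow> bool" where
  "hcover d A U \<longleftrightarrow> A \<subseteq> (\<Union>n. U n) \<and> (\<forall>n. bounded (U n) \<and> diameter (U n) \<le> d)"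

lemma hausdorff_content_alt: "hausdorff_content s d A = (INF U\<in>{U. hcover d A U}. suminf (\<lambda>n. hweight s (U n)))"
  unfolding hausdorff_content_def hcover_def hweight_def by (rule arg_cong[where f = Inf]) auto

lemma hausdorff_content_le: "hcover d A U \<Longrightarrow> hausdorff_content s d A \<le> (suminf (\<lambda>n. hweight s (U n)))"
  unfolding hausdorff_content_alt by (rule INF_lower) simp

lemma hausdorff_content_ge:
  "(\<And>U. hcover d A U \<Longrightarrow> c \<le> (suminf (\<lambda>n. hweight s (U n)))) \<Longrightarrow> c \<le> hausdorff_content s d A"
  unfolding hausdorff_content_alt by (rule INF_greatest) simp

lemma hausdorff_content_antimono: "d \<le> d' \<Longrightarrow> hausdorff_content s d' A \<le> hausdorff_content s d A"
  by (intro hausdorff_content_ge hausdorff_content_le) (auto simp: hcover_def intro: order_trans)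

lemma hausdorff_content_mono: "A \<subseteq> B \<Longrightarrow> hausdorff_content s d A \<le> hausdorff_content s d B"
  by (intro hausdorff_content_ge hausdorff_content_le) (auto simp: hcover_def)

lemma hausdorff_content_le_measure: "d > 0 \<Longrightarrow> hausdorff_content s d A \<le> hausdorff_measure s A"
  unfolding hausdorff_measure_def by (rule SUP_upper) simp

lemma hausdorff_measure_le: "(\<And>d. d > 0 \<Longrightarrow> hausdorff_content s d A \<le> c) \<Longrightarrow> hausdorff_measure s A \<le> c"
  unfolding hausdorff_measure_def by (rule SUP_least) simp

lemma hausdorff_measure_mono: "A \<subseteq> B \<Longrightarrow> hausdorff_measure s A \<le> hausdorff_measure s B"
  by (intro hausdorff_measure_le) (meson hausdorff_content_le_measure hausdorff_content_mono order_trans)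

lemma hweight_empty [simp]: "hweight s {} = 0"
  by (simp add: hweight_def)

lemma hweight_mono:
  assumes "bounded U" "diameter U \<le> D"
  shows "hweight s U \<le> ennreal (unit_ball_vol (real s) * (D / 2) ^ s)"
proof (cases "U = {}")
  case False
  have "(diameter U / 2) ^ s \<le> (D / 2) ^ s"
    using assms diameter_ge_0[OF assms(1)] by (intro power_mono) auto
  then show ?thesis using False by (auto simp: hweight_def intro!: ennreal_leI mult_left_mono)
qed simp

lemma hausdorff_content_finite_cover:
  assumes I: "finite I" and A: "A \<subseteq> (\<Union>i\<in>I. U i)" and U: "\<And>i. i \<in> I \<Longrightarrow> bounded (U i) \<and> diameter (U i) \<le> d"
    and d: "d \<ge> 0"
  shows "hausdorff_content s d A \<le> (\<Sum>i\<in>I. hweight s (U i))"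
proof -
  obtain h where h: "bij_betw h {..<card I} I"
    using ex_bij_betw_nat_finite[OF I] by (auto simp: atLeast0LessThan)
  let ?V = "\<lambda>n. if n < card I then U (h n) else {}"
  have "hcover d A ?V"
    unfolding hcover_def
  proof (intro conjI allI)
    show "A \<subseteq> (\<Union>n. ?V n)"
    proof
      fix x assume "x \<in> A"
      then obtain i where i: "i \<in> I" "x \<in> U i" using A by blast
      then obtain n where "n < card I" "h n = i" using h by (metis bij_betw_iff_bijections lessThan_iff)
      then show "x \<in> (\<Union>n. ?V n)" using i by (intro UN_I[of n]) auto
    qed
    fix n
    show "bounded (?V n)" "diameter (?V n) \<le> d"
      using U[of "h n"] bij_betwE[OF h] d by auto
  qed
  then have "hausdorff_content s d A \<le> (suminf (\<lambda>n. hweight s (?V n)))" by (rule hausdorff_content_le)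
  also have "\<dots> = (\<Sum>n<card I. hweight s (?V n))" by (rule suminf_finite) auto
  also have "\<dots> = (\<Sum>n<card I. hweight s (U (h n)))" by (rule sum.cong) auto
  also have "\<dots> = (\<Sum>i\<in>I. hweight s (U i))" by (rule sum.reindex_bij_betw[OF h])
  finally show ?thesis .
qed

lemma ennreal_le_INF_add:
  fixes f :: "'a \<Rightarrow> ennreal" and g :: "'b \<Rightarrow> ennreal"
  assumes "\<And>i j. i \<in> I \<Longrightarrow> j \<in> J \<Longrightarrow> c \<le> f i + g j"
  shows "c \<le> (INF i\<in>I. f i) + (INF j\<in>J. g j)"
proof (cases "(INF i\<in>I. f i) = \<infinity> \<or> (INF j\<in>J. g j) = \<infinity>")
  case False
  then obtain r t where r: "r \<ge> 0" "(INF i\<in>I. f i) = ennreal r" and t: "t \<ge> 0" "(INF j\<in>J. g j) = ennreal t"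
    by (metis ennreal_cases infinity_ennreal_def)
  show ?thesis
  proof (rule ennreal_le_epsilon)
    fix e :: real assume e: "e > 0"
    have "(INF i\<in>I. f i) < ennreal (r + e / 2)" unfolding r(2) using r(1) e by (intro ennreal_lessI) auto
    then obtain i where i: "i \<in> I" "f i < ennreal (r + e / 2)" unfolding INF_less_iff by blast
    have "(INF j\<in>J. g j) < ennreal (t + e / 2)" unfolding t(2) using t(1) e by (intro ennreal_lessI) auto
    then obtain j where j: "j \<in> J" "g j < ennreal (t + e / 2)" unfolding INF_less_iff by blast
    have "c \<le> f i + g j" by (rule assms[OF i(1) j(1)])
    also have "\<dots> \<le> ennreal (r + e / 2) + ennreal (t + e / 2)" using i j by (intro add_mono) auto
    also have "\<dots> = ennreal (r + t + e)" using r(1) t(1) e by (simp add: ennreal_plus[symmetric] del: ennreal_plus)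
    also have "\<dots> = ennreal r + ennreal t + ennreal e" using r(1) t(1) e by simp
    finally show "c \<le> (INF i\<in>I. f i) + (INF j\<in>J. g j) + ennreal e" unfolding r(2) t(2) .
  qed
qed auto

lemma hausdorff_content_subadd:
  "hausdorff_content s d (A \<union> B) \<le> hausdorff_content s d A + hausdorff_content s d B"
proof -
  have "hausdorff_content s d (A \<union> B) \<le> (suminf (\<lambda>n. hweight s (U n))) + (suminf (\<lambda>n. hweight s (V n)))"
    if U: "hcover d A U" and V: "hcover d B V" for U V
  proof -
    \<comment> \<open>Interleave the two coverings at even and odd indices.\<close>
    let ?W = "\<lambda>n. if even n then U (n div 2) else V (n div 2)"
    have "hcover d (A \<union> B) ?W"
      unfolding hcover_def
    proof (intro conjI allI subsetI)
      fix x assume "x \<in> A \<union> B"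
      then consider n where "x \<in> U n" | n where "x \<in> V n" using U V unfolding hcover_def by blast
      then show "x \<in> (\<Union>n. ?W n)"
      proof cases
        case 1
        then show ?thesis by (intro UN_I[of "2 * n"]) auto
      next
        case 2
        then show ?thesis by (intro UN_I[of "2 * n + 1"]) auto
      qed
    qed (use U V in \<open>auto simp: hcover_def\<close>)
    then have "hausdorff_content s d (A \<union> B) \<le> (suminf (\<lambda>n. hweight s (?W n)))" by (rule hausdorff_content_le)
    also have "\<dots> = (SUP n. \<Sum>i<n. hweight s (?W i))" by (rule suminf_eq_SUP)
    also have "\<dots> \<le> (suminf (\<lambda>n. hweight s (U n))) + (suminf (\<lambda>n. hweight s (V n)))"
    proof (rule SUP_least)
      fix n
      have "(\<Sum>i<n. hweight s (?W i)) \<le> (\<Sum>i<2 * n. hweight s (?W i))"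
        by (rule sum_mono2) auto
      also have "\<dots> = (\<Sum>i<n. hweight s (U i)) + (\<Sum>i<n. hweight s (V i))"
        by (induction n) (auto simp: algebra_simps)
      also have "\<dots> \<le> (suminf (\<lambda>n. hweight s (U n))) + (suminf (\<lambda>n. hweight s (V n)))"
        by (intro add_mono sum_le_suminf) auto
      finally show "(\<Sum>i<n. hweight s (?W i)) \<le> (suminf (\<lambda>n. hweight s (U n))) + (suminf (\<lambda>n. hweight s (V n)))" .
    qed
    finally show ?thesis .
  qed
  then show ?thesis
    unfolding hausdorff_content_alt[of s d A] hausdorff_content_alt[of s d B]
    by (intro ennreal_le_INF_add) auto
qed

lemma hausdorff_measure_subadd:
  "hausdorff_measure s (A \<union> B) \<le> hausdorff_measure s A + hausdorff_measure s B"
  by (intro hausdorff_measure_le)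
    (meson add_mono hausdorff_content_le_measure hausdorff_content_subadd order_trans)

lemma hausdorff_measure_empty: "hausdorff_measure s {} = 0"
proof -
  have "hausdorff_content s d {} \<le> 0" if "d > 0" for d
    using hausdorff_content_finite_cover[of "{}" "{}" "\<lambda>_. {}" d s] that by simp
  then show ?thesis using hausdorff_measure_le[of s "{}" 0] by (simp add: le_zero_eq)
qed

lemma hausdorff_measure_UN: "finite I \<Longrightarrow> hausdorff_measure s (\<Union>i\<in>I. A i) \<le> (\<Sum>i\<in>I. hausdorff_measure s (A i))"
proof (induction I rule: finite_induct)
  case (insert i I)
  have "hausdorff_measure s (\<Union>i\<in>insert i I. A i) \<le> hausdorff_measure s (A i) + hausdorff_measure s (\<Union>i\<in>I. A i)"
    using hausdorff_measure_subadd[of s "A i" "\<Union>i\<in>I. A i"] by simp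
  also have "\<dots> \<le> hausdorff_measure s (A i) + (\<Sum>i\<in>I. hausdorff_measure s (A i))"
    by (intro add_left_mono insert.IH)
  finally show ?case using insert.hyps by simp
qed (simp add: hausdorff_measure_empty)

text \<open>In a covering by sets of diameter below \<open>e\<close> no set meets both
  \<open>A\<close> and \<open>B\<close>, so the covering splits and contents at small scales
  add.\<close>

lemma hausdorff_measure_separated:
  assumes e: "e > 0" "\<And>a b. a \<in> A \<Longrightarrow> b \<in> B \<Longrightarrow> e \<le> dist a b"
  shows "hausdorff_measure s A + hausdorff_measure s B \<le> hausdorff_measure s (A \<union> B)"
proof -
  have c: "hausdorff_content s d A + hausdorff_content s d B \<le> hausdorff_content s d (A \<union> B)" if d: "0 < d" "d < e" for d
  proof (rule hausdorff_content_ge)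
    fix U assume U: "hcover d (A \<union> B) U"
    let ?P = "\<lambda>C n. if U n \<inter> C \<noteq> {} then U n else {}"
    have P: "hcover d C (?P C)" if "C \<subseteq> A \<union> B" for C
      unfolding hcover_def
    proof (intro conjI allI)
      show "C \<subseteq> (\<Union>n. ?P C n)"
      proof
        fix x assume x: "x \<in> C"
        then obtain n where "x \<in> U n" using U \<open>C \<subseteq> A \<union> B\<close> unfolding hcover_def by blast
        then show "x \<in> (\<Union>n. ?P C n)" using x by (intro UN_I[of n]) auto
      qed
    qed (use U d in \<open>auto simp: hcover_def\<close>)
    have "hausdorff_content s d A + hausdorff_content s d B \<le> (suminf (\<lambda>n. hweight s (?P A n))) + (suminf (\<lambda>n. hweight s (?P B n)))"
      by (intro add_mono hausdorff_content_le P) auto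
    also have "\<dots> = (suminf (\<lambda>n. hweight s (?P A n) + hweight s (?P B n)))" by (rule suminf_add) auto
    also have "\<dots> \<le> (suminf (\<lambda>n. hweight s (U n)))"
    proof (rule suminf_le)
      fix n
      have "\<not> (U n \<inter> A \<noteq> {} \<and> U n \<inter> B \<noteq> {})"
      proof
        assume "U n \<inter> A \<noteq> {} \<and> U n \<inter> B \<noteq> {}"
        then obtain a b where ab: "a \<in> U n" "a \<in> A" "b \<in> U n" "b \<in> B" by blast
        have "dist a b \<le> diameter (U n)" using U ab by (intro diameter_bounded_bound) (auto simp: hcover_def)
        then show False using e(2)[OF ab(2,4)] U d(2) unfolding hcover_def by (smt (verit))
      qed
      then show "hweight s (?P A n) + hweight s (?P B n) \<le> hweight s (U n)" by auto
    qed auto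
    finally show "hausdorff_content s d A + hausdorff_content s d B \<le> (suminf (\<lambda>n. hweight s (U n)))" .
  qed
  \<comment> \<open>Two independent scales allow the suprema for \<open>A\<close> and
    \<open>B\<close> to be taken one after the other.\<close>
  have le: "hausdorff_content s d A + hausdorff_content s d' B \<le> hausdorff_measure s (A \<union> B)" if "d > 0" "d' > 0" for d d'
  proof -
    let ?m = "min (min d d') (e / 2)"
    have m: "0 < ?m" "?m < e" "?m \<le> d" "?m \<le> d'" using that e(1) by auto
    have "hausdorff_content s d A + hausdorff_content s d' B \<le> hausdorff_content s ?m A + hausdorff_content s ?m B"
      by (intro add_mono hausdorff_content_antimono m)
    also have "\<dots> \<le> hausdorff_content s ?m (A \<union> B)" by (rule c[OF m(1,2)])
    also have "\<dots> \<le> hausdorff_measure s (A \<union> B)" by (rule hausdorff_content_le_measure[OF m(1)])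
    finally show ?thesis .
  qed
  have ne: "{0<..} \<noteq> ({} :: real set)" by (auto intro: exI[of _ 1])
  have "hausdorff_measure s A + hausdorff_content s d' B \<le> hausdorff_measure s (A \<union> B)" if "d' > 0" for d'
    unfolding hausdorff_measure_def[of s A] ennreal_SUP_add_left[OF ne, symmetric]
    by (rule SUP_least) (use le that in auto)
  then show ?thesis
    unfolding hausdorff_measure_def[of s B] add.commute[of "hausdorff_measure s A"] ennreal_SUP_add_left[OF ne, symmetric]
    by (intro SUP_least) (auto simp: add.commute)
qed

text \<open>Disjoint compact sets have positive distance, so the separated case applies
  inductively.\<close>

lemma hausdorff_measure_disjoint_compacts:
  assumes "finite I" "\<And>i. i \<in> I \<Longrightarrow> compact (K i)" "\<And>i j. i \<in> I \<Longrightarrow> j \<in> I \<Longrightarrow> i \<noteq> j \<Longrightarrow> K i \<inter> K j = {}"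
    "\<And>i. i \<in> I \<Longrightarrow> T i \<subseteq> K i"
  shows "(\<Sum>i\<in>I. hausdorff_measure s (T i)) \<le> hausdorff_measure s (\<Union>i\<in>I. T i)"
  using assms
proof (induction I rule: finite_induct)
  case (insert i I)
  have "compact (K i)" "closed (\<Union>j\<in>I. K j)" "K i \<inter> (\<Union>j\<in>I. K j) = {}"
    using insert.prems insert.hyps by (auto intro!: closed_UN compact_imp_closed)
  then obtain e where e: "e > 0" "\<And>x y. x \<in> K i \<Longrightarrow> y \<in> (\<Union>j\<in>I. K j) \<Longrightarrow> e \<le> dist x y"
    using separate_compact_closed by metis
  have "(\<Sum>i\<in>I. hausdorff_measure s (T i)) \<le> hausdorff_measure s (\<Union>i\<in>I. T i)"
    by (rule insert.IH) (use insert.prems in auto)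
  then have "(\<Sum>i\<in>insert i I. hausdorff_measure s (T i)) \<le> hausdorff_measure s (T i) + hausdorff_measure s (\<Union>i\<in>I. T i)"
    using insert.hyps by (simp add: add_left_mono)
  also have "\<dots> \<le> hausdorff_measure s (T i \<union> (\<Union>i\<in>I. T i))"
    by (rule hausdorff_measure_separated[OF e(1)]) (rule e(2); use insert.prems(3) in blast)
  finally show ?case by simp
qed simp

text \<open>A covering of \<open>T\<close> is carried to one of the image with diameters scaled by
  \<open>L\<close>, hence weights scaled by at most \<open>L ^ s\<close>.\<close>

lemma hausdorff_measure_similarity:
  assumes L: "L > 0" "\<And>x y. dist (g x) (g y) = L * dist x y"
  shows "ennreal ((1 / L) ^ s) * hausdorff_measure s (g ` T) \<le> hausdorff_measure s T"
proof -
  have "ennreal ((1 / L) ^ s) * hausdorff_content s d (g ` T) \<le> hausdorff_measure s T" if d: "d > 0" for d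
  proof -
    have "ennreal ((1 / L) ^ s) * hausdorff_content s d (g ` T) \<le> hausdorff_content s (d / L) T"
    proof (rule hausdorff_content_ge)
      fix U assume U: "hcover (d / L) T U"
      have di: "bounded (g ` U n)" "diameter (g ` U n) \<le> L * diameter (U n)" for n
      proof -
        have b: "bounded (U n)" using U by (simp add: hcover_def)
        have le: "norm (x - y) \<le> L * diameter (U n)" if "x \<in> g ` U n" "y \<in> g ` U n" for x y
        proof -
          obtain a c where ac: "x = g a" "y = g c" "a \<in> U n" "c \<in> U n" using \<open>x \<in> g ` U n\<close> \<open>y \<in> g ` U n\<close> by blast
          have "dist a c \<le> diameter (U n)" by (rule diameter_bounded_bound[OF b ac(3,4)])
          then show ?thesis using L ac by (simp add: dist_norm[symmetric])
        qed
        then show "diameter (g ` U n) \<le> L * diameter (U n)"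
          using L(1) diameter_ge_0[OF b] by (intro diameter_le) auto
        show "bounded (g ` U n)"
        proof (cases "U n = {}")
          case False
          then obtain a where "a \<in> U n" by blast
          then show ?thesis using le unfolding bounded_def by (intro exI[of _ "g a"] exI[of _ "L * diameter (U n)"]) (auto simp: dist_norm)
        qed simp
      qed
      have "hcover d (g ` T) (\<lambda>n. g ` U n)"
        unfolding hcover_def
      proof (intro conjI allI)
        show "g ` T \<subseteq> (\<Union>n. g ` U n)" using U unfolding hcover_def by blast
        fix n
        show "bounded (g ` U n)" by (rule di)
        have "L * diameter (U n) \<le> L * (d / L)" using U L(1) unfolding hcover_def by (intro mult_left_mono) auto
        then show "diameter (g ` U n) \<le> d" using di(2)[of n] L(1) by simp
      qed
      then have "hausdorff_content s d (g ` T) \<le> (suminf (\<lambda>n. hweight s (g ` U n)))" by (rule hausdorff_content_le)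
      then have "ennreal ((1 / L) ^ s) * hausdorff_content s d (g ` T) \<le> ennreal ((1 / L) ^ s) * (suminf (\<lambda>n. hweight s (g ` U n)))"
        by (rule mult_left_mono) simp
      also have "\<dots> = (suminf (\<lambda>n. ennreal ((1 / L) ^ s) * hweight s (g ` U n)))" by (rule ennreal_suminf_cmult[symmetric])
      also have "\<dots> \<le> (suminf (\<lambda>n. hweight s (U n)))"
      proof (rule suminf_le)
        fix n
        show "ennreal ((1 / L) ^ s) * hweight s (g ` U n) \<le> hweight s (U n)"
        proof (cases "U n = {}")
          case False
          have b: "bounded (U n)" using U by (simp add: hcover_def)
          have "ennreal ((1 / L) ^ s) * hweight s (g ` U n) \<le> ennreal ((1 / L) ^ s) * ennreal (unit_ball_vol (real s) * (L * diameter (U n) / 2) ^ s)"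
            by (intro mult_left_mono hweight_mono di) simp
          also have "\<dots> = ennreal ((1 / L) ^ s * (unit_ball_vol (real s) * (L * diameter (U n) / 2) ^ s))"
            using L(1) diameter_ge_0[OF b] by (intro ennreal_mult[symmetric]) auto
          also have "(1 / L) ^ s * (unit_ball_vol (real s) * (L * diameter (U n) / 2) ^ s) = unit_ball_vol (real s) * (diameter (U n) / 2) ^ s"
            using L(1) by (simp add: power_divide power_mult_distrib)
          finally show ?thesis using False by (simp add: hweight_def)
        qed simp
      qed auto
      finally show "ennreal ((1 / L) ^ s) * hausdorff_content s d (g ` T) \<le> (suminf (\<lambda>n. hweight s (U n)))" .
    qed
    also have "\<dots> \<le> hausdorff_measure s T" by (rule hausdorff_content_le_measure) (use d L(1) in simp)
    finally show ?thesis .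
  qed
  then show ?thesis
    unfolding hausdorff_measure_def[of s "g ` T"] SUP_mult_left_ennreal by (intro SUP_least) auto
qed

section \<open>Hausdorff measure of bounded subsets of planes\<close>

lemma plane_grid_cover:
  assumes b: "orthonormal_frame b" and A: "bounded A" "A \<subseteq> plane p b"
  obtains D where "D > 0" "\<And>n. n > 0 \<Longrightarrow> \<exists>U. A \<subseteq> (\<Union>i\<in>PiE {..<length b} (\<lambda>_. {..<n}). U i) \<and>
    (\<forall>i\<in>PiE {..<length b} (\<lambda>_. {..<n}). bounded (U i) \<and> diameter (U i) \<le> D / real n)"
proof -
  let ?m = "length b"
  have "\<exists>e. \<forall>x\<in>A. dist p x \<le> e" using A(1) unfolding bounded_any_center[of _ p] .
  then obtain R0 where R0: "\<And>x. x \<in> A \<Longrightarrow> dist p x \<le> R0" by blast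
  define R where "R = max R0 1"
  have R: "R > 0" "\<And>x. x \<in> A \<Longrightarrow> norm (x - p) \<le> R"
    using R0 by (force simp: R_def dist_norm norm_minus_commute)+
  show thesis
  proof (rule that[of "2 * R * real ?m + 1"])
    \<comment> \<open>The summand 1 keeps the constant positive for a 0-dimensional plane, where
      \<open>?m = 0\<close>.\<close>
    show "2 * R * real ?m + 1 > 0" using R(1) by (simp add: add_nonneg_pos)
    fix n :: nat assume n: "n > 0"
    let ?I = "PiE {..<?m} (\<lambda>_. {..<n})"
    \<comment> \<open>Rescales a coordinate between - R and R to one between 0 and n, so that unit
      intervals form the grid.\<close>
    let ?f = "\<lambda>x j. ((x - p) \<bullet> b ! j + R) * real n / (2 * R)"
    let ?U = "\<lambda>i. {x \<in> A. \<forall>j<?m. real (i j) \<le> ?f x j \<and> ?f x j \<le> real (i j) + 1}"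
    have "A \<subseteq> (\<Union>i\<in>?I. ?U i)"
    proof
      fix x assume x: "x \<in> A"
      \<comment> \<open>The minimum puts the end value \<open>n\<close> into the last interval of
        the grid.\<close>
      define i where "i = restrict (\<lambda>j. min (n - 1) (nat \<lfloor>?f x j\<rfloor>)) {..<?m}"
      have "i \<in> ?I" using n by (auto simp: i_def)
      moreover have "real (i j) \<le> ?f x j \<and> ?f x j \<le> real (i j) + 1" if j: "j < ?m" for j
      proof -
        have nb: "norm (b ! j) = 1" by (rule orthonormal_frame_norm[OF b]) (use j in simp)
        have "\<bar>(x - p) \<bullet> b ! j\<bar> \<le> norm (x - p) * norm (b ! j)" by (rule Cauchy_Schwarz_ineq2)
        then have le: "\<bar>(x - p) \<bullet> b ! j\<bar> \<le> R" using R(2)[OF x] nb by simp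
        have "((x - p) \<bullet> b ! j + R) / (2 * R) \<le> 1" "0 \<le> ((x - p) \<bullet> b ! j + R) / (2 * R)"
          using le R(1) by (auto simp: field_simps)
        moreover have "0 \<le> a * m \<and> a * m \<le> m" if "a \<le> 1" "0 \<le> a" "0 \<le> m" for a m :: real
          using that mult_right_mono[of a 1 m] by simp
        ultimately have "0 \<le> ((x - p) \<bullet> b ! j + R) / (2 * R) * real n \<and> ((x - p) \<bullet> b ! j + R) / (2 * R) * real n \<le> real n"
          using of_nat_0_le_iff by blast
        then have f: "0 \<le> ?f x j" "?f x j \<le> real n" by simp_all
        then show ?thesis using j n unfolding i_def by (simp add: min_def) linarith
      qed
      ultimately show "x \<in> (\<Union>i\<in>?I. ?U i)" using x by blast
    qed
    moreover have "bounded (?U i) \<and> diameter (?U i) \<le> (2 * R * real ?m + 1) / real n" for i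
    proof
      show "bounded (?U i)" by (rule bounded_subset[OF A(1)]) auto
      have "norm (x - y) \<le> (2 * R * real ?m + 1) / real n" if "x \<in> ?U i" "y \<in> ?U i" for x y
      proof -
        have "x \<in> plane p b" "y \<in> plane p b" using that A(2) by auto
        then have "(x - p) - (y - p) \<in> span (set b)" by (intro span_diff[of "x - p" _ "y - p"]) (auto simp: plane_alt)
        then have "x - y \<in> span (set b)" by simp
        then have "x - y = (\<Sum>j<?m. ((x - y) \<bullet> b ! j) *\<^sub>R b ! j)" by (rule orthonormal_frame_expand[OF b])
        then have "norm (x - y) = norm (\<Sum>j<?m. ((x - y) \<bullet> b ! j) *\<^sub>R b ! j)" by (rule arg_cong)
        also have "\<dots> \<le> (\<Sum>j<?m. norm (((x - y) \<bullet> b ! j) *\<^sub>R b ! j))" by (rule norm_sum)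
        also have "\<dots> \<le> (\<Sum>j<?m. 2 * R / real n)"
        proof (rule sum_mono)
          fix j assume "j \<in> {..<?m}"
          then have j: "j < ?m" by simp
          have nb: "norm (b ! j) = 1" by (rule orthonormal_frame_norm[OF b]) (use j in simp)
          have "real (i j) \<le> ?f x j" "?f x j \<le> real (i j) + 1" "real (i j) \<le> ?f y j" "?f y j \<le> real (i j) + 1"
            using that j by auto
          then have "\<bar>?f x j - ?f y j\<bar> \<le> 1" by linarith
          moreover have "?f x j - ?f y j = ((x - y) \<bullet> b ! j) * (real n / (2 * R))"
            by (simp add: inner_diff_left diff_divide_distrib[symmetric] algebra_simps)
          ultimately have "\<bar>(x - y) \<bullet> b ! j\<bar> * (real n / (2 * R)) \<le> 1"
            using R(1) by (simp add: abs_mult)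
          then have "\<bar>(x - y) \<bullet> b ! j\<bar> \<le> 2 * R / real n" using R(1) n by (simp add: field_simps)
          then show "norm (((x - y) \<bullet> b ! j) *\<^sub>R b ! j) \<le> 2 * R / real n" using nb by simp
        qed
        also have "\<dots> = 2 * R * real ?m / real n" by simp
        also have "\<dots> \<le> (2 * R * real ?m + 1) / real n" using n by (simp add: divide_right_mono)
        finally show ?thesis .
      qed
      then show "diameter (?U i) \<le> (2 * R * real ?m + 1) / real n"
        using R(1) by (intro diameter_le) auto
    qed
    ultimately show "\<exists>U. A \<subseteq> (\<Union>i\<in>?I. U i) \<and> (\<forall>i\<in>?I. bounded (U i) \<and> diameter (U i) \<le> (2 * R * real ?m + 1) / real n)"
      by blast
  qed
qed

text \<open>A grid of \<open>n ^ length b\<close> pieces of diameter at most \<open>D / n\<close>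
  bounds the content. For \<open>s = length b\<close> the bound is constant in \<open>n\<close> and
  gives finite measure; for larger \<open>s\<close> it tends to 0 and gives measure zero.\<close>

lemma plane_content_bound:
  assumes b: "orthonormal_frame b" and A: "bounded A" "A \<subseteq> plane p b"
  obtains D C where "D > 0" "C \<ge> 0"
    "\<And>n. n > 0 \<Longrightarrow> hausdorff_content s (D / real n) A \<le> ennreal (C * real n ^ length b / real n ^ s)"
proof -
  obtain D where D: "D > 0" "\<And>n. n > 0 \<Longrightarrow> \<exists>U. A \<subseteq> (\<Union>i\<in>PiE {..<length b} (\<lambda>_. {..<n}). U i) \<and>
    (\<forall>i\<in>PiE {..<length b} (\<lambda>_. {..<n}). bounded (U i) \<and> diameter (U i) \<le> D / real n)"
    by (rule plane_grid_cover[OF b A]) (rule that)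
  let ?C = "unit_ball_vol (real s) * (D / 2) ^ s"
  show thesis
  proof (rule that[of D ?C])
    show "?C \<ge> 0" using D(1) by simp
    fix n :: nat assume n: "n > 0"
    let ?I = "PiE {..<length b} (\<lambda>_. {..<n})"
    from D(2)[OF n] obtain U where U0: "A \<subseteq> (\<Union>i\<in>?I. U i) \<and> (\<forall>i\<in>?I. bounded (U i) \<and> diameter (U i) \<le> D / real n)"
      by (rule exE)
    note U = conjunct1[OF U0] bspec[OF conjunct2[OF U0]]
    have f: "finite ?I" by (intro finite_PiE) auto
    have "hausdorff_content s (D / real n) A \<le> (\<Sum>i\<in>?I. hweight s (U i))"
      by (rule hausdorff_content_finite_cover[OF f U]) (use D(1) in auto)
    also have "\<dots> \<le> (\<Sum>i\<in>?I. ennreal (unit_ball_vol (real s) * (D / real n / 2) ^ s))"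
      by (intro sum_mono hweight_mono) (use U(2) in auto)
    also have "\<dots> = ennreal (real (card ?I) * (unit_ball_vol (real s) * (D / real n / 2) ^ s))"
      using D(1) by (subst sum_ennreal) auto
    also have "card ?I = n ^ length b" by (simp add: card_PiE)
    also have "real (n ^ length b) * (unit_ball_vol (real s) * (D / real n / 2) ^ s) = ?C * real n ^ length b / real n ^ s"
      by (simp add: power_divide mult_ac)
    finally show "hausdorff_content s (D / real n) A \<le> ennreal (?C * real n ^ length b / real n ^ s)" .
  qed (rule D)
qed

lemma hausdorff_measure_plane_finite:
  assumes b: "orthonormal_frame b" and A: "bounded A" "A \<subseteq> plane p b"
  shows "hausdorff_measure (length b) A < \<infinity>"
proof -
  obtain D C where D: "D > 0" "C \<ge> 0"
    "\<And>n. n > 0 \<Longrightarrow> hausdorff_content (length b) (D / real n) A \<le> ennreal (C * real n ^ length b / real n ^ length b)"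
    by (rule plane_content_bound[OF b A]) (rule that)
  have "hausdorff_measure (length b) A \<le> ennreal C"
  proof (rule hausdorff_measure_le)
    fix d :: real assume d: "d > 0"
    obtain n where n: "real n > D / d" using reals_Archimedean2 by blast
    then have n0: "n > 0" using D(1) d by (metis divide_pos_pos less_trans of_nat_0_less_iff)
    have "D / real n \<le> d" using n n0 d by (simp add: field_simps)
    then have "hausdorff_content (length b) d A \<le> hausdorff_content (length b) (D / real n) A"
      by (rule hausdorff_content_antimono)
    also have "\<dots> \<le> ennreal C" using D(3)[OF n0] n0 by simp
    finally show "hausdorff_content (length b) d A \<le> ennreal C" .
  qed
  then show ?thesis using ennreal_less_top le_less_trans by (metis infinity_ennreal_def)
qed

lemma hausdorff_measure_lowdim_null:
  assumes b: "orthonormal_frame b" and A: "bounded A" "A \<subseteq> plane p b" and s: "length b < s"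
  shows "hausdorff_measure s A = 0"
proof -
  obtain D C where D: "D > 0" "C \<ge> 0"
    "\<And>n. n > 0 \<Longrightarrow> hausdorff_content s (D / real n) A \<le> ennreal (C * real n ^ length b / real n ^ s)"
    by (rule plane_content_bound[OF b A]) (rule that)
  have "hausdorff_content s d A \<le> 0" if d: "d > 0" for d
  proof (rule ennreal_le_epsilon)
    fix e :: real assume e: "e > 0"
    obtain n where n: "real n > max (D / d) (C / e)" using reals_Archimedean2 by blast
    then have n1: "real n > D / d" "real n > C / e" by auto
    then have n0: "n > 0" using D(1) d by (metis divide_pos_pos less_trans of_nat_0_less_iff)
    have "D / real n \<le> d" using n1 n0 d by (simp add: field_simps)
    then have "hausdorff_content s d A \<le> hausdorff_content s (D / real n) A"
      by (rule hausdorff_content_antimono)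
    also have "\<dots> \<le> ennreal (C * real n ^ length b / real n ^ s)" by (rule D(3)[OF n0])
    also have "\<dots> \<le> ennreal e"
    proof (rule ennreal_leI)
      have "real n ^ Suc (length b) \<le> real n ^ s" using s n0 by (intro power_increasing) auto
      then have "C * real n ^ length b / real n ^ s \<le> C * real n ^ length b / real n ^ Suc (length b)"
        using D(2) n0 by (intro divide_left_mono) auto
      also have "\<dots> = C / real n" using n0 by simp
      also have "\<dots> \<le> e" using n1(2) n0 e by (simp add: field_simps)
      finally show "C * real n ^ length b / real n ^ s \<le> e" .
    qed
    finally show "hausdorff_content s d A \<le> 0 + ennreal e" by simp
  qed
  then show ?thesis using hausdorff_measure_le[of s A 0] by (simp add: le_zero_eq)
qed

lemma hausdorff_measure_thin:
  assumes E: "thin k E" "bounded E"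
  shows "hausdorff_measure (nat k) E = 0"
proof -
  obtain \<A> where A: "finite \<A>" "E \<subseteq> \<Union>\<A>" "\<And>H. H \<in> \<A> \<Longrightarrow> affine H \<and> aff_dim H < k"
    using E(1) unfolding thin_def by blast
  have "hausdorff_measure (nat k) (E \<inter> H) = 0" if H: "H \<in> \<A>" for H
  proof (cases "H = {}")
    case False
    then obtain p where p: "p \<in> H" by blast
    have aH: "affine H" "aff_dim H < k" using A(3)[OF H] by auto
    obtain c where c: "orthonormal_frame c" "plane p c = H"
      by (rule exists_frame_affine[OF aH(1) p]) (rule that)
    show ?thesis
      by (rule hausdorff_measure_lowdim_null[OF c(1), of _ p])
        (use c aH(2) aff_dim_plane[OF c(1), of p] E(2) in \<open>auto intro: bounded_subset\<close>)
  qed (simp add: hausdorff_measure_empty)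
  moreover have "hausdorff_measure (nat k) E \<le> hausdorff_measure (nat k) (\<Union>H\<in>\<A>. E \<inter> H)"
    by (rule hausdorff_measure_mono) (use A(2) in blast)
  moreover have "hausdorff_measure (nat k) (\<Union>H\<in>\<A>. E \<inter> H) \<le> (\<Sum>H\<in>\<A>. hausdorff_measure (nat k) (E \<inter> H))"
    by (rule hausdorff_measure_UN[OF A(1)])
  ultimately show ?thesis by (simp add: le_zero_eq)
qed

lemma cell_hausdorff_finite:
  assumes "\<sigma> \<in> cells k"
  shows "hausdorff_measure (nat k) (fst \<sigma>) < \<infinity>" "hausdorff_measure (nat k) (fst \<sigma>) = ennreal (cell_mass \<sigma>)"
proof -
  obtain A b where s: "\<sigma> = (A, b)" "(A, b) \<in> cells k" using assms by (cases \<sigma>) auto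
  obtain p where p: "p \<in> A" using cellsD(3)[OF s(2)] by auto
  have b: "orthonormal_frame b" "length b = nat k" "bounded A" using cellsD[OF s(2)] by auto
  show 1: "hausdorff_measure (nat k) (fst \<sigma>) < \<infinity>"
    using hausdorff_measure_plane_finite[OF b(1,3) cell_subset_plane[OF s(2) p]] b(2) s(1) by simp
  show "hausdorff_measure (nat k) (fst \<sigma>) = ennreal (cell_mass \<sigma>)"
    using 1 b(2) s(1) by (simp add: cell_mass_def)
qed

lemma cell_mass_nonneg: "cell_mass \<sigma> \<ge> 0"
  by (simp add: cell_mass_def)

text \<open>One inequality is subadditivity, as bounded thin sets have measure zero. For the other
  the pieces may touch along their frontiers, so each is shrunk by a factor \<open>r\<close> into
  itself; the images lie in disjoint compact sets, on which Hausdorff measure adds, and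
  \<open>r\<close> tends to 1.\<close>

lemma cell_mass_partition:
  assumes s: "(A, b) \<in> cells k"
    and S: "finite \<S>" "disjoint \<S>" "\<And>S. S \<in> \<S> \<Longrightarrow> S \<subseteq> A \<and> (S, b) \<in> cells k" "thin k (A - \<Union>\<S>)"
  shows "cell_mass (A, b) = (\<Sum>S\<in>\<S>. cell_mass (S, b))"
proof -
  let ?H = "hausdorff_measure (nat k)"
  have HA: "?H A = ennreal (cell_mass (A, b))" using cell_hausdorff_finite(2)[OF s] by simp
  have HS: "?H S = ennreal (cell_mass (S, b))" if "S \<in> \<S>" for S
    using cell_hausdorff_finite(2)[of "(S, b)" k] S(3)[OF that] by simp
  have sum: "(\<Sum>S\<in>\<S>. ?H S) = ennreal (\<Sum>S\<in>\<S>. cell_mass (S, b))"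
    by (subst sum_ennreal[symmetric]) (auto simp: HS cell_mass_nonneg)
  have "?H A \<le> ?H ((A - \<Union>\<S>) \<union> \<Union>\<S>)" by (rule hausdorff_measure_mono) blast
  also have "\<dots> \<le> ?H (A - \<Union>\<S>) + ?H (\<Union>\<S>)" by (rule hausdorff_measure_subadd)
  also have "?H (A - \<Union>\<S>) = 0"
    by (rule hausdorff_measure_thin[OF S(4)]) (use cellsD(4)[OF s] in \<open>auto intro: bounded_subset\<close>)
  also have "0 + ?H (\<Union>\<S>) \<le> (\<Sum>S\<in>\<S>. ?H S)"
    using hausdorff_measure_UN[OF S(1), of "nat k" "\<lambda>S. S"] by simp
  finally have le: "cell_mass (A, b) \<le> (\<Sum>S\<in>\<S>. cell_mass (S, b))"
    unfolding HA sum by (simp add: sum_nonneg cell_mass_nonneg)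
  have ge: "r ^ nat k * (\<Sum>S\<in>\<S>. cell_mass (S, b)) \<le> cell_mass (A, b)" if r: "0 < r" "r < 1" for r
  proof -
    have "\<forall>S\<in>\<S>. \<exists>y. y \<in> S" using S(3) cellsD(3) by fastforce
    from bchoice[OF this] obtain y where y: "\<And>S. S \<in> \<S> \<Longrightarrow> y S \<in> S" by blast
    \<comment> \<open>The contraction of a piece towards one of its points, and its inverse
      \<open>g\<close>, whose scaling law bounds the measure of the contracted piece from
      below.\<close>
    define h where "h S x = x - (1 - r) *\<^sub>R (x - y S)" for S x
    define g where "g S x = y S + (1 / r) *\<^sub>R (x - y S)" for S x
    have hS: "h S ` closure S \<subseteq> S" if "S \<in> \<S>" for S
    proof -
      have c: "(S, b) \<in> cells k" using S(3)[OF that] by simp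
      have "x - (1 - r) *\<^sub>R (x - y S) \<in> rel_interior S" if "x \<in> closure S" for x
        by (rule rel_interior_closure_convex_shrink)
          (use that r y[OF \<open>S \<in> \<S>\<close>] cell_convex[OF c] cell_rel_interior[OF c] in auto)
      then show ?thesis using cell_rel_interior[OF c] by (auto simp: h_def)
    qed
    have gh: "g S ` (h S ` S) = S" for S
    proof -
      have "g S (h S x) = x" for x using r by (simp add: g_def h_def algebra_simps)
      then show ?thesis by (simp add: image_image)
    qed
    have "(\<Sum>S\<in>\<S>. ?H (h S ` S)) \<le> ?H (\<Union>S\<in>\<S>. h S ` S)"
    proof (rule hausdorff_measure_disjoint_compacts[OF S(1), where K = "\<lambda>S. h S ` closure S"])
      fix S assume "S \<in> \<S>"
      have "bounded S" using S(3)[OF \<open>S \<in> \<S>\<close>] cellsD(4)[of "(S, b)" k] by simp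
      then show "compact (h S ` closure S)"
        unfolding h_def by (intro compact_continuous_image continuous_intros) simp
      show "h S ` S \<subseteq> h S ` closure S" using closure_subset by blast
    next
      fix S T assume "S \<in> \<S>" "T \<in> \<S>" "S \<noteq> T"
      then have "S \<inter> T = {}" using S(2) by (auto simp: disjoint_def)
      then show "h S ` closure S \<inter> h T ` closure T = {}" using hS \<open>S \<in> \<S>\<close> \<open>T \<in> \<S>\<close> by blast
    qed
    also have "\<dots> \<le> ?H A"
      by (rule hausdorff_measure_mono) (use hS S(3) closure_subset in blast)
    finally have 1: "(\<Sum>S\<in>\<S>. ?H (h S ` S)) \<le> ?H A" .
    have 2: "ennreal (r ^ nat k) * ?H S \<le> ?H (h S ` S)" for S
    proof -
      have "ennreal ((1 / (1 / r)) ^ nat k) * ?H (g S ` (h S ` S)) \<le> ?H (h S ` S)"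
      proof (rule hausdorff_measure_similarity)
        show "dist (g S x) (g S z) = 1 / r * dist x z" for x z
        proof -
          have "g S x - g S z = (1 / r) *\<^sub>R (x - z)" by (simp add: g_def algebra_simps)
          then show ?thesis using r by (simp add: dist_norm)
        qed
      qed (use r in simp)
      then show ?thesis unfolding gh by simp
    qed
    have "ennreal (r ^ nat k) * (\<Sum>S\<in>\<S>. ?H S) \<le> (\<Sum>S\<in>\<S>. ?H (h S ` S))"
      unfolding sum_distrib_left by (intro sum_mono 2)
    with 1 have "ennreal (r ^ nat k) * (\<Sum>S\<in>\<S>. ?H S) \<le> ?H A" by (rule order_trans[rotated])
    then show ?thesis
      unfolding sum HA using r by (simp add: ennreal_mult[symmetric] sum_nonneg cell_mass_nonneg)
  qed
  have "(\<lambda>n. (1 - 1 / real (n + 2)) ^ nat k * (\<Sum>S\<in>\<S>. cell_mass (S, b))) \<longlonglongrightarrow> (1 - 0) ^ nat k * (\<Sum>S\<in>\<S>. cell_mass (S, b))"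
    using LIMSEQ_ignore_initial_segment[OF lim_1_over_n, of 2] by (intro tendsto_intros) simp
  then have "(1 - 0) ^ nat k * (\<Sum>S\<in>\<S>. cell_mass (S, b)) \<le> cell_mass (A, b)"
    by (rule LIMSEQ_le_const2) (intro exI[of _ 0] allI impI ge; simp)
  then show ?thesis using le by simp
qed

section \<open>Shadows of cells\<close>

text \<open>In orthonormal coordinates extending \<open>e\<close> the set fits into a box:
  \<open>length e\<close> sides come from the covectors, the others from the ball of radius
  \<open>R\<close>.\<close>

lemma slab_box_measure:
  assumes e: "orthonormal_frame e" and d: "d \<ge> 0" and R: "R \<ge> 0"
  obtains B where "B \<in> sets lborel" "{x. norm x \<le> R \<and> (\<forall>v\<in>set e. \<bar>v \<bullet> (x - z)\<bar> \<le> d)} \<subseteq> B"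
    "emeasure lborel B \<le> ennreal ((2 * d) ^ length e * (2 * R) ^ (3 - length e))"
proof -
  interpret product_sigma_finite "\<lambda>_::nat. lborel :: real measure"
    by (rule product_sigma_finite_lborel)
  obtain c where c: "orthonormal_frame (e @ c)" "length (e @ c) = 3"
    by (rule orthonormal_frame_extend[OF e]) (rule that)
  let ?f = "e @ c" and ?k = "length e"
  let ?I = "\<lambda>i. if i < ?k then {z \<bullet> e ! i - d .. z \<bullet> e ! i + d} else {- R .. R}"
  let ?B = "{x. \<forall>i<3. x \<bullet> ?f ! i \<in> ?I i}"
  have k3: "?k \<le> 3" using c(2) by simp
  have "?B = (\<Inter>i\<in>{..<3}. {x. x \<bullet> ?f ! i \<in> ?I i})"
    by (simp only: set_eq_iff INT_iff Ball_def lessThan_iff mem_Collect_eq) blast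
  also have "closed \<dots>"
  proof (rule closed_INT, rule ballI)
    fix i
    have "closed ((\<lambda>x. x \<bullet> ?f ! i) -` ?I i)"
      by (intro closed_vimage continuous_intros) auto
    then show "closed {x. x \<bullet> ?f ! i \<in> ?I i}" by (simp add: vimage_def)
  qed
  finally have cl: "closed ?B" .
  have mB: "?B \<in> sets lborel" unfolding sets_lborel by (rule borel_closed[OF cl])
  have m: "chart 0 ?f \<in> borel_measurable (pi_lborel {..<3})"
    by (rule measurable_chart) (use c(2) in simp)
  have ch: "chart 0 ?f t \<bullet> ?f ! i = t i" if "i < 3" for t i
  proof -
    have "chart 0 ?f t \<bullet> ?f ! i = (\<Sum>j<3. t j * (?f ! j \<bullet> ?f ! i))"
      unfolding chart_def c(2) by (simp add: inner_sum_left)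
    also have "\<dots> = (\<Sum>j<3. if j = i then t i else 0)"
      by (rule sum.cong) (use orthonormal_frame_inner[OF c(1)] c(2) that in auto)
    finally show ?thesis using that by simp
  qed
  have "emeasure lborel ?B = emeasure (distr (pi_lborel {..<3}) borel (chart 0 ?f)) ?B"
    unfolding distr_chart[OF c] ..
  also have "\<dots> = emeasure (pi_lborel {..<3}) (chart 0 ?f -` ?B \<inter> space (pi_lborel {..<3}))"
    by (rule emeasure_distr[OF m borel_closed[OF cl]])
  also have "chart 0 ?f -` ?B \<inter> space (pi_lborel {..<3}) = PiE {..<3} ?I"
    unfolding space_PiM by (auto simp: ch PiE_def Pi_def)
  also have "emeasure (pi_lborel {..<3}) \<dots> = (\<Prod>i<3. emeasure lborel (?I i))"
    by (rule emeasure_PiM) auto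
  also have "\<dots> = (\<Prod>i<3. ennreal (if i < ?k then 2 * d else 2 * R))"
    by (rule prod.cong) (use d R in auto)
  also have "\<dots> = ennreal (\<Prod>i<3. if i < ?k then 2 * d else 2 * R)"
    by (rule prod_ennreal) (use d R in auto)
  also have "(\<Prod>i<3. if i < ?k then 2 * d else 2 * R) = (2 * d) ^ ?k * (2 * R) ^ (3 - ?k)"
  proof -
    have "{..<3} \<inter> {i. i < ?k} = {..<?k}" "{..<3} \<inter> - {i. i < ?k} = {?k..<3}" using k3 by auto
    then show ?thesis by (subst prod.If_cases) auto
  qed
  finally have em: "emeasure lborel ?B = ennreal ((2 * d) ^ ?k * (2 * R) ^ (3 - ?k))" .
  show thesis
  proof (rule that[OF mB _ eq_refl[OF em]])
    show "{x. norm x \<le> R \<and> (\<forall>v\<in>set e. \<bar>v \<bullet> (x - z)\<bar> \<le> d)} \<subseteq> ?B"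
    proof safe
      fix x i assume x: "norm x \<le> R" "\<forall>v\<in>set e. \<bar>v \<bullet> (x - z)\<bar> \<le> d" and i: "i < (3::nat)"
      show "x \<bullet> ?f ! i \<in> ?I i"
      proof (cases "i < ?k")
        case True
        then have "\<bar>e ! i \<bullet> (x - z)\<bar> \<le> d" using x(2) by simp
        then show ?thesis using True
          by (auto simp: nth_append inner_diff_left inner_diff_right abs_le_iff inner_commute)
      next
        case False
        have "norm (?f ! i) = 1" by (rule orthonormal_frame_norm[OF c(1)]) (use i c(2) in \<open>metis nth_mem\<close>)
        moreover have "\<bar>x \<bullet> ?f ! i\<bar> \<le> norm x * norm (?f ! i)" by (rule Cauchy_Schwarz_ineq2)
        ultimately have "\<bar>x \<bullet> ?f ! i\<bar> \<le> R" using x(1) by simp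
        then show ?thesis using False by (auto simp: abs_le_iff)
      qed
    qed
  qed
qed

text \<open>A set of diameter \<open>d\<close> has a shadow that fits into a box with \<open>k\<close> sides proportional to \<open>d\<close> and
  the others to \<open>R\<close>; sum this over a covering.\<close>

lemma shadow_le_hausdorff:
  assumes e: "orthonormal_frame e" and R: "R > 0" and M: "M \<in> sets lborel"
    "M \<subseteq> {x. norm x \<le> R \<and> (\<exists>z\<in>A. qeq e z x)}"
  shows "emeasure lborel M \<le> ennreal (4 ^ length e / unit_ball_vol (real (length e)) * (2 * R) ^ (3 - length e)) * hausdorff_measure (length e) A"
    (is "_ \<le> ennreal ?C * _")
proof -
  let ?k = "length e"
  have w: "unit_ball_vol (real ?k) > 0" by simp
  have C: "?C \<ge> 0" using R w by simp
  \<comment> \<open>The mesh 1 is as good as any other, because the content at each scale is at most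
    the measure.\<close>
  have "emeasure lborel M \<le> ennreal ?C * (suminf (\<lambda>n. hweight ?k (U n)))" if U: "hcover 1 A U" for U
  proof -
    have "\<exists>B. B \<in> sets lborel \<and> {x. norm x \<le> R \<and> (\<exists>z\<in>U n. qeq e z x)} \<subseteq> B \<and> emeasure lborel B \<le> ennreal ?C * hweight ?k (U n)" for n
    proof (cases "U n = {}")
      case False
      then obtain z where z: "z \<in> U n" by blast
      have b: "bounded (U n)" using U by (simp add: hcover_def)
      obtain B where B: "B \<in> sets lborel" "{x. norm x \<le> R \<and> (\<forall>v\<in>set e. \<bar>v \<bullet> (x - z)\<bar> \<le> diameter (U n))} \<subseteq> B"
        "emeasure lborel B \<le> ennreal ((2 * diameter (U n)) ^ ?k * (2 * R) ^ (3 - ?k))"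
        by (rule slab_box_measure[OF e diameter_ge_0[OF b] less_imp_le[OF R]]) (rule that)
      have "{x. norm x \<le> R \<and> (\<exists>z\<in>U n. qeq e z x)} \<subseteq> B"
      proof (rule subset_trans[OF _ B(2)], safe)
        fix x y v assume x: "norm x \<le> R" "y \<in> U n" "qeq e y x" "v \<in> set e"
        have "v \<bullet> (x - z) = v \<bullet> (y - z)" using x(3,4) by (simp add: qeq_def inner_diff_right)
        also have "\<bar>\<dots>\<bar> \<le> norm v * norm (y - z)" by (rule Cauchy_Schwarz_ineq2)
        also have "norm v = 1" by (rule orthonormal_frame_norm[OF e x(4)])
        also have "1 * norm (y - z) \<le> diameter (U n)"
          using diameter_bounded_bound[OF b x(2) z] by (simp add: dist_norm)
        finally show "\<bar>v \<bullet> (x - z)\<bar> \<le> diameter (U n)" .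
      qed
      \<comment> \<open>The power of 4 in the constant converts the sides of the box, twice a
        diameter, to the half diameters in the Hausdorff weight.\<close>
      moreover have "ennreal ((2 * diameter (U n)) ^ ?k * (2 * R) ^ (3 - ?k)) = ennreal ?C * hweight ?k (U n)"
      proof -
        have "ennreal ?C * hweight ?k (U n) = ennreal (?C * (unit_ball_vol (real ?k) * (diameter (U n) / 2) ^ ?k))"
        proof -
          have hw: "hweight ?k (U n) = ennreal (unit_ball_vol (real ?k) * (diameter (U n) / 2) ^ ?k)"
            using False by (simp only: hweight_def if_False)
          show ?thesis unfolding hw
            by (rule ennreal_mult[symmetric]) (use C w diameter_ge_0[OF b] in auto)
        qed
        also have "?C * (unit_ball_vol (real ?k) * (diameter (U n) / 2) ^ ?k) = (4 * (diameter (U n) / 2)) ^ ?k * (2 * R) ^ (3 - ?k)"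
        proof -
          have "a / u * r * (u * p) = a * p * r" if "u \<noteq> 0" for a u r p :: real using that by simp
          from this[of "unit_ball_vol (real ?k)"] show ?thesis using w by (simp only: power_mult_distrib less_irrefl not_False_eq_True less_imp_neq[THEN not_sym])
        qed
        also have "4 * (diameter (U n) / 2) = 2 * diameter (U n)" by simp
        finally show ?thesis by simp
      qed
      ultimately show ?thesis using B(1,3) by (intro exI[of _ B]) simp
    qed auto
    from choice[OF allI[OF this]] obtain B where B0: "\<forall>n. B n \<in> sets lborel \<and> {x. norm x \<le> R \<and> (\<exists>z\<in>U n. qeq e z x)} \<subseteq> B n \<and>
      emeasure lborel (B n) \<le> ennreal ?C * hweight ?k (U n)" by (rule exE)
    have B: "\<And>n. B n \<in> sets lborel" "\<And>n. {x. norm x \<le> R \<and> (\<exists>z\<in>U n. qeq e z x)} \<subseteq> B n"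
      "\<And>n. emeasure lborel (B n) \<le> ennreal ?C * hweight ?k (U n)"
      using B0 by (simp_all only:)
    have "M \<subseteq> (\<Union>n. B n)"
    proof
      fix x assume "x \<in> M"
      then obtain z where z: "norm x \<le> R" "z \<in> A" "qeq e z x" using M(2) by blast
      then obtain n where "z \<in> U n" using U unfolding hcover_def by blast
      then show "x \<in> (\<Union>n. B n)" using B(2)[of n] z by blast
    qed
    then have "emeasure lborel M \<le> emeasure lborel (\<Union>n. B n)"
      by (rule emeasure_mono) (use B(1) in auto)
    also have "\<dots> \<le> (suminf (\<lambda>n. emeasure lborel (B n)))"
      by (rule emeasure_subadditive_countably) (use B(1) in auto)
    also have "\<dots> \<le> (suminf (\<lambda>n. ennreal ?C * hweight ?k (U n)))"
      by (rule suminf_le) (use B(3) in auto)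
    also have "\<dots> = ennreal ?C * (suminf (\<lambda>n. hweight ?k (U n)))" by (rule ennreal_suminf_cmult)
    finally show ?thesis .
  qed
  note le = this
  \<comment> \<open>Dividing by the constant lets the infimum over coverings be taken on the content
    alone.\<close>
  have Cp: "?C > 0" using R w by simp
  have "ennreal (1 / c) * ennreal c = 1" if "c > 0" for c :: real
    using that by (simp add: ennreal_mult[symmetric])
  then have c1: "ennreal (1 / ?C) * ennreal ?C = 1" using Cp by blast
  have "ennreal (1 / ?C) * emeasure lborel M \<le> hausdorff_content ?k 1 A"
  proof (rule hausdorff_content_ge)
    fix U assume "hcover 1 A U"
    then have "ennreal (1 / ?C) * emeasure lborel M \<le> ennreal (1 / ?C) * (ennreal ?C * (suminf (\<lambda>n. hweight ?k (U n))))"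
      by (intro mult_left_mono le) auto
    then show "ennreal (1 / ?C) * emeasure lborel M \<le> (suminf (\<lambda>n. hweight ?k (U n)))"
      unfolding mult.assoc[symmetric] c1 by simp
  qed
  also have "\<dots> \<le> hausdorff_measure ?k A" by (rule hausdorff_content_le_measure) simp
  finally have "ennreal ?C * (ennreal (1 / ?C) * emeasure lborel M) \<le> ennreal ?C * hausdorff_measure ?k A"
    by (rule mult_left_mono) simp
  then show ?thesis unfolding mult.assoc[symmetric] mult.commute[of "ennreal ?C" "ennreal (1 / ?C)"] c1 by simp
qed

text \<open>The covectors \<open>q\<close> are traded for an orthonormal frame of their span, which
  has the same fibres, so the constant depends on \<open>k\<close> and \<open>R\<close> but not on
  \<open>q\<close>.\<close>

lemma shadow_bound:
  assumes R: "R > 0"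
  obtains C where "C \<ge> 0" "\<And>\<sigma> q. \<sigma> \<in> cells k \<Longrightarrow> length q = nat k \<Longrightarrow> frame_sign q (snd \<sigma>) \<noteq> 0 \<Longrightarrow>
    {x. norm x \<le> R \<and> (\<exists>z\<in>fst \<sigma>. qeq q z x)} \<in> sets borel \<and>
    emeasure lborel {x. norm x \<le> R \<and> (\<exists>z\<in>fst \<sigma>. qeq q z x)} \<le> ennreal (C * cell_mass \<sigma>)"
proof -
  let ?C = "4 ^ nat k / unit_ball_vol (real (nat k)) * (2 * R) ^ (3 - nat k)"
  have C: "?C \<ge> 0" using R by simp
  have "{x. norm x \<le> R \<and> (\<exists>z\<in>fst \<sigma>. qeq q z x)} \<in> sets borel \<and>
    emeasure lborel {x. norm x \<le> R \<and> (\<exists>z\<in>fst \<sigma>. qeq q z x)} \<le> ennreal (?C * cell_mass \<sigma>)"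
    if s: "\<sigma> \<in> cells k" and q: "length q = nat k" "frame_sign q (snd \<sigma>) \<noteq> 0" for \<sigma> q
  proof
    have c: "(fst \<sigma>, snd \<sigma>) \<in> cells k" using s by simp
    have b: "orthonormal_frame (snd \<sigma>)" "length q = length (snd \<sigma>)" using cellsD[OF s] q by auto
    obtain Z where Z: "continuous_on UNIV Z" "\<And>x z. z \<in> fst \<sigma> \<and> qeq q z x \<longleftrightarrow> z \<in> fst \<sigma> \<and> z = Z x"
      "\<And>x. qeq q (Z x) x"
      by (rule cell_slice_map[OF c q]) (rule that)
    have "(\<exists>z\<in>fst \<sigma>. qeq q z x) \<longleftrightarrow> Z x \<in> fst \<sigma>" for x
    proof
      assume "\<exists>z\<in>fst \<sigma>. qeq q z x"
      then obtain z where "z \<in> fst \<sigma>" "qeq q z x" by blast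
      then show "Z x \<in> fst \<sigma>" using Z(2)[of z x] by simp
    qed (use Z(3)[of x] in blast)
    note ZZ = this
    let ?M = "{x. norm x \<le> R \<and> (\<exists>z\<in>fst \<sigma>. qeq q z x)}"
    have "?M = cball 0 R \<inter> Z -` fst \<sigma>" using ZZ by auto
    also have "\<dots> \<in> sets borel"
    proof -
      have "Z \<in> borel_measurable borel" using Z(1) by (rule borel_measurable_continuous_onI)
      then have "Z -` fst \<sigma> \<inter> space borel \<in> sets borel" using cell_borel[OF s] by (rule measurable_sets)
      then show ?thesis by (intro sets.Int) auto
    qed
    finally show M: "?M \<in> sets borel" .
    have "frame_det q (snd \<sigma>) \<noteq> 0" using q(2) by (auto simp: frame_sign_def)
    then have dq: "dim (set q) = nat k" using frame_det_dim[OF b] b(2) q(1) by simp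
    have aff: "affine (span (set q))" by (rule subspace_imp_affine[OF subspace_span])
    obtain e where e: "orthonormal_frame e" "plane 0 e = span (set q)"
      by (rule exists_frame_affine[OF aff span_zero]) (rule that)
    have sp: "span (set e) = span (set q)" using e(2) by (simp add: plane_def)
    have le: "length e = nat k" using dim_orthonormal_frame[OF e(1)] dq unfolding sp by simp
    have qe: "qeq e z x \<longleftrightarrow> qeq q z x" for z x unfolding qeq_qker qker_span sp ..
    have "emeasure lborel ?M \<le> ennreal (4 ^ length e / unit_ball_vol (real (length e)) * (2 * R) ^ (3 - length e)) * hausdorff_measure (length e) (fst \<sigma>)"
      by (rule shadow_le_hausdorff[OF e(1) R]) (use M qe in auto)
    also have "\<dots> = ennreal (?C * cell_mass \<sigma>)"
      unfolding le cell_hausdorff_finite(2)[OF s]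
      by (rule ennreal_mult[symmetric, OF C cell_mass_nonneg])
    finally show "emeasure lborel ?M \<le> ennreal (?C * cell_mass \<sigma>)" .
  qed
  with C show thesis by (rule that)
qed

section \<open>Common refinements\<close>

lemma cells_nonneg: "\<sigma> \<in> cells k \<Longrightarrow> k \<ge> 0"
  using cellsD(1)[of \<sigma> k] by linarith

lemma cell_mass_frame: "length b = length c \<Longrightarrow> cell_mass (A, b) = cell_mass (A, c)"
  by (simp add: cell_mass_def)

text \<open>Each piece gets the frame of one arbitrarily chosen cell that contains it, and
  \<open>\<epsilon>\<close> compares this orientation with those of all cells containing the
  piece.\<close>

lemma common_refinement:
  assumes "finite \<F>" "\<F> \<subseteq> cells k"
  obtains T \<epsilon> where "finite T" "T \<subseteq> cells k" "nonoverlapping k T"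
    "\<And>\<sigma>. \<sigma> \<in> \<F> \<Longrightarrow> frag_of \<sigma> - (\<Sum>\<tau>\<in>T. frag_cmul (\<epsilon> \<sigma> \<tau>) (frag_of \<tau>)) \<in> null_chains k"
    "\<And>\<sigma> \<tau>. \<sigma> \<in> \<F> \<Longrightarrow> \<tau> \<in> T \<Longrightarrow> fst \<tau> \<subseteq> fst \<sigma> \<Longrightarrow> \<epsilon> \<sigma> \<tau> = 1 \<or> \<epsilon> \<sigma> \<tau> = (- 1 :: int)"
    "\<And>\<sigma> \<tau>. \<sigma> \<in> \<F> \<Longrightarrow> \<tau> \<in> T \<Longrightarrow> \<not> fst \<tau> \<subseteq> fst \<sigma> \<Longrightarrow> \<epsilon> \<sigma> \<tau> = 0"
    "\<And>\<sigma>. \<sigma> \<in> \<F> \<Longrightarrow> cell_mass \<sigma> = (\<Sum>\<tau>\<in>{\<tau>\<in>T. fst \<tau> \<subseteq> fst \<sigma>}. cell_mass \<tau>)"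
proof -
  obtain \<S> where S: "finite \<S>" "disjoint \<S>"
    "\<And>S. S \<in> \<S> \<Longrightarrow> \<exists>\<sigma>\<in>\<F>. S \<subseteq> fst \<sigma>"
    "\<And>S \<sigma>. S \<in> \<S> \<Longrightarrow> \<sigma> \<in> \<F> \<Longrightarrow> S \<subseteq> fst \<sigma> \<or> S \<inter> fst \<sigma> = {}"
    "\<And>S \<sigma>. S \<in> \<S> \<Longrightarrow> \<sigma> \<in> \<F> \<Longrightarrow> S \<subseteq> fst \<sigma> \<Longrightarrow> (S, snd \<sigma>) \<in> cells k"
    "\<And>\<sigma>. \<sigma> \<in> \<F> \<Longrightarrow> thin k (fst \<sigma> - \<Union>{S \<in> \<S>. S \<subseteq> fst \<sigma>})"
    by (rule exists_refinement[OF assms]) (rule that)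
  have "\<forall>S\<in>\<S>. \<exists>\<sigma>. \<sigma> \<in> \<F> \<and> S \<subseteq> fst \<sigma>" using S(3) by blast
  from bchoice[OF this] obtain f where f: "\<And>S. S \<in> \<S> \<Longrightarrow> f S \<in> \<F> \<and> S \<subseteq> fst (f S)" by blast
  define cl where "cl S = (S, snd (f S))" for S
  have clc: "cl S \<in> cells k" if "S \<in> \<S>" for S
    unfolding cl_def using S(5)[OF that, of "f S"] f[OF that] by blast
  have inj: "inj_on cl \<S>" by (auto simp: cl_def inj_on_def)
  define T where "T = cl ` \<S>"
  define \<epsilon> where "\<epsilon> \<sigma> \<tau> = (if fst \<tau> \<subseteq> fst \<sigma> then frame_sign (snd \<sigma>) (snd \<tau>) else 0)" for \<sigma> \<tau> :: cell
  have T: "finite T" "T \<subseteq> cells k" using S(1) clc by (auto simp: T_def)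
  have no: "nonoverlapping k T"
    unfolding nonoverlapping_def
  proof (intro ballI impI)
    fix \<sigma> \<tau> assume a: "\<sigma> \<in> T" "\<tau> \<in> T" "\<sigma> \<noteq> \<tau>"
    then obtain S S' where S': "S \<in> \<S>" "S' \<in> \<S>" "\<sigma> = cl S" "\<tau> = cl S'" by (auto simp: T_def)
    then have "S \<noteq> S'" using a(3) by blast
    then have "fst \<sigma> \<inter> fst \<tau> = {}" using S' S(2) by (auto simp: cl_def disjoint_def)
    \<comment> \<open>The empty intersection has affine dimension - 1, which must be below
      \<open>k\<close>.\<close>
    moreover have "k \<ge> 0" using cells_nonneg a(1) T(2) by blast
    ultimately show "aff_dim (fst \<sigma> \<inter> fst \<tau>) < k" by simp
  qed
  have part: "\<And>S. S \<in> {S \<in> \<S>. S \<subseteq> fst \<sigma>} \<Longrightarrow> S \<subseteq> fst \<sigma> \<and> (S, snd \<sigma>) \<in> cells k"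
    "finite {S \<in> \<S>. S \<subseteq> fst \<sigma>}" "disjoint {S \<in> \<S>. S \<subseteq> fst \<sigma>}" "(fst \<sigma>, snd \<sigma>) \<in> cells k" if "\<sigma> \<in> \<F>" for \<sigma>
    using S(1,2) S(5)[OF _ that] that assms(2) by (auto simp: disjoint_def)
  have "frag_of \<sigma> - (\<Sum>\<tau>\<in>T. frag_cmul (\<epsilon> \<sigma> \<tau>) (frag_of \<tau>)) \<in> null_chains k" if s: "\<sigma> \<in> \<F>" for \<sigma>
  proof -
    let ?P = "{S \<in> \<S>. S \<subseteq> fst \<sigma>}"
    have 1: "frag_of (fst \<sigma>, snd \<sigma>) - (\<Sum>S\<in>?P. frag_of (S, snd \<sigma>)) \<in> null_chains k"
      using null_partition[OF part(4)[OF s] part(2,3)[OF s] part(1)[OF s] S(6)[OF s]] by blast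
    have 2: "(\<Sum>S\<in>?P. frag_of (S, snd \<sigma>) - frag_cmul (frame_sign (snd \<sigma>) (snd (cl S))) (frag_of (cl S))) \<in> null_chains k"
    proof (rule null_chains_sum)
      fix S assume "S \<in> ?P"
      then show "frag_of (S, snd \<sigma>) - frag_cmul (frame_sign (snd \<sigma>) (snd (cl S))) (frag_of (cl S)) \<in> null_chains k"
        using null_frame[of S "snd (f S)" k "snd \<sigma>"] clc[of S] part(1)[OF s, of S] unfolding cl_def snd_conv by blast
    qed
    have "(\<Sum>\<tau>\<in>T. frag_cmul (\<epsilon> \<sigma> \<tau>) (frag_of \<tau>)) = (\<Sum>S\<in>\<S>. frag_cmul (\<epsilon> \<sigma> (cl S)) (frag_of (cl S)))"
      unfolding T_def by (rule sum.reindex_cong[OF inj]) auto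
    also have "\<dots> = (\<Sum>S\<in>?P. frag_cmul (\<epsilon> \<sigma> (cl S)) (frag_of (cl S)))"
      by (rule sum.mono_neutral_right) (use S(1) in \<open>auto simp: \<epsilon>_def cl_def\<close>)
    also have "\<dots> = (\<Sum>S\<in>?P. frag_cmul (frame_sign (snd \<sigma>) (snd (cl S))) (frag_of (cl S)))"
      by (rule sum.cong) (auto simp: \<epsilon>_def cl_def)
    finally have e: "(\<Sum>\<tau>\<in>T. frag_cmul (\<epsilon> \<sigma> \<tau>) (frag_of \<tau>)) = (\<Sum>S\<in>?P. frag_cmul (frame_sign (snd \<sigma>) (snd (cl S))) (frag_of (cl S)))" .
    have "frag_of \<sigma> - (\<Sum>\<tau>\<in>T. frag_cmul (\<epsilon> \<sigma> \<tau>) (frag_of \<tau>)) =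
      (frag_of (fst \<sigma>, snd \<sigma>) - (\<Sum>S\<in>?P. frag_of (S, snd \<sigma>))) + (\<Sum>S\<in>?P. frag_of (S, snd \<sigma>) - frag_cmul (frame_sign (snd \<sigma>) (snd (cl S))) (frag_of (cl S)))"
      unfolding e by (simp add: sum_subtractf)
    then show ?thesis using null_chains_add[OF 1 2] by (rule ssubst)
  qed
  moreover have "\<epsilon> \<sigma> \<tau> = 1 \<or> \<epsilon> \<sigma> \<tau> = (- 1 :: int)" if s: "\<sigma> \<in> \<F>" and t: "\<tau> \<in> T" and st: "fst \<tau> \<subseteq> fst \<sigma>" for \<sigma> \<tau>
  proof -
    obtain S where S': "S \<in> \<S>" "\<tau> = cl S" using t by (auto simp: T_def)
    have c: "(S, snd \<sigma>) \<in> cells k" "(S, snd \<tau>) \<in> cells k"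
      using S(5)[OF S'(1) s] st clc[OF S'(1)] by (auto simp: S'(2) cl_def)
    have "frame_sign (snd \<sigma>) (snd \<tau>) = 1 \<or> frame_sign (snd \<sigma>) (snd \<tau>) = - 1"
      by (rule frame_sign_pm1(1)) (use cellsD[OF c(1)] cellsD[OF c(2)] cells_same_span[OF c] in auto)
    then show ?thesis using st by (simp add: \<epsilon>_def)
  qed
  moreover have "\<epsilon> \<sigma> \<tau> = 0" if "\<sigma> \<in> \<F>" "\<tau> \<in> T" "\<not> fst \<tau> \<subseteq> fst \<sigma>" for \<sigma> \<tau> using that by (simp add: \<epsilon>_def)
  moreover have "cell_mass \<sigma> = (\<Sum>\<tau>\<in>{\<tau>\<in>T. fst \<tau> \<subseteq> fst \<sigma>}. cell_mass \<tau>)" if s: "\<sigma> \<in> \<F>" for \<sigma>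
  proof -
    let ?P = "{S \<in> \<S>. S \<subseteq> fst \<sigma>}"
    have "cell_mass \<sigma> = (\<Sum>S\<in>?P. cell_mass (S, snd \<sigma>))"
      using cell_mass_partition[OF part(4)[OF s] part(2,3)[OF s] part(1)[OF s] S(6)[OF s]] by simp
    also have "\<dots> = (\<Sum>S\<in>?P. cell_mass (cl S))"
    proof (rule sum.cong)
      fix S assume "S \<in> ?P"
      then have "int (length (snd \<sigma>)) = k" "int (length (snd (cl S))) = k"
        using cellsD(1)[OF clc] cellsD(1)[OF part(4)[OF s]] by auto
      then show "cell_mass (S, snd \<sigma>) = cell_mass (cl S)"
        unfolding cl_def by (intro cell_mass_frame) (simp add: cl_def)
    qed simp
    also have "\<dots> = (\<Sum>\<tau>\<in>cl ` ?P. cell_mass \<tau>)"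
      by (rule sum.reindex_cong[symmetric, OF inj_on_subset[OF inj]]) auto
    also have "cl ` ?P = {\<tau>\<in>T. fst \<tau> \<subseteq> fst \<sigma>}" by (auto simp: T_def cl_def)
    finally show ?thesis .
  qed
  ultimately show thesis using that[of T \<epsilon>] T no by blast
qed

section \<open>Quotients of free abelian groups\<close>

lemma subgroup_free_iff:
  "subgroup N (free_Abelian_group S) \<longleftrightarrow> N \<subseteq> {c. Poly_Mapping.keys c \<subseteq> S} \<and> 0 \<in> N \<and>
     (\<forall>c\<in>N. \<forall>d\<in>N. c + d \<in> N) \<and> (\<forall>c\<in>N. - c \<in> N)"
proof
  assume s: "subgroup N (free_Abelian_group S)"
  have sub: "N \<subseteq> {c. Poly_Mapping.keys c \<subseteq> S}"
    using subgroup.subset[OF s] by (intro subsetI CollectI) (metis carrier_free_Abelian_group_iff subset_iff)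
  moreover have "- c \<in> N" if "c \<in> N" for c
    using subgroup.m_inv_closed[OF s that] sub that by (auto simp: inv_free_Abelian_group subset_iff)
  ultimately show "N \<subseteq> {c. Poly_Mapping.keys c \<subseteq> S} \<and> 0 \<in> N \<and> (\<forall>c\<in>N. \<forall>d\<in>N. c + d \<in> N) \<and> (\<forall>c\<in>N. - c \<in> N)"
    using subgroup.one_closed[OF s] subgroup.m_closed[OF s] by auto
next
  assume a: "N \<subseteq> {c. Poly_Mapping.keys c \<subseteq> S} \<and> 0 \<in> N \<and> (\<forall>c\<in>N. \<forall>d\<in>N. c + d \<in> N) \<and> (\<forall>c\<in>N. - c \<in> N)"
  show "subgroup N (free_Abelian_group S)"
  proof (rule subgroup.intro)
    show "N \<subseteq> carrier (free_Abelian_group S)" using a by (auto simp: carrier_free_Abelian_group_iff)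
    show "inv\<^bsub>free_Abelian_group S\<^esub> x \<in> N" if "x \<in> N" for x
      using a that by (subst inv_free_Abelian_group) auto
  qed (use a in auto)
qed

lemma r_coset_free: "N #>\<^bsub>free_Abelian_group S\<^esub> c = (\<lambda>h. h + c) ` N"
  by (auto simp: r_coset_def)

lemma mem_r_coset_free: "d \<in> N #>\<^bsub>free_Abelian_group S\<^esub> c \<longleftrightarrow> d - c \<in> N"
  unfolding r_coset_free by (auto simp: image_iff) (metis diff_add_cancel)

lemma r_coset_free_eq:
  assumes "subgroup N (free_Abelian_group S)"
  shows "N #>\<^bsub>free_Abelian_group S\<^esub> c = N #>\<^bsub>free_Abelian_group S\<^esub> d \<longleftrightarrow> c - d \<in> N"
proof -
  have N: "0 \<in> N" "\<And>c d. c \<in> N \<Longrightarrow> d \<in> N \<Longrightarrow> c + d \<in> N" "\<And>c. c \<in> N \<Longrightarrow> - c \<in> N"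
    using assms unfolding subgroup_free_iff by blast+
  show ?thesis
  proof
    assume "N #>\<^bsub>free_Abelian_group S\<^esub> c = N #>\<^bsub>free_Abelian_group S\<^esub> d"
    moreover have "c \<in> N #>\<^bsub>free_Abelian_group S\<^esub> c" using N(1) by (simp add: mem_r_coset_free)
    ultimately show "c - d \<in> N" by (simp add: mem_r_coset_free)
  next
    assume cd: "c - d \<in> N"
    have "x - c \<in> N \<longleftrightarrow> x - d \<in> N" for x
    proof
      assume "x - c \<in> N"
      then show "x - d \<in> N" using N(2)[of "x - c" "c - d"] cd by simp
    next
      assume "x - d \<in> N"
      then show "x - c \<in> N" using N(2)[of "x - d" "- (c - d)"] N(3)[OF cd] by simp
    qed
    then show "N #>\<^bsub>free_Abelian_group S\<^esub> c = N #>\<^bsub>free_Abelian_group S\<^esub> d"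
      by (intro Set.set_eqI) (simp add: mem_r_coset_free)
  qed
qed

text \<open>Used twice, for integral chains and for the tensor product: each is a free abelian group
  modulo a subgroup.\<close>

lemma quotient_free:
  assumes N: "subgroup N (free_Abelian_group S)"
  shows "comm_group (free_Abelian_group S Mod N)"
    "carrier (free_Abelian_group S Mod N) = (\<lambda>c. N #>\<^bsub>free_Abelian_group S\<^esub> c) ` {c. Poly_Mapping.keys c \<subseteq> S}"
    "Poly_Mapping.keys c \<subseteq> S \<Longrightarrow> Poly_Mapping.keys d \<subseteq> S \<Longrightarrow>
      (N #>\<^bsub>free_Abelian_group S\<^esub> c) \<otimes>\<^bsub>free_Abelian_group S Mod N\<^esub> (N #>\<^bsub>free_Abelian_group S\<^esub> d)
       = N #>\<^bsub>free_Abelian_group S\<^esub> (c + d)"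
    "\<one>\<^bsub>free_Abelian_group S Mod N\<^esub> = N #>\<^bsub>free_Abelian_group S\<^esub> 0"
    "Poly_Mapping.keys c \<subseteq> S \<Longrightarrow> inv\<^bsub>free_Abelian_group S Mod N\<^esub> (N #>\<^bsub>free_Abelian_group S\<^esub> c)
       = N #>\<^bsub>free_Abelian_group S\<^esub> (- c)"
proof -
  let ?G = "free_Abelian_group S"
  have G: "comm_group ?G" by (rule abelian_free_Abelian_group)
  have nm: "normal N ?G" using comm_group.subgroup_imp_normal[OF G N] .
  show C: "comm_group (?G Mod N)" by (rule comm_group.abelian_FactGroup[OF G N])
  show car: "carrier (?G Mod N) = (\<lambda>c. N #>\<^bsub>?G\<^esub> c) ` {c. Poly_Mapping.keys c \<subseteq> S}"
    by (auto simp: FactGroup_def RCOSETS_def carrier_free_Abelian_group_iff)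
  show mult: "(N #>\<^bsub>?G\<^esub> c) \<otimes>\<^bsub>?G Mod N\<^esub> (N #>\<^bsub>?G\<^esub> d) = N #>\<^bsub>?G\<^esub> (c + d)"
    if "Poly_Mapping.keys c \<subseteq> S" "Poly_Mapping.keys d \<subseteq> S" for c d
    using normal.rcos_sum[OF nm, of c d] that by (simp add: FactGroup_def carrier_free_Abelian_group_iff)
  show one: "\<one>\<^bsub>?G Mod N\<^esub> = N #>\<^bsub>?G\<^esub> 0"
    by (simp add: FactGroup_def r_coset_free)
  show "inv\<^bsub>?G Mod N\<^esub> (N #>\<^bsub>?G\<^esub> c) = N #>\<^bsub>?G\<^esub> (- c)" if "Poly_Mapping.keys c \<subseteq> S"
  proof (rule group.inv_equality)
    show "Group.group (?G Mod N)" using C by (simp add: comm_group_def)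
    show "(N #>\<^bsub>?G\<^esub> (- c)) \<otimes>\<^bsub>?G Mod N\<^esub> (N #>\<^bsub>?G\<^esub> c) = \<one>\<^bsub>?G Mod N\<^esub>"
      unfolding one using mult[of "- c" c] that by simp
  qed (use that in \<open>auto simp: car\<close>)
qed

lemma subgroup_null_chains: "subgroup (null_chains k) (free_Abelian_group (cells k))"
  unfolding subgroup_free_iff
  using null_chains_0 null_chains_add null_chains_minus by (auto simp: null_chains_iff)

lemma int_chain_of_eq: "int_chain_of k c = int_chain_of k d \<longleftrightarrow> c - d \<in> null_chains k"
  unfolding int_chain_of_def by (rule r_coset_free_eq[OF subgroup_null_chains])

lemma mem_int_chain_of: "d \<in> int_chain_of k c \<longleftrightarrow> d - c \<in> null_chains k"
  unfolding int_chain_of_def by (rule mem_r_coset_free)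

lemmas int_chains_quotient =
  quotient_free[OF subgroup_null_chains, folded int_chains_def, folded int_chain_of_def]

lemma int_chain_of_carrier: "Poly_Mapping.keys c \<subseteq> cells k \<Longrightarrow> int_chain_of k c \<in> carrier (int_chains k)"
  unfolding int_chains_quotient(2) by blast

section \<open>The tensor product with the coefficient group\<close>

definition tensor_ker :: "int \<Rightarrow> ('g::ab_group_add \<times> int_chain \<Rightarrow>\<^sub>0 int) set" where
  "tensor_ker k = tensor_kernel coefficient_group (int_chains k)"

definition tensor_gens :: "int \<Rightarrow> ('g \<times> int_chain) set" where
  "tensor_gens k = UNIV \<times> carrier (int_chains k)"

definition tensor_cls :: "int \<Rightarrow> ('g::ab_group_add \<times> int_chain \<Rightarrow>\<^sub>0 int) \<Rightarrow> 'g chain" where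
  "tensor_cls k z = tensor_class coefficient_group (int_chains k) z"

lemma coefficient_group_simps [simp]:
  "carrier coefficient_group = UNIV" "x \<otimes>\<^bsub>coefficient_group\<^esub> y = x + y"
  by (simp_all add: coefficient_group_def)

lemma tensor_ker_alt: "tensor_ker k = generate (free_Abelian_group (tensor_gens k)) (tensor_relations coefficient_group (int_chains k))"
  by (simp add: tensor_ker_def tensor_kernel_def tensor_gens_def)

lemma keys_add_subset: "Poly_Mapping.keys c \<subseteq> S \<Longrightarrow> Poly_Mapping.keys d \<subseteq> S \<Longrightarrow> Poly_Mapping.keys (c + d) \<subseteq> S"
  using keys_add[of c d] by blast

lemma int_chains_mult_closed:
  "y \<in> carrier (int_chains k) \<Longrightarrow> y' \<in> carrier (int_chains k) \<Longrightarrow> y \<otimes>\<^bsub>int_chains k\<^esub> y' \<in> carrier (int_chains k)"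
  by (rule monoid.m_closed) (use int_chains_quotient(1)[of k] in \<open>simp_all add: comm_group_def comm_monoid_def\<close>)

lemma tensor_relations_subset:
  "tensor_relations coefficient_group (int_chains k) \<subseteq> {z. Poly_Mapping.keys z \<subseteq> tensor_gens k}"
proof -
  have f: "Poly_Mapping.keys (frag_of (x, y)) \<subseteq> tensor_gens k" if "y \<in> carrier (int_chains k)" for x and y
    using that by (simp add: tensor_gens_def)
  show ?thesis
    unfolding tensor_relations_def
    by (rule subsetI, elim UnE CollectE exE conjE; simp only: mem_Collect_eq; intro keys_diff_subset keys_add_subset f int_chains_mult_closed; assumption)
qed

lemma subgroup_tensor_ker: "subgroup (tensor_ker k) (free_Abelian_group (tensor_gens k))"
  unfolding tensor_ker_alt
  by (rule group.generate_is_subgroup)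
    (use tensor_relations_subset[of k] in \<open>auto simp: carrier_free_Abelian_group_iff\<close>)

lemma polyhedral_chains_alt: "polyhedral_chains k = free_Abelian_group (tensor_gens k) Mod tensor_ker k"
  by (simp add: polyhedral_chains_def tensor_product_def tensor_ker_def tensor_gens_def)

lemma tensor_cls_alt: "tensor_cls k z = tensor_ker k #>\<^bsub>free_Abelian_group (tensor_gens k)\<^esub> z"
  by (simp add: tensor_cls_def tensor_class_def tensor_ker_def tensor_gens_def)

lemmas polyhedral_chains_quotient =
  quotient_free[OF subgroup_tensor_ker, folded polyhedral_chains_alt, folded tensor_cls_alt]

lemma tensor_cls_eq: "tensor_cls k z = tensor_cls k w \<longleftrightarrow> z - w \<in> tensor_ker k"
  unfolding tensor_cls_alt by (rule r_coset_free_eq[OF subgroup_tensor_ker])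

lemma mem_tensor_cls: "w \<in> tensor_cls k z \<longleftrightarrow> w - z \<in> tensor_ker k"
  unfolding tensor_cls_alt by (rule mem_r_coset_free)

lemma tensor_ker_closed:
  "z \<in> tensor_ker k \<Longrightarrow> Poly_Mapping.keys z \<subseteq> tensor_gens k" "0 \<in> tensor_ker k"
  "z \<in> tensor_ker k \<Longrightarrow> w \<in> tensor_ker k \<Longrightarrow> z + w \<in> tensor_ker k" "z \<in> tensor_ker k \<Longrightarrow> - z \<in> tensor_ker k"
  using subgroup_tensor_ker[of k] unfolding subgroup_free_iff by auto

lemma tensor_ker_diff: "z \<in> tensor_ker k \<Longrightarrow> w \<in> tensor_ker k \<Longrightarrow> z - w \<in> tensor_ker k"
  using tensor_ker_closed(3)[of z k "- w"] tensor_ker_closed(4)[of w k] by simp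

lemma tensor_ker_sum: "(\<And>i. i \<in> I \<Longrightarrow> f i \<in> tensor_ker k) \<Longrightarrow> (\<Sum>i\<in>I. f i) \<in> tensor_ker k"
  by (induction I rule: infinite_finite_induct) (auto intro: tensor_ker_closed)

lemma tensor_ker_rel1:
  "y \<in> carrier (int_chains k) \<Longrightarrow> frag_of (x + x', y) - (frag_of (x, y) + frag_of (x', y)) \<in> tensor_ker k"
  unfolding tensor_ker_alt by (rule generate.incl) (auto simp: tensor_relations_def)

lemma tensor_ker_rel2:
  "y \<in> carrier (int_chains k) \<Longrightarrow> y' \<in> carrier (int_chains k) \<Longrightarrow>
   frag_of (x, y \<otimes>\<^bsub>int_chains k\<^esub> y') - (frag_of (x, y) + frag_of (x, y')) \<in> tensor_ker k"
  unfolding tensor_ker_alt by (rule generate.incl) (auto simp: tensor_relations_def)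

text \<open>Properties stable under the group operations, such as vanishing of slices almost
  everywhere, need to be checked on the two kinds of relations only.\<close>

lemma tensor_ker_induct [consumes 1, case_names zero rel1 rel2 minus add]:
  assumes z: "z \<in> tensor_ker k" and "P 0"
    and r1: "\<And>x x' y. y \<in> carrier (int_chains k) \<Longrightarrow> P (frag_of (x + x', y) - (frag_of (x, y) + frag_of (x', y)))"
    and r2: "\<And>x y y'. y \<in> carrier (int_chains k) \<Longrightarrow> y' \<in> carrier (int_chains k) \<Longrightarrow>
        P (frag_of (x, y \<otimes>\<^bsub>int_chains k\<^esub> y') - (frag_of (x, y) + frag_of (x, y')))"
    and m: "\<And>z. P z \<Longrightarrow> P (- z)" and a: "\<And>z w. P z \<Longrightarrow> P w \<Longrightarrow> P (z + w)"
  shows "P z"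
proof -
  have rel: "P h" if "h \<in> tensor_relations coefficient_group (int_chains k)" for h
    using that r1 r2 unfolding tensor_relations_def by auto
  show ?thesis
    using z unfolding tensor_ker_alt
  proof (induction rule: generate.induct)
    case (inv h)
    then have "Poly_Mapping.keys h \<subseteq> tensor_gens k" using tensor_relations_subset by blast
    then show ?case using m[OF rel[OF inv]] by simp
  qed (use assms(2) rel a in auto)
qed

lemma tensor_ker_zero_left: "y \<in> carrier (int_chains k) \<Longrightarrow> frag_of (0, y) \<in> tensor_ker k"
  using tensor_ker_closed(4)[OF tensor_ker_rel1[of y k 0 0]] by simp

lemma tensor_ker_minus_left: "y \<in> carrier (int_chains k) \<Longrightarrow> frag_of (- x, y) + frag_of (x, y) \<in> tensor_ker k"
  using tensor_ker_diff[OF tensor_ker_zero_left[of y k] tensor_ker_rel1[of y k "- x" x]] by simp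

lemma tensor_ker_sum_left:
  assumes "y \<in> carrier (int_chains k)" "finite I"
  shows "frag_of ((\<Sum>i\<in>I. f i), y) - (\<Sum>i\<in>I. frag_of (f i, y)) \<in> tensor_ker k"
  using assms(2)
proof (induction I rule: finite_induct)
  case empty
  then show ?case using tensor_ker_zero_left[OF assms(1)] by simp
next
  case (insert i I)
  from tensor_ker_closed(3)[OF tensor_ker_rel1[OF assms(1), of "f i" "\<Sum>i\<in>I. f i"] insert.IH] insert.hyps
  show ?case by (simp add: algebra_simps)
qed

lemma tensor_ker_add_right:
  assumes "Poly_Mapping.keys c \<subseteq> cells k" "Poly_Mapping.keys d \<subseteq> cells k"
  shows "frag_of (x, int_chain_of k (c + d)) - (frag_of (x, int_chain_of k c) + frag_of (x, int_chain_of k d)) \<in> tensor_ker k"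
  using tensor_ker_rel2[OF int_chain_of_carrier[OF assms(1)] int_chain_of_carrier[OF assms(2)], of x]
  unfolding int_chains_quotient(3)[OF assms] .

lemma tensor_ker_zero_right: "frag_of (x, int_chain_of k 0) \<in> tensor_ker k"
  using tensor_ker_closed(4)[OF tensor_ker_add_right[of 0 k 0 x]] by simp

lemma tensor_ker_sum_right:
  assumes "finite I" "\<And>i. i \<in> I \<Longrightarrow> Poly_Mapping.keys (c i) \<subseteq> cells k"
  shows "frag_of (x, int_chain_of k (\<Sum>i\<in>I. c i)) - (\<Sum>i\<in>I. frag_of (x, int_chain_of k (c i))) \<in> tensor_ker k"
  using assms
proof (induction I rule: finite_induct)
  case empty
  then show ?case using tensor_ker_zero_right by simp
next
  case (insert i I)
  have "Poly_Mapping.keys (c i) \<subseteq> cells k" "Poly_Mapping.keys (\<Sum>i\<in>I. c i) \<subseteq> cells k"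
    using insert.prems by simp (rule keys_sum_subset, use insert.prems in simp)
  from tensor_ker_closed(3)[OF tensor_ker_add_right[OF this, of x] insert.IH] insert.hyps insert.prems
  show ?case by (simp add: algebra_simps)
qed

text \<open>Signs move from the chain to the coefficient. The values 1, - 1 and 0 are those that
  occur in refinements.\<close>

lemma tensor_ker_sign:
  assumes c: "Poly_Mapping.keys c \<subseteq> cells k" and e: "e = 1 \<or> e = - 1 \<or> e = (0::int)"
  shows "frag_of (x, int_chain_of k (frag_cmul e c)) - frag_of (imul e x, int_chain_of k c) \<in> tensor_ker k"
proof -
  have y: "int_chain_of k c \<in> carrier (int_chains k)" by (rule int_chain_of_carrier[OF c])
  consider "e = 1" | "e = - 1" | "e = 0" using e by blast
  then show ?thesis
  proof cases
    case 1
    then show ?thesis using tensor_ker_closed(2) by simp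
  next
    case 2
    have "Poly_Mapping.keys (- c) \<subseteq> cells k" using c by simp
    from tensor_ker_diff[OF tensor_ker_zero_right tensor_ker_add_right[OF this c, of x], of x]
    have "frag_of (x, int_chain_of k (- c)) + frag_of (x, int_chain_of k c) \<in> tensor_ker k" by simp
    from tensor_ker_diff[OF this tensor_ker_minus_left[OF y, of x]] show ?thesis using 2 by simp
  next
    case 3
    then show ?thesis using tensor_ker_diff[OF tensor_ker_zero_right tensor_ker_zero_left[OF y]] by simp
  qed
qed

text \<open>A representative, in the free group on pairs, of a sum of weighted cells. Identities
  between such sums become membership of differences in \<open>tensor_ker\<close>.\<close>

definition wsum :: "int \<Rightarrow> cell set \<Rightarrow> (cell \<Rightarrow> 'g) \<Rightarrow> ('g::ab_group_add \<times> int_chain \<Rightarrow>\<^sub>0 int)" where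
  "wsum k F g = (\<Sum>\<sigma>\<in>F. frag_of (g \<sigma>, int_chain_of k (frag_of \<sigma>)))"

lemma keys_wsum: "F \<subseteq> cells k \<Longrightarrow> Poly_Mapping.keys (wsum k F g) \<subseteq> tensor_gens k"
  unfolding wsum_def
  by (rule keys_sum_subset) (auto simp: tensor_gens_def intro!: int_chain_of_carrier)

lemma finprod_weighted_cell:
  assumes "finite F" "F \<subseteq> cells k"
  shows "finprod (polyhedral_chains k) (\<lambda>\<sigma>. weighted_cell k (g \<sigma>) \<sigma>) F = tensor_cls k (wsum k F g)"
  using assms
proof (induction F rule: finite_induct)
  case empty
  interpret comm_group "polyhedral_chains k" by (rule polyhedral_chains_quotient(1))
  show ?case by (simp add: wsum_def polyhedral_chains_quotient(4))
next
  case (insert \<sigma> F)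
  interpret comm_group "polyhedral_chains k" by (rule polyhedral_chains_quotient(1))
  have w: "weighted_cell k (g \<tau>) \<tau> = tensor_cls k (frag_of (g \<tau>, int_chain_of k (frag_of \<tau>)))" for \<tau>
    by (simp add: weighted_cell_def tensor_cls_def)
  have kk: "Poly_Mapping.keys (frag_of (g \<tau>, int_chain_of k (frag_of \<tau>))) \<subseteq> tensor_gens k" if "\<tau> \<in> insert \<sigma> F" for \<tau>
    using that insert.prems by (auto simp: tensor_gens_def intro!: int_chain_of_carrier)
  have car: "weighted_cell k (g \<tau>) \<tau> \<in> carrier (polyhedral_chains k)" if "\<tau> \<in> insert \<sigma> F" for \<tau>
    unfolding w polyhedral_chains_quotient(2) using kk[OF that] by blast
  have "finprod (polyhedral_chains k) (\<lambda>\<sigma>. weighted_cell k (g \<sigma>) \<sigma>) (insert \<sigma> F)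
    = weighted_cell k (g \<sigma>) \<sigma> \<otimes>\<^bsub>polyhedral_chains k\<^esub> finprod (polyhedral_chains k) (\<lambda>\<sigma>. weighted_cell k (g \<sigma>) \<sigma>) F"
    by (rule finprod_insert) (use insert.hyps car in auto)
  also have "\<dots> = tensor_cls k (frag_of (g \<sigma>, int_chain_of k (frag_of \<sigma>))) \<otimes>\<^bsub>polyhedral_chains k\<^esub> tensor_cls k (wsum k F g)"
    using insert.IH insert.prems w by simp
  also have "\<dots> = tensor_cls k (frag_of (g \<sigma>, int_chain_of k (frag_of \<sigma>)) + wsum k F g)"
    by (rule polyhedral_chains_quotient(3)) (use kk[of \<sigma>] keys_wsum insert.prems in auto)
  finally show ?case using insert.hyps by (simp add: wsum_def)
qed

lemma wsum_add: "F \<subseteq> cells k \<Longrightarrow> wsum k F (\<lambda>\<sigma>. g \<sigma> + h \<sigma>) - (wsum k F g + wsum k F h) \<in> tensor_ker k"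
proof -
  assume F: "F \<subseteq> cells k"
  have "(\<Sum>\<sigma>\<in>F. frag_of (g \<sigma> + h \<sigma>, int_chain_of k (frag_of \<sigma>)) - (frag_of (g \<sigma>, int_chain_of k (frag_of \<sigma>)) + frag_of (h \<sigma>, int_chain_of k (frag_of \<sigma>)))) \<in> tensor_ker k"
    by (rule tensor_ker_sum, rule tensor_ker_rel1, rule int_chain_of_carrier) (use F in auto)
  then show ?thesis unfolding wsum_def by (simp add: sum_subtractf sum.distrib)
qed

lemma wsum_minus: "F \<subseteq> cells k \<Longrightarrow> wsum k F (\<lambda>\<sigma>. - g \<sigma>) + wsum k F g \<in> tensor_ker k"
proof -
  assume F: "F \<subseteq> cells k"
  have "(\<Sum>\<sigma>\<in>F. frag_of (- g \<sigma>, int_chain_of k (frag_of \<sigma>)) + frag_of (g \<sigma>, int_chain_of k (frag_of \<sigma>))) \<in> tensor_ker k"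
    by (rule tensor_ker_sum, rule tensor_ker_minus_left, rule int_chain_of_carrier) (use F in auto)
  then show ?thesis unfolding wsum_def by (simp add: sum.distrib)
qed

lemma wsum_mono_neutral:
  assumes "finite F'" "F \<subseteq> F'" "F' \<subseteq> cells k" "\<And>\<sigma>. \<sigma> \<in> F' - F \<Longrightarrow> g \<sigma> = 0"
  shows "wsum k F' g - wsum k F g \<in> tensor_ker k"
proof -
  have "wsum k F' g - wsum k F g = (\<Sum>\<sigma>\<in>F' - F. frag_of (g \<sigma>, int_chain_of k (frag_of \<sigma>)))"
    unfolding wsum_def using sum.subset_diff[OF assms(2,1)] by (simp add: algebra_simps)
  also have "\<dots> = (\<Sum>\<sigma>\<in>F' - F. frag_of (0, int_chain_of k (frag_of \<sigma>)))"
    by (rule sum.cong) (auto simp: assms(4))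
  also have "\<dots> \<in> tensor_ker k"
    by (rule tensor_ker_sum, rule tensor_ker_zero_left, rule int_chain_of_carrier) (use assms in auto)
  finally show ?thesis .
qed

text \<open>Replace each cell by its signed pieces, move the signs to the coefficients and collect
  the coefficients of every piece.\<close>

lemma wsum_refine:
  fixes g :: "cell \<Rightarrow> 'g::ab_group_add"
  assumes F: "finite F" "F \<subseteq> cells k" and T: "finite T" "T \<subseteq> cells k"
    and n: "\<And>\<sigma>. \<sigma> \<in> F \<Longrightarrow> frag_of \<sigma> - (\<Sum>\<tau>\<in>T. frag_cmul (\<epsilon> \<sigma> \<tau>) (frag_of \<tau>)) \<in> null_chains k"
    and e: "\<And>\<sigma> \<tau>. \<sigma> \<in> F \<Longrightarrow> \<tau> \<in> T \<Longrightarrow> \<epsilon> \<sigma> \<tau> = 1 \<or> \<epsilon> \<sigma> \<tau> = - 1 \<or> \<epsilon> \<sigma> \<tau> = 0"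
  shows "wsum k F g - wsum k T (\<lambda>\<tau>. \<Sum>\<sigma>\<in>F. imul (\<epsilon> \<sigma> \<tau>) (g \<sigma>)) \<in> tensor_ker k"
proof -
  let ?y = "\<lambda>\<tau>. int_chain_of k (frag_of \<tau>)"
  have y: "?y \<tau> \<in> carrier (int_chains k)" if "\<tau> \<in> T" for \<tau>
    by (rule int_chain_of_carrier) (use T that in auto)
  have 1: "(\<Sum>\<sigma>\<in>F. frag_of (g \<sigma>, ?y \<sigma>) - (\<Sum>\<tau>\<in>T. frag_of (imul (\<epsilon> \<sigma> \<tau>) (g \<sigma>), ?y \<tau>))) \<in> tensor_ker k"
  proof (rule tensor_ker_sum)
    fix \<sigma> assume s: "\<sigma> \<in> F"
    have k: "Poly_Mapping.keys (frag_cmul (\<epsilon> \<sigma> \<tau>) (frag_of \<tau>)) \<subseteq> cells k" if "\<tau> \<in> T" for \<tau>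
      by (rule keys_cmul_subset) (use T that in auto)
    have ye: "?y \<sigma> = int_chain_of k (\<Sum>\<tau>\<in>T. frag_cmul (\<epsilon> \<sigma> \<tau>) (frag_of \<tau>))"
      unfolding int_chain_of_eq by (rule n[OF s])
    have a: "frag_of (g \<sigma>, ?y \<sigma>) - (\<Sum>\<tau>\<in>T. frag_of (g \<sigma>, int_chain_of k (frag_cmul (\<epsilon> \<sigma> \<tau>) (frag_of \<tau>)))) \<in> tensor_ker k"
      unfolding ye by (rule tensor_ker_sum_right[OF T(1) k])
    have "(\<Sum>\<tau>\<in>T. frag_of (g \<sigma>, int_chain_of k (frag_cmul (\<epsilon> \<sigma> \<tau>) (frag_of \<tau>))) - frag_of (imul (\<epsilon> \<sigma> \<tau>) (g \<sigma>), ?y \<tau>)) \<in> tensor_ker k"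
      by (rule tensor_ker_sum, rule tensor_ker_sign) (use T e[OF s] in auto)
    from tensor_ker_closed(3)[OF a this]
    show "frag_of (g \<sigma>, ?y \<sigma>) - (\<Sum>\<tau>\<in>T. frag_of (imul (\<epsilon> \<sigma> \<tau>) (g \<sigma>), ?y \<tau>)) \<in> tensor_ker k"
      by (simp add: sum_subtractf)
  qed
  have 2: "(\<Sum>\<tau>\<in>T. frag_of ((\<Sum>\<sigma>\<in>F. imul (\<epsilon> \<sigma> \<tau>) (g \<sigma>)), ?y \<tau>) - (\<Sum>\<sigma>\<in>F. frag_of (imul (\<epsilon> \<sigma> \<tau>) (g \<sigma>), ?y \<tau>))) \<in> tensor_ker k"
    by (rule tensor_ker_sum, rule tensor_ker_sum_left[OF y F(1)])
  have sw: "(\<Sum>\<tau>\<in>T. \<Sum>\<sigma>\<in>F. frag_of (imul (\<epsilon> \<sigma> \<tau>) (g \<sigma>), ?y \<tau>)) = (\<Sum>\<sigma>\<in>F. \<Sum>\<tau>\<in>T. frag_of (imul (\<epsilon> \<sigma> \<tau>) (g \<sigma>), ?y \<tau>))"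
    by (rule sum.swap)
  from tensor_ker_diff[OF 1 2] show ?thesis
    unfolding wsum_def by (simp add: sum_subtractf sw)
qed

lemma tensor_ker_diff_right:
  assumes "Poly_Mapping.keys c \<subseteq> cells k" "Poly_Mapping.keys d \<subseteq> cells k"
  shows "frag_of (x, int_chain_of k (c - d)) - (frag_of (x, int_chain_of k c) - frag_of (x, int_chain_of k d)) \<in> tensor_ker k"
proof -
  have "Poly_Mapping.keys (c - d) \<subseteq> cells k" using assms by (rule keys_diff_subset)
  from tensor_ker_closed(4)[OF tensor_ker_add_right[OF this assms(2), of x]] show ?thesis
    by (simp add: algebra_simps)
qed

text \<open>Being congruent to a sum of weighted cells, which may overlap. As a predicate closed
  under differences it suits \<open>frag_induction\<close>.\<close>

definition wrep :: "int \<Rightarrow> ('g::ab_group_add \<times> int_chain \<Rightarrow>\<^sub>0 int) \<Rightarrow> bool" where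
  "wrep k z \<longleftrightarrow> (\<exists>F g. finite F \<and> F \<subseteq> cells k \<and> z - wsum k F g \<in> tensor_ker k)"

lemma wrep_0: "wrep k 0"
  unfolding wrep_def by (intro exI[of _ "{}"] exI[of _ "\<lambda>_. 0"]) (simp add: wsum_def tensor_ker_closed)

lemma wrep_frag_of: "\<sigma> \<in> cells k \<Longrightarrow> wrep k (frag_of (x, int_chain_of k (frag_of \<sigma>)))"
  unfolding wrep_def by (intro exI[of _ "{\<sigma>}"] exI[of _ "\<lambda>_. x"]) (simp add: wsum_def tensor_ker_closed)

lemma wrep_cong: "wrep k w \<Longrightarrow> z - w \<in> tensor_ker k \<Longrightarrow> wrep k z"
proof -
  assume w: "wrep k w" and d: "z - w \<in> tensor_ker k"
  obtain F g where F: "finite F" "F \<subseteq> cells k" "w - wsum k F g \<in> tensor_ker k"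
    using w unfolding wrep_def by blast
  have "z - wsum k F g \<in> tensor_ker k" using tensor_ker_closed(3)[OF d F(3)] by simp
  then show ?thesis using F(1,2) unfolding wrep_def by blast
qed

lemma wsum_diff: "F \<subseteq> cells k \<Longrightarrow> wsum k F (\<lambda>\<sigma>. g \<sigma> - h \<sigma>) - (wsum k F g - wsum k F h) \<in> tensor_ker k"
  using tensor_ker_closed(4)[OF wsum_add[of F k "\<lambda>\<sigma>. g \<sigma> - h \<sigma>" h]] by (simp add: algebra_simps)

lemma wrep_diff:
  assumes "wrep k z" "wrep k w"
  shows "wrep k (z - w)"
proof -
  obtain F g where F: "finite F" "F \<subseteq> cells k" "z - wsum k F g \<in> tensor_ker k"
    using assms(1) unfolding wrep_def by blast
  obtain F' g' where F': "finite F'" "F' \<subseteq> cells k" "w - wsum k F' g' \<in> tensor_ker k"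
    using assms(2) unfolding wrep_def by blast
  define G where "G = F \<union> F'"
  define h where "h \<sigma> = (if \<sigma> \<in> F then g \<sigma> else 0)" for \<sigma>
  define h' where "h' \<sigma> = (if \<sigma> \<in> F' then g' \<sigma> else 0)" for \<sigma>
  have G: "finite G" "G \<subseteq> cells k" "F \<subseteq> G" "F' \<subseteq> G" using F F' by (auto simp: G_def)
  have "wsum k F g = wsum k F h" "wsum k F' g' = wsum k F' h'"
    unfolding wsum_def h_def h'_def by (auto intro: sum.cong)
  moreover have "wsum k G h - wsum k F h \<in> tensor_ker k"
    by (rule wsum_mono_neutral) (use G in \<open>auto simp: h_def\<close>)
  moreover have "wsum k G h' - wsum k F' h' \<in> tensor_ker k"
    by (rule wsum_mono_neutral) (use G in \<open>auto simp: h'_def\<close>)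
  ultimately have "z - wsum k G h \<in> tensor_ker k" "w - wsum k G h' \<in> tensor_ker k"
    using tensor_ker_diff[OF F(3), of "wsum k G h - wsum k F h"] tensor_ker_diff[OF F'(3), of "wsum k G h' - wsum k F' h'"] by simp_all
  from tensor_ker_diff[OF tensor_ker_diff[OF this] wsum_diff[OF G(2), of h h']]
  have "(z - w) - wsum k G (\<lambda>\<sigma>. h \<sigma> - h' \<sigma>) \<in> tensor_ker k" by (simp add: algebra_simps)
  then show ?thesis using G(1,2) unfolding wrep_def by blast
qed

lemma tensor_cls_wsum_surj:
  fixes P :: "'g::ab_group_add chain"
  assumes "P \<in> carrier (polyhedral_chains k)"
  obtains F g where "finite F" "F \<subseteq> cells k" "P = tensor_cls k (wsum k F g)"
proof -
  obtain z where z: "Poly_Mapping.keys z \<subseteq> tensor_gens k" "P = tensor_cls k z"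
    using assms unfolding polyhedral_chains_quotient(2) by blast
  have "wrep k z"
    using z(1)
  proof (induction z rule: frag_induction)
    case (one p)
    obtain x y where p: "p = (x, y)" "y \<in> carrier (int_chains k)" using one by (auto simp: tensor_gens_def)
    then obtain c where c: "Poly_Mapping.keys c \<subseteq> cells k" "y = int_chain_of k c"
      unfolding int_chains_quotient(2) by blast
    have "Poly_Mapping.keys c \<subseteq> cells k \<and> wrep k (frag_of (x, int_chain_of k c))"
      using c(1)
    proof (induction c rule: frag_induction)
      case zero
      have "frag_of (x, int_chain_of k 0) - 0 \<in> tensor_ker k" by (simp add: tensor_ker_zero_right)
      then show ?case using wrep_cong[OF wrep_0] by simp
    next
      case (one \<sigma>)
      then show ?case by (simp add: wrep_frag_of)
    next
      case (diff a b)
      then have "Poly_Mapping.keys (a - b) \<subseteq> cells k" by (auto intro: keys_diff_subset[THEN subsetD])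
      moreover have "wrep k (frag_of (x, int_chain_of k (a - b)))"
        using wrep_cong[OF wrep_diff tensor_ker_diff_right] diff by blast
      ultimately show ?case by simp
    qed
    then show ?case using p c by simp
  qed (rule wrep_0, erule wrep_diff, assumption)
  then obtain F g where "finite F" "F \<subseteq> cells k" "z - wsum k F g \<in> tensor_ker k" unfolding wrep_def by blast
  then show thesis using that[of F g] z(2) by (simp add: tensor_cls_eq)
qed

section \<open>Slices of polyhedral chains\<close>

text \<open>The choice of a representative changes the value only on a null set of points \<open>x\<close>.\<close>

definition int_slice :: "(real^3) list \<Rightarrow> real^3 \<Rightarrow> real \<Rightarrow> real^3 \<Rightarrow> int_chain \<Rightarrow> int" where
  "int_slice q l s x Y = frag_sum (\<lambda>\<sigma>. cut q l s \<sigma> x) (SOME c. c \<in> Y)"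

definition tensor_slice ::
    "(real^3) list \<Rightarrow> real^3 \<Rightarrow> real \<Rightarrow> real^3 \<Rightarrow> ('g::ab_group_add \<times> int_chain \<Rightarrow>\<^sub>0 int) \<Rightarrow> 'g" where
  "tensor_slice q l s x = frag_sum (\<lambda>(g, Y). imul (int_slice q l s x Y) g)"

text \<open>The representative chosen from the coset differs from \<open>c\<close> by a null chain,
  whose slice vanishes almost everywhere.\<close>

lemma int_slice_int_chain_of:
  assumes q: "length q = nat k"
  shows "AE x in lborel. int_slice q l s x (int_chain_of k c) = frag_sum (\<lambda>\<sigma>. cut q l s \<sigma> x) c"
proof -
  let ?c = "SOME c'. c' \<in> int_chain_of k c"
  have "c \<in> int_chain_of k c" by (simp add: mem_int_chain_of null_chains_0)
  then have "?c \<in> int_chain_of k c" by (rule someI)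
  then have "?c - c \<in> null_chains k" by (simp add: mem_int_chain_of)
  from null_slice[OF this q, of l s] show ?thesis
    by (simp add: int_slice_def frag_sum_diff)
qed

lemma int_slice_mult:
  assumes q: "length q = nat k" and y: "y \<in> carrier (int_chains k)" "y' \<in> carrier (int_chains k)"
  shows "AE x in lborel. int_slice q l s x (y \<otimes>\<^bsub>int_chains k\<^esub> y') = int_slice q l s x y + int_slice q l s x y'"
proof -
  obtain c where c: "Poly_Mapping.keys c \<subseteq> cells k" "y = int_chain_of k c"
    using y(1) unfolding int_chains_quotient(2) by blast
  obtain d where d: "Poly_Mapping.keys d \<subseteq> cells k" "y' = int_chain_of k d"
    using y(2) unfolding int_chains_quotient(2) by blast
  have e: "y \<otimes>\<^bsub>int_chains k\<^esub> y' = int_chain_of k (c + d)"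
    unfolding c(2) d(2) by (rule int_chains_quotient(3)[OF c(1) d(1)])
  show ?thesis
    unfolding e
    using int_slice_int_chain_of[OF q, of l s c] int_slice_int_chain_of[OF q, of l s d]
      int_slice_int_chain_of[OF q, of l s "c + d"]
    unfolding c(2) d(2) by eventually_elim (simp add: frag_sum_add)
qed

text \<open>Additivity in the coefficient holds at every \<open>x\<close>. Additivity in the chain
  holds only almost everywhere, because representatives were chosen; the induction intersects
  finitely many sets of full measure.\<close>

lemma tensor_ker_slice:
  assumes z: "z \<in> tensor_ker k" and q: "length q = nat k"
  shows "AE x in lborel. tensor_slice q l s x z = 0"
  using z
proof (induction z rule: tensor_ker_induct)
  case zero
  show ?case by (simp add: tensor_slice_def)
next
  case (rel1 x x' y)
  show ?case by (simp add: tensor_slice_def frag_sum_diff frag_sum_add imul_add_right)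
next
  case (rel2 x y y')
  from int_slice_mult[OF q rel2, of l s] show ?case
    by eventually_elim (simp add: tensor_slice_def frag_sum_diff frag_sum_add imul_add)
next
  case (minus z)
  then show ?case by eventually_elim (simp add: tensor_slice_def frag_sum_minus)
next
  case (add z w)
  then show ?case by eventually_elim (simp add: tensor_slice_def frag_sum_add)
qed

lemma wsum_slice:
  assumes q: "length q = nat k" and F: "finite F"
  shows "AE x in lborel. tensor_slice q l s x (wsum k F g) = (\<Sum>\<sigma>\<in>F. imul (cut q l s \<sigma> x) (g \<sigma>))"
proof -
  have "AE x in lborel. \<forall>\<sigma>\<in>F. int_slice q l s x (int_chain_of k (frag_of \<sigma>)) = cut q l s \<sigma> x"
    using int_slice_int_chain_of[OF q, of l s "frag_of \<sigma>" for \<sigma>] by (intro AE_finite_allI F) (simp only: frag_sum_of)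
  then show ?thesis
    by eventually_elim (simp add: wsum_def tensor_slice_def frag_sum_sum)
qed

lemma wsum_tensor_ker_slice:
  assumes "wsum k F g \<in> tensor_ker k" "length q = nat k" "finite F"
  shows "AE x in lborel. (\<Sum>\<sigma>\<in>F. imul (cut q l s \<sigma> x) (g \<sigma>)) = 0"
  using tensor_ker_slice[OF assms(1,2), of l s] wsum_slice[OF assms(2,3), of l s g]
  by eventually_elim simp

lemma nonoverlapping_subset: "nonoverlapping k F \<Longrightarrow> G \<subseteq> F \<Longrightarrow> nonoverlapping k G"
  unfolding nonoverlapping_def by blast

text \<open>After the zero coefficients are dropped, \<open>exists_nonzero_slice\<close> would
  supply an open set on which a slice is a nonzero constant. The restriction on \<open>s\<close>
  matches the slices that can be computed for boundaries.\<close>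

lemma slices_zero:
  fixes g :: "cell \<Rightarrow> 'g::ab_group_add"
  assumes F: "finite F" "F \<subseteq> cells k" "nonoverlapping k F"
    and sl: "\<And>q l s. length q = nat k \<Longrightarrow> (k \<le> 2 \<Longrightarrow> s = 0) \<Longrightarrow> AE x in lborel. (\<Sum>\<sigma>\<in>F. imul (cut q l s \<sigma> x) (g \<sigma>)) = 0"
    and "\<sigma> \<in> F"
  shows "g \<sigma> = 0"
proof (rule ccontr)
  assume nz: "g \<sigma> \<noteq> 0"
  define G where "G = {\<sigma>\<in>F. g \<sigma> \<noteq> 0}"
  have G: "finite G" "G \<subseteq> cells k" "nonoverlapping k G"
    using F nonoverlapping_subset[OF F(3), of G] by (auto simp: G_def)
  have "\<sigma> \<in> G" using nz assms(5) by (simp add: G_def)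
  then have ne: "G \<noteq> {}" by blast
  have gG: "\<And>\<sigma>. \<sigma> \<in> G \<Longrightarrow> g \<sigma> \<noteq> 0" by (simp add: G_def)
  obtain q l s a U where q: "length q = nat k" "k \<le> 2 \<Longrightarrow> s = 0" "a \<noteq> 0" "open U" "U \<noteq> {}"
    "\<And>x. x \<in> U \<Longrightarrow> (\<Sum>\<sigma>\<in>G. imul (cut q l s \<sigma> x) (g \<sigma>)) = a"
    by (rule exists_nonzero_slice[OF G ne, of g], erule gG) (rule that)
  obtain x where x: "x \<in> U" "(\<Sum>\<sigma>\<in>F. imul (cut q l s \<sigma> x) (g \<sigma>)) = 0"
    by (rule AE_ex_open[OF sl[OF q(1,2)] q(4,5)])
  have "(\<Sum>\<sigma>\<in>F. imul (cut q l s \<sigma> x) (g \<sigma>)) = (\<Sum>\<sigma>\<in>G. imul (cut q l s \<sigma> x) (g \<sigma>))"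
    by (rule sum.mono_neutral_right) (use F in \<open>auto simp: G_def\<close>)
  then show False using q(3) q(6)[OF x(1)] x(2) by simp
qed

lemma wsum_tensor_ker_zero:
  assumes "finite F" "F \<subseteq> cells k" "nonoverlapping k F" "wsum k F g \<in> tensor_ker k" "\<sigma> \<in> F"
  shows "g \<sigma> = 0"
  by (rule slices_zero[OF assms(1-3) _ assms(5)]) (rule wsum_tensor_ker_slice[OF assms(4) _ assms(1)])

section \<open>The boundary of a polyhedral chain\<close>

lemma cells_le_3: "\<sigma> \<in> cells k \<Longrightarrow> k \<le> 3"
  using cellsD(1)[of \<sigma> k] cellsD(2)[of \<sigma> k] orthonormal_frame_length[of "snd \<sigma>"] by linarith

lemma frag_cmul_sum_left: "frag_cmul (\<Sum>i\<in>I. f i) c = (\<Sum>i\<in>I. frag_cmul (f i) c)"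
  by (induction I rule: infinite_finite_induct) (simp_all add: frag_cmul_distrib)

lemma frag_cmul_diff_right: "frag_cmul n (c - d) = frag_cmul n c - frag_cmul n d"
  using frag_cmul_distrib2[of n "c - d" d] by simp

text \<open>The converse of \<open>null_slice\<close>. After refinement the chain is congruent to
  one on nonoverlapping cells, and \<open>slices_zero\<close>, applied with integer coefficients,
  makes the latter zero.\<close>

lemma null_chains_if_slices:
  assumes c: "Poly_Mapping.keys c \<subseteq> cells k"
    and sl: "\<And>q l s. length q = nat k \<Longrightarrow> (k \<le> 2 \<Longrightarrow> s = 0) \<Longrightarrow> AE x in lborel. frag_sum (\<lambda>\<sigma>. cut q l s \<sigma> x) c = 0"
  shows "c \<in> null_chains k"
proof -
  let ?F = "Poly_Mapping.keys c"
  obtain T \<epsilon> where T: "finite T" "T \<subseteq> cells k" "nonoverlapping k T"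
    "\<And>\<sigma>. \<sigma> \<in> ?F \<Longrightarrow> frag_of \<sigma> - (\<Sum>\<tau>\<in>T. frag_cmul (\<epsilon> \<sigma> \<tau>) (frag_of \<tau>)) \<in> null_chains k"
    by (rule common_refinement[OF finite_keys c]) (rule that)
  define n where "n \<tau> = (\<Sum>\<sigma>\<in>?F. Poly_Mapping.lookup c \<sigma> * \<epsilon> \<sigma> \<tau>)" for \<tau>
  define d where "d = (\<Sum>\<tau>\<in>T. frag_cmul (n \<tau>) (frag_of \<tau>))"
  have 1: "(\<Sum>\<sigma>\<in>?F. frag_cmul (Poly_Mapping.lookup c \<sigma>) (frag_of \<sigma> - (\<Sum>\<tau>\<in>T. frag_cmul (\<epsilon> \<sigma> \<tau>) (frag_of \<tau>)))) \<in> null_chains k"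
    by (rule null_chains_sum, rule null_chains_cmul, rule T(4))
  have 2: "(\<Sum>\<sigma>\<in>?F. frag_cmul (Poly_Mapping.lookup c \<sigma>) (\<Sum>\<tau>\<in>T. frag_cmul (\<epsilon> \<sigma> \<tau>) (frag_of \<tau>))) = d"
    unfolding d_def n_def frag_cmul_sum frag_cmul_cmul
    by (subst sum.swap) (simp add: frag_cmul_sum_left)
  have cd: "c - d \<in> null_chains k"
    using 1 frag_expansion[of c] unfolding frag_extend_def by (simp add: frag_cmul_diff_right sum_subtractf 2)
  have "n \<tau> = 0" if "\<tau> \<in> T" for \<tau>
  proof (rule slices_zero[OF T(1-3) _ that])
    fix q :: "(real^3) list" and l :: "real^3" and s :: real
    assume q: "length q = nat k" and s: "k \<le> 2 \<Longrightarrow> s = 0"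
    have d: "frag_sum (\<lambda>\<sigma>. cut q l s \<sigma> x) d = (\<Sum>\<sigma>\<in>T. imul (cut q l s \<sigma> x) (n \<sigma>))" for x
      by (simp add: d_def frag_sum_sum frag_sum_cmul imul_int mult.commute)
    have "AE x in lborel. frag_sum (\<lambda>\<sigma>. cut q l s \<sigma> x) c = 0" by (rule sl[OF q]) (rule s)
    with null_slice[OF cd q, of l s] show "AE x in lborel. (\<Sum>\<sigma>\<in>T. imul (cut q l s \<sigma> x) (n \<sigma>)) = 0"
      by eventually_elim (simp add: frag_sum_diff d)
  qed
  then have "d = 0" by (simp add: d_def)
  then show ?thesis using cd by simp
qed

lemma keys_boundary:
  "Poly_Mapping.keys c \<subseteq> cells k \<Longrightarrow> Poly_Mapping.keys (frag_extend cell_boundary c) \<subseteq> cells (k - 1)"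
  unfolding frag_extend_def
  by (rule keys_sum_subset, rule keys_cmul_subset, rule keys_cell_boundary) auto

text \<open>This takes the place of Stokes' theorem. By \<open>slice_boundary\<close> the slices of
  the boundary are, up to sign, slices of \<open>c\<close> by \<open>l # q\<close>, which vanish
  almost everywhere.\<close>

lemma null_boundary:
  assumes c: "c \<in> null_chains k"
  shows "frag_extend cell_boundary c \<in> null_chains (k - 1)"
proof (cases "c = 0")
  case True
  then show ?thesis by (simp add: null_chains_0)
next
  case False
  then obtain \<sigma> where "\<sigma> \<in> Poly_Mapping.keys c" by (metis all_not_in_conv keys_eq_empty)
  moreover have kc: "Poly_Mapping.keys c \<subseteq> cells k" using c null_chains_iff by blast
  ultimately have k: "0 \<le> k" "k \<le> 3" using cells_nonneg cells_le_3 by blast+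
  have kb: "Poly_Mapping.keys (frag_extend cell_boundary c) \<subseteq> cells (k - 1)" by (rule keys_boundary[OF kc])
  show ?thesis
  proof (cases "k = 0")
    case True
    \<comment> \<open>There are no cells of dimension - 1.\<close>
    then have "Poly_Mapping.keys (frag_extend cell_boundary c) = {}" using kb cells_nonneg by fastforce
    then show ?thesis by (simp add: null_chains_0)
  next
    case k0: False
    show ?thesis
    proof (rule null_chains_if_slices[OF kb])
      fix q :: "(real^3) list" and l :: "real^3" and s :: real
      assume q: "length q = nat (k - 1)" and s: "k - 1 \<le> 2 \<Longrightarrow> s = 0"
      \<comment> \<open>Cells have dimension at most 3, so their boundaries fall into the range
        where slices with \<open>s = 0\<close> suffice.\<close>
      have s: "s = 0" using s k by simp
      have q': "length (l # q) = nat k" using q k k0 by simp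
      have "AE x in lborel. \<forall>\<sigma>\<in>Poly_Mapping.keys c. frag_sum (\<lambda>\<tau>. cut q l 0 \<tau> x) (cell_boundary \<sigma>) = - cut (l # q) 0 1 \<sigma> x"
      proof (rule AE_finite_allI[OF finite_keys])
        fix \<sigma> assume "\<sigma> \<in> Poly_Mapping.keys c"
        then have "(fst \<sigma>, snd \<sigma>) \<in> cells k" using kc by auto
        moreover from this have "length (snd \<sigma>) = Suc (length q)" using cellsD(1)[of "(fst \<sigma>, snd \<sigma>)" k] q k k0 by simp
        ultimately show "AE x in lborel. frag_sum (\<lambda>\<tau>. cut q l 0 \<tau> x) (cell_boundary \<sigma>) = - cut (l # q) 0 1 \<sigma> x"
          using slice_boundary[of "fst \<sigma>" "snd \<sigma>" k q l] by simp
      qed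
      with null_slice[OF c q', of 0 1]
      show "AE x in lborel. frag_sum (\<lambda>\<sigma>. cut q l s \<sigma> x) (frag_extend cell_boundary c) = 0"
        unfolding s
      proof eventually_elim
        case (elim x)
        have "frag_sum (\<lambda>\<sigma>. cut q l 0 \<sigma> x) (frag_extend cell_boundary c) = frag_sum (\<lambda>\<sigma>. - cut (l # q) 0 1 \<sigma> x) c"
          unfolding frag_sum_extend by (rule frag_sum_cong) (use elim(2) in blast)
        also have "\<dots> = - frag_sum (\<lambda>\<sigma>. cut (l # q) 0 1 \<sigma> x) c"
          unfolding frag_sum_def by (simp add: imul_minus_right sum_negf)
        finally show ?case using elim(1) by simp
      qed
    qed
  qed
qed

text \<open>The boundary does not depend on the representative, so the image in the definition is a
  singleton.\<close>

lemma int_boundary_int_chain_of: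
  "int_boundary k (int_chain_of k c) = int_chain_of (k - 1) (frag_extend cell_boundary c)"
  unfolding int_boundary_def
proof (rule the_elem_image_unique)
  show "int_chain_of k c \<noteq> {}" using mem_int_chain_of[of c k c] null_chains_0[of k] by auto
  fix d assume "d \<in> int_chain_of k c"
  then have "frag_extend cell_boundary (d - c) \<in> null_chains (k - 1)"
    by (intro null_boundary) (simp add: mem_int_chain_of)
  then show "int_chain_of (k - 1) (frag_extend cell_boundary d) = int_chain_of (k - 1) (frag_extend cell_boundary c)"
    by (simp add: int_chain_of_eq frag_extend_diff)
qed

lemma int_boundary_hom:
  assumes "y \<in> carrier (int_chains k)"
  shows "int_boundary k y \<in> carrier (int_chains (k - 1))"
    "y' \<in> carrier (int_chains k) \<Longrightarrow> int_boundary k (y \<otimes>\<^bsub>int_chains k\<^esub> y') =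
      int_boundary k y \<otimes>\<^bsub>int_chains (k - 1)\<^esub> int_boundary k y'"
proof -
  obtain c where c: "Poly_Mapping.keys c \<subseteq> cells k" "y = int_chain_of k c"
    using assms unfolding int_chains_quotient(2) by blast
  show "int_boundary k y \<in> carrier (int_chains (k - 1))"
    unfolding c(2) int_boundary_int_chain_of by (rule int_chain_of_carrier[OF keys_boundary[OF c(1)]])
  assume "y' \<in> carrier (int_chains k)"
  then obtain d where d: "Poly_Mapping.keys d \<subseteq> cells k" "y' = int_chain_of k d"
    unfolding int_chains_quotient(2) by blast
  have "int_boundary k (y \<otimes>\<^bsub>int_chains k\<^esub> y') = int_chain_of (k - 1) (frag_extend cell_boundary (c + d))"
    unfolding c(2) d(2) int_chains_quotient(3)[OF c(1) d(1)] int_boundary_int_chain_of ..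
  also have "\<dots> = int_boundary k y \<otimes>\<^bsub>int_chains (k - 1)\<^esub> int_boundary k y'"
    unfolding c(2) d(2) int_boundary_int_chain_of frag_extend_add
    by (rule int_chains_quotient(3)[OF keys_boundary[OF c(1)] keys_boundary[OF d(1)], symmetric])
  finally show "int_boundary k (y \<otimes>\<^bsub>int_chains k\<^esub> y') = int_boundary k y \<otimes>\<^bsub>int_chains (k - 1)\<^esub> int_boundary k y'" .
qed

section \<open>The boundary on the tensor product\<close>

definition tensor_boundary ::
    "int \<Rightarrow> ('g::ab_group_add \<times> int_chain \<Rightarrow>\<^sub>0 int) \<Rightarrow> ('g \<times> int_chain \<Rightarrow>\<^sub>0 int)" where
  "tensor_boundary k = frag_extend (\<lambda>(x, y). frag_of (x, int_boundary k y))"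

lemma tensor_boundary_simps:
  "tensor_boundary k 0 = 0" "tensor_boundary k (frag_of (x, y)) = frag_of (x, int_boundary k y)"
  "tensor_boundary k (z + w) = tensor_boundary k z + tensor_boundary k w"
  "tensor_boundary k (z - w) = tensor_boundary k z - tensor_boundary k w"
  "tensor_boundary k (- z) = - tensor_boundary k z"
  by (simp_all add: tensor_boundary_def frag_extend_add frag_extend_diff frag_extend_minus)

lemma keys_tensor_boundary:
  "Poly_Mapping.keys z \<subseteq> tensor_gens k \<Longrightarrow> Poly_Mapping.keys (tensor_boundary k z) \<subseteq> tensor_gens (k - 1)"
  unfolding tensor_boundary_def frag_extend_def
  by (rule keys_sum_subset, rule keys_cmul_subset) (auto simp: tensor_gens_def subset_iff int_boundary_hom(1))

lemma tensor_boundary_tensor_ker: "z \<in> tensor_ker k \<Longrightarrow> tensor_boundary k z \<in> tensor_ker (k - 1)"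
proof (induction z rule: tensor_ker_induct)
  case (rel1 x x' y)
  then show ?case using tensor_ker_rel1[OF int_boundary_hom(1)] by (simp add: tensor_boundary_simps)
next
  case (rel2 x y y')
  then show ?case using tensor_ker_rel2[OF int_boundary_hom(1) int_boundary_hom(1)]
    by (simp add: tensor_boundary_simps int_boundary_hom(2))
qed (simp_all add: tensor_boundary_simps tensor_ker_closed)

lemma chain_boundary_tensor_cls: "chain_boundary k (tensor_cls k z) = tensor_cls (k - 1) (tensor_boundary k z)"
  unfolding chain_boundary_def tensor_map_def tensor_cls_def[symmetric] tensor_boundary_def[symmetric]
proof (rule the_elem_image_unique)
  show "tensor_cls k z \<noteq> {}" using mem_tensor_cls[of z k z] tensor_ker_closed(2)[of k] by auto
  fix w assume "w \<in> tensor_cls k z"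
  then have "tensor_boundary k (w - z) \<in> tensor_ker (k - 1)"
    by (intro tensor_boundary_tensor_ker) (simp add: mem_tensor_cls)
  then show "tensor_cls (k - 1) (tensor_boundary k w) = tensor_cls (k - 1) (tensor_boundary k z)"
    by (simp add: tensor_cls_eq tensor_boundary_simps)
qed

lemma chain_boundary_closed:
  assumes "P \<in> carrier (polyhedral_chains k)"
  shows "chain_boundary k P \<in> carrier (polyhedral_chains (k - 1))"
proof -
  obtain z where z: "Poly_Mapping.keys z \<subseteq> tensor_gens k" "P = tensor_cls k z"
    using assms unfolding polyhedral_chains_quotient(2) by blast
  show ?thesis
    unfolding z(2) chain_boundary_tensor_cls polyhedral_chains_quotient(2)
    by (rule imageI) (simp add: keys_tensor_boundary z(1))
qed

lemma chain_boundary_mult: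
  assumes "P \<in> carrier (polyhedral_chains k)" "Q \<in> carrier (polyhedral_chains k)"
  shows "chain_boundary k (P \<otimes>\<^bsub>polyhedral_chains k\<^esub> Q) =
    chain_boundary k P \<otimes>\<^bsub>polyhedral_chains (k - 1)\<^esub> chain_boundary k Q"
proof -
  obtain z where z: "Poly_Mapping.keys z \<subseteq> tensor_gens k" "P = tensor_cls k z"
    using assms(1) unfolding polyhedral_chains_quotient(2) by blast
  obtain w where w: "Poly_Mapping.keys w \<subseteq> tensor_gens k" "Q = tensor_cls k w"
    using assms(2) unfolding polyhedral_chains_quotient(2) by blast
  show ?thesis
    unfolding z(2) w(2) polyhedral_chains_quotient(3)[OF z(1) w(1)] chain_boundary_tensor_cls tensor_boundary_simps
    by (rule polyhedral_chains_quotient(3)[OF keys_tensor_boundary[OF z(1)] keys_tensor_boundary[OF w(1)], symmetric])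
qed

lemma boundary_slice:
  assumes q: "length q = nat k" and k: "k \<ge> 0" and F: "finite F" "F \<subseteq> cells (k + 1)"
  shows "AE x in lborel. tensor_slice q l 0 x (tensor_boundary (k + 1) (wsum (k + 1) F h)) =
    (\<Sum>\<sigma>\<in>F. imul (- cut (l # q) 0 1 \<sigma> x) (h \<sigma>))"
proof -
  have e: "tensor_boundary (k + 1) (wsum (k + 1) F h) = (\<Sum>\<sigma>\<in>F. frag_of (h \<sigma>, int_chain_of k (cell_boundary \<sigma>)))"
    unfolding wsum_def
    by (induction F rule: infinite_finite_induct)
      (simp_all add: tensor_boundary_simps int_boundary_int_chain_of)
  have "AE x in lborel. \<forall>\<sigma>\<in>F. int_slice q l 0 x (int_chain_of k (cell_boundary \<sigma>)) = - cut (l # q) 0 1 \<sigma> x"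
  proof (rule AE_finite_allI[OF F(1)])
    fix \<sigma> assume "\<sigma> \<in> F"
    then have c: "(fst \<sigma>, snd \<sigma>) \<in> cells (k + 1)" using F by auto
    then have "length (snd \<sigma>) = Suc (length q)" using cellsD(1)[OF c] q k by simp
    from slice_boundary[OF c this, of l] int_slice_int_chain_of[OF q, of l 0 "cell_boundary \<sigma>"]
    show "AE x in lborel. int_slice q l 0 x (int_chain_of k (cell_boundary \<sigma>)) = - cut (l # q) 0 1 \<sigma> x"
      by eventually_elim simp
  qed
  then show ?thesis
    by eventually_elim (simp add: e tensor_slice_def frag_sum_sum)
qed

section \<open>The mass of a polyhedral chain\<close>

definition wmass :: "cell set \<Rightarrow> (cell \<Rightarrow> 'g::{ab_group_add,metric_space}) \<Rightarrow> real" where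
  "wmass F g = (\<Sum>\<sigma>\<in>F. dist (g \<sigma>) 0 * cell_mass \<sigma>)"

lemma wmass_nonneg: "wmass F g \<ge> 0"
  unfolding wmass_def by (intro sum_nonneg mult_nonneg_nonneg zero_le_dist cell_mass_nonneg)

lemma wmass_refine:
  assumes "finite F" "finite T"
    "\<And>\<sigma>. \<sigma> \<in> F \<Longrightarrow> cell_mass \<sigma> = (\<Sum>\<tau>\<in>{\<tau>\<in>T. fst \<tau> \<subseteq> fst \<sigma>}. cell_mass \<tau>)"
  shows "wmass F g = (\<Sum>\<tau>\<in>T. (\<Sum>\<sigma>\<in>{\<sigma>\<in>F. fst \<tau> \<subseteq> fst \<sigma>}. dist (g \<sigma>) 0) * cell_mass \<tau>)"
proof -
  have "wmass F g = (\<Sum>\<sigma>\<in>F. \<Sum>\<tau>\<in>{\<tau>\<in>T. fst \<tau> \<subseteq> fst \<sigma>}. dist (g \<sigma>) 0 * cell_mass \<tau>)"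
    unfolding wmass_def by (rule sum.cong) (use assms(3) in \<open>simp_all add: sum_distrib_left\<close>)
  also have "\<dots> = (\<Sum>\<tau>\<in>T. \<Sum>\<sigma>\<in>{\<sigma>\<in>F. fst \<tau> \<subseteq> fst \<sigma>}. dist (g \<sigma>) 0 * cell_mass \<tau>)"
    by (rule sum.swap_restrict[OF assms(1,2)])
  finally show ?thesis by (simp add: sum_distrib_right)
qed

context
  assumes translation_invariant:
    "\<And>x y z :: 'g::{ab_group_add,metric_space}. dist (x + z) (y + z) = dist x y"
begin

lemma dist_minus_0: "dist (- x) 0 = dist (x :: 'g) 0"
  using translation_invariant[of "- x" x 0] by (simp add: dist_commute)

lemma dist_add_0: "dist (x + y) 0 \<le> dist x 0 + dist (y :: 'g) 0"
  using dist_triangle[of "x + y" 0 y] translation_invariant[of x y 0] by simp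

lemma dist_sum_0: "dist (\<Sum>i\<in>I. f i) 0 \<le> (\<Sum>i\<in>I. dist (f i :: 'g) 0)"
proof (induction I rule: infinite_finite_induct)
  case (insert i I)
  then show ?case using dist_add_0[of "f i" "\<Sum>i\<in>I. f i"] by simp
qed simp_all

text \<open>On a common refinement both sides have the same coefficients, by uniqueness on
  nonoverlapping cells. A piece lies in at most one cell of \<open>F\<close>, so the left side is
  preserved exactly; on the right, coefficients of overlapping cells are estimated by the triangle
  inequality.\<close>

lemma wmass_mono:
  fixes g h :: "cell \<Rightarrow> 'g"
  assumes F: "finite F" "F \<subseteq> cells k" "nonoverlapping k F" and F': "finite F'" "F' \<subseteq> cells k"
    and eq: "wsum k F g - wsum k F' h \<in> tensor_ker k"
  shows "wmass F g \<le> wmass F' h"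
proof -
  have FF: "finite (F \<union> F')" "F \<union> F' \<subseteq> cells k" using F F' by auto
  obtain T \<epsilon> where T: "finite T" "T \<subseteq> cells k" "nonoverlapping k T"
    and n: "\<And>\<sigma>. \<sigma> \<in> F \<union> F' \<Longrightarrow> frag_of \<sigma> - (\<Sum>\<tau>\<in>T. frag_cmul (\<epsilon> \<sigma> \<tau>) (frag_of \<tau>)) \<in> null_chains k"
    and e: "\<And>\<sigma> \<tau>. \<sigma> \<in> F \<union> F' \<Longrightarrow> \<tau> \<in> T \<Longrightarrow> fst \<tau> \<subseteq> fst \<sigma> \<Longrightarrow> \<epsilon> \<sigma> \<tau> = 1 \<or> \<epsilon> \<sigma> \<tau> = (- 1 :: int)"
    and e0: "\<And>\<sigma> \<tau>. \<sigma> \<in> F \<union> F' \<Longrightarrow> \<tau> \<in> T \<Longrightarrow> \<not> fst \<tau> \<subseteq> fst \<sigma> \<Longrightarrow> \<epsilon> \<sigma> \<tau> = 0"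
    and m: "\<And>\<sigma>. \<sigma> \<in> F \<union> F' \<Longrightarrow> cell_mass \<sigma> = (\<Sum>\<tau>\<in>{\<tau>\<in>T. fst \<tau> \<subseteq> fst \<sigma>}. cell_mass \<tau>)"
    by (rule common_refinement[OF FF]) (rule that)
  have e3: "\<epsilon> \<sigma> \<tau> = 1 \<or> \<epsilon> \<sigma> \<tau> = - 1 \<or> \<epsilon> \<sigma> \<tau> = 0" if "\<sigma> \<in> F \<union> F'" "\<tau> \<in> T" for \<sigma> \<tau>
    using e[OF that] e0[OF that] by blast
  define G where "G \<tau> = (\<Sum>\<sigma>\<in>F. imul (\<epsilon> \<sigma> \<tau>) (g \<sigma>))" for \<tau>
  define H where "H \<tau> = (\<Sum>\<sigma>\<in>F'. imul (\<epsilon> \<sigma> \<tau>) (h \<sigma>))" for \<tau>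
  have 1: "wsum k F g - wsum k T G \<in> tensor_ker k"
    unfolding G_def by (rule wsum_refine[OF F(1,2) T(1,2) n e3]) simp_all
  have 2: "wsum k F' h - wsum k T H \<in> tensor_ker k"
    unfolding H_def by (rule wsum_refine[OF F' T(1,2) n e3]) simp_all
  have "wsum k T G - wsum k T H \<in> tensor_ker k"
    using tensor_ker_closed(3)[OF tensor_ker_diff[OF eq 1] 2] by simp
  from tensor_ker_closed(3)[OF wsum_diff[OF T(2), of G H] this]
  have "wsum k T (\<lambda>\<sigma>. G \<sigma> - H \<sigma>) \<in> tensor_ker k" by simp
  from wsum_tensor_ker_zero[OF T this] have GH: "G \<tau> = H \<tau>" if "\<tau> \<in> T" for \<tau>
    using that by simp
  have G: "(\<Sum>\<sigma>\<in>{\<sigma>\<in>F. fst \<tau> \<subseteq> fst \<sigma>}. dist (g \<sigma>) 0) = dist (G \<tau>) 0" if t: "\<tau> \<in> T" for \<tau>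
  proof (cases "\<exists>\<sigma>\<in>F. fst \<tau> \<subseteq> fst \<sigma>")
    case True
    then obtain \<sigma> where s: "\<sigma> \<in> F" "fst \<tau> \<subseteq> fst \<sigma>" by blast
    have u: "\<not> fst \<tau> \<subseteq> fst \<sigma>'" if s': "\<sigma>' \<in> F" "\<sigma>' \<noteq> \<sigma>" for \<sigma>'
    proof
      assume "fst \<tau> \<subseteq> fst \<sigma>'"
      \<comment> \<open>A piece has dimension \<open>k\<close>, too much for the overlap of two
        cells.\<close>
      then have "aff_dim (fst \<tau>) \<le> aff_dim (fst \<sigma>' \<inter> fst \<sigma>)" using s by (intro aff_dim_subset) simp
      moreover have "aff_dim (fst \<tau>) = k" using cell_aff_dim[of \<tau> k] t T(2) by blast
      moreover have "aff_dim (fst \<sigma>' \<inter> fst \<sigma>) < k" using F(3) s' s(1) unfolding nonoverlapping_def by blast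
      ultimately show False by simp
    qed
    have "{\<sigma>\<in>F. fst \<tau> \<subseteq> fst \<sigma>} = {\<sigma>}" using s u by blast
    moreover have "G \<tau> = (\<Sum>\<sigma>'\<in>F. if \<sigma>' = \<sigma> then imul (\<epsilon> \<sigma> \<tau>) (g \<sigma>) else 0)"
      unfolding G_def by (rule sum.cong) (use u e0 t in auto)
    then have "G \<tau> = imul (\<epsilon> \<sigma> \<tau>) (g \<sigma>)" using F(1) s(1) by simp
    ultimately show ?thesis using e[of \<sigma> \<tau>] s t by (auto simp: dist_minus_0)
  next
    case False
    then have "G \<tau> = (\<Sum>\<sigma>'\<in>F. 0)" unfolding G_def by (intro sum.cong) (use e0 t in auto)
    moreover have "{\<sigma>\<in>F. fst \<tau> \<subseteq> fst \<sigma>} = {}" using False by blast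
    ultimately show ?thesis by (simp only: sum.empty sum.neutral_const dist_self)
  qed
  have H: "dist (H \<tau>) 0 \<le> (\<Sum>\<sigma>\<in>{\<sigma>\<in>F'. fst \<tau> \<subseteq> fst \<sigma>}. dist (h \<sigma>) 0)" if t: "\<tau> \<in> T" for \<tau>
  proof -
    have "H \<tau> = (\<Sum>\<sigma>\<in>{\<sigma>\<in>F'. fst \<tau> \<subseteq> fst \<sigma>}. imul (\<epsilon> \<sigma> \<tau>) (h \<sigma>))"
      unfolding H_def by (rule sum.mono_neutral_right) (use F' e0 t in auto)
    moreover have "dist (\<Sum>\<sigma>\<in>{\<sigma>\<in>F'. fst \<tau> \<subseteq> fst \<sigma>}. imul (\<epsilon> \<sigma> \<tau>) (h \<sigma>)) 0
        \<le> (\<Sum>\<sigma>\<in>{\<sigma>\<in>F'. fst \<tau> \<subseteq> fst \<sigma>}. dist (imul (\<epsilon> \<sigma> \<tau>) (h \<sigma>)) 0)" by (rule dist_sum_0)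
    moreover have "dist (imul (\<epsilon> \<sigma> \<tau>) (h \<sigma>)) 0 = dist (h \<sigma>) 0" if "\<sigma> \<in> {\<sigma>\<in>F'. fst \<tau> \<subseteq> fst \<sigma>}" for \<sigma>
      using e[of \<sigma> \<tau>] that t by (auto simp: dist_minus_0)
    ultimately show ?thesis by simp
  qed
  have "wmass F g = (\<Sum>\<tau>\<in>T. dist (G \<tau>) 0 * cell_mass \<tau>)"
    by (subst wmass_refine[OF F(1) T(1) m]) (simp_all add: G)
  also have "\<dots> \<le> (\<Sum>\<tau>\<in>T. (\<Sum>\<sigma>\<in>{\<sigma>\<in>F'. fst \<tau> \<subseteq> fst \<sigma>}. dist (h \<sigma>) 0) * cell_mass \<tau>)"
    by (intro sum_mono mult_right_mono cell_mass_nonneg) (use H in \<open>simp add: GH\<close>)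
  also have "\<dots> = wmass F' h"
    by (rule wmass_refine[OF F'(1) T(1), symmetric]) (rule m, simp)
  finally show ?thesis .
qed

text \<open>Two nonoverlapping representations have the same mass, by \<open>wmass_mono\<close> in
  both directions; this makes the description in \<open>chain_mass\<close> definite.\<close>

lemma chain_mass_eq:
  fixes g :: "cell \<Rightarrow> 'g"
  assumes F: "finite F" "F \<subseteq> cells k" "nonoverlapping k F"
  shows "chain_mass k (tensor_cls k (wsum k F g)) = wmass F g"
  unfolding chain_mass_def
proof (rule the_equality)
  show "\<exists>F' g'. finite F' \<and> F' \<subseteq> cells k \<and> nonoverlapping k F' \<and>
     tensor_cls k (wsum k F g) = finprod (polyhedral_chains k) (\<lambda>\<sigma>. weighted_cell k (g' \<sigma>) \<sigma>) F' \<and>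
     wmass F g = (\<Sum>\<sigma>\<in>F'. dist (g' \<sigma>) 0 * cell_mass \<sigma>)"
    using F finprod_weighted_cell[OF F(1,2), of g] by (intro exI[of _ F] exI[of _ g]) (simp add: wmass_def)
  fix m assume "\<exists>F' g'. finite F' \<and> F' \<subseteq> cells k \<and> nonoverlapping k F' \<and>
     tensor_cls k (wsum k F g) = finprod (polyhedral_chains k) (\<lambda>\<sigma>. weighted_cell k (g' \<sigma>) \<sigma>) F' \<and>
     m = (\<Sum>\<sigma>\<in>F'. dist (g' \<sigma>) 0 * cell_mass \<sigma>)"
  then obtain F' g' where F': "finite F'" "F' \<subseteq> cells k" "nonoverlapping k F'"
    and e: "tensor_cls k (wsum k F g) = finprod (polyhedral_chains k) (\<lambda>\<sigma>. weighted_cell k (g' \<sigma>) \<sigma>) F'"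
    and m: "m = wmass F' g'" unfolding wmass_def by blast
  have "wsum k F g - wsum k F' g' \<in> tensor_ker k"
    using e unfolding finprod_weighted_cell[OF F'(1,2)] tensor_cls_eq .
  moreover from tensor_ker_closed(4)[OF this] have "wsum k F' g' - wsum k F g \<in> tensor_ker k" by simp
  ultimately show "m = wmass F g"
    unfolding m using wmass_mono[OF F F'(1,2)] wmass_mono[OF F' F(1,2)] by (intro order.antisym)
qed

lemma nonoverlapping_representation:
  assumes "P \<in> carrier (polyhedral_chains k)"
  obtains F and g :: "cell \<Rightarrow> 'g" where "finite F" "F \<subseteq> cells k" "nonoverlapping k F"
    "P = tensor_cls k (wsum k F g)" "chain_mass k P = wmass F g"
proof -
  obtain F g where F: "finite F" "F \<subseteq> cells k" and P: "P = tensor_cls k (wsum k F g)"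
    by (rule tensor_cls_wsum_surj[OF assms]) (rule that)
  obtain T \<epsilon> where T: "finite T" "T \<subseteq> cells k" "nonoverlapping k T"
    and n: "\<And>\<sigma>. \<sigma> \<in> F \<Longrightarrow> frag_of \<sigma> - (\<Sum>\<tau>\<in>T. frag_cmul (\<epsilon> \<sigma> \<tau>) (frag_of \<tau>)) \<in> null_chains k"
    and e: "\<And>\<sigma> \<tau>. \<sigma> \<in> F \<Longrightarrow> \<tau> \<in> T \<Longrightarrow> fst \<tau> \<subseteq> fst \<sigma> \<Longrightarrow> \<epsilon> \<sigma> \<tau> = 1 \<or> \<epsilon> \<sigma> \<tau> = (- 1 :: int)"
    and e0: "\<And>\<sigma> \<tau>. \<sigma> \<in> F \<Longrightarrow> \<tau> \<in> T \<Longrightarrow> \<not> fst \<tau> \<subseteq> fst \<sigma> \<Longrightarrow> \<epsilon> \<sigma> \<tau> = 0"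
    by (rule common_refinement[OF F]) (rule that)
  have e3: "\<epsilon> \<sigma> \<tau> = 1 \<or> \<epsilon> \<sigma> \<tau> = - 1 \<or> \<epsilon> \<sigma> \<tau> = 0" if "\<sigma> \<in> F" "\<tau> \<in> T" for \<sigma> \<tau>
    using e[OF that] e0[OF that] by blast
  define G where "G \<tau> = (\<Sum>\<sigma>\<in>F. imul (\<epsilon> \<sigma> \<tau>) (g \<sigma>))" for \<tau>
  have "wsum k F g - wsum k T G \<in> tensor_ker k"
    unfolding G_def by (rule wsum_refine[OF F T(1,2) n e3]) simp_all
  then have "P = tensor_cls k (wsum k T G)" unfolding P tensor_cls_eq .
  then show thesis using that[OF T, of G] chain_mass_eq[OF T, of G] by simp
qed

text \<open>Overlapping representations still bound the mass from above, which is how subadditivity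
  is obtained.\<close>

lemma chain_mass_le:
  fixes g :: "cell \<Rightarrow> 'g"
  assumes F: "finite F" "F \<subseteq> cells k"
  shows "chain_mass k (tensor_cls k (wsum k F g)) \<le> wmass F g"
proof -
  have "tensor_cls k (wsum k F g) \<in> carrier (polyhedral_chains k)"
    unfolding polyhedral_chains_quotient(2) using keys_wsum[OF F(2)] by blast
  then obtain T and h :: "cell \<Rightarrow> 'g" where T: "finite T" "T \<subseteq> cells k" "nonoverlapping k T"
    "tensor_cls k (wsum k F g) = tensor_cls k (wsum k T h)" "chain_mass k (tensor_cls k (wsum k F g)) = wmass T h"
    by (rule nonoverlapping_representation) (rule that)
  have "wsum k T h - wsum k F g \<in> tensor_ker k" using T(4)[symmetric] unfolding tensor_cls_eq .
  then show ?thesis unfolding T(5) by (rule wmass_mono[OF T(1-3) F])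
qed

lemma chain_mass_nonneg:
  "P \<in> carrier (polyhedral_chains k) \<Longrightarrow> 0 \<le> chain_mass k (P :: 'g chain)"
  by (erule nonoverlapping_representation) (simp add: wmass_nonneg)

lemma chain_mass_one: "chain_mass k (\<one>\<^bsub>polyhedral_chains k\<^esub> :: 'g chain) = 0"
  using chain_mass_eq[of "{}" k "\<lambda>_. 0"] unfolding polyhedral_chains_quotient(4)
  by (simp add: wsum_def wmass_def nonoverlapping_def)

lemma chain_mass_inv_le:
  assumes "P \<in> carrier (polyhedral_chains k)"
  shows "chain_mass k (inv\<^bsub>polyhedral_chains k\<^esub> P) \<le> chain_mass k (P :: 'g chain)"
proof -
  obtain F and g :: "cell \<Rightarrow> 'g" where F: "finite F" "F \<subseteq> cells k" "nonoverlapping k F"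
    "P = tensor_cls k (wsum k F g)" "chain_mass k P = wmass F g"
    by (rule nonoverlapping_representation[OF assms]) (rule that)
  have "inv\<^bsub>polyhedral_chains k\<^esub> P = tensor_cls k (- wsum k F g)"
    unfolding F(4) by (rule polyhedral_chains_quotient(5)[OF keys_wsum[OF F(2)]])
  also have "\<dots> = tensor_cls k (wsum k F (\<lambda>\<sigma>. - g \<sigma>))"
    unfolding tensor_cls_eq using tensor_ker_closed(4)[OF wsum_minus[OF F(2), of g]] by (simp add: algebra_simps)
  finally have "chain_mass k (inv\<^bsub>polyhedral_chains k\<^esub> P) \<le> wmass F (\<lambda>\<sigma>. - g \<sigma>)"
    using chain_mass_le[OF F(1,2)] by simp
  then show ?thesis unfolding F(5) by (simp add: wmass_def dist_minus_0)
qed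

lemma chain_mass_mult_le:
  assumes "P \<in> carrier (polyhedral_chains k)" "Q \<in> carrier (polyhedral_chains k)"
  shows "chain_mass k (P \<otimes>\<^bsub>polyhedral_chains k\<^esub> Q) \<le> chain_mass k P + chain_mass k (Q :: 'g chain)"
proof -
  obtain F and g :: "cell \<Rightarrow> 'g" where F: "finite F" "F \<subseteq> cells k" "nonoverlapping k F"
    "P = tensor_cls k (wsum k F g)" "chain_mass k P = wmass F g"
    by (rule nonoverlapping_representation[OF assms(1)]) (rule that)
  obtain F' and g' :: "cell \<Rightarrow> 'g" where F': "finite F'" "F' \<subseteq> cells k" "nonoverlapping k F'"
    "Q = tensor_cls k (wsum k F' g')" "chain_mass k Q = wmass F' g'"
    by (rule nonoverlapping_representation[OF assms(2)]) (rule that)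
  define G where "G = F \<union> F'"
  define h where "h \<sigma> = (if \<sigma> \<in> F then g \<sigma> else 0)" for \<sigma>
  define h' where "h' \<sigma> = (if \<sigma> \<in> F' then g' \<sigma> else 0)" for \<sigma>
  have G: "finite G" "G \<subseteq> cells k" "F \<subseteq> G" "F' \<subseteq> G" using F F' by (auto simp: G_def)
  have e: "wsum k F g = wsum k F h" "wsum k F' g' = wsum k F' h'"
    unfolding wsum_def h_def h'_def by (auto intro: sum.cong)
  have 1: "wsum k G h - wsum k F h \<in> tensor_ker k"
    by (rule wsum_mono_neutral) (use G in \<open>auto simp: h_def\<close>)
  have 2: "wsum k G h' - wsum k F' h' \<in> tensor_ker k"
    by (rule wsum_mono_neutral) (use G in \<open>auto simp: h'_def\<close>)
  have m: "wmass F g = wmass G h" "wmass F' g' = wmass G h'"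
    unfolding wmass_def using G by (auto intro!: sum.mono_neutral_cong_left simp: h_def h'_def)
  have "P \<otimes>\<^bsub>polyhedral_chains k\<^esub> Q = tensor_cls k (wsum k F h + wsum k F' h')"
    unfolding F(4) F'(4) e by (rule polyhedral_chains_quotient(3)[OF keys_wsum[OF F(2)] keys_wsum[OF F'(2)]])
  also have "\<dots> = tensor_cls k (wsum k G (\<lambda>\<sigma>. h \<sigma> + h' \<sigma>))"
    unfolding tensor_cls_eq
    using tensor_ker_closed(4)[OF tensor_ker_closed(3)[OF wsum_add[OF G(2), of h h'] tensor_ker_closed(3)[OF 1 2]]]
    by (simp add: algebra_simps)
  finally have "chain_mass k (P \<otimes>\<^bsub>polyhedral_chains k\<^esub> Q) \<le> wmass G (\<lambda>\<sigma>. h \<sigma> + h' \<sigma>)"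
    using chain_mass_le[OF G(1,2)] by simp
  also have "\<dots> \<le> (\<Sum>\<sigma>\<in>G. (dist (h \<sigma>) 0 + dist (h' \<sigma>) 0) * cell_mass \<sigma>)"
    unfolding wmass_def by (intro sum_mono mult_right_mono dist_add_0 cell_mass_nonneg)
  also have "\<dots> = wmass G h + wmass G h'"
    by (simp add: wmass_def distrib_right sum.distrib)
  finally show ?thesis unfolding F(5) F'(5) m .
qed

section \<open>Slices are bounded by mass\<close>

text \<open>Empty when the sign vanishes: the cut is then 0, and \<open>shadow_bound\<close> speaks
  only of nonzero signs.\<close>

definition shadow :: "real \<Rightarrow> (real^3) list \<Rightarrow> cell \<Rightarrow> (real^3) set" where
  "shadow R q \<sigma> = (if frame_sign q (snd \<sigma>) = 0 then {} else {x. norm x \<le> R \<and> (\<exists>z\<in>fst \<sigma>. qeq q z x)})"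

lemma dist_cut_le:
  assumes "norm x \<le> R"
  shows "ennreal (dist (imul (cut q l s \<sigma> x) (g :: 'g)) 0) \<le> ennreal (dist g 0) * indicator (shadow R q \<sigma>) x"
proof (cases "cut q l s \<sigma> x = 0")
  case False
  then have c: "cut q l s \<sigma> x = frame_sign q (snd \<sigma>)" "\<exists>z\<in>fst \<sigma>. qeq q z x" "frame_sign q (snd \<sigma>) \<noteq> 0"
    unfolding cut_def by (auto split: if_splits)
  then have "x \<in> shadow R q \<sigma>" using assms by (simp add: shadow_def)
  moreover have "frame_sign q (snd \<sigma>) = 1 \<or> frame_sign q (snd \<sigma>) = - 1" using c(3) by (auto simp: frame_sign_def split: if_splits)
  ultimately show ?thesis by (auto simp: c(1) dist_minus_0)
qed simp

lemma dist_slice_le: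
  assumes "norm x \<le> R"
  shows "ennreal (dist (\<Sum>\<sigma>\<in>F. imul (cut q l s \<sigma> x) (g \<sigma> :: 'g)) 0)
    \<le> (\<Sum>\<sigma>\<in>F. ennreal (dist (g \<sigma>) 0) * indicator (shadow R q \<sigma>) x)"
proof -
  have "ennreal (dist (\<Sum>\<sigma>\<in>F. imul (cut q l s \<sigma> x) (g \<sigma>)) 0) \<le> ennreal (\<Sum>\<sigma>\<in>F. dist (imul (cut q l s \<sigma> x) (g \<sigma>)) 0)"
    by (rule ennreal_leI[OF dist_sum_0])
  also have "\<dots> = (\<Sum>\<sigma>\<in>F. ennreal (dist (imul (cut q l s \<sigma> x) (g \<sigma>)) 0))" by (simp add: sum_ennreal)
  also have "\<dots> \<le> (\<Sum>\<sigma>\<in>F. ennreal (dist (g \<sigma>) 0) * indicator (shadow R q \<sigma>) x)"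
    by (intro sum_mono dist_cut_le assms)
  finally show ?thesis .
qed

text \<open>The constant is uniform in the cells, their coefficients and the covectors; positivity
  needs it before a decomposition is given.\<close>

lemma shadow_integral:
  assumes R: "R > 0"
  obtains C where "C \<ge> 0" "\<And>F (q :: (real^3) list) (g :: cell \<Rightarrow> 'g). finite F \<Longrightarrow> F \<subseteq> cells k \<Longrightarrow> length q = nat k \<Longrightarrow>
     (\<lambda>x. \<Sum>\<sigma>\<in>F. ennreal (dist (g \<sigma>) 0) * indicator (shadow R q \<sigma>) x) \<in> borel_measurable lborel \<and>
     (\<integral>\<^sup>+ x. (\<Sum>\<sigma>\<in>F. ennreal (dist (g \<sigma>) 0) * indicator (shadow R q \<sigma>) x) \<partial>lborel) \<le> ennreal (C * wmass F g)"
proof -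
  obtain C where C: "C \<ge> 0" "\<And>\<sigma> q. \<sigma> \<in> cells k \<Longrightarrow> length q = nat k \<Longrightarrow> frame_sign q (snd \<sigma>) \<noteq> 0 \<Longrightarrow>
    {x. norm x \<le> R \<and> (\<exists>z\<in>fst \<sigma>. qeq q z x)} \<in> sets borel \<and>
    emeasure lborel {x. norm x \<le> R \<and> (\<exists>z\<in>fst \<sigma>. qeq q z x)} \<le> ennreal (C * cell_mass \<sigma>)"
    by (rule shadow_bound[OF R]) (rule that)
  have sh: "shadow R q \<sigma> \<in> sets lborel" "emeasure lborel (shadow R q \<sigma>) \<le> ennreal (C * cell_mass \<sigma>)"
    if "\<sigma> \<in> cells k" "length q = nat k" for \<sigma> q
    using C(2)[OF that] by (auto simp: shadow_def)
  show thesis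
  proof (rule that[OF C(1)], intro conjI)
    fix F and q :: "(real^3) list" and g :: "cell \<Rightarrow> 'g"
    assume F: "finite F" "F \<subseteq> cells k" "length q = nat k"
    have meas: "(\<lambda>x. ennreal (dist (g \<sigma>) 0) * indicator (shadow R q \<sigma>) x) \<in> borel_measurable lborel" if "\<sigma> \<in> F" for \<sigma>
      using sh(1)[of \<sigma> q] F that by (intro borel_measurable_times_ennreal borel_measurable_const borel_measurable_indicator) auto
    then show "(\<lambda>x. \<Sum>\<sigma>\<in>F. ennreal (dist (g \<sigma>) 0) * indicator (shadow R q \<sigma>) x) \<in> borel_measurable lborel"
      by (intro borel_measurable_sum)
    have "(\<integral>\<^sup>+ x. (\<Sum>\<sigma>\<in>F. ennreal (dist (g \<sigma>) 0) * indicator (shadow R q \<sigma>) x) \<partial>lborel)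
      = (\<Sum>\<sigma>\<in>F. \<integral>\<^sup>+ x. ennreal (dist (g \<sigma>) 0) * indicator (shadow R q \<sigma>) x \<partial>lborel)"
      by (rule nn_integral_sum) (rule meas)
    also have "\<dots> = (\<Sum>\<sigma>\<in>F. ennreal (dist (g \<sigma>) 0) * emeasure lborel (shadow R q \<sigma>))"
      by (intro sum.cong refl nn_integral_cmult_indicator sh(1)) (use F in auto)
    also have "\<dots> \<le> (\<Sum>\<sigma>\<in>F. ennreal (dist (g \<sigma>) 0) * ennreal (C * cell_mass \<sigma>))"
      by (intro sum_mono mult_left_mono sh(2)) (use F in auto)
    also have "\<dots> = (\<Sum>\<sigma>\<in>F. ennreal (dist (g \<sigma>) 0 * (C * cell_mass \<sigma>)))"
      by (intro sum.cong refl ennreal_mult'[symmetric]) (simp add: C(1) cell_mass_nonneg)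
    also have "\<dots> = ennreal (C * wmass F g)"
      unfolding wmass_def sum_distrib_left
      by (subst sum_ennreal) (auto simp: C(1) cell_mass_nonneg mult.left_commute)
    finally show "(\<integral>\<^sup>+ x. (\<Sum>\<sigma>\<in>F. ennreal (dist (g \<sigma>) 0) * indicator (shadow R q \<sigma>) x) \<partial>lborel) \<le> ennreal (C * wmass F g)" .
  qed
qed

text \<open>The witnesses \<open>q\<close>, \<open>l\<close>, \<open>a\<close> and \<open>U\<close>,
  and with them the bound, depend on \<open>P\<close> alone; the decompositions enter only through
  their masses.\<close>

lemma flat_mass_positive:
  assumes P: "P \<in> carrier (polyhedral_chains k)" "P \<noteq> \<one>\<^bsub>polyhedral_chains k\<^esub>"
  obtains c :: real where "c > 0"
    "\<And>P1 R :: 'g chain. P1 \<in> carrier (polyhedral_chains k) \<Longrightarrow> R \<in> carrier (polyhedral_chains (k + 1)) \<Longrightarrow>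
      P = P1 \<otimes>\<^bsub>polyhedral_chains k\<^esub> chain_boundary (k + 1) R \<Longrightarrow>
      c \<le> chain_mass k P1 + chain_mass (k + 1) R"
proof -
  obtain F' and g :: "cell \<Rightarrow> 'g" where F': "finite F'" "F' \<subseteq> cells k" "nonoverlapping k F'"
    "P = tensor_cls k (wsum k F' g)" "chain_mass k P = wmass F' g"
    by (rule nonoverlapping_representation[OF P(1)]) (rule that)
  define F where "F = {\<sigma>\<in>F'. g \<sigma> \<noteq> 0}"
  have F: "finite F" "F \<subseteq> cells k" "nonoverlapping k F"
    using F' nonoverlapping_subset[OF F'(3), of F] by (auto simp: F_def)
  have gF: "\<And>\<sigma>. \<sigma> \<in> F \<Longrightarrow> g \<sigma> \<noteq> 0" by (simp add: F_def)
  have "wsum k F' g - wsum k F g \<in> tensor_ker k"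
    by (rule wsum_mono_neutral) (use F' in \<open>auto simp: F_def\<close>)
  then have PF: "P = tensor_cls k (wsum k F g)" unfolding F'(4) tensor_cls_eq .
  have ne: "F \<noteq> {}"
  proof
    assume "F = {}"
    then have "P = tensor_cls k 0" using PF by (simp add: wsum_def)
    then show False using P(2) by (simp add: polyhedral_chains_quotient(4))
  qed
  then obtain \<sigma> where "\<sigma> \<in> cells k" using F(2) by blast
  then have k0: "k \<ge> 0" by (rule cells_nonneg)
  obtain q l s a U where q: "length q = nat k" and s: "k \<le> 2 \<Longrightarrow> s = 0" and a: "a \<noteq> 0"
    and U: "open U" "U \<noteq> {}" "\<And>x. x \<in> U \<Longrightarrow> (\<Sum>\<sigma>\<in>F. imul (cut q l s \<sigma> x) (g \<sigma>)) = a"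
    by (rule exists_nonzero_slice[OF F ne, of g], erule gF) (rule that)
  obtain u where u: "u \<in> U" using U(2) by blast
  define r where "r = norm u + 1"
  have r: "r > 0" by (simp add: r_def add_nonneg_pos)
  \<comment> \<open>Bounding the open set makes its volume finite and confines the estimate to a
    ball, where shadows are controlled.\<close>
  define V where "V = U \<inter> ball 0 r"
  have V: "open V" "V \<noteq> {}" using U(1) u by (auto simp: V_def r_def)
  have Vb: "V \<in> sets lborel" using V(1) by simp
  have Vfin: "emeasure lborel V < \<infinity>"
    by (rule emeasure_bounded_finite) (auto simp: V_def intro: bounded_subset[OF bounded_ball])
  have "\<not> negligible V" by (rule open_not_negligible[OF V])
  then have "emeasure lborel V \<noteq> 0"
    using V(1) by (auto simp: negligible_iff_null_sets null_sets_def)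
  then have Vpos: "measure lborel V > 0"
    using Vfin by (auto simp: measure_def enn2real_positive_iff zero_less_iff_neq_zero)
  have Vm: "emeasure lborel V = ennreal (measure lborel V)"
    using Vfin by (intro emeasure_eq_ennreal_measure) auto
  obtain C1 where C1: "C1 \<ge> 0" "\<And>F (q :: (real^3) list) (g :: cell \<Rightarrow> 'g). finite F \<Longrightarrow> F \<subseteq> cells k \<Longrightarrow> length q = nat k \<Longrightarrow>
     (\<lambda>x. \<Sum>\<sigma>\<in>F. ennreal (dist (g \<sigma>) 0) * indicator (shadow r q \<sigma>) x) \<in> borel_measurable lborel \<and>
     (\<integral>\<^sup>+ x. (\<Sum>\<sigma>\<in>F. ennreal (dist (g \<sigma>) 0) * indicator (shadow r q \<sigma>) x) \<partial>lborel) \<le> ennreal (C1 * wmass F g)"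
    by (rule shadow_integral[OF r, where k = k]) (rule that)
  obtain C2 where C2: "C2 \<ge> 0" "\<And>F (q :: (real^3) list) (g :: cell \<Rightarrow> 'g). finite F \<Longrightarrow> F \<subseteq> cells (k + 1) \<Longrightarrow> length q = nat (k + 1) \<Longrightarrow>
     (\<lambda>x. \<Sum>\<sigma>\<in>F. ennreal (dist (g \<sigma>) 0) * indicator (shadow r q \<sigma>) x) \<in> borel_measurable lborel \<and>
     (\<integral>\<^sup>+ x. (\<Sum>\<sigma>\<in>F. ennreal (dist (g \<sigma>) 0) * indicator (shadow r q \<sigma>) x) \<partial>lborel) \<le> ennreal (C2 * wmass F g)"
    by (rule shadow_integral[OF r, where k = "k + 1"]) (rule that)
  \<comment> \<open>The 1 makes the constant positive, so that it can be divided by.\<close>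
  define C where "C = C1 + C2 + 1"
  have C: "C > 0" "C1 \<le> C" "C2 \<le> C" using C1(1) C2(1) by (auto simp: C_def)
  show thesis
  proof (rule that)
    show "dist a 0 * measure lborel V / C > 0" using a Vpos C by simp
    fix P1 R :: "'g chain"
    assume P1: "P1 \<in> carrier (polyhedral_chains k)" and R: "R \<in> carrier (polyhedral_chains (k + 1))"
      and eq: "P = P1 \<otimes>\<^bsub>polyhedral_chains k\<^esub> chain_boundary (k + 1) R"
    obtain F1 and g1 :: "cell \<Rightarrow> 'g" where F1: "finite F1" "F1 \<subseteq> cells k" "nonoverlapping k F1"
      "P1 = tensor_cls k (wsum k F1 g1)" "chain_mass k P1 = wmass F1 g1"
      by (rule nonoverlapping_representation[OF P1]) (rule that)
    obtain F2 and g2 :: "cell \<Rightarrow> 'g" where F2: "finite F2" "F2 \<subseteq> cells (k + 1)" "nonoverlapping (k + 1) F2"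
      "R = tensor_cls (k + 1) (wsum (k + 1) F2 g2)" "chain_mass (k + 1) R = wmass F2 g2"
      by (rule nonoverlapping_representation[OF R]) (rule that)
    let ?b = "tensor_boundary (k + 1) (wsum (k + 1) F2 g2)"
    have kb: "Poly_Mapping.keys ?b \<subseteq> tensor_gens k" using keys_tensor_boundary[OF keys_wsum[OF F2(2)], of g2] by simp
    have "chain_boundary (k + 1) R = tensor_cls k ?b" unfolding F2(4) chain_boundary_tensor_cls by simp
    then have "tensor_cls k (wsum k F g) = tensor_cls k (wsum k F1 g1 + ?b)"
      using eq unfolding PF F1(4) by (simp add: polyhedral_chains_quotient(3)[OF keys_wsum[OF F1(2)] kb])
    then have tk: "wsum k F g - (wsum k F1 g1 + ?b) \<in> tensor_ker k" unfolding tensor_cls_eq .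
    \<comment> \<open>A nonzero \<open>s\<close> can occur only for \<open>k = 3\<close>. There are
      no cells of dimension 4, so then both sides are empty sums.\<close>
    have bs: "AE x in lborel. tensor_slice q l s x ?b = (\<Sum>\<sigma>\<in>F2. imul (- cut (l # q) 0 1 \<sigma> x) (g2 \<sigma>))"
    proof (cases "F2 = {}")
      case True
      then show ?thesis by (simp add: wsum_def tensor_boundary_simps tensor_slice_def)
    next
      case False
      then obtain \<sigma> where "\<sigma> \<in> cells (k + 1)" using F2(2) by blast
      then have "s = 0" using cells_le_3[of \<sigma> "k + 1"] s by simp
      then show ?thesis using boundary_slice[OF q k0 F2(1,2), of l g2] by simp
    qed
    let ?f1 = "\<lambda>x. \<Sum>\<sigma>\<in>F1. ennreal (dist (g1 \<sigma>) 0) * indicator (shadow r q \<sigma>) x"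
    let ?f2 = "\<lambda>x. \<Sum>\<sigma>\<in>F2. ennreal (dist (g2 \<sigma>) 0) * indicator (shadow r (l # q) \<sigma>) x"
    have "AE x in lborel. ennreal (dist a 0) * indicator V x \<le> ?f1 x + ?f2 x"
      using tensor_ker_slice[OF tk q, of l s] wsum_slice[OF q F(1), of l s g] wsum_slice[OF q F1(1), of l s g1] bs
    proof eventually_elim
      case (elim x)
      show ?case
      proof (cases "x \<in> V")
        case True
        then have x: "x \<in> U" "norm x \<le> r" by (auto simp: V_def)
        have "tensor_slice q l s x (wsum k F g) = tensor_slice q l s x (wsum k F1 g1) + tensor_slice q l s x ?b"
          using elim(1) by (simp add: tensor_slice_def frag_sum_diff frag_sum_add)
        then have "a = (\<Sum>\<sigma>\<in>F1. imul (cut q l s \<sigma> x) (g1 \<sigma>)) + - (\<Sum>\<sigma>\<in>F2. imul (cut (l # q) 0 1 \<sigma> x) (g2 \<sigma>))"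
          using elim(2-4) U(3)[OF x(1)] by (simp add: imul_minus sum_negf)
        then have "dist a 0 \<le> dist (\<Sum>\<sigma>\<in>F1. imul (cut q l s \<sigma> x) (g1 \<sigma>)) 0 + dist (\<Sum>\<sigma>\<in>F2. imul (cut (l # q) 0 1 \<sigma> x) (g2 \<sigma>)) 0"
          using dist_add_0[of "\<Sum>\<sigma>\<in>F1. imul (cut q l s \<sigma> x) (g1 \<sigma>)" "- (\<Sum>\<sigma>\<in>F2. imul (cut (l # q) 0 1 \<sigma> x) (g2 \<sigma>))"]
          unfolding dist_minus_0 by simp
        then have "ennreal (dist a 0) \<le> ennreal (dist (\<Sum>\<sigma>\<in>F1. imul (cut q l s \<sigma> x) (g1 \<sigma>)) 0) + ennreal (dist (\<Sum>\<sigma>\<in>F2. imul (cut (l # q) 0 1 \<sigma> x) (g2 \<sigma>)) 0)"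
          by (simp add: ennreal_leI flip: ennreal_plus)
        also have "\<dots> \<le> ?f1 x + ?f2 x"
          by (intro add_mono dist_slice_le x(2))
        finally show ?thesis using True by simp
      qed simp
    qed
    then have "(\<integral>\<^sup>+ x. ennreal (dist a 0) * indicator V x \<partial>lborel) \<le> (\<integral>\<^sup>+ x. ?f1 x + ?f2 x \<partial>lborel)"
      by (rule nn_integral_mono_AE)
    also have "\<dots> = (\<integral>\<^sup>+ x. ?f1 x \<partial>lborel) + (\<integral>\<^sup>+ x. ?f2 x \<partial>lborel)"
      by (rule nn_integral_add) (use C1(2)[OF F1(1,2) q] C2(2)[OF F2(1,2), of "l # q"] q k0 in auto)
    also have "\<dots> \<le> ennreal (C1 * wmass F1 g1) + ennreal (C2 * wmass F2 g2)"
      using C1(2)[OF F1(1,2) q, of g1] C2(2)[OF F2(1,2), of "l # q" g2] q k0 by (intro add_mono) (auto simp: nat_add_distrib)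
    also have "\<dots> \<le> ennreal (C * wmass F1 g1) + ennreal (C * wmass F2 g2)"
      by (intro add_mono ennreal_leI mult_right_mono C wmass_nonneg)
    also have "\<dots> = ennreal (C * (wmass F1 g1 + wmass F2 g2))"
      using C(1) by (subst ennreal_plus[symmetric]) (auto simp: wmass_nonneg distrib_left)
    also have "(\<integral>\<^sup>+ x. ennreal (dist a 0) * indicator V x \<partial>lborel) = ennreal (dist a 0 * measure lborel V)"
      using nn_integral_cmult_indicator[OF Vb, of "ennreal (dist a 0)"] by (simp add: Vm ennreal_mult)
    finally have "dist a 0 * measure lborel V \<le> C * (wmass F1 g1 + wmass F2 g2)"
      using C(1) by (subst (asm) ennreal_le_iff) (auto simp: wmass_nonneg add_nonneg_nonneg)
    then show "dist a 0 * measure lborel V / C \<le> chain_mass k P1 + chain_mass (k + 1) R"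
      unfolding F1(5) F2(5) using C(1) by (simp add: pos_divide_le_eq mult.commute)
  qed
qed

end

section \<open>The flat energy\<close>

lemma comm_group_polyhedral_chains: "comm_group (polyhedral_chains k)"
  by (rule polyhedral_chains_quotient(1))

lemma comm_group_dipolyhedra: "comm_group (dipolyhedra k :: 'g::ab_group_add dipolyhedron monoid)"
proof -
  interpret A: comm_group "polyhedral_chains k :: 'g chain monoid" by (rule comm_group_polyhedral_chains)
  interpret B: comm_group "polyhedral_chains (k - 1) :: 'g chain monoid" by (rule comm_group_polyhedral_chains)
  interpret G: Group.group "polyhedral_chains k \<times>\<times> polyhedral_chains (k - 1) :: 'g dipolyhedron monoid"
    by (rule DirProd_group[OF A.is_group B.is_group])
  show ?thesis
    unfolding dipolyhedra_def
    by (rule G.group_comm_groupI) (auto simp: DirProd_def A.m_comm B.m_comm)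
qed

lemma dipolyhedra_simps:
  "carrier (dipolyhedra k) = carrier (polyhedral_chains k) \<times> carrier (polyhedral_chains (k - 1))"
  "(P, Q) \<otimes>\<^bsub>dipolyhedra k\<^esub> (P', Q') = (P \<otimes>\<^bsub>polyhedral_chains k\<^esub> P', Q \<otimes>\<^bsub>polyhedral_chains (k - 1)\<^esub> Q')"
  "\<one>\<^bsub>dipolyhedra k\<^esub> = (\<one>\<^bsub>polyhedral_chains k\<^esub>, \<one>\<^bsub>polyhedral_chains (k - 1)\<^esub>)"
  by (simp_all add: dipolyhedra_def DirProd_def)

lemma inv_dipolyhedra:
  assumes "P \<in> carrier (polyhedral_chains k)" "Q \<in> carrier (polyhedral_chains (k - 1))"
  shows "inv\<^bsub>dipolyhedra k\<^esub> (P, Q) = (inv\<^bsub>polyhedral_chains k\<^esub> P, inv\<^bsub>polyhedral_chains (k - 1)\<^esub> Q)"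
  unfolding dipolyhedra_def
  by (rule inv_DirProd[OF comm_group.axioms(2) comm_group.axioms(2) assms])
    (simp_all add: comm_group_polyhedral_chains)

lemma chain_boundary_hom:
  "group_hom (polyhedral_chains k) (polyhedral_chains (k - 1)) (chain_boundary k)"
  by (intro group_hom.intro group_hom_axioms.intro comm_group.axioms(2) comm_group_polyhedral_chains homI
      chain_boundary_closed chain_boundary_mult)

text \<open>The cross term \<open>S\<close>, which comes from the dipole part of the boundary of a
  mass cell, is the only coupling between the two coordinates.\<close>

lemma dipolyhedron_boundary_eq:
  fixes R S :: "'g::ab_group_add chain"
  assumes "R \<in> carrier (polyhedral_chains (k + 1))" "S \<in> carrier (polyhedral_chains k)"
  shows "dipolyhedron_boundary (k + 1) (R, S) =
    (chain_boundary (k + 1) R \<otimes>\<^bsub>polyhedral_chains k\<^esub> S, inv\<^bsub>polyhedral_chains (k - 1)\<^esub> chain_boundary k S)"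
proof -
  interpret A: comm_group "polyhedral_chains k :: 'g chain monoid" by (rule comm_group_polyhedral_chains)
  interpret B: comm_group "polyhedral_chains (k - 1) :: 'g chain monoid" by (rule comm_group_polyhedral_chains)
  have b: "chain_boundary k S \<in> carrier (polyhedral_chains (k - 1))" by (rule chain_boundary_closed[OF assms(2)])
  show ?thesis
    using assms b chain_boundary_closed[OF assms(1)]
    by (simp add: dipolyhedron_boundary_def dipole_chain_def mass_chain_def inv_dipolyhedra dipolyhedra_simps)
qed

lemma dipolyhedron_boundary_hom:
  "group_hom (dipolyhedra (k + 1) :: 'g::ab_group_add dipolyhedron monoid) (dipolyhedra k) (dipolyhedron_boundary (k + 1))"
proof (intro group_hom.intro group_hom_axioms.intro comm_group.axioms(2) comm_group_dipolyhedra homI)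
  interpret A: comm_group "polyhedral_chains k :: 'g chain monoid" by (rule comm_group_polyhedral_chains)
  interpret B: comm_group "polyhedral_chains (k - 1) :: 'g chain monoid" by (rule comm_group_polyhedral_chains)
  interpret C: comm_group "polyhedral_chains (k + 1) :: 'g chain monoid" by (rule comm_group_polyhedral_chains)
  have c: "chain_boundary k S \<in> carrier (polyhedral_chains (k - 1))" if "S \<in> carrier (polyhedral_chains k)" for S :: "'g chain"
    by (rule chain_boundary_closed[OF that])
  have c': "chain_boundary (k + 1) R \<in> carrier (polyhedral_chains k)" if "R \<in> carrier (polyhedral_chains (k + 1))" for R :: "'g chain"
    using chain_boundary_closed[OF that] by simp
  fix X' :: "'g dipolyhedron" assume "X' \<in> carrier (dipolyhedra (k + 1))"
  then obtain R S where x: "X' = (R, S)" "R \<in> carrier (polyhedral_chains (k + 1))" "S \<in> carrier (polyhedral_chains k)"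
    by (auto simp: dipolyhedra_simps)
  show "dipolyhedron_boundary (k + 1) X' \<in> carrier (dipolyhedra k)"
    unfolding x(1) dipolyhedron_boundary_eq[OF x(2,3)] using c[OF x(3)] c'[OF x(2)] x(3) by (simp add: dipolyhedra_simps)
  fix Y' :: "'g dipolyhedron" assume "Y' \<in> carrier (dipolyhedra (k + 1))"
  then obtain R' S' where y: "Y' = (R', S')" "R' \<in> carrier (polyhedral_chains (k + 1))" "S' \<in> carrier (polyhedral_chains k)"
    by (auto simp: dipolyhedra_simps)
  have m: "X' \<otimes>\<^bsub>dipolyhedra (k + 1)\<^esub> Y' = (R \<otimes>\<^bsub>polyhedral_chains (k + 1)\<^esub> R', S \<otimes>\<^bsub>polyhedral_chains k\<^esub> S')"
    unfolding x(1) y(1) dipolyhedra_simps by simp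
  have b: "chain_boundary (k + 1) (R \<otimes>\<^bsub>polyhedral_chains (k + 1)\<^esub> R')
    = chain_boundary (k + 1) R \<otimes>\<^bsub>polyhedral_chains k\<^esub> chain_boundary (k + 1) R'"
    using chain_boundary_mult[OF x(2) y(2)] by simp
  show "dipolyhedron_boundary (k + 1) (X' \<otimes>\<^bsub>dipolyhedra (k + 1)\<^esub> Y')
     = dipolyhedron_boundary (k + 1) X' \<otimes>\<^bsub>dipolyhedra k\<^esub> dipolyhedron_boundary (k + 1) Y'"
    unfolding m dipolyhedron_boundary_eq[OF C.m_closed[OF x(2) y(2)] A.m_closed[OF x(3) y(3)]] b
      chain_boundary_mult[OF x(3) y(3)]
    unfolding x(1) y(1) dipolyhedron_boundary_eq[OF x(2,3)] dipolyhedron_boundary_eq[OF y(2,3)] dipolyhedra_simps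
    using c[OF x(3)] c[OF y(3)] c'[OF x(2)] c'[OF y(2)] x(3) y(3)
    by (simp add: A.m_ac B.inv_mult)
qed

context
  assumes translation_invariant:
    "\<And>x y z :: 'g::{ab_group_add,metric_space}. dist (x + z) (y + z) = dist x y"
begin

lemma energy_nonneg: "B \<in> carrier (dipolyhedra k) \<Longrightarrow> 0 \<le> energy k (B :: 'g dipolyhedron)"
  by (auto simp: energy_def dipolyhedra_simps intro!: add_nonneg_nonneg chain_mass_nonneg translation_invariant)

lemma energy_one: "energy k (\<one>\<^bsub>dipolyhedra k\<^esub> :: 'g dipolyhedron) = 0"
  by (simp add: energy_def dipolyhedra_simps chain_mass_one[OF translation_invariant])

lemma energy_inv_le:
  assumes "B \<in> carrier (dipolyhedra k)"
  shows "energy k (inv\<^bsub>dipolyhedra k\<^esub> B) \<le> energy k (B :: 'g dipolyhedron)"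
proof -
  obtain P Q where B: "B = (P, Q)" "P \<in> carrier (polyhedral_chains k)" "Q \<in> carrier (polyhedral_chains (k - 1))"
    using assms by (auto simp: dipolyhedra_simps)
  show ?thesis
    unfolding B(1) inv_dipolyhedra[OF B(2,3)] energy_def prod.case
    by (intro add_mono chain_mass_inv_le[OF translation_invariant] B)
qed

lemma energy_mult_le:
  assumes "B \<in> carrier (dipolyhedra k)" "B' \<in> carrier (dipolyhedra k)"
  shows "energy k (B \<otimes>\<^bsub>dipolyhedra k\<^esub> B') \<le> energy k B + energy k (B' :: 'g dipolyhedron)"
proof -
  obtain P Q where B: "B = (P, Q)" "P \<in> carrier (polyhedral_chains k)" "Q \<in> carrier (polyhedral_chains (k - 1))"
    using assms(1) by (auto simp: dipolyhedra_simps)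
  obtain P' Q' where B': "B' = (P', Q')" "P' \<in> carrier (polyhedral_chains k)" "Q' \<in> carrier (polyhedral_chains (k - 1))"
    using assms(2) by (auto simp: dipolyhedra_simps)
  show ?thesis
    using chain_mass_mult_le[OF translation_invariant B(2) B'(2)] chain_mass_mult_le[OF translation_invariant B(3) B'(3)]
    by (simp add: B(1) B'(1) energy_def dipolyhedra_simps)
qed

definition decomposition_energies :: "int \<Rightarrow> 'g dipolyhedron \<Rightarrow> real set" where
  "decomposition_energies k D = {energy k B + energy (k + 1) C | B C.
     B \<in> carrier (dipolyhedra k) \<and> C \<in> carrier (dipolyhedra (k + 1)) \<and>
     D = B \<otimes>\<^bsub>dipolyhedra k\<^esub> dipolyhedron_boundary (k + 1) C}"

lemma decomposition_energies_lower: "e \<in> decomposition_energies k D \<Longrightarrow> 0 \<le> e"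
  unfolding decomposition_energies_def by (auto intro!: add_nonneg_nonneg energy_nonneg)

lemma bdd_below_decomposition_energies: "bdd_below (decomposition_energies k D)"
  using decomposition_energies_lower by (rule bdd_belowI)

text \<open>The decomposition with trivial boundary part shows that the set is nonempty, so its real
  infimum is meaningful.\<close>

lemma energy_in_decomposition_energies:
  fixes D :: "'g dipolyhedron"
  assumes D: "D \<in> carrier (dipolyhedra k)"
  shows "energy k D \<in> decomposition_energies k D"
proof -
  interpret D: comm_group "dipolyhedra k :: 'g dipolyhedron monoid" by (rule comm_group_dipolyhedra)
  interpret E: comm_group "dipolyhedra (k + 1) :: 'g dipolyhedron monoid" by (rule comm_group_dipolyhedra)
  interpret h: group_hom "dipolyhedra (k + 1) :: 'g dipolyhedron monoid" "dipolyhedra k" "dipolyhedron_boundary (k + 1)"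
    by (rule dipolyhedron_boundary_hom)
  show ?thesis
    unfolding decomposition_energies_def
    by (rule CollectI, rule exI[of _ D], rule exI[of _ "\<one>\<^bsub>dipolyhedra (k + 1)\<^esub>"]) (simp add: D energy_one)
qed

lemma flat_energy_le: "e \<in> decomposition_energies k D \<Longrightarrow> flat_energy k D \<le> e"
  unfolding flat_energy_def decomposition_energies_def[symmetric]
  by (rule cInf_lower[OF _ bdd_below_decomposition_energies])

lemma flat_energy_ge:
  fixes D :: "'g dipolyhedron"
  assumes "D \<in> carrier (dipolyhedra k)" "\<And>e. e \<in> decomposition_energies k D \<Longrightarrow> c \<le> e"
  shows "c \<le> flat_energy k D"
  unfolding flat_energy_def decomposition_energies_def[symmetric]
  using energy_in_decomposition_energies[OF assms(1)] assms(2) by (intro cInf_greatest) auto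

lemma flat_energy_inv_le:
  fixes D :: "'g dipolyhedron"
  assumes D: "D \<in> carrier (dipolyhedra k)"
  shows "flat_energy k (inv\<^bsub>dipolyhedra k\<^esub> D) \<le> flat_energy k D"
proof (rule flat_energy_ge[OF D])
  interpret D: comm_group "dipolyhedra k :: 'g dipolyhedron monoid" by (rule comm_group_dipolyhedra)
  interpret E: comm_group "dipolyhedra (k + 1) :: 'g dipolyhedron monoid" by (rule comm_group_dipolyhedra)
  interpret h: group_hom "dipolyhedra (k + 1) :: 'g dipolyhedron monoid" "dipolyhedra k" "dipolyhedron_boundary (k + 1)"
    by (rule dipolyhedron_boundary_hom)
  fix e assume "e \<in> decomposition_energies k D"
  then obtain B C where e: "e = energy k B + energy (k + 1) C"
    and B: "B \<in> carrier (dipolyhedra k)" and C: "C \<in> carrier (dipolyhedra (k + 1))"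
    and eq: "D = B \<otimes>\<^bsub>dipolyhedra k\<^esub> dipolyhedron_boundary (k + 1) C"
    unfolding decomposition_energies_def by blast
  have "inv\<^bsub>dipolyhedra k\<^esub> D = inv\<^bsub>dipolyhedra k\<^esub> B \<otimes>\<^bsub>dipolyhedra k\<^esub> dipolyhedron_boundary (k + 1) (inv\<^bsub>dipolyhedra (k + 1)\<^esub> C)"
    unfolding eq using B C by (simp add: D.inv_mult)
  then have "energy k (inv\<^bsub>dipolyhedra k\<^esub> B) + energy (k + 1) (inv\<^bsub>dipolyhedra (k + 1)\<^esub> C) \<in> decomposition_energies k (inv\<^bsub>dipolyhedra k\<^esub> D)"
    unfolding decomposition_energies_def using B C by blast
  from flat_energy_le[OF this] show "flat_energy k (inv\<^bsub>dipolyhedra k\<^esub> D) \<le> e"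
    using energy_inv_le[OF B] energy_inv_le[OF C] e by linarith
qed

lemma flat_energy_inv:
  fixes D :: "'g dipolyhedron"
  assumes D: "D \<in> carrier (dipolyhedra k)"
  shows "flat_energy k (inv\<^bsub>dipolyhedra k\<^esub> D) = flat_energy k D"
proof (rule order.antisym)
  interpret D: comm_group "dipolyhedra k :: 'g dipolyhedron monoid" by (rule comm_group_dipolyhedra)
  show "flat_energy k (inv\<^bsub>dipolyhedra k\<^esub> D) \<le> flat_energy k D" by (rule flat_energy_inv_le[OF D])
  \<comment> \<open>Apply the inequality to the inverse.\<close>
  show "flat_energy k D \<le> flat_energy k (inv\<^bsub>dipolyhedra k\<^esub> D)"
    using flat_energy_inv_le[OF D.inv_closed[OF D]] D by simp
qed

lemma flat_energy_mult_le:
  fixes D D' :: "'g dipolyhedron"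
  assumes D: "D \<in> carrier (dipolyhedra k)" and D': "D' \<in> carrier (dipolyhedra k)"
  shows "flat_energy k (D \<otimes>\<^bsub>dipolyhedra k\<^esub> D') \<le> flat_energy k D + flat_energy k D'"
proof -
  interpret D: comm_group "dipolyhedra k :: 'g dipolyhedron monoid" by (rule comm_group_dipolyhedra)
  interpret E: comm_group "dipolyhedra (k + 1) :: 'g dipolyhedron monoid" by (rule comm_group_dipolyhedra)
  interpret h: group_hom "dipolyhedra (k + 1) :: 'g dipolyhedron monoid" "dipolyhedra k" "dipolyhedron_boundary (k + 1)"
    by (rule dipolyhedron_boundary_hom)
  have *: "flat_energy k (D \<otimes>\<^bsub>dipolyhedra k\<^esub> D') \<le> e + e'"
    if "e \<in> decomposition_energies k D" "e' \<in> decomposition_energies k D'" for e e'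
  proof -
    obtain B C where e: "e = energy k B + energy (k + 1) C"
      and B: "B \<in> carrier (dipolyhedra k)" and C: "C \<in> carrier (dipolyhedra (k + 1))"
      and eq: "D = B \<otimes>\<^bsub>dipolyhedra k\<^esub> dipolyhedron_boundary (k + 1) C"
      using \<open>e \<in> _\<close> unfolding decomposition_energies_def by blast
    obtain B' C' where e': "e' = energy k B' + energy (k + 1) C'"
      and B': "B' \<in> carrier (dipolyhedra k)" and C': "C' \<in> carrier (dipolyhedra (k + 1))"
      and eq': "D' = B' \<otimes>\<^bsub>dipolyhedra k\<^esub> dipolyhedron_boundary (k + 1) C'"
      using \<open>e' \<in> _\<close> unfolding decomposition_energies_def by blast
    have "D \<otimes>\<^bsub>dipolyhedra k\<^esub> D' = (B \<otimes>\<^bsub>dipolyhedra k\<^esub> B') \<otimes>\<^bsub>dipolyhedra k\<^esub>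
        dipolyhedron_boundary (k + 1) (C \<otimes>\<^bsub>dipolyhedra (k + 1)\<^esub> C')"
      unfolding eq eq' using B C B' C' by (simp add: D.m_ac)
    then have "energy k (B \<otimes>\<^bsub>dipolyhedra k\<^esub> B') + energy (k + 1) (C \<otimes>\<^bsub>dipolyhedra (k + 1)\<^esub> C')
        \<in> decomposition_energies k (D \<otimes>\<^bsub>dipolyhedra k\<^esub> D')"
      unfolding decomposition_energies_def using B C B' C' D.m_closed E.m_closed by blast
    from flat_energy_le[OF this] show ?thesis
      using energy_mult_le[OF B B'] energy_mult_le[OF C C'] e e' by linarith
  qed
  \<comment> \<open>The infima are taken one at a time: fix \<open>e\<close> and let the energy for
    \<open>D'\<close> vary, then vary \<open>e\<close>.\<close>
  have "flat_energy k (D \<otimes>\<^bsub>dipolyhedra k\<^esub> D') - flat_energy k D' \<le> flat_energy k D"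
  proof (rule flat_energy_ge[OF D])
    fix e assume e: "e \<in> decomposition_energies k D"
    have "flat_energy k (D \<otimes>\<^bsub>dipolyhedra k\<^esub> D') - e \<le> flat_energy k D'"
      by (rule flat_energy_ge[OF D']) (use *[OF e] in \<open>simp add: diff_le_eq add.commute\<close>)
    then show "flat_energy k (D \<otimes>\<^bsub>dipolyhedra k\<^esub> D') - flat_energy k D' \<le> e" by simp
  qed
  then show ?thesis by simp
qed

lemma flat_energy_positive:
  fixes D :: "'g dipolyhedron"
  assumes D: "D \<in> carrier (dipolyhedra k)" "D \<noteq> \<one>\<^bsub>dipolyhedra k\<^esub>"
  shows "flat_energy k D > 0"
proof -
  interpret A: comm_group "polyhedral_chains k :: 'g chain monoid" by (rule comm_group_polyhedral_chains)
  interpret B: comm_group "polyhedral_chains (k - 1) :: 'g chain monoid" by (rule comm_group_polyhedral_chains)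
  interpret h: group_hom "polyhedral_chains k :: 'g chain monoid" "polyhedral_chains (k - 1)" "chain_boundary k"
    by (rule chain_boundary_hom)
  obtain P Q where PQ: "D = (P, Q)" "P \<in> carrier (polyhedral_chains k)" "Q \<in> carrier (polyhedral_chains (k - 1))"
    using D(1) by (auto simp: dipolyhedra_simps)
  have dec: "\<exists>P1\<in>carrier (polyhedral_chains k). \<exists>Q1\<in>carrier (polyhedral_chains (k - 1)).
      \<exists>R\<in>carrier (polyhedral_chains (k + 1)). \<exists>S\<in>carrier (polyhedral_chains k).
      e = chain_mass k P1 + chain_mass (k - 1) Q1 + (chain_mass (k + 1) R + chain_mass k S) \<and>
      P = P1 \<otimes>\<^bsub>polyhedral_chains k\<^esub> (chain_boundary (k + 1) R \<otimes>\<^bsub>polyhedral_chains k\<^esub> S) \<and>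
      Q = Q1 \<otimes>\<^bsub>polyhedral_chains (k - 1)\<^esub> inv\<^bsub>polyhedral_chains (k - 1)\<^esub> chain_boundary k S"
    if e: "e \<in> decomposition_energies k D" for e
  proof -
    obtain B C where e: "e = energy k B + energy (k + 1) C"
      and B: "B \<in> carrier (dipolyhedra k)" and C: "C \<in> carrier (dipolyhedra (k + 1))"
      and eq: "D = B \<otimes>\<^bsub>dipolyhedra k\<^esub> dipolyhedron_boundary (k + 1) C"
      using e unfolding decomposition_energies_def by blast
    obtain P1 Q1 where B1: "B = (P1, Q1)" "P1 \<in> carrier (polyhedral_chains k)" "Q1 \<in> carrier (polyhedral_chains (k - 1))"
      using B by (auto simp: dipolyhedra_simps)
    obtain R S where C1: "C = (R, S)" "R \<in> carrier (polyhedral_chains (k + 1))" "S \<in> carrier (polyhedral_chains k)"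
      using C by (auto simp: dipolyhedra_simps)
    show ?thesis
      using eq e unfolding PQ(1) B1(1) C1(1) dipolyhedron_boundary_eq[OF C1(2,3)] dipolyhedra_simps energy_def
      using B1(2,3) C1(2,3) by auto
  qed
  have "\<exists>c>0. \<forall>e\<in>decomposition_energies k D. c \<le> e"
  proof (cases "P = \<one>\<^bsub>polyhedral_chains k\<^esub>")
    case False
    obtain c where c: "c > 0" "\<And>P1 R. P1 \<in> carrier (polyhedral_chains k) \<Longrightarrow> R \<in> carrier (polyhedral_chains (k + 1)) \<Longrightarrow>
      P = P1 \<otimes>\<^bsub>polyhedral_chains k\<^esub> chain_boundary (k + 1) R \<Longrightarrow> c \<le> chain_mass k P1 + chain_mass (k + 1) R"
      by (rule flat_mass_positive[OF translation_invariant PQ(2) False]) (rule that)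
    have "c \<le> e" if e: "e \<in> decomposition_energies k D" for e
    proof -
      obtain P1 Q1 R S :: "'g chain" where w: "P1 \<in> carrier (polyhedral_chains k)" "Q1 \<in> carrier (polyhedral_chains (k - 1))"
        "R \<in> carrier (polyhedral_chains (k + 1))" "S \<in> carrier (polyhedral_chains k)"
        "e = chain_mass k P1 + chain_mass (k - 1) Q1 + (chain_mass (k + 1) R + chain_mass k S)"
        "P = P1 \<otimes>\<^bsub>polyhedral_chains k\<^esub> (chain_boundary (k + 1) R \<otimes>\<^bsub>polyhedral_chains k\<^esub> S)"
        using dec[OF e] by (elim bexE conjE) (rule that)
      have "chain_boundary (k + 1) R \<in> carrier (polyhedral_chains k)" using chain_boundary_closed[OF w(3)] by simp
      \<comment> \<open>Absorb \<open>S\<close> into \<open>P1\<close>; its mass is part of the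
        energy.\<close>
      then have "P = (P1 \<otimes>\<^bsub>polyhedral_chains k\<^esub> S) \<otimes>\<^bsub>polyhedral_chains k\<^esub> chain_boundary (k + 1) R"
        unfolding w(6) using w(1,4) by (simp add: A.m_ac)
      from c(2)[OF A.m_closed[OF w(1,4)] w(3) this] show ?thesis
        using chain_mass_mult_le[OF translation_invariant w(1,4)] chain_mass_nonneg[OF translation_invariant w(2)]
        unfolding w(5) by linarith
    qed
    then show ?thesis using c(1) by blast
  next
    case True
    then have Q: "Q \<noteq> \<one>\<^bsub>polyhedral_chains (k - 1)\<^esub>" using D(2) by (simp add: PQ(1) dipolyhedra_simps)
    \<comment> \<open>The same bound one dimension lower, where the inverse of \<open>S\<close> will
      be the chain whose boundary is taken.\<close>
    obtain c where c: "c > 0" "\<And>Q1 R. Q1 \<in> carrier (polyhedral_chains (k - 1)) \<Longrightarrow> R \<in> carrier (polyhedral_chains (k - 1 + 1)) \<Longrightarrow>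
      Q = Q1 \<otimes>\<^bsub>polyhedral_chains (k - 1)\<^esub> chain_boundary (k - 1 + 1) R \<Longrightarrow> c \<le> chain_mass (k - 1) Q1 + chain_mass (k - 1 + 1) R"
      by (rule flat_mass_positive[OF translation_invariant PQ(3) Q]) (rule that)
    have "c \<le> e" if e: "e \<in> decomposition_energies k D" for e
    proof -
      obtain P1 Q1 R S :: "'g chain" where w: "P1 \<in> carrier (polyhedral_chains k)" "Q1 \<in> carrier (polyhedral_chains (k - 1))"
        "R \<in> carrier (polyhedral_chains (k + 1))" "S \<in> carrier (polyhedral_chains k)"
        "e = chain_mass k P1 + chain_mass (k - 1) Q1 + (chain_mass (k + 1) R + chain_mass k S)"
        "Q = Q1 \<otimes>\<^bsub>polyhedral_chains (k - 1)\<^esub> inv\<^bsub>polyhedral_chains (k - 1)\<^esub> chain_boundary k S"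
        using dec[OF e] by (elim bexE conjE) (rule that)
      \<comment> \<open>The sign in the boundary of a mass cell is moved inside the boundary, at no
        cost because inversion does not increase mass.\<close>
      have "Q = Q1 \<otimes>\<^bsub>polyhedral_chains (k - 1)\<^esub> chain_boundary k (inv\<^bsub>polyhedral_chains k\<^esub> S)"
        unfolding w(6) using w(4) by simp
      then have "c \<le> chain_mass (k - 1) Q1 + chain_mass k (inv\<^bsub>polyhedral_chains k\<^esub> S)"
        using c(2)[of Q1 "inv\<^bsub>polyhedral_chains k\<^esub> S"] w(2,4) by simp
      then show ?thesis
        using chain_mass_inv_le[OF translation_invariant w(4)] chain_mass_nonneg[OF translation_invariant w(1)]
          chain_mass_nonneg[OF translation_invariant w(3)]
        unfolding w(5) by linarith
    qed
    then show ?thesis using c(1) by blast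
  qed
  then obtain c where "c > 0" "\<And>e. e \<in> decomposition_energies k D \<Longrightarrow> c \<le> e" by blast
  then have "c \<le> flat_energy k D" using flat_energy_ge[OF D(1)] by blast
  then show ?thesis using \<open>c > 0\<close> by simp
qed

lemma flat_energy_one: "flat_energy k (\<one>\<^bsub>dipolyhedra k\<^esub> :: 'g dipolyhedron) = 0"
proof (rule order.antisym)
  interpret D: comm_group "dipolyhedra k :: 'g dipolyhedron monoid" by (rule comm_group_dipolyhedra)
  show "flat_energy k (\<one>\<^bsub>dipolyhedra k\<^esub> :: 'g dipolyhedron) \<le> 0"
    using flat_energy_le[OF energy_in_decomposition_energies[OF D.one_closed]] by (simp add: energy_one)
  show "0 \<le> flat_energy k (\<one>\<^bsub>dipolyhedra k\<^esub> :: 'g dipolyhedron)"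
    by (rule flat_energy_ge[OF D.one_closed]) (rule decomposition_energies_lower)
qed

end

theorem theorem3p13:
  fixes k :: int
  assumes translation_invariant:
      "\<And>x y z :: 'g::{ab_group_add,complete_space}. dist (x + z) (y + z) = dist x y"
    and "0 \<le> k"
  shows "(\<forall>D \<in> carrier (dipolyhedra k :: 'g dipolyhedron monoid).
            0 \<le> flat_energy k D \<and>
            (flat_energy k D = 0 \<longleftrightarrow> D = \<one>\<^bsub>dipolyhedra k\<^esub>) \<and>
            flat_energy k (inv\<^bsub>dipolyhedra k\<^esub> D) = flat_energy k D) \<and>
         (\<forall>D \<in> carrier (dipolyhedra k :: 'g dipolyhedron monoid).
          \<forall>D' \<in> carrier (dipolyhedra k).
            flat_energy k (D \<otimes>\<^bsub>dipolyhedra k\<^esub> D') \<le> flat_energy k D + flat_energy k D')"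
proof (intro conjI ballI)
  fix D :: "'g dipolyhedron" assume D: "D \<in> carrier (dipolyhedra k)"
  note positive = flat_energy_positive[OF translation_invariant D]
    and one = flat_energy_one[OF translation_invariant, of k]
  show "0 \<le> flat_energy k D" using positive one by (cases "D = \<one>\<^bsub>dipolyhedra k\<^esub>") auto
  show "flat_energy k D = 0 \<longleftrightarrow> D = \<one>\<^bsub>dipolyhedra k\<^esub>"
    using positive one by (cases "D = \<one>\<^bsub>dipolyhedra k\<^esub>") auto
  show "flat_energy k (inv\<^bsub>dipolyhedra k\<^esub> D) = flat_energy k D"
    by (rule flat_energy_inv[OF translation_invariant D])
  fix D' :: "'g dipolyhedron" assume "D' \<in> carrier (dipolyhedra k)"
  then show "flat_energy k (D \<otimes>\<^bsub>dipolyhedra k\<^esub> D') \<le> flat_energy k D + flat_energy k D'"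
    by (rule flat_energy_mult_le[OF translation_invariant D])
qed

end
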